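(* Let $I \subseteq \mathbb{R}$ be an interval. Let $I \ni t \mapsto A(t)$ be a generic smooth curve of unbounded normal operators in a Hilbert space $H$ with common domain of definition and with compact resolvents. Let $t_0 \in I$, let $z_0$ be an eigenvalue of $A(t_0)$, and let $n$ be the multiplicity of $z_0$. Then: (1) There exists a positive integer $N$ such that, for each choice of the sign $\pm$, the $n$ eigenvalues of $t \mapsto A(t_0\pm(t-t_0)^N)$ passing through $z_0$ and the corresponding eigenvectors allow smooth parameterizations, locally near $t_0$. If $A$ is real analytic, then the $n$ eigenvalues of $t \mapsto A(t_0\pm(t-t_0)^N)$ passing through $z_0$ and the corresponding eigenvectors may be arranged real analytically, locally near $t_0$. (2) There exist locally absolutely continuous parameterizations of the $n$ eigenvalues of $A$ passing through $z_0$ and of the corresponding eigenvectors, locally near $t_0$.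
   Context: $H$ is a complex Hilbert space; smooth means $C^\infty$. That $t\mapsto A(t)$ is a smooth (resp. real analytic) curve of unbounded normal operators with common domain of definition means: there is a dense subspace $V$ of $H$ such that $V$ is the domain of definition of each $A(t)$; each $A(t)$ is closed and satisfies $A(t)^*A(t)=A(t)A(t)^*$, where the adjoint $A(t)^*$ is defined as usual by $\langle A(t)u,v\rangle=\langle u,A(t)^*v\rangle$ for all $v$ for which the left-hand side is bounded as a function of $u$ (with respect to the norm of $H$) (the domain of $A(t)^*$ is then also $V$); and $t\mapsto\langle A(t)u,v\rangle$ is smooth (resp. real analytic) for each $u\in V$ and $v\in H$. Compact resolvents: $(A(t)-z)^{-1}$ is a compact operator for $z$ in the resolvent set of $A(t)$. For a continuous function $f$ near $t_0$, $m_{t_0}(f)$ is the supremum of all integers $p$ such that $f(t)=(t-t_0)^p g(t)$ near $t_0$ with $g$ continuous; two functions $f,g$ meet of infinite order at $t_0$ if $m_{t_0}(f-g)=\infty$. The curve $t\mapsto A(t)$ is called generic if no two unequal continuously parameterized eigenvalues meet of infinite order at any $t\in I$ (unequal is understood in terms of germs: two continuously parameterized eigenvalues that meet of infinite order at $t$ have equal germs at $t$). Eigenvalues passing through $z_0$: if $\gamma$ is a simple closed curve in the resolvent set of $A(t_0)$ enclosing only $z_0$ among the eigenvalues of $A(t_0)$, then for $t$ near $t_0$ there are exactly $n$ eigenvalues of $A(t)$ (counted with multiplicity) in the interior of $\gamma$; these are the $n$ eigenvalues passing through $z_0$. A parameterization of them and of the corresponding eigenvectors of a given regularity, near $t_0$,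 consists of functions $\lambda_1,\ldots,\lambda_n$ with values in $\mathbb{C}$ and $e_1,\ldots,e_n$ with values in $H$, of that regularity, such that for each $t$ near $t_0$ the $\lambda_i(t)$ are these $n$ eigenvalues with multiplicity, the $e_i(t)$ are linearly independent, and $e_i(t)$ is an eigenvector for the eigenvalue $\lambda_i(t)$. If $t_0$ is an endpoint of $I$, "near $t_0$" refers to those $t$ near $t_0$ for which $A$ is defined at the parameter value in question. *)

theory Defs
  imports "HOL-Analysis.Analysis" "HOL-Library.Extended_Nat"
begin

text \<open>The inner product is linear in the first and conjugate linear in the second argument.\<close>

class complex_hilbert_space = banach +
  fixes scaleC :: "complex \<Rightarrow> 'a \<Rightarrow> 'a"  (infixr "*\<^sub>C" 75)
    and cinner :: "'a \<Rightarrow> 'a \<Rightarrow> complex"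
  assumes scaleC_add_right: "c *\<^sub>C (x + y) = c *\<^sub>C x + c *\<^sub>C y"
    and scaleC_add_left: "(c + d) *\<^sub>C x = c *\<^sub>C x + d *\<^sub>C x"
    and scaleC_scaleC: "c *\<^sub>C d *\<^sub>C x = (c * d) *\<^sub>C x"
    and scaleR_scaleC: "r *\<^sub>R x = complex_of_real r *\<^sub>C x"
    and cinner_commute: "cinner x y = cnj (cinner y x)"
    and cinner_add_left: "cinner (x + y) z = cinner x z + cinner y z"
    and cinner_scaleC_left: "cinner (c *\<^sub>C x) y = c * cinner x y"
    and cinner_self: "cinner x x = complex_of_real ((norm x)\<^sup>2)"

lemma scaleC_one: "1 *\<^sub>C x = (x :: 'h::complex_hilbert_space)"
  using scaleR_scaleC[of 1 x] by simp

global_interpretation complex_vector: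
  vector_space "scaleC :: complex \<Rightarrow> 'h \<Rightarrow> 'h::complex_hilbert_space"
  by unfold_locales (simp_all add: scaleC_add_right scaleC_add_left scaleC_scaleC scaleC_one)

text \<open>An unbounded operator is given by its domain \<open>V\<close> and a function \<open>T\<close>; the values of
  \<open>T\<close> outside \<open>V\<close> are irrelevant.\<close>

definition densely_defined_operator ::
    "'h::complex_hilbert_space set \<Rightarrow> ('h \<Rightarrow> 'h) \<Rightarrow> bool" where
  "densely_defined_operator V T \<longleftrightarrow>
     complex_vector.subspace V \<and> closure V = UNIV \<and>
     (\<forall>u\<in>V. \<forall>v\<in>V. T (u + v) = T u + T v) \<and>
     (\<forall>c. \<forall>u\<in>V. T (c *\<^sub>C u) = c *\<^sub>C T u)"

definition closed_operator :: "'h::complex_hilbert_space set \<Rightarrow> ('h \<Rightarrow> 'h) \<Rightarrow> bool" where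
  "closed_operator V T \<longleftrightarrow> closed {(u, T u) | u. u \<in> V}"

definition adjoint_domain :: "'h::complex_hilbert_space set \<Rightarrow> ('h \<Rightarrow> 'h) \<Rightarrow> 'h set" where
  "adjoint_domain V T = {v. \<exists>C. \<forall>u\<in>V. cmod (cinner (T u) v) \<le> C * norm u}"

definition adjoint_op :: "'h::complex_hilbert_space set \<Rightarrow> ('h \<Rightarrow> 'h) \<Rightarrow> 'h \<Rightarrow> 'h" where
  "adjoint_op V T v = (THE w. \<forall>u\<in>V. cinner (T u) v = cinner u w)"

text \<open>Equality of the unbounded operators \<open>T\<^sup>*T\<close> and \<open>TT\<^sup>*\<close> includes equality of their
  natural domains.\<close>

definition normal_operator :: "'h::complex_hilbert_space set \<Rightarrow> ('h \<Rightarrow> 'h) \<Rightarrow> bool" where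
  "normal_operator V T \<longleftrightarrow>
     densely_defined_operator V T \<and> closed_operator V T \<and>
     {u \<in> V. T u \<in> adjoint_domain V T} = {u \<in> adjoint_domain V T. adjoint_op V T u \<in> V} \<and>
     (\<forall>u \<in> {u \<in> V. T u \<in> adjoint_domain V T}.
        adjoint_op V T (T u) = T (adjoint_op V T u))"

definition resolvent :: "'h::complex_hilbert_space set \<Rightarrow> ('h \<Rightarrow> 'h) \<Rightarrow> complex \<Rightarrow> 'h \<Rightarrow> 'h" where
  "resolvent V T z = inv_into V (\<lambda>u. T u - z *\<^sub>C u)"

definition resolvent_set :: "'h::complex_hilbert_space set \<Rightarrow> ('h \<Rightarrow> 'h) \<Rightarrow> complex set" where
  "resolvent_set V T =
     {z. bij_betw (\<lambda>u. T u - z *\<^sub>C u) V UNIV \<and> (\<exists>C. \<forall>w. norm (resolvent V T z w) \<le> C * norm w)}"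

definition compact_operator :: "('h::complex_hilbert_space \<Rightarrow> 'h) \<Rightarrow> bool" where
  "compact_operator R \<longleftrightarrow>
     Vector_Spaces.linear (*\<^sub>C) (*\<^sub>C) R \<and> (\<forall>S. bounded S \<longrightarrow> compact (closure (R ` S)))"

text \<open>As usual, having compact resolvents includes that the resolvent set is nonempty.\<close>

definition compact_resolvent :: "'h::complex_hilbert_space set \<Rightarrow> ('h \<Rightarrow> 'h) \<Rightarrow> bool" where
  "compact_resolvent V T \<longleftrightarrow>
     resolvent_set V T \<noteq> {} \<and> (\<forall>z \<in> resolvent_set V T. compact_operator (resolvent V T z))"

definition eigenvalue :: "'h::complex_hilbert_space set \<Rightarrow> ('h \<Rightarrow> 'h) \<Rightarrow> complex \<Rightarrow> bool" where
  "eigenvalue V T z \<longleftrightarrow> (\<exists>u\<in>V. u \<noteq> 0 \<and> T u = z *\<^sub>C u)"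

text \<open>For normal operators the geometric and the algebraic multiplicity coincide.\<close>

definition multiplicity_of :: "'h::complex_hilbert_space set \<Rightarrow> ('h \<Rightarrow> 'h) \<Rightarrow> complex \<Rightarrow> nat" where
  "multiplicity_of V T z = complex_vector.dim {u \<in> V. T u = z *\<^sub>C u}"

text \<open>The set \<open>S\<close> is meant to be an interval; at endpoints belonging to \<open>S\<close> the derivatives
  are one-sided.\<close>

definition smooth_on :: "real set \<Rightarrow> (real \<Rightarrow> 'b::real_normed_vector) \<Rightarrow> bool" where
  "smooth_on S f \<longleftrightarrow>
     (\<exists>D :: nat \<Rightarrow> real \<Rightarrow> 'b. (\<forall>t\<in>S. D 0 t = f t) \<and>
        (\<forall>k. \<forall>t\<in>S. (D k has_vector_derivative D (Suc k) t) (at t within S)))"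

definition real_analytic_on :: "real set \<Rightarrow> (real \<Rightarrow> 'b::real_normed_vector) \<Rightarrow> bool" where
  "real_analytic_on S f \<longleftrightarrow>
     (\<forall>s\<in>S. \<exists>r>0. \<exists>c :: nat \<Rightarrow> 'b.
        \<forall>t \<in> S \<inter> ball s r. (\<lambda>k. (t - s) ^ k *\<^sub>R c k) sums f t)"

text \<open>In the following definition, \<open>D\<close> is a finite set of pairs of endpoints of nonoverlapping
  compact intervals.\<close>

definition abs_continuous_on :: "real set \<Rightarrow> (real \<Rightarrow> 'b::real_normed_vector) \<Rightarrow> bool" where
  "abs_continuous_on S f \<longleftrightarrow>
     (\<forall>\<epsilon>>0. \<exists>\<delta>>0. \<forall>D :: (real \<times> real) set.
        finite D \<and> (\<forall>(a, b) \<in> D. a \<le> b \<and> {a..b} \<subseteq> S) \<and>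
        disjoint_family_on (\<lambda>(a, b). {a<..<b}) D \<and> (\<Sum>(a, b)\<in>D. b - a) < \<delta> \<longrightarrow>
        (\<Sum>(a, b)\<in>D. norm (f b - f a)) < \<epsilon>)"

definition locally_abs_continuous_on :: "real set \<Rightarrow> (real \<Rightarrow> 'b::real_normed_vector) \<Rightarrow> bool" where
  "locally_abs_continuous_on S f \<longleftrightarrow> (\<forall>a b. {a..b} \<subseteq> S \<longrightarrow> abs_continuous_on {a..b} f)"

text \<open>The order \<open>m\<^sub>s(f)\<close> for a function \<open>f\<close> on the interval \<open>I\<close> that is continuous near \<open>s\<close>. Since
  \<open>p = 0\<close> is always admissible for such \<open>f\<close>, only nonnegative \<open>p\<close> matter for the supremum.\<close>

definition meeting_order :: "real set \<Rightarrow> real \<Rightarrow> (real \<Rightarrow> complex) \<Rightarrow> enat" where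
  "meeting_order I s f =
     Sup {enat p | p. \<exists>\<delta>>0. \<exists>g. continuous_on (I \<inter> ball s \<delta>) g \<and>
                        (\<forall>t \<in> I \<inter> ball s \<delta>. f t = of_real ((t - s) ^ p) * g t)}"

definition continuous_eigenvalue_on ::
    "real set \<Rightarrow> 'h::complex_hilbert_space set \<Rightarrow> (real \<Rightarrow> 'h \<Rightarrow> 'h) \<Rightarrow> (real \<Rightarrow> complex) \<Rightarrow> bool" where
  "continuous_eigenvalue_on S V A l \<longleftrightarrow>
     continuous_on S l \<and> (\<forall>t\<in>S. eigenvalue V (A t) (l t))"

definition generic_curve ::
    "real set \<Rightarrow> 'h::complex_hilbert_space set \<Rightarrow> (real \<Rightarrow> 'h \<Rightarrow> 'h) \<Rightarrow> bool" where
  "generic_curve I V A \<longleftrightarrow>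
     (\<forall>s\<in>I. \<forall>\<delta>>0. \<forall>l m.
        continuous_eigenvalue_on (I \<inter> ball s \<delta>) V A l \<and>
        continuous_eigenvalue_on (I \<inter> ball s \<delta>) V A m \<and>
        meeting_order I s (\<lambda>t. l t - m t) = \<infinity> \<longrightarrow>
        (\<exists>\<eta>>0. \<forall>t \<in> I \<inter> ball s \<delta> \<inter> ball s \<eta>. l t = m t))"

definition isolating_curve ::
    "'h::complex_hilbert_space set \<Rightarrow> ('h \<Rightarrow> 'h) \<Rightarrow> complex \<Rightarrow> (real \<Rightarrow> complex) \<Rightarrow> bool" where
  "isolating_curve V T z0 \<gamma> \<longleftrightarrow>
     simple_path \<gamma> \<and> pathfinish \<gamma> = pathstart \<gamma> \<and>
     path_image \<gamma> \<subseteq> resolvent_set V T \<and>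
     {z. eigenvalue V T z} \<inter> inside (path_image \<gamma>) = {z0}"

text \<open>The functions \<open>l i\<close>, \<open>i < n\<close>, on \<open>S\<close> enumerate, with multiplicity, the eigenvalues of the
  curve \<open>B\<close> passing through \<open>z0\<close> at \<open>t0\<close>. The neighbourhood of \<open>t0\<close> on which these are the
  eigenvalues inside \<open>\<gamma>\<close> depends on \<open>\<gamma>\<close>.\<close>

definition eigenvalues_through ::
    "'h::complex_hilbert_space set \<Rightarrow> (real \<Rightarrow> 'h \<Rightarrow> 'h) \<Rightarrow> real set \<Rightarrow> real \<Rightarrow> complex \<Rightarrow> nat
      \<Rightarrow> (nat \<Rightarrow> real \<Rightarrow> complex) \<Rightarrow> bool" where
  "eigenvalues_through V B S t0 z0 n l \<longleftrightarrow>
     (\<forall>\<gamma>. isolating_curve V (B t0) z0 \<gamma> \<longrightarrow>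
        (\<exists>\<delta>>0. \<forall>t \<in> S \<inter> ball t0 \<delta>.
           (\<forall>i<n. l i t \<in> inside (path_image \<gamma>)) \<and>
           (\<forall>z \<in> inside (path_image \<gamma>). card {i. i < n \<and> l i t = z} = multiplicity_of V (B t) z)))"

definition eigenvector_frame ::
    "'h::complex_hilbert_space set \<Rightarrow> (real \<Rightarrow> 'h \<Rightarrow> 'h) \<Rightarrow> real set \<Rightarrow> nat
      \<Rightarrow> (nat \<Rightarrow> real \<Rightarrow> complex) \<Rightarrow> (nat \<Rightarrow> real \<Rightarrow> 'h) \<Rightarrow> bool" where
  "eigenvector_frame V B S n l e \<longleftrightarrow>
     (\<forall>t\<in>S. inj_on (\<lambda>i. e i t) {..<n} \<and> complex_vector.independent ((\<lambda>i. e i t) ` {..<n}) \<and>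
        (\<forall>i<n. e i t \<in> V \<and> B t (e i t) = l i t *\<^sub>C e i t))"

text \<open>\<open>J\<close> is the set of parameters at which the curve \<open>B\<close> is defined. The regularity is passed
  twice, once for complex valued and once for vector valued functions.\<close>

definition parameterizable_near ::
    "(real set \<Rightarrow> (real \<Rightarrow> complex) \<Rightarrow> bool) \<Rightarrow> (real set \<Rightarrow> (real \<Rightarrow> 'h) \<Rightarrow> bool)
      \<Rightarrow> 'h::complex_hilbert_space set \<Rightarrow> (real \<Rightarrow> 'h \<Rightarrow> 'h) \<Rightarrow> real set \<Rightarrow> real \<Rightarrow> complex \<Rightarrow> nat
      \<Rightarrow> bool" where
  "parameterizable_near reg regH V B J t0 z0 n \<longleftrightarrow>
     (\<exists>\<delta>>0. \<exists>l e.
        (\<forall>i<n. reg (J \<inter> ball t0 \<delta>) (l i) \<and> regH (J \<inter> ball t0 \<delta>) (e i)) \<and>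
        eigenvalues_through V B (J \<inter> ball t0 \<delta>) t0 z0 n l \<and>
        eigenvector_frame V B (J \<inter> ball t0 \<delta>) n l e)"

end

theory Submission
  imports Defs "HOL-Computational_Algebra.Fundamental_Theorem_Algebra"
begin

text \<open>
  The exponent \<open>N = 1\<close> works. Fix \<open>z\<close> in the resolvent set of \<open>A(t0)\<close>. Near \<open>t0\<close>
  the resolvent \<open>R(t) = (A(t) - z)\<^sup>-\<^sup>1\<close> exists and is smooth, or analytic, in the operator norm, and
  \<open>z + 1 / l\<close> is an eigenvalue of \<open>A(t)\<close> iff \<open>l\<close> is one of \<open>R(t)\<close>. The eigenspace of \<open>R(t0)\<close>
  belonging to \<open>z0\<close> extends to a smooth family of projections \<open>P(t)\<close> that commute with \<open>R(t)\<close>.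

  By induction on the rank of \<open>P\<close>, the range of \<open>P(t)\<close> has a smooth basis of eigenvectors of \<open>R(t)\<close>:
  there is a smooth scalar function \<open>\<tau>\<close> such that \<open>T = (R - \<tau>) P\<close> vanishes at \<open>t0\<close> and \<open>T(t)\<close> vanishes
  whenever \<open>R(t)\<close> is scalar on the range of \<open>P(t)\<close>. If all derivatives of \<open>T\<close> vanish at \<open>t0\<close>, then
  the continuous eigenvalues of \<open>R P\<close> meet of infinite order, so they coincide because the curve is generic,
  and \<open>R\<close> is scalar on the range of \<open>P\<close>. Otherwise \<open>T(t) = (t - t0)\<^sup>m Q(t)\<close> with \<open>Q(t0) \<noteq> 0\<close>.
  By normality \<open>Q(t0)\<close> is diagonalizable, and it is not scalar by the choice of \<open>\<tau>\<close>, so the spectral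
  projection of one of its eigenvalues extends to smooth projections that commute with \<open>R\<close> and split \<open>P\<close>
  into two parts of smaller rank.
\<close>

text \<open>Two things could prevent smooth eigenvectors: a nilpotent part of \<open>Q(t0)\<close>,
  and distinct eigenvalues in contact of infinite order. Genericity excludes the second. The first
  is excluded by \<open>paranormal_on\<close>: for \<open>Y = X - c\<close> it reads |Y x|^2 \<le>
  |Y (Y x)| |x|, so \<open>Y\<close> and its square have the same kernel. Hence no roots of t - t0
  ever have to be extracted, which is why \<open>N = 1\<close> works. The inequality survives
  restriction to invariant subspaces, affine changes of the operator and limits, and so it passes
  from \<open>R\<close> to \<open>Q(t0)\<close>, where only limits are available. Normality also
  makes \<open>V\<close> the domain of every adjoint. Therefore \<open>A(t)\<close> times the fixed
  resolvent at \<open>t0\<close> is bounded, and uniform boundedness upgrades weak smoothness to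
  smoothness in operator norm. Genericity speaks about continuous eigenvalues, which first have to
  be produced. Complex values cannot be sorted, so they are selected by matching along fine grids,
  with a bound on the drift that does not depend on the grid, followed by a compactness
  argument.\<close>

text \<open>The flag \<open>an\<close> below switches between smooth and real analytic functions, the latter being characterized
  by factorial bounds on the derivatives, so that both cases are proved at once.\<close>

definition derivs :: "real set \<Rightarrow> (nat \<Rightarrow> real \<Rightarrow> 'b::real_normed_vector) \<Rightarrow> bool" where
  "derivs S D \<longleftrightarrow> (\<forall>k. \<forall>t\<in>S. (D k has_vector_derivative D (Suc k) t) (at t within S))"

text \<open>The constants are uniform over \<open>S\<close>, which bounds all radii of convergence
  from below by 1/r. A pointwise analytic curve satisfies this only near a given point, hence the
  passage to a ball in \<open>weak_regular\<close>.\<close>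

definition factorial_bound :: "real set \<Rightarrow> (nat \<Rightarrow> real \<Rightarrow> 'b::real_normed_vector) \<Rightarrow> bool" where
  "factorial_bound S D \<longleftrightarrow> (\<exists>M>0. \<exists>r>0. \<forall>k. \<forall>t\<in>S. norm (D k t) \<le> M * fact k * r ^ k)"

definition regular_derivs :: "bool \<Rightarrow> real set \<Rightarrow> (nat \<Rightarrow> real \<Rightarrow> 'b::real_normed_vector) \<Rightarrow> bool" where
  "regular_derivs an S D \<longleftrightarrow> derivs S D \<and> (an \<longrightarrow> factorial_bound S D)"

text \<open>The derivatives are existentially quantified because they are not unique on a one-point
  set.\<close>

definition regular :: "bool \<Rightarrow> real set \<Rightarrow> (real \<Rightarrow> 'b::real_normed_vector) \<Rightarrow> bool" where
  "regular an S f \<longleftrightarrow> (\<exists>D. (\<forall>t\<in>S. D 0 t = f t) \<and> regular_derivs an S D)"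

section \<open>Calculus of smooth and of factorially bounded curves\<close>

lemma regularI: "regular_derivs an S D \<Longrightarrow> (\<And>t. t \<in> S \<Longrightarrow> D 0 t = f t) \<Longrightarrow> regular an S f"
  unfolding regular_def by blast

lemma factorial_boundI:
  assumes "\<And>k t. t \<in> S \<Longrightarrow> norm (D k t) \<le> M * fact k * r ^ k" "0 \<le> r"
  shows "factorial_bound S D"
proof -
  have "norm (D k t) \<le> (\<bar>M\<bar> + 1) * fact k * (r + 1) ^ k" if "t \<in> S" for k t
  proof -
    have "M * (fact k * r ^ k) \<le> (\<bar>M\<bar> + 1) * (fact k * (r + 1) ^ k)"
      using assms(2) by (intro mult_mono power_mono) auto
    with assms(1)[OF that, of k] show ?thesis by (simp only: mult.assoc)
  qed
  moreover have "\<bar>M\<bar> + 1 > 0" "r + 1 > 0" using assms(2) by auto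
  ultimately show ?thesis unfolding factorial_bound_def by blast
qed

lemma derivs_subset: "derivs S D \<Longrightarrow> T \<subseteq> S \<Longrightarrow> derivs T D"
  unfolding derivs_def by (meson has_vector_derivative_within_subset subsetD)

lemma regular_derivs_subset: "regular_derivs an S D \<Longrightarrow> T \<subseteq> S \<Longrightarrow> regular_derivs an T D"
  unfolding regular_derivs_def factorial_bound_def using derivs_subset by blast

lemma regular_subset: "regular an S f \<Longrightarrow> T \<subseteq> S \<Longrightarrow> regular an T f"
  unfolding regular_def using regular_derivs_subset by blast

lemma regular_cong: "regular an S f \<Longrightarrow> (\<And>t. t \<in> S \<Longrightarrow> f t = g t) \<Longrightarrow> regular an S g"
  unfolding regular_def by force

lemma derivs_continuous: "derivs S D \<Longrightarrow> continuous_on S (D k)"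
  unfolding derivs_def
  by (meson continuous_on_eq_continuous_within has_vector_derivative_continuous)

lemma regular_continuous: "regular an S f \<Longrightarrow> continuous_on S f"
  unfolding regular_def regular_derivs_def
  by (metis continuous_on_cong derivs_continuous)

lemma regular_const: "regular an S (\<lambda>_. c)"
proof (rule regularI)
  let ?D = "\<lambda>k t. if k = 0 then c else 0"
  have "factorial_bound S ?D"
    by (rule factorial_boundI[where M = "norm c" and r = 0]) auto
  then show "regular_derivs an S ?D"
    by (auto simp: regular_derivs_def derivs_def)
qed auto

text \<open>Pascal's rule: the Leibniz sum of order k differentiates into the one of order k + 1.
  Stating it for an arbitrary array \<open>a\<close> allows its use in
  \<open>derivs_inverse\<close>, where one entry is not yet known to be the right
  derivative.\<close>

lemma binomial_recursion_sum:
  fixes a :: "nat \<Rightarrow> nat \<Rightarrow> 'b::real_vector"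
  shows "(\<Sum>j\<le>k. real (k choose j) *\<^sub>R (a (Suc j) (k - j) + a j (Suc (k - j)))) =
    (\<Sum>j\<le>Suc k. real (Suc k choose j) *\<^sub>R a j (Suc k - j))"
proof -
  have "(\<Sum>j\<le>Suc k. real (Suc k choose j) *\<^sub>R a j (Suc k - j)) =
     a 0 (Suc k) + (\<Sum>j\<le>k. real (Suc k choose Suc j) *\<^sub>R a (Suc j) (k - j))"
    by (subst sum.atMost_Suc_shift) simp
  also have "(\<Sum>j\<le>k. real (Suc k choose Suc j) *\<^sub>R a (Suc j) (k - j)) =
     (\<Sum>j\<le>k. real (k choose j) *\<^sub>R a (Suc j) (k - j)) +
     (\<Sum>j\<le>k. real (k choose Suc j) *\<^sub>R a (Suc j) (k - j))"
    by (simp add: sum.distrib scaleR_left_distrib)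
  also have "a 0 (Suc k) + (\<dots>) = (\<Sum>j\<le>k. real (k choose j) *\<^sub>R a (Suc j) (k - j)) +
     (\<Sum>j\<le>Suc k. real (k choose j) *\<^sub>R a j (Suc k - j))"
    by (simp add: sum.atMost_Suc_shift[of _ k] del: sum.atMost_Suc)
  also have "(\<Sum>j\<le>Suc k. real (k choose j) *\<^sub>R a j (Suc k - j)) =
     (\<Sum>j\<le>k. real (k choose j) *\<^sub>R a j (Suc (k - j)))"
    by (simp add: Suc_diff_le)
  finally show ?thesis by (simp add: sum.distrib scaleR_right_distrib)
qed

lemma (in bounded_bilinear) leibniz_derivs:
  assumes D: "derivs S D" and E: "derivs S E"
  shows "derivs S (\<lambda>k t. \<Sum>j\<le>k. real (k choose j) *\<^sub>R prod (D j t) (E (k - j) t))"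
  unfolding derivs_def
proof (intro allI ballI)
  fix k t assume t: "t \<in> S"
  have d: "(D j has_vector_derivative D (Suc j) t) (at t within S)"
     "(E j has_vector_derivative E (Suc j) t) (at t within S)" for j
    using D E t by (auto simp: derivs_def)
  have "((\<lambda>t. \<Sum>j\<le>k. real (k choose j) *\<^sub>R prod (D j t) (E (k - j) t)) has_vector_derivative
     (\<Sum>j\<le>k. real (k choose j) *\<^sub>R (prod (D j t) (E (Suc (k - j)) t) + prod (D (Suc j) t) (E (k - j) t))))
     (at t within S)"
    by (intro has_vector_derivative_sum bounded_linear.has_vector_derivative[OF bounded_linear_scaleR_right] has_vector_derivative d)
  then show "((\<lambda>t. \<Sum>j\<le>k. real (k choose j) *\<^sub>R prod (D j t) (E (k - j) t)) has_vector_derivative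
     (\<Sum>j\<le>Suc k. real (Suc k choose j) *\<^sub>R prod (D j t) (E (Suc k - j) t))) (at t within S)"
    by (subst binomial_recursion_sum[symmetric]) (simp add: add.commute)
qed

lemma factorial_bound_mono:
  assumes "M > 0" "r > 0" "\<And>k t. t \<in> S \<Longrightarrow> norm (D k t) \<le> M * fact k * r ^ k" "r \<le> q" "t \<in> S"
  shows "norm (D k t) \<le> M * fact k * q ^ k"
proof -
  have "M * fact k * r ^ k \<le> M * fact k * q ^ k"
    using assms by (intro mult_left_mono power_mono) auto
  with assms(3)[OF assms(5), of k] show ?thesis by linarith
qed

lemma Suc_le_power2: "real (Suc k) \<le> 2 ^ k"
proof -
  have "Suc k \<le> 2 ^ k" using less_exp[of k] by linarith
  then show ?thesis by (metis of_nat_le_iff of_nat_numeral of_nat_power)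
qed

text \<open>The factorials of both factors cancel against the binomial coefficient and leave
  \<open>fact k\<close>, so there are k + 1 equal bounds. The factor k + 1 \<le> 2^k is absorbed by
  doubling the rate.\<close>

lemma (in bounded_bilinear) leibniz_factorial_bound:
  assumes D: "factorial_bound S D" and E: "factorial_bound S E"
  shows "factorial_bound S (\<lambda>k t. \<Sum>j\<le>k. real (k choose j) *\<^sub>R prod (D j t) (E (k - j) t))"
proof -
  obtain M1 r1 where 1: "M1 > 0" "r1 > 0" "\<And>k t. t \<in> S \<Longrightarrow> norm (D k t) \<le> M1 * fact k * r1 ^ k"
    using D unfolding factorial_bound_def by blast
  obtain M2 r2 where 2: "M2 > 0" "r2 > 0" "\<And>k t. t \<in> S \<Longrightarrow> norm (E k t) \<le> M2 * fact k * r2 ^ k"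
    using E unfolding factorial_bound_def by blast
  obtain K where K: "K > 0" "\<And>a b. norm (prod a b) \<le> norm a * norm b * K"
    using pos_bounded by blast
  define r where "r = max r1 r2"
  have r: "r > 0" using 1 by (auto simp: r_def)
  have "norm (\<Sum>j\<le>k. real (k choose j) *\<^sub>R prod (D j t) (E (k - j) t)) \<le> (K * M1 * M2) * fact k * (2 * r) ^ k"
    if t: "t \<in> S" for k t
  proof -
    have "norm (real (k choose j) *\<^sub>R prod (D j t) (E (k - j) t)) \<le> (K * M1 * M2) * fact k * r ^ k"
      if j: "j \<in> {..k}" for j
    proof -
      have "norm (D j t) \<le> M1 * fact j * r ^ j"
        by (rule factorial_bound_mono[OF 1 _ t]) (auto simp: r_def)
      moreover have "norm (E (k - j) t) \<le> M2 * fact (k - j) * r ^ (k - j)"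
        by (rule factorial_bound_mono[OF 2 _ t]) (auto simp: r_def)
      ultimately have "norm (D j t) * norm (E (k - j) t) * K \<le>
          (M1 * fact j * r ^ j) * (M2 * fact (k - j) * r ^ (k - j)) * K"
        using K 1 2 r by (intro mult_right_mono mult_mono) auto
      then have "norm (prod (D j t) (E (k - j) t)) \<le> (M1 * fact j * r ^ j) * (M2 * fact (k - j) * r ^ (k - j)) * K"
        using K(2) order_trans by blast
      then have "real (k choose j) * norm (prod (D j t) (E (k - j) t)) \<le>
          real (k choose j) * ((M1 * fact j * r ^ j) * (M2 * fact (k - j) * r ^ (k - j)) * K)"
        by (intro mult_left_mono) auto
      also have "\<dots> = (K * M1 * M2) * (fact j * fact (k - j) * real (k choose j)) * (r ^ j * r ^ (k - j))"
        by (simp add: mult_ac)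
      also have "fact j * fact (k - j) * real (k choose j) = fact k"
        using j by (metis atMost_iff binomial_fact_lemma of_nat_fact of_nat_mult)
      also have "r ^ j * r ^ (k - j) = r ^ k" using j by (simp flip: power_add)
      finally show ?thesis by simp
    qed
    then have "norm (\<Sum>j\<le>k. real (k choose j) *\<^sub>R prod (D j t) (E (k - j) t)) \<le>
        (\<Sum>j\<le>k. (K * M1 * M2) * fact k * r ^ k)"
      by (intro order_trans[OF norm_sum] sum_mono) auto
    also have "\<dots> = real (Suc k) * ((K * M1 * M2) * fact k * r ^ k)" by simp
    also have "\<dots> \<le> 2 ^ k * ((K * M1 * M2) * fact k * r ^ k)"
      using K 1 2 r Suc_le_power2 by (intro mult_right_mono) auto
    finally show ?thesis by (simp add: power_mult_distrib mult_ac)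
  qed
  then show ?thesis using r by (intro factorial_boundI[where r = "2 * r"]) auto
qed

lemma (in bounded_bilinear) regular_bilinear:
  assumes "regular an S f" "regular an S g"
  shows "regular an S (\<lambda>t. prod (f t) (g t))"
proof -
  obtain D where D: "\<And>t. t \<in> S \<Longrightarrow> D 0 t = f t" "derivs S D" "an \<Longrightarrow> factorial_bound S D"
    using assms(1) by (auto simp: regular_def regular_derivs_def)
  obtain E where E: "\<And>t. t \<in> S \<Longrightarrow> E 0 t = g t" "derivs S E" "an \<Longrightarrow> factorial_bound S E"
    using assms(2) by (auto simp: regular_def regular_derivs_def)
  show ?thesis
  proof (rule regularI)
    show "regular_derivs an S (\<lambda>k t. \<Sum>j\<le>k. real (k choose j) *\<^sub>R prod (D j t) (E (k - j) t))"
      using leibniz_derivs[OF D(2) E(2)] leibniz_factorial_bound[OF D(3) E(3)]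
      by (auto simp: regular_derivs_def)
  qed (use D E in auto)
qed

lemma regular_add:
  assumes "regular an S f" "regular an S g"
  shows "regular an S (\<lambda>t. f t + g t)"
proof -
  obtain D where D: "\<And>t. t \<in> S \<Longrightarrow> D 0 t = f t" "derivs S D" "an \<Longrightarrow> factorial_bound S D"
    using assms(1) by (auto simp: regular_def regular_derivs_def)
  obtain E where E: "\<And>t. t \<in> S \<Longrightarrow> E 0 t = g t" "derivs S E" "an \<Longrightarrow> factorial_bound S E"
    using assms(2) by (auto simp: regular_def regular_derivs_def)
  have "factorial_bound S (\<lambda>k t. D k t + E k t)" if an: an
  proof -
    obtain M1 r1 where 1: "M1 > 0" "r1 > 0" "\<And>k t. t \<in> S \<Longrightarrow> norm (D k t) \<le> M1 * fact k * r1 ^ k"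
      using D(3)[OF an] unfolding factorial_bound_def by blast
    obtain M2 r2 where 2: "M2 > 0" "r2 > 0" "\<And>k t. t \<in> S \<Longrightarrow> norm (E k t) \<le> M2 * fact k * r2 ^ k"
      using E(3)[OF an] unfolding factorial_bound_def by blast
    have "norm (D k t + E k t) \<le> (M1 + M2) * fact k * (max r1 r2) ^ k" if t: "t \<in> S" for k t
    proof -
      have "norm (D k t) \<le> M1 * fact k * (max r1 r2) ^ k"
        by (rule factorial_bound_mono[OF 1 _ t]) auto
      moreover have "norm (E k t) \<le> M2 * fact k * (max r1 r2) ^ k"
        by (rule factorial_bound_mono[OF 2 _ t]) auto
      ultimately show ?thesis
        by (intro order_trans[OF norm_triangle_ineq]) (simp add: distrib_right)
    qed
    then show ?thesis using 1 by (intro factorial_boundI) auto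
  qed
  moreover have "derivs S (\<lambda>k t. D k t + E k t)"
    using D(2) E(2) by (auto simp: derivs_def intro!: has_vector_derivative_add)
  ultimately show ?thesis
    by (intro regularI[where D = "\<lambda>k t. D k t + E k t"]) (auto simp: D E regular_derivs_def)
qed

lemma regular_linear:
  assumes "bounded_linear h" "regular an S f"
  shows "regular an S (\<lambda>t. h (f t))"
proof -
  interpret h: bounded_linear h by fact
  obtain D where D: "\<And>t. t \<in> S \<Longrightarrow> D 0 t = f t" "derivs S D" "an \<Longrightarrow> factorial_bound S D"
    using assms(2) by (auto simp: regular_def regular_derivs_def)
  have "factorial_bound S (\<lambda>k t. h (D k t))" if an: an
  proof -
    obtain M1 r1 where 1: "M1 > 0" "r1 > 0" "\<And>k t. t \<in> S \<Longrightarrow> norm (D k t) \<le> M1 * fact k * r1 ^ k"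
      using D(3)[OF an] unfolding factorial_bound_def by blast
    obtain K where K: "K > 0" "\<And>a. norm (h a) \<le> norm a * K"
      using h.pos_bounded by blast
    have "norm (h (D k t)) \<le> (M1 * K) * fact k * r1 ^ k" if t: "t \<in> S" for k t
    proof -
      have "norm (D k t) * K \<le> (M1 * fact k * r1 ^ k) * K"
        using K 1(3)[OF t] by (intro mult_right_mono) auto
      with K(2)[of "D k t"] show ?thesis by (simp add: mult_ac)
    qed
    then show ?thesis using 1 by (intro factorial_boundI) auto
  qed
  moreover have "derivs S (\<lambda>k t. h (D k t))"
    using D(2) by (auto simp: derivs_def intro!: h.has_vector_derivative)
  ultimately show ?thesis
    by (intro regularI[where D = "\<lambda>k t. h (D k t)"]) (auto simp: D regular_derivs_def)
qed

lemma regular_minus: "regular an S f \<Longrightarrow> regular an S (\<lambda>t. - f t)"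
  by (rule regular_linear[OF bounded_linear_minus[OF bounded_linear_ident]])

lemma regular_diff: "regular an S f \<Longrightarrow> regular an S g \<Longrightarrow> regular an S (\<lambda>t. f t - g t)"
  using regular_add[of an S f "\<lambda>t. - g t"] regular_minus[of an S g] by simp

text \<open>Since the exponent is 1, the only substitutions that occur are the identity and the
  reflection at \<open>t0\<close>; the k-th derivative picks up the factor \<sigma>^k.\<close>

lemma regular_reflect:
  assumes "regular an S f" "\<sigma> = 1 \<or> \<sigma> = (-1::real)"
  shows "regular an {t. t0 + \<sigma> * (t - t0) \<in> S} (\<lambda>t. f (t0 + \<sigma> * (t - t0)))"
proof -
  obtain D where D: "\<And>t. t \<in> S \<Longrightarrow> D 0 t = f t" "derivs S D" "an \<Longrightarrow> factorial_bound S D"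
    using assms(1) by (auto simp: regular_def regular_derivs_def)
  let ?p = "\<lambda>t. t0 + \<sigma> * (t - t0)"
  let ?S = "{t. ?p t \<in> S}"
  let ?D = "\<lambda>k t. \<sigma> ^ k *\<^sub>R D k (?p t)"
  have "derivs ?S ?D"
    unfolding derivs_def
  proof (intro allI ballI)
    fix k t assume t: "t \<in> ?S"
    have "(?p has_vector_derivative \<sigma>) (at t within ?S)"
      by (auto intro!: derivative_eq_intros simp: has_real_derivative_iff_has_vector_derivative[symmetric])
    moreover have "(D k has_vector_derivative D (Suc k) (?p t)) (at (?p t) within ?p ` ?S)"
      by (rule has_vector_derivative_within_subset[where S = S]) (use D(2) t in \<open>auto simp: derivs_def\<close>)
    ultimately have "(D k \<circ> ?p has_vector_derivative \<sigma> *\<^sub>R D (Suc k) (?p t)) (at t within ?S)"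
      by (rule vector_diff_chain_within)
    from bounded_linear.has_vector_derivative[OF bounded_linear_scaleR_right[of "\<sigma> ^ k"] this]
    have "((\<lambda>t. \<sigma> ^ k *\<^sub>R D k (?p t)) has_vector_derivative \<sigma> ^ k *\<^sub>R (\<sigma> *\<^sub>R D (Suc k) (?p t))) (at t within ?S)"
      by (simp add: o_def)
    then show "(?D k has_vector_derivative ?D (Suc k) t) (at t within ?S)"
      by (simp add: mult.commute)
  qed
  moreover have "factorial_bound ?S ?D" if an: an
  proof -
    obtain M1 r1 where 1: "M1 > 0" "r1 > 0" "\<And>k t. t \<in> S \<Longrightarrow> norm (D k t) \<le> M1 * fact k * r1 ^ k"
      using D(3)[OF an] unfolding factorial_bound_def by blast
    then show ?thesis using assms(2) by (intro factorial_boundI[of _ _ M1 r1]) (auto simp: power_abs)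
  qed
  ultimately show ?thesis
    by (intro regularI[where D = ?D]) (auto simp: D regular_derivs_def)
qed

lemma regular_imp_smooth: "regular an S f \<Longrightarrow> smooth_on S f"
  by (auto simp: regular_def regular_derivs_def smooth_on_def derivs_def)

section \<open>Taylor estimates and the consequences of regularity\<close>

lemma taylor_bound:
  fixes D :: "nat \<Rightarrow> real \<Rightarrow> 'b::banach"
  assumes D: "derivs S D" and seg: "closed_segment s t \<subseteq> S"
    and K: "\<And>x. x \<in> closed_segment s t \<Longrightarrow> norm (D (Suc n) x) \<le> K"
  shows "norm (D 0 t - (\<Sum>k\<le>n. ((t - s) ^ k / fact k) *\<^sub>R D k s)) \<le> K * \<bar>t - s\<bar> ^ Suc n / fact n"
proof -
  let ?C = "closed_segment s t"
  \<comment> \<open>The centre \<open>x\<close> moves from \<open>s\<close> to \<open>t\<close>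
    while the evaluation point stays \<open>t\<close>, so the derivative telescopes to its top term.
    The mean value inequality then gives n! instead of (n + 1)! in the denominator, a loss of n + 1
    that the applications tolerate.\<close>
  define \<phi> where "\<phi> x = (\<Sum>k\<le>n. ((t - x) ^ k / fact k) *\<^sub>R D k x)" for x
  have der: "(\<phi> has_vector_derivative ((t - x) ^ n / fact n) *\<^sub>R D (Suc n) x) (at x within ?C)" if x: "x \<in> ?C" for x
  proof -
    have dD: "(D k has_vector_derivative D (Suc k) x) (at x within ?C)" for k
      using D seg x unfolding derivs_def by (meson has_vector_derivative_within_subset subsetD)
    have dp: "((\<lambda>x. (t - x) ^ k / fact k) has_field_derivative (- (real k * (t - x) ^ (k - 1) / fact k))) (at x within ?C)" for k
      by (auto intro!: derivative_eq_intros simp: field_simps)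
    have d1: "((\<lambda>x. ((t - x) ^ k / fact k) *\<^sub>R D k x) has_vector_derivative
        (((t - x) ^ k / fact k) *\<^sub>R D (Suc k) x + (- (real k * (t - x) ^ (k - 1) / fact k)) *\<^sub>R D k x)) (at x within ?C)" for k
      by (rule has_vector_derivative_scaleR[OF dp dD])
    have "(\<phi> has_vector_derivative (\<Sum>k\<le>n. ((t - x) ^ k / fact k) *\<^sub>R D (Suc k) x + (- (real k * (t - x) ^ (k - 1) / fact k)) *\<^sub>R D k x)) (at x within ?C)"
      unfolding \<phi>_def by (intro has_vector_derivative_sum d1)
    moreover have "(\<Sum>k\<le>n. ((t - x) ^ k / fact k) *\<^sub>R D (Suc k) x + (- (real k * (t - x) ^ (k - 1) / fact k)) *\<^sub>R D k x)
       = ((t - x) ^ n / fact n) *\<^sub>R D (Suc n) x" for n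
    proof (induction n)
      case (Suc n)
      have "real (Suc n) * (t - x) ^ n / fact (Suc n) = (t - x) ^ n / fact n"
        unfolding fact_Suc by (rule mult_divide_mult_cancel_left) simp
      with Suc show ?case by (simp del: fact_Suc)
    qed auto
    ultimately show ?thesis by simp
  qed
  have K0: "0 \<le> K" using K[of s] norm_ge_zero order_trans by blast
  have "norm (\<phi> t - \<phi> s) \<le> (\<bar>t - s\<bar> ^ n / fact n * K) * norm (t - s)"
  proof (rule differentiable_bound[OF convex_closed_segment])
    show "(\<phi> has_derivative (\<lambda>h. h *\<^sub>R ((t - x) ^ n / fact n) *\<^sub>R D (Suc n) x)) (at x within ?C)" if "x \<in> ?C" for x
      using der[OF that] by (simp add: has_vector_derivative_def)
    show "onorm (\<lambda>h. h *\<^sub>R ((t - x) ^ n / fact n) *\<^sub>R D (Suc n) x) \<le> \<bar>t - s\<bar> ^ n / fact n * K" if x: "x \<in> ?C" for x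
    proof (rule onorm_le)
      fix h :: real
      have "\<bar>t - x\<bar> \<le> \<bar>t - s\<bar>"
        using x by (auto simp: closed_segment_eq_real_ivl split: if_splits)
      then have "\<bar>t - x\<bar> ^ n / fact n * norm (D (Suc n) x) \<le> \<bar>t - s\<bar> ^ n / fact n * K"
        using K[OF x] K0 by (intro mult_mono divide_right_mono power_mono) auto
      then have "\<bar>t - x\<bar> ^ n / fact n * norm (D (Suc n) x) * norm h \<le> \<bar>t - s\<bar> ^ n / fact n * K * norm h"
        by (intro mult_right_mono) auto
      then show "norm (h *\<^sub>R ((t - x) ^ n / fact n) *\<^sub>R D (Suc n) x) \<le> \<bar>t - s\<bar> ^ n / fact n * K * norm h"
        by (simp add: power_abs abs_mult mult_ac)
    qed
  qed auto
  moreover have "\<phi> t = D 0 t"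
    unfolding \<phi>_def by (subst sum.atMost_shift) (simp add: power_0_left)
  ultimately show ?thesis by (simp add: \<phi>_def mult_ac)
qed

text \<open>With x = r |t - s| < 1 the remainder is at most M (n + 1) x^(n + 1), which tends to 0.
  Convexity keeps the segment from \<open>s\<close> to \<open>t\<close> inside
  \<open>S\<close>.\<close>

lemma regular_imp_analytic:
  fixes f :: "real \<Rightarrow> 'b::banach"
  assumes "regular True S f" "convex S"
  shows "real_analytic_on S f"
proof -
  obtain D where D: "\<And>t. t \<in> S \<Longrightarrow> D 0 t = f t" "derivs S D" "factorial_bound S D"
    using assms(1) by (auto simp: regular_def regular_derivs_def)
  obtain M r where M: "M > 0" "r > 0" "\<And>k t. t \<in> S \<Longrightarrow> norm (D k t) \<le> M * fact k * r ^ k"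
    using D(3) unfolding factorial_bound_def by blast
  show ?thesis unfolding real_analytic_on_def
  proof (intro ballI exI conjI)
    fix s t assume s: "s \<in> S" and "t \<in> S \<inter> ball s (1 / r)"
    then have t: "t \<in> S" "\<bar>t - s\<bar> < 1 / r" by (auto simp: dist_real_def)
    define x where "x = r * \<bar>t - s\<bar>"
    have x: "0 \<le> x" "x < 1" using t M by (auto simp: x_def field_simps)
    have seg: "closed_segment s t \<subseteq> S" using s t assms(2) closed_segment_subset by blast
    have bound: "norm ((\<Sum>k<Suc n. (t - s) ^ k *\<^sub>R ((1 / fact k) *\<^sub>R D k s)) - f t) \<le> M * (real (Suc n) * x ^ Suc n)" for n
    proof -
      have "norm (D 0 t - (\<Sum>k\<le>n. ((t - s) ^ k / fact k) *\<^sub>R D k s)) \<le>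
          (M * fact (Suc n) * r ^ Suc n) * \<bar>t - s\<bar> ^ Suc n / fact n"
        by (rule taylor_bound[OF D(2) seg]) (use seg M in blast)
      also have "\<dots> = M * (real (Suc n) * x ^ Suc n)"
        by (simp add: x_def power_mult_distrib field_simps)
      finally show ?thesis using D(1)[OF t(1)]
        by (simp add: lessThan_Suc_atMost norm_minus_commute)
    qed
    have "(\<lambda>n. real n * x ^ n) \<longlonglongrightarrow> 0" using x by (intro powser_times_n_limit_0) auto
    then have "(\<lambda>n. M * (real (Suc n) * x ^ Suc n)) \<longlonglongrightarrow> M * 0"
      by (intro tendsto_mult_left) (rule LIMSEQ_Suc)
    then have "(\<lambda>n. (\<Sum>k<Suc n. (t - s) ^ k *\<^sub>R ((1 / fact k) *\<^sub>R D k s)) - f t) \<longlonglongrightarrow> 0"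
      by (intro Lim_null_comparison[OF always_eventually[OF allI, OF bound]]) simp
    then have "(\<lambda>n. (\<Sum>k<n. (t - s) ^ k *\<^sub>R ((1 / fact k) *\<^sub>R D k s)) - f t) \<longlonglongrightarrow> 0"
      by (rule LIMSEQ_imp_Suc[where f = "\<lambda>n. (\<Sum>k<n. (t - s) ^ k *\<^sub>R ((1 / fact k) *\<^sub>R D k s)) - f t"])
    then show "(\<lambda>k. (t - s) ^ k *\<^sub>R ((1 / fact k) *\<^sub>R D k s)) sums f t"
      unfolding sums_def by (simp add: LIM_zero_iff)
  qed (use M in auto)
qed

text \<open>The continuous first derivative is bounded by some \<open>L\<close> on a compact
  interval, so the curve is Lipschitz there and \<delta> = \<epsilon> / L serves.\<close>

lemma regular_imp_locally_abs_continuous: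
  fixes f :: "real \<Rightarrow> 'b::banach"
  assumes "regular an S f"
  shows "locally_abs_continuous_on S f"
  unfolding locally_abs_continuous_on_def
proof (intro allI impI)
  fix a b assume ab: "{a..b} \<subseteq> S"
  obtain D where D: "\<And>t. t \<in> S \<Longrightarrow> D 0 t = f t" "derivs S D"
    using assms(1) by (auto simp: regular_def regular_derivs_def)
  have "compact (D 1 ` {a..b})"
    by (intro compact_continuous_image continuous_on_subset[OF derivs_continuous[OF D(2)] ab]) auto
  then have "bounded (D 1 ` {a..b})" by (rule compact_imp_bounded)
  then obtain L where L: "L > 0" "\<And>x. x \<in> {a..b} \<Longrightarrow> norm (D 1 x) \<le> L"
    unfolding bounded_pos by blast
  have lip: "norm (f y - f x) \<le> L * (y - x)" if "x \<le> y" "{x..y} \<subseteq> {a..b}" for x y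
  proof -
    have sub: "x \<in> S" "y \<in> S" using that ab by auto
    have "norm (D 0 y - (\<Sum>k\<le>0. ((y - x) ^ k / fact k) *\<^sub>R D k x)) \<le> L * \<bar>y - x\<bar> ^ Suc 0 / fact 0"
      by (rule taylor_bound[OF D(2)]) (use that ab L in \<open>auto simp: closed_segment_eq_real_ivl\<close>)
    then show ?thesis using that sub D(1) by simp
  qed
  show "abs_continuous_on {a..b} f"
    unfolding abs_continuous_on_def
  proof (intro allI impI)
    fix \<epsilon> :: real assume e: "\<epsilon> > 0"
    have "(\<Sum>(x, y)\<in>E. norm (f y - f x)) < \<epsilon>"
      if E: "finite E" "\<forall>(x, y) \<in> E. x \<le> y \<and> {x..y} \<subseteq> {a..b}" "(\<Sum>(x, y)\<in>E. y - x) < \<epsilon> / L" for E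
    proof -
      have "(\<Sum>(x, y)\<in>E. norm (f y - f x)) \<le> (\<Sum>(x, y)\<in>E. L * (y - x))"
        using E(2) lip by (intro sum_mono) auto
      also have "\<dots> = L * (\<Sum>(x, y)\<in>E. y - x)"
        by (simp add: sum_distrib_left case_prod_unfold)
      also have "\<dots> < \<epsilon>" using E(3) L by (simp add: field_simps)
      finally show ?thesis .
    qed
    then show "\<exists>\<delta>>0. \<forall>D. finite D \<and> (\<forall>(a', b')\<in>D. a' \<le> b' \<and> {a'..b'} \<subseteq> {a..b}) \<and>
        disjoint_family_on (\<lambda>(a, b). {a<..<b}) D \<and> (\<Sum>(a, b)\<in>D. b - a) < \<delta> \<longrightarrow>
        (\<Sum>(a, b)\<in>D. norm (f b - f a)) < \<epsilon>"
      using e L by (intro exI[of _ "\<epsilon> / L"]) auto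
  qed
qed

section \<open>Derivatives of inverses\<close>

lemma has_vector_derivative_iff_quotient:
  fixes f :: "real \<Rightarrow> 'b::real_normed_vector"
  shows "(f has_vector_derivative d) (at t within S) \<longleftrightarrow>
    ((\<lambda>y. (f y - f t) /\<^sub>R (y - t)) \<longlongrightarrow> d) (at t within S)"
proof -
  have "(f has_vector_derivative d) (at t within S) \<longleftrightarrow>
      ((\<lambda>y. norm (f y - f t - (y - t) *\<^sub>R d) / \<bar>y - t\<bar>) \<longlongrightarrow> 0) (at t within S)"
    unfolding has_vector_derivative_def has_derivative_iff_norm
    by (auto intro: bounded_linear_scaleR_left)
  also have "\<dots> \<longleftrightarrow> ((\<lambda>y. norm ((f y - f t) /\<^sub>R (y - t) - d)) \<longlongrightarrow> 0) (at t within S)"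
  proof (intro tendsto_cong)
    have "norm (f y - f t - (y - t) *\<^sub>R d) / \<bar>y - t\<bar> = norm ((f y - f t) /\<^sub>R (y - t) - d)" if "y \<noteq> t" for y
    proof -
      have "(f y - f t) /\<^sub>R (y - t) - d = (f y - f t - (y - t) *\<^sub>R d) /\<^sub>R (y - t)"
        using that by (simp add: scaleR_diff_right)
      then show ?thesis by (simp add: divide_inverse mult.commute)
    qed
    then show "\<forall>\<^sub>F y in at t within S. norm (f y - f t - (y - t) *\<^sub>R d) / \<bar>y - t\<bar> = norm ((f y - f t) /\<^sub>R (y - t) - d)"
      by (auto simp: eventually_at_filter)
  qed
  also have "\<dots> \<longleftrightarrow> ((\<lambda>y. (f y - f t) /\<^sub>R (y - t)) \<longlongrightarrow> d) (at t within S)"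
    by (simp add: tendsto_norm_zero_iff Lim_null[symmetric])
  finally show ?thesis .
qed

text \<open>Solving the Leibniz rule for the derivatives of an inverse.\<close>

fun inverse_derivs :: "('a \<Rightarrow> 'a \<Rightarrow> 'a::real_normed_vector) \<Rightarrow> (nat \<Rightarrow> real \<Rightarrow> 'a) \<Rightarrow> (real \<Rightarrow> 'a) \<Rightarrow> nat \<Rightarrow> real \<Rightarrow> 'a" where
  "inverse_derivs p D g 0 = g"
| "inverse_derivs p D g (Suc k) =
     (\<lambda>t. - p (g t) (\<Sum>j\<le>k. real (Suc k choose Suc j) *\<^sub>R p (D (Suc j) t) (inverse_derivs p D g (k - j) t)))"

text \<open>Covers composition of operators and multiplication of scalars at once. The value of
  \<open>norm e\<close> is left open, since the identity of the zero space has norm 0.\<close>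

locale normed_product = bounded_bilinear prod
  for prod :: "'a \<Rightarrow> 'a \<Rightarrow> 'a::real_normed_vector" (infixl "\<odot>" 70) +
  fixes e :: 'a
  assumes assoc: "(a \<odot> b) \<odot> c = a \<odot> (b \<odot> c)"
    and left_unit: "e \<odot> a = a" and right_unit: "a \<odot> e = a"
    and norm_prod: "norm (a \<odot> b) \<le> norm a * norm b"
begin

text \<open>The identity g y - g t = - g y (f y - f t) g t gives continuity of the bounded function
  \<open>g\<close> first and, after division by y - t, its derivative.\<close>

lemma has_derivative_inverse:
  assumes f: "(f has_vector_derivative d) (at t within S)" and t: "t \<in> S"
    and inv: "\<And>t. t \<in> S \<Longrightarrow> f t \<odot> g t = e" "\<And>t. t \<in> S \<Longrightarrow> g t \<odot> f t = e"
    and C: "\<And>t. t \<in> S \<Longrightarrow> norm (g t) \<le> C"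
  shows "(g has_vector_derivative (- (g t \<odot> (d \<odot> g t)))) (at t within S)"
proof -
  have gy: "g y - g t = - (g y \<odot> ((f y - f t) \<odot> g t))" if y: "y \<in> S" for y
  proof -
    have "g y \<odot> ((f y - f t) \<odot> g t) = (g y \<odot> f y) \<odot> g t - g y \<odot> (f t \<odot> g t)"
      by (simp add: diff_left diff_right assoc)
    then show ?thesis using inv y t by (simp add: left_unit right_unit)
  qed
  have C0: "0 \<le> C" using C[OF t] norm_ge_zero order_trans by blast
  have fc: "((\<lambda>y. f y - f t) \<longlongrightarrow> 0) (at t within S)"
    using has_vector_derivative_continuous[OF f] by (simp add: continuous_within LIM_zero)
  have "((\<lambda>y. g y - g t) \<longlongrightarrow> 0) (at t within S)"
  proof (rule Lim_null_comparison)
    show "\<forall>\<^sub>F y in at t within S. norm (g y - g t) \<le> C * (norm (f y - f t) * C)"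
    proof (unfold eventually_at_filter, rule always_eventually, intro allI impI)
      fix y assume y: "y \<in> S"
      have "norm (g y - g t) \<le> norm (g y) * (norm (f y - f t) * norm (g t))"
        unfolding gy[OF y] norm_minus_cancel
        by (meson norm_prod mult_left_mono norm_ge_zero order_trans)
      also have "\<dots> \<le> C * (norm (f y - f t) * C)"
        using C[OF y] C[OF t] C0 by (intro mult_mono) auto
      finally show "norm (g y - g t) \<le> C * (norm (f y - f t) * C)" .
    qed
    have "((\<lambda>y. C * (norm (f y - f t) * C)) \<longlongrightarrow> C * (norm (0::'a) * C)) (at t within S)"
      by (intro tendsto_intros fc)
    then show "((\<lambda>y. C * (norm (f y - f t) * C)) \<longlongrightarrow> 0) (at t within S)" by simp
  qed
  then have gc: "(g \<longlongrightarrow> g t) (at t within S)" by (rule LIM_zero_cancel)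
  have "((\<lambda>y. - (g y \<odot> (((f y - f t) /\<^sub>R (y - t)) \<odot> g t))) \<longlongrightarrow> - (g t \<odot> (d \<odot> g t))) (at t within S)"
    by (intro tendsto_minus tendsto gc f[unfolded has_vector_derivative_iff_quotient] tendsto_const)
  moreover have "\<forall>\<^sub>F y in at t within S. - (g y \<odot> (((f y - f t) /\<^sub>R (y - t)) \<odot> g t)) = (g y - g t) /\<^sub>R (y - t)"
    unfolding eventually_at_filter
    by (rule always_eventually) (simp add: gy scaleR_left scaleR_right)
  ultimately show ?thesis
    unfolding has_vector_derivative_iff_quotient by (rule Lim_transform_eventually)
qed

text \<open>The Leibniz identity for the constant product \<open>e\<close>. It holds algebraically
  by construction, so it is available before \<open>inverse_derivs\<close> is known to consist of
  derivatives.\<close>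

lemma inverse_derivs_identity:
  assumes "f \<odot> g t = e"
  shows "(\<Sum>j\<le>Suc k. real (Suc k choose j) *\<^sub>R ((if j = 0 then f else D j t) \<odot> inverse_derivs (\<odot>) D g (Suc k - j) t)) = 0"
proof -
  have "f \<odot> inverse_derivs (\<odot>) D g (Suc k) t =
     - (\<Sum>j\<le>k. real (Suc k choose Suc j) *\<^sub>R (D (Suc j) t \<odot> inverse_derivs (\<odot>) D g (k - j) t))"
    using assms by (simp add: minus_right left_unit flip: assoc)
  then show ?thesis
    by (subst sum.atMost_Suc_shift) (simp del: inverse_derivs.simps)
qed

text \<open>The entry of order k is built from \<open>g\<close> and lower entries, so by induction
  it has some derivative \<open>d\<close>. Instead of expanding \<open>d\<close>, two Leibniz
  identities of order k + 1 are compared, one with \<open>d\<close> and one with the next entry as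
  top term; the invertible factor \<open>D 0 t\<close> forces them to agree.\<close>

lemma derivs_inverse:
  assumes D: "derivs S D"
    and inv: "\<And>t. t \<in> S \<Longrightarrow> D 0 t \<odot> g t = e" "\<And>t. t \<in> S \<Longrightarrow> g t \<odot> D 0 t = e"
    and C: "\<And>t. t \<in> S \<Longrightarrow> norm (g t) \<le> C"
  shows "derivs S (inverse_derivs (\<odot>) D g)"
proof -
  let ?G = "inverse_derivs (\<odot>) D g"
  have dD: "(D j has_vector_derivative D (Suc j) t) (at t within S)" if "t \<in> S" for j t
    using D that by (auto simp: derivs_def)
  have ident: "(\<Sum>j\<le>Suc k. real (Suc k choose j) *\<^sub>R (D j t \<odot> ?G (Suc k - j) t)) = 0" if "t \<in> S" for k t
  proof -
    have "(if j = 0 then D 0 t else D j t) = D j t" for j by simp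
    with inverse_derivs_identity[where f = "D 0 t" and g = g and t = t and k = k and D = D, OF inv(1)[OF that]] show ?thesis by (simp only:)
  qed
  have "\<forall>t\<in>S. (?G k has_vector_derivative ?G (Suc k) t) (at t within S)" for k
  proof (induction k rule: less_induct)
    case (less k)
    show ?case
    proof (cases k)
      case 0
      then show ?thesis
        using has_derivative_inverse[OF dD _ inv C] by simp
    next
      case (Suc m)
      show ?thesis
      proof
        fix t assume t: "t \<in> S"
        define s where "s = (\<lambda>t. \<Sum>j\<le>m. real (Suc m choose Suc j) *\<^sub>R (D (Suc j) t \<odot> ?G (m - j) t))"
        have dG: "(?G j has_vector_derivative ?G (Suc j) t) (at t within S)" if "j \<le> m" for j
          using less.IH[of j] that Suc t by auto
        have G0: "(g has_vector_derivative ?G 1 t) (at t within S)"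
          using dG[of 0] by simp
        have sd: "\<exists>s'. (s has_vector_derivative s') (at t within S)"
        proof
          show "(s has_vector_derivative (\<Sum>j\<le>m. real (Suc m choose Suc j) *\<^sub>R
              (D (Suc j) t \<odot> ?G (Suc (m - j)) t + D (Suc (Suc j)) t \<odot> ?G (m - j) t))) (at t within S)"
            unfolding s_def
            by (intro has_vector_derivative_sum bounded_linear.has_vector_derivative[OF bounded_linear_scaleR_right]
                has_vector_derivative dD dG t) auto
        qed
        then obtain s' where s': "(s has_vector_derivative s') (at t within S)" by blast
        have "((\<lambda>t. - (g t \<odot> s t)) has_vector_derivative - (g t \<odot> s' + ?G 1 t \<odot> s t)) (at t within S)"
          by (intro has_vector_derivative_minus has_vector_derivative G0 s')
        moreover have "(\<lambda>t. - (g t \<odot> s t)) = ?G k" by (simp add: s_def Suc)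
        ultimately obtain d where d: "(?G k has_vector_derivative d) (at t within S)" by metis
        \<comment> \<open>Differentiating the Leibniz identity of order \<open>k\<close> determines \<open>d\<close>.\<close>
        define H where "H j = (if j = Suc k then d else ?G j t)" for j
        have H_le: "H j = ?G j t" if "j \<le> k" for j
        proof -
          have "j \<noteq> Suc k" using that by simp
          then show ?thesis by (simp only: H_def if_False)
        qed
        have H_Suc: "H (Suc k) = d" by (simp only: H_def refl if_True)
        have dGk: "(?G j has_vector_derivative H (Suc j)) (at t within S)" if "j \<le> k" for j
        proof (cases "j = k")
          case True
          then show ?thesis using d by (simp only: H_Suc)
        next
          case False
          then have "j \<le> m" "Suc j \<le> k" using that Suc by auto
          then show ?thesis using dG[of j] by (simp only: H_le)
        qed
        have "((\<lambda>t. \<Sum>j\<le>k. real (k choose j) *\<^sub>R (D j t \<odot> ?G (k - j) t)) has_vector_derivative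
           (\<Sum>j\<le>k. real (k choose j) *\<^sub>R (D j t \<odot> H (Suc (k - j)) + D (Suc j) t \<odot> ?G (k - j) t))) (at t within S)"
          by (intro has_vector_derivative_sum bounded_linear.has_vector_derivative[OF bounded_linear_scaleR_right]
                has_vector_derivative dD dGk t) auto
        moreover have "((\<lambda>t. \<Sum>j\<le>k. real (k choose j) *\<^sub>R (D j t \<odot> ?G (k - j) t)) has_vector_derivative 0) (at t within S)"
          by (rule has_vector_derivative_transform[OF t _ has_vector_derivative_const[of 0]])
            (use ident[of _ m] Suc in \<open>simp only:\<close>)
        \<comment> \<open>Derivatives within \<open>S\<close> are unique except at isolated points,
          where every vector is a derivative.\<close>
        ultimately have Z: "at t within S = bot \<or>
            (\<Sum>j\<le>k. real (k choose j) *\<^sub>R (D j t \<odot> H (Suc (k - j)) + D (Suc j) t \<odot> ?G (k - j) t)) = 0"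
          using vector_derivative_unique_within by blast
        show "(?G k has_vector_derivative ?G (Suc k) t) (at t within S)"
        proof (cases "at t within S = bot")
          case True
          then show ?thesis unfolding has_vector_derivative_iff_quotient by (simp only: tendsto_bot)
        next
          case False
          have "(\<Sum>j\<le>k. real (k choose j) *\<^sub>R (D (Suc j) t \<odot> H (k - j) + D j t \<odot> H (Suc (k - j)))) =
             (\<Sum>j\<le>k. real (k choose j) *\<^sub>R (D j t \<odot> H (Suc (k - j)) + D (Suc j) t \<odot> ?G (k - j) t))"
            by (intro sum.cong refl) (simp only: H_le diff_le_self add.commute)
          also have "\<dots> = 0" using Z False by blast
          finally have "(\<Sum>j\<le>Suc k. real (Suc k choose j) *\<^sub>R (D j t \<odot> H (Suc k - j))) = 0"
            by (simp only: binomial_recursion_sum[where a = "\<lambda>i j. D i t \<odot> H j"])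
          also have "(\<Sum>j\<le>Suc k. real (Suc k choose j) *\<^sub>R (D j t \<odot> H (Suc k - j))) =
              D 0 t \<odot> d + (\<Sum>j\<le>k. real (Suc k choose Suc j) *\<^sub>R (D (Suc j) t \<odot> ?G (k - j) t))"
            by (subst sum.atMost_Suc_shift)
              (simp only: H_Suc H_le diff_le_self binomial_n_0 of_nat_1 scaleR_one diff_zero diff_Suc_Suc)
          finally have 1: "D 0 t \<odot> d = - (\<Sum>j\<le>k. real (Suc k choose Suc j) *\<^sub>R (D (Suc j) t \<odot> ?G (k - j) t))"
            by (simp only: add_eq_0_iff2)
          have "(\<Sum>j\<le>Suc k. real (Suc k choose j) *\<^sub>R (D j t \<odot> ?G (Suc k - j) t)) =
              D 0 t \<odot> ?G (Suc k) t + (\<Sum>j\<le>k. real (Suc k choose Suc j) *\<^sub>R (D (Suc j) t \<odot> ?G (k - j) t))"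
            by (subst sum.atMost_Suc_shift)
              (simp only: binomial_n_0 of_nat_1 scaleR_one diff_zero diff_Suc_Suc)
          then have "D 0 t \<odot> ?G (Suc k) t = - (\<Sum>j\<le>k. real (Suc k choose Suc j) *\<^sub>R (D (Suc j) t \<odot> ?G (k - j) t))"
            unfolding ident[OF t, of k] by (simp only: add_eq_0_iff2 eq_commute[of 0])
          with 1 have "D 0 t \<odot> d = D 0 t \<odot> ?G (Suc k) t" by (simp only:)
          then have "(g t \<odot> D 0 t) \<odot> d = (g t \<odot> D 0 t) \<odot> ?G (Suc k) t"
            by (simp only: assoc)
          then have "d = ?G (Suc k) t" using inv(2)[OF t] by (simp only: left_unit)
          with d show ?thesis by simp
        qed
      qed
    qed
  qed
  then show ?thesis by (auto simp: derivs_def)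
qed

lemma sum_geometric_half:
  fixes x :: real assumes "0 \<le> x" "x \<le> 1/2"
  shows "(\<Sum>j\<le>k. x ^ Suc j) \<le> 2 * x"
proof -
  have "(\<Sum>j\<le>k. x ^ Suc j) \<le> (\<Sum>j\<le>k. x * (1/2) ^ j)"
    using assms by (intro sum_mono) (auto intro!: mult_left_mono power_mono)
  also have "\<dots> = x * (\<Sum>j<Suc k. (1/2) ^ j)" by (simp add: sum_distrib_left lessThan_Suc_atMost)
  also have "\<dots> \<le> x * 2"
    using assms by (intro mult_left_mono) (subst sum_gp_strict, auto)
  finally show ?thesis by simp
qed

lemma factorial_bound_inverse:
  assumes D: "factorial_bound S D" and C: "\<And>t. t \<in> S \<Longrightarrow> norm (g t) \<le> C"
  shows "factorial_bound S (inverse_derivs (\<odot>) D g)"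
proof -
  let ?G = "inverse_derivs (\<odot>) D g"
  obtain M r where M: "M > 0" "r > 0" "\<And>k t. t \<in> S \<Longrightarrow> norm (D k t) \<le> M * fact k * r ^ k"
    using D unfolding factorial_bound_def by blast
  define C' where "C' = \<bar>C\<bar> + 1"
  have C': "C' > 0" "\<And>t. t \<in> S \<Longrightarrow> norm (g t) \<le> C'" using C by (force simp: C'_def)+
  \<comment> \<open>The choice gives r/q \<le> 1/2, so the geometric series in r/q is at most 2 r/q,
    and 2 C' M r/q \<le> 1, which closes the induction for the bound C' k! q^k.\<close>
  define q where "q = 2 * r * (1 + C' * M)"
  have CM: "C' * M > 0" using C' M by simp
  have "q > 0" using M CM by (auto simp: q_def intro!: mult_pos_pos add_pos_pos)
  moreover from this have "r / q \<le> 1/2" using M CM by (simp add: q_def divide_le_eq)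
  moreover have "C' * M * (2 * (r / q)) \<le> 1"
    using \<open>q > 0\<close> M by (simp add: divide_le_eq) (simp add: q_def algebra_simps)
  ultimately have q: "q > 0" "r / q \<le> 1/2" "C' * M * (2 * (r / q)) \<le> 1" by auto
  have "norm (?G k t) \<le> C' * fact k * q ^ k" if t: "t \<in> S" for k t
  proof (induction k rule: less_induct)
    case (less k)
    show ?case
    proof (cases k)
      case 0
      then show ?thesis using C' t by simp
    next
      case (Suc m)
      let ?s = "\<Sum>j\<le>m. real (Suc m choose Suc j) *\<^sub>R (D (Suc j) t \<odot> ?G (m - j) t)"
      have summand: "norm (real (Suc m choose Suc j) *\<^sub>R (D (Suc j) t \<odot> ?G (m - j) t)) \<le>
          fact (Suc m) * q ^ Suc m * (M * C') * (r / q) ^ Suc j" if j: "j \<le> m" for j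
      proof -
        have "norm (D (Suc j) t \<odot> ?G (m - j) t) \<le> norm (D (Suc j) t) * norm (?G (m - j) t)" by (rule norm_prod)
        also have "\<dots> \<le> (M * fact (Suc j) * r ^ Suc j) * (C' * fact (m - j) * q ^ (m - j))"
          using M(3)[OF t, of "Suc j"] less.IH[of "m - j"] Suc M by (intro mult_mono) auto
        finally have "real (Suc m choose Suc j) * norm (D (Suc j) t \<odot> ?G (m - j) t) \<le>
           real (Suc m choose Suc j) * ((M * fact (Suc j) * r ^ Suc j) * (C' * fact (m - j) * q ^ (m - j)))"
          by (intro mult_left_mono) auto
        also have "\<dots> = (fact (Suc j) * fact (Suc m - Suc j) * real (Suc m choose Suc j)) * (q ^ (m - j) * r ^ Suc j) * (M * C')"
          by (simp add: mult_ac)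
        also have "fact (Suc j) * fact (Suc m - Suc j) * real (Suc m choose Suc j) = fact (Suc m)"
          using j by (metis Suc_le_mono binomial_fact_lemma of_nat_fact of_nat_mult)
        also have "q ^ (m - j) * r ^ Suc j = q ^ Suc m * (r / q) ^ Suc j"
        proof -
          have "q ^ Suc m = q ^ (m - j) * q ^ Suc j" using j by (simp flip: power_add)
          then show ?thesis using q by (simp add: power_divide)
        qed
        finally show ?thesis by (simp only: norm_scaleR abs_of_nat mult_ac)
      qed
      have "norm ?s \<le> (\<Sum>j\<le>m. fact (Suc m) * q ^ Suc m * (M * C') * (r / q) ^ Suc j)"
        using summand by (intro order_trans[OF norm_sum] sum_mono) auto
      also have "\<dots> = fact (Suc m) * q ^ Suc m * (M * C') * (\<Sum>j\<le>m. (r / q) ^ Suc j)"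
        by (simp add: sum_distrib_left)
      also have "\<dots> \<le> fact (Suc m) * q ^ Suc m * (M * C') * (2 * (r / q))"
        using q M C' by (intro mult_left_mono sum_geometric_half) auto
      also have "\<dots> = fact (Suc m) * q ^ Suc m * (C' * M * (2 * (r / q)))" by (simp add: mult_ac)
      also have "\<dots> \<le> fact (Suc m) * q ^ Suc m * 1"
        using q by (intro mult_left_mono) auto
      finally have s: "norm ?s \<le> fact k * q ^ k" by (simp only: Suc mult_1_right)
      have "norm (?G k t) = norm (g t \<odot> ?s)" by (simp add: Suc)
      also have "\<dots> \<le> norm (g t) * norm ?s" by (rule norm_prod)
      also have "\<dots> \<le> C' * (fact k * q ^ k)"
        using s C'(1) C'(2)[OF t] by (intro mult_mono) auto
      finally show ?thesis by (simp add: mult.assoc)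
    qed
  qed
  then show ?thesis using q by (intro factorial_boundI[where r = q]) auto
qed

lemma regular_inverse:
  assumes "regular an S f"
    and inv: "\<And>t. t \<in> S \<Longrightarrow> f t \<odot> g t = e" "\<And>t. t \<in> S \<Longrightarrow> g t \<odot> f t = e"
    and C: "\<And>t. t \<in> S \<Longrightarrow> norm (g t) \<le> C"
  shows "regular an S g"
proof -
  obtain D where D: "\<And>t. t \<in> S \<Longrightarrow> D 0 t = f t" "derivs S D" "an \<Longrightarrow> factorial_bound S D"
    using assms(1) by (auto simp: regular_def regular_derivs_def)
  show ?thesis
  proof (rule regularI)
    show "regular_derivs an S (inverse_derivs (\<odot>) D g)"
      unfolding regular_derivs_def using D inv
      by (auto intro!: derivs_inverse[OF _ _ _ C] factorial_bound_inverse[OF _ C])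
  qed auto
qed

end

interpretation blinfun_product: normed_product "(o\<^sub>L)" "id_blinfun :: 'a::real_normed_vector \<Rightarrow>\<^sub>L 'a"
proof -
  interpret bounded_bilinear "(o\<^sub>L)" by (rule bounded_bilinear_blinfun_compose)
  show "normed_product (o\<^sub>L) (id_blinfun :: 'a \<Rightarrow>\<^sub>L 'a)"
    by unfold_locales (auto simp: norm_blinfun_compose intro!: blinfun_eqI)
qed

interpretation mult_product: normed_product "(*)" "1 :: 'a::real_normed_field"
proof -
  interpret bounded_bilinear "(*) :: 'a \<Rightarrow> 'a \<Rightarrow> 'a" by (rule bounded_bilinear_mult)
  show "normed_product (*) (1 :: 'a)"
    by unfold_locales (auto simp: norm_mult)
qed

section \<open>Division by powers of t - t0\<close>

lemma regular_divide_step: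
  fixes D :: "nat \<Rightarrow> real \<Rightarrow> 'b::banach"
  assumes D: "regular_derivs an S D" and S: "convex S" "t0 \<in> S" and "D 0 t0 = 0"
  obtains E where "regular_derivs an S E" "\<And>t. t \<in> S \<Longrightarrow> D 0 t = (t - t0) *\<^sub>R E 0 t"
    "\<And>k. E k t0 = D (Suc k) t0 /\<^sub>R real (Suc k)"
proof
  have dD: "derivs S D" using D by (simp add: regular_derivs_def)
  define p where "p t x = t0 + x * (t - t0)" for t x :: real
  \<comment> \<open>Hadamard's formula: E 0 is the mean of D 1 over the segment from
    \<open>t0\<close> to \<open>t\<close>. Differentiating under the integral multiplies the
    integrand by \<open>x\<close>, which explains the weight x^k and makes \<open>E\<close> a
    sequence of derivatives by definition.\<close>
  define E where "E k t = integral (cbox 0 1) (\<lambda>x. x ^ k *\<^sub>R D (Suc k) (p t x))" for k t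
  have p: "p t x \<in> S" if "t \<in> S" "x \<in> cbox 0 1" for t x
    using convexD_alt[OF S(1) S(2) that(1), of x] that(2) by (simp add: p_def algebra_simps)
  have cont: "continuous_on (S \<times> cbox 0 1) (\<lambda>(t, x). x ^ k *\<^sub>R D j (p t x))" for k j
  proof -
    have "continuous_on (S \<times> cbox 0 1) (\<lambda>z. snd z ^ k *\<^sub>R D j (p (fst z) (snd z)))"
      by (intro continuous_intros continuous_on_compose2[OF derivs_continuous[OF dD]])
        (auto simp: p_def[abs_def] intro!: continuous_intros p[unfolded p_def])
    then show ?thesis by (simp add: case_prod_unfold)
  qed
  have cont1: "continuous_on (cbox 0 1) (\<lambda>x. x ^ k *\<^sub>R D j (p t x))" if "t \<in> S" for k j t
    using that by (intro continuous_on_compose2[OF cont[of k j], of _ "\<lambda>x. (t, x)", simplified]) (auto intro!: continuous_intros)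
  have dp: "((\<lambda>x. D j (p t x)) has_vector_derivative (t - t0) *\<^sub>R D (Suc j) (p t x)) (at x within cbox 0 1)"
    if "t \<in> S" "x \<in> cbox 0 1" for j t x
  proof -
    have 1: "(p t has_vector_derivative (t - t0)) (at x within cbox 0 1)"
      unfolding p_def[abs_def] has_real_derivative_iff_has_vector_derivative[symmetric] by (auto intro!: derivative_eq_intros)
    have 2: "(D j has_vector_derivative D (Suc j) (p t x)) (at (p t x) within p t ` cbox 0 1)"
      by (rule has_vector_derivative_within_subset[where S = S]) (use dD p that in \<open>auto simp: derivs_def\<close>)
    show ?thesis using vector_diff_chain_within[OF 1 2] by (simp add: o_def)
  qed
  have dq: "((\<lambda>t. D j (p t x)) has_vector_derivative x *\<^sub>R D (Suc j) (p t x)) (at t within S)"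
    if "t \<in> S" "x \<in> cbox 0 1" for j t x
  proof -
    have 1: "((\<lambda>t. p t x) has_vector_derivative x) (at t within S)"
      unfolding p_def[abs_def] has_real_derivative_iff_has_vector_derivative[symmetric] by (auto intro!: derivative_eq_intros)
    have 2: "(D j has_vector_derivative D (Suc j) (p t x)) (at (p t x) within (\<lambda>t. p t x) ` S)"
      by (rule has_vector_derivative_within_subset[where S = S]) (use dD p that in \<open>auto simp: derivs_def\<close>)
    show ?thesis using vector_diff_chain_within[OF 1 2] by (simp add: o_def)
  qed
  show "D 0 t = (t - t0) *\<^sub>R E 0 t" if t: "t \<in> S" for t
  proof -
    have "((\<lambda>x. (t - t0) *\<^sub>R D 1 (p t x)) has_integral D 0 (p t 1) - D 0 (p t 0)) {0..1}"
      by (rule fundamental_theorem_of_calculus) (use dp[OF t, of _ 0] in auto)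
    moreover have "p t 1 = t" "p t 0 = t0" by (auto simp: p_def)
    ultimately have "((\<lambda>x. (t - t0) *\<^sub>R D 1 (p t x)) has_integral D 0 t) (cbox 0 1)" using assms(4) by simp
    then have "D 0 t = integral (cbox 0 1) (\<lambda>x. (t - t0) *\<^sub>R D 1 (p t x))" by (rule integral_unique[symmetric])
    then show ?thesis by (simp add: E_def)
  qed
  show "E k t0 = D (Suc k) t0 /\<^sub>R real (Suc k)" for k
  proof -
    have "((\<lambda>x. x ^ k) has_integral (1 ^ Suc k / real (Suc k) - 0 ^ Suc k / real (Suc k))) {0..1::real}"
      by (intro fundamental_theorem_of_calculus)
        (auto intro!: derivative_eq_intros simp: has_real_derivative_iff_has_vector_derivative[symmetric] simp del: power_Suc)
    then have "((\<lambda>x. x ^ k *\<^sub>R D (Suc k) t0) has_integral (1 / real (Suc k)) *\<^sub>R D (Suc k) t0) (cbox 0 1)"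
      by (intro has_integral_scaleR_left) simp
    then show ?thesis
      unfolding E_def p_def by (simp add: integral_unique divide_inverse)
  qed
  have "derivs S E"
    unfolding derivs_def
  proof (intro allI ballI)
    fix k t assume t: "t \<in> S"
    have d: "((\<lambda>t. x ^ k *\<^sub>R D (Suc k) (p t x)) has_vector_derivative x ^ Suc k *\<^sub>R D (Suc (Suc k)) (p t x)) (at t within S)"
      if "t \<in> S" "x \<in> cbox 0 1" for t x
    proof -
      from bounded_linear.has_vector_derivative[OF bounded_linear_scaleR_right dq[OF that], of "x ^ k" "Suc k"]
      show ?thesis by (simp add: mult.commute)
    qed
    show "(E k has_vector_derivative E (Suc k) t) (at t within S)"
      unfolding E_def
    proof (rule leibniz_rule_vector_derivative[OF d _ _ t S(1)])
      show "continuous_on (S \<times> cbox 0 1) (\<lambda>(t, x). x ^ Suc k *\<^sub>R D (Suc (Suc k)) (p t x))" by (rule cont)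
    qed (use integrable_continuous[OF cont1] in auto)
  qed
  moreover have "factorial_bound S E" if an: an
  proof -
    obtain M r where M: "M > 0" "r > 0" "\<And>k t. t \<in> S \<Longrightarrow> norm (D k t) \<le> M * fact k * r ^ k"
      using D an unfolding regular_derivs_def factorial_bound_def by blast
    have "norm (E k t) \<le> (M * r) * fact k * (2 * r) ^ k" if t: "t \<in> S" for k t
    proof -
      have "norm (E k t) \<le> (M * fact (Suc k) * r ^ Suc k) * Henstock_Kurzweil_Integration.content (cbox 0 (1::real))"
        unfolding E_def
      proof (rule integrable_bound)
        show "(\<lambda>x. x ^ k *\<^sub>R D (Suc k) (p t x)) integrable_on cbox 0 1"
          by (intro integrable_continuous cont1 t)
        fix x :: real assume x: "x \<in> cbox 0 1"
        have "norm (x ^ k *\<^sub>R D (Suc k) (p t x)) \<le> 1 * norm (D (Suc k) (p t x))"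
          unfolding norm_scaleR using x by (intro mult_right_mono) (auto simp: power_le_one)
        also have "\<dots> \<le> M * fact (Suc k) * r ^ Suc k" using M(3)[OF p[OF t x], of "Suc k"] by simp
        finally show "norm (x ^ k *\<^sub>R D (Suc k) (p t x)) \<le> M * fact (Suc k) * r ^ Suc k" .
      qed (use M in auto)
      also have "\<dots> = real (Suc k) * ((M * r) * fact k * r ^ k)" by simp
      also have "\<dots> \<le> 2 ^ k * ((M * r) * fact k * r ^ k)"
        using M Suc_le_power2 by (intro mult_right_mono) auto
      finally show ?thesis by (simp add: power_mult_distrib mult_ac)
    qed
    then show ?thesis using M by (intro factorial_boundI[where r = "2 * r"]) auto
  qed
  ultimately show "regular_derivs an S E" by (simp add: regular_derivs_def)
qed

text \<open>Iteration of the previous step; the value at \<open>t0\<close> becomes D m t0 / m!, of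
  which only the vanishing is recorded.\<close>

lemma regular_divide_power:
  fixes D :: "nat \<Rightarrow> real \<Rightarrow> 'b::banach"
  assumes "regular_derivs an S D" "convex S" "t0 \<in> S" "\<And>k. k < m \<Longrightarrow> D k t0 = 0"
  shows "\<exists>E. regular_derivs an S E \<and> (\<forall>t\<in>S. D 0 t = (t - t0) ^ m *\<^sub>R E 0 t) \<and> (E 0 t0 = 0 \<longleftrightarrow> D m t0 = 0)"
  using assms(1,4)
proof (induction m arbitrary: D)
  case 0
  then show ?case by (intro exI[of _ D]) auto
next
  case (Suc m)
  obtain E where E: "regular_derivs an S E" "\<And>t. t \<in> S \<Longrightarrow> D 0 t = (t - t0) *\<^sub>R E 0 t"
    "\<And>k. E k t0 = D (Suc k) t0 /\<^sub>R real (Suc k)"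
    using regular_divide_step[OF Suc.prems(1) assms(2,3)] Suc.prems(2) by blast
  have "E k t0 = 0" if "k < m" for k using Suc.prems(2) that by (simp add: E)
  from Suc.IH[OF E(1) this] obtain F where F: "regular_derivs an S F"
    "\<And>t. t \<in> S \<Longrightarrow> E 0 t = (t - t0) ^ m *\<^sub>R F 0 t" "F 0 t0 = 0 \<longleftrightarrow> E m t0 = 0" by blast
  then show ?case by (intro exI[of _ F]) (auto simp: E)
qed

section \<open>Complex Hilbert spaces\<close>

lemma cinner_add_right: "cinner x (y + z) = cinner x y + cinner x (z::'h::complex_hilbert_space)"
  by (metis cinner_add_left cinner_commute complex_cnj_add)

lemma cinner_scaleC_right: "cinner x (c *\<^sub>C y) = cnj c * cinner x (y::'h::complex_hilbert_space)"
  by (metis cinner_scaleC_left cinner_commute complex_cnj_mult)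

lemma cinner_zero_left [simp]: "cinner 0 (x::'h::complex_hilbert_space) = 0"
  using cinner_add_left[of 0 0 x] by simp

lemma cinner_zero_right [simp]: "cinner (x::'h::complex_hilbert_space) 0 = 0"
  using cinner_add_right[of x 0 0] by simp

lemma cinner_minus_left [simp]: "cinner (- x) (y::'h::complex_hilbert_space) = - cinner x y"
  using cinner_add_left[of x "- x" y] by (simp add: eq_neg_iff_add_eq_0 add.commute)

lemma cinner_minus_right [simp]: "cinner x (- y::'h::complex_hilbert_space) = - cinner x y"
  using cinner_add_right[of x y "- y"] by (simp add: eq_neg_iff_add_eq_0 add.commute)

lemma cinner_diff_left: "cinner (x - y) (z::'h::complex_hilbert_space) = cinner x z - cinner y z"
  using cinner_add_left[of x "- y" z] by simp

lemma cinner_diff_right: "cinner x (y - z::'h::complex_hilbert_space) = cinner x y - cinner x z"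
  using cinner_add_right[of x y "- z"] by simp

lemma cinner_sum_left: "cinner (sum f A) (y::'h::complex_hilbert_space) = (\<Sum>a\<in>A. cinner (f a) y)"
  by (induction A rule: infinite_finite_induct) (auto simp: cinner_add_left)

lemma cinner_sum_right: "cinner (y::'h::complex_hilbert_space) (sum f A) = (\<Sum>a\<in>A. cinner y (f a))"
  by (induction A rule: infinite_finite_induct) (auto simp: cinner_add_right)

lemmas cinner_simps = cinner_add_left cinner_add_right cinner_diff_left cinner_diff_right
  cinner_scaleC_left cinner_scaleC_right cinner_sum_left cinner_sum_right

lemma Re_cinner_self: "Re (cinner x x) = (norm (x::'h::complex_hilbert_space))\<^sup>2"
  by (simp add: cinner_self)

lemma cinner_eq_zero_iff [simp]: "cinner x x = 0 \<longleftrightarrow> x = (0::'h::complex_hilbert_space)"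
  by (simp add: cinner_self)

lemma norm_scaleC: "norm (c *\<^sub>C x) = cmod c * norm (x::'h::complex_hilbert_space)"
proof -
  have "complex_of_real ((norm (c *\<^sub>C x))\<^sup>2) = c * (cnj c * complex_of_real ((norm x)\<^sup>2))"
    by (simp only: cinner_self[symmetric] cinner_scaleC_left cinner_scaleC_right mult.left_commute)
  also have "\<dots> = complex_of_real ((cmod c * norm x)\<^sup>2)"
    using complex_norm_square[of c] by (simp add: power_mult_distrib flip: mult.assoc)
  finally have "(norm (c *\<^sub>C x))\<^sup>2 = (cmod c * norm x)\<^sup>2" by (simp only: of_real_eq_iff)
  then show ?thesis by (simp add: power2_eq_iff_nonneg)
qed

lemma norm_add_square:
  "(norm (x + y))\<^sup>2 = (norm x)\<^sup>2 + (norm y)\<^sup>2 + 2 * Re (cinner x (y::'h::complex_hilbert_space))"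
proof -
  have "Re (cinner y x) = Re (cinner x y)" by (subst cinner_commute) simp
  then show ?thesis by (simp add: cinner_simps flip: Re_cinner_self)
qed

lemma norm_diff_square:
  "(norm (x - y))\<^sup>2 = (norm x)\<^sup>2 + (norm y)\<^sup>2 - 2 * Re (cinner x (y::'h::complex_hilbert_space))"
  using norm_add_square[of x "- y"] by simp

lemma parallelogram:
  "(norm (x + y))\<^sup>2 + (norm (x - y))\<^sup>2 = 2 * (norm x)\<^sup>2 + 2 * (norm (y::'h::complex_hilbert_space))\<^sup>2"
  by (simp add: norm_add_square norm_diff_square)

lemma cauchy_schwarz: "cmod (cinner x y) \<le> norm x * norm (y::'h::complex_hilbert_space)"
proof (cases "y = 0")
  case False
  define a where "a = cinner x y / complex_of_real ((norm y)\<^sup>2)"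
  have "0 \<le> (norm (x - a *\<^sub>C y))\<^sup>2" by simp
  also have "\<dots> = (norm x)\<^sup>2 + (cmod a)\<^sup>2 * (norm y)\<^sup>2 - 2 * Re (cnj a * cinner x y)"
    by (simp add: norm_diff_square norm_scaleC cinner_simps power_mult_distrib)
  also have "cnj a * cinner x y = complex_of_real ((cmod (cinner x y))\<^sup>2 / (norm y)\<^sup>2)"
    using complex_norm_square[of "cinner x y"] by (simp add: a_def mult.commute)
  also have "(cmod a)\<^sup>2 * (norm y)\<^sup>2 = (cmod (cinner x y))\<^sup>2 / (norm y)\<^sup>2"
    using False by (simp add: a_def norm_divide norm_power power_divide) (simp add: power2_eq_square power4_eq_xxxx)
  finally have "(cmod (cinner x y))\<^sup>2 / (norm y)\<^sup>2 \<le> (norm x)\<^sup>2" by simp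
  then have "(cmod (cinner x y))\<^sup>2 \<le> (norm x * norm y)\<^sup>2"
    using False by (simp add: field_simps power_mult_distrib)
  then show ?thesis by (rule power2_le_imp_le) simp
qed auto

lemma bounded_bilinear_cinner: "bounded_bilinear (cinner :: 'h::complex_hilbert_space \<Rightarrow> 'h \<Rightarrow> complex)"
proof
  show "\<exists>K. \<forall>a b::'h. norm (cinner a b) \<le> norm a * norm b * K"
    using cauchy_schwarz by (intro exI[of _ 1]) auto
qed (auto simp: cinner_simps scaleR_scaleC scaleR_conv_of_real)

lemma bounded_bilinear_scaleC: "bounded_bilinear (scaleC :: complex \<Rightarrow> 'h \<Rightarrow> 'h::complex_hilbert_space)"
proof
  show "\<exists>K. \<forall>a (b::'h). norm (a *\<^sub>C b) \<le> norm a * norm b * K"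
    by (intro exI[of _ 1]) (auto simp: norm_scaleC)
qed (auto simp: scaleC_add_left scaleC_add_right scaleR_scaleC scaleC_scaleC scaleR_conv_of_real mult.commute)

interpretation cinner: bounded_bilinear "cinner :: 'h::complex_hilbert_space \<Rightarrow> 'h \<Rightarrow> complex"
  by (rule bounded_bilinear_cinner)

interpretation scaleC: bounded_bilinear "scaleC :: complex \<Rightarrow> 'h \<Rightarrow> 'h::complex_hilbert_space"
  by (rule bounded_bilinear_scaleC)

lemma cinner_left_eqI: "(\<And>x. cinner x y = cinner x z) \<Longrightarrow> y = (z::'h::complex_hilbert_space)"
  by (metis cinner_diff_right cinner_eq_zero_iff right_minus_eq)

text \<open>Graphs of operators are subspaces of the product, and this inner product restricts to
  the graph inner product on them. Riesz representation on graphs is the engine of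
  \<open>normal_operator_adjoint\<close>.\<close>

instantiation prod :: (complex_hilbert_space, complex_hilbert_space) complex_hilbert_space
begin

definition scaleC_prod :: "complex \<Rightarrow> 'a \<times> 'b \<Rightarrow> 'a \<times> 'b" where
  "scaleC_prod c x = (c *\<^sub>C fst x, c *\<^sub>C snd x)"

definition cinner_prod :: "'a \<times> 'b \<Rightarrow> 'a \<times> 'b \<Rightarrow> complex" where
  "cinner_prod x y = cinner (fst x) (fst y) + cinner (snd x) (snd y)"

instance
proof
  fix x y :: "'a \<times> 'b"
  show "cinner x y = cnj (cinner y x)"
    unfolding cinner_prod_def by (metis cinner_commute complex_cnj_add)
  show "cinner x x = complex_of_real ((norm x)\<^sup>2)"
    by (simp add: cinner_prod_def cinner_self norm_prod_def)
qed (auto simp: scaleC_prod_def cinner_prod_def scaleC_add_left scaleC_add_right scaleC_scaleC cinner_simps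
      scaleR_scaleC scaleR_prod_def algebra_simps)

end

text \<open>Riesz representation by minimising \<open>(norm u)\<^sup>2 - 2 Re (\<phi> u)\<close> over the subspace, which need
  not be closed.\<close>

lemma riesz_subspace:
  fixes V :: "'h::complex_hilbert_space set"
  assumes V: "complex_vector.subspace V"
    and add: "\<And>u v. u \<in> V \<Longrightarrow> v \<in> V \<Longrightarrow> \<phi> (u + v) = \<phi> u + \<phi> v"
    and scale: "\<And>c u. u \<in> V \<Longrightarrow> \<phi> (c *\<^sub>C u) = c * \<phi> u"
    and bound: "\<And>u. u \<in> V \<Longrightarrow> cmod (\<phi> u) \<le> C * norm u"
  obtains w where "w \<in> closure V" "\<And>u. u \<in> V \<Longrightarrow> \<phi> u = cinner u w"
proof -
  have V0: "0 \<in> V" and Vadd: "u + v \<in> V" and Vsc: "c *\<^sub>C u \<in> V" if "u \<in> V" "v \<in> V" for u v c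
    using V that by (auto simp: complex_vector.subspace_def)
  have V0: "0 \<in> V" using V by (auto simp: complex_vector.subspace_def)
  define F where "F u = (norm u)\<^sup>2 - 2 * Re (\<phi> u)" for u
  have Flow: "F u \<ge> - C\<^sup>2" if "u \<in> V" for u
  proof -
    have "0 \<le> (norm u - C)\<^sup>2" by simp
    moreover have "Re (\<phi> u) \<le> C * norm u" using bound[OF that] complex_Re_le_cmod order_trans by blast
    ultimately show ?thesis by (simp add: F_def power2_diff algebra_simps)
  qed
  define m where "m = Inf (F ` V)"
  have bdd: "bdd_below (F ` V)" using Flow by (intro bdd_belowI[of _ "- C\<^sup>2"]) auto
  have m_le: "m \<le> F u" if "u \<in> V" for u unfolding m_def using bdd that by (intro cInf_lower) auto
  have "\<exists>u\<in>V. F u < m + 1 / real (Suc k)" for k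
  proof -
    have "Inf (F ` V) < m + 1 / real (Suc k)" by (simp add: m_def)
    then show ?thesis using cInf_less_iff[of "F ` V"] V0 bdd by auto
  qed
  then obtain u where u: "\<And>k. u k \<in> V" "\<And>k. F (u k) < m + 1 / real (Suc k)" by metis
  have phi_half: "\<phi> ((1/2) *\<^sub>C (a + b)) = (\<phi> a + \<phi> b) / 2" if "a \<in> V" "b \<in> V" for a b
    using that by (simp add: scale Vadd add)
  \<comment> \<open>The parallelogram law at the midpoint of \<open>a\<close> and \<open>b\<close>:
    almost minimal vectors are close together, so a minimising sequence is Cauchy.\<close>
  have near: "(norm (a - b))\<^sup>2 \<le> 2 * (F a - m) + 2 * (F b - m)" if ab: "a \<in> V" "b \<in> V" for a b
  proof -
    let ?c = "(1/2::complex) *\<^sub>C (a + b)"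
    have "norm ?c = norm (a + b) / 2" by (simp add: norm_scaleC norm_divide)
    then have "(norm ?c)\<^sup>2 = (norm (a + b))\<^sup>2 / 4" by (simp only: power_divide) simp
    then have "F ?c = (norm (a + b))\<^sup>2 / 4 - Re (\<phi> a) - Re (\<phi> b)"
      unfolding F_def phi_half[OF ab] by (simp add: field_simps)
    moreover have "m \<le> F ?c" using ab by (intro m_le Vsc Vadd) auto
    ultimately show ?thesis using parallelogram[of a b] by (simp add: F_def)
  qed
  have "Cauchy u"
  proof (rule metric_CauchyI)
    fix \<epsilon> :: real assume e: "\<epsilon> > 0"
    obtain K where K: "4 / real (Suc K) < \<epsilon>\<^sup>2"
    proof -
      obtain K where "4 / \<epsilon>\<^sup>2 < real K" using reals_Archimedean2 by blast
      then have "4 < \<epsilon>\<^sup>2 * real (Suc K)" using e by (simp add: field_simps) (smt (verit) zero_less_power2)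
      then have "4 / real (Suc K) < \<epsilon>\<^sup>2" by (simp add: field_simps)
      then show ?thesis using that by blast
    qed
    have "dist (u i) (u j) < \<epsilon>" if "i \<ge> K" "j \<ge> K" for i j
    proof -
      have small: "F (u i) - m < 1 / real (Suc K)" if "i \<ge> K" for i
      proof -
        have "1 / real (Suc i) \<le> 1 / real (Suc K)" using that by (simp add: frac_le)
        with u(2)[of i] show ?thesis by linarith
      qed
      have "(norm (u i - u j))\<^sup>2 < \<epsilon>\<^sup>2"
        using near[OF u(1)[of i] u(1)[of j]] small[OF that(1)] small[OF that(2)] K by simp
      then show ?thesis using e by (simp add: dist_norm power2_less_imp_less)
    qed
    then show "\<exists>M. \<forall>m\<ge>M. \<forall>n\<ge>M. dist (u m) (u n) < \<epsilon>" by blast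
  qed
  then obtain w where w: "u \<longlonglongrightarrow> w" using convergent_eq_Cauchy by blast
  show ?thesis
  proof
    show "w \<in> closure V" unfolding closure_sequential using u w by blast
    fix v assume v: "v \<in> V"
    \<comment> \<open>First-order condition at the minimum in direction \<open>x\<close>. Comparing
      with u k + r x for r = s and r = - s leaves an error of second order in
      \<open>s\<close>.\<close>
    have re: "\<bar>Re (cinner x w) - Re (\<phi> x)\<bar> * 2 \<le> s * (norm x)\<^sup>2" if x: "x \<in> V" and s: "s > 0" for x s
    proof -
      have key: "- (2 * r * (Re (cinner x w) - Re (\<phi> x))) \<le> r\<^sup>2 * (norm x)\<^sup>2" for r :: real
      proof -
        have "- (2 * r * (Re (cinner x (u k)) - Re (\<phi> x))) \<le> r\<^sup>2 * (norm x)\<^sup>2 + 1 / real (Suc k)" for k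
        proof -
          have "m \<le> F (u k + complex_of_real r *\<^sub>C x)"
            using x u by (intro m_le Vadd Vsc) auto
          also have "\<dots> = F (u k) + r\<^sup>2 * (norm x)\<^sup>2 + 2 * r * (Re (cinner x (u k)) - Re (\<phi> x))"
          proof -
            have "Re (cinner (u k) x) = Re (cinner x (u k))" by (subst cinner_commute) simp
            then show ?thesis
              using x u by (simp add: F_def norm_add_square norm_scaleC add scale Vsc cinner_simps
                  power_mult_distrib algebra_simps)
          qed
          finally show ?thesis using u(2)[of k] by simp
        qed
        moreover have "(\<lambda>k. - (2 * r * (Re (cinner x (u k)) - Re (\<phi> x)))) \<longlonglongrightarrow> - (2 * r * (Re (cinner x w) - Re (\<phi> x)))"
          by (intro tendsto_intros cinner.tendsto w)
        moreover have "(\<lambda>k. r\<^sup>2 * (norm x)\<^sup>2 + 1 / real (Suc k)) \<longlonglongrightarrow> r\<^sup>2 * (norm x)\<^sup>2 + 0"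
          by (intro tendsto_add tendsto_const LIMSEQ_Suc[OF lim_const_over_n])
        ultimately show ?thesis using LIMSEQ_le[of _ _ _ "r\<^sup>2 * (norm x)\<^sup>2 + 0"] by auto
      qed
      have "s * (2 * \<bar>Re (cinner x w) - Re (\<phi> x)\<bar>) \<le> s * (s * (norm x)\<^sup>2)"
        using key[of s] key[of "- s"] by (auto simp: abs_if power2_eq_square algebra_simps)
      then show ?thesis using s by simp
    qed
    \<comment> \<open>Taking \<open>s\<close> to be the deviation divided by |x|^2 + 1 would bound
      twice the deviation by the deviation itself.\<close>
    have re0: "Re (cinner x w) = Re (\<phi> x)" if x: "x \<in> V" for x
    proof (rule ccontr)
      assume "Re (cinner x w) \<noteq> Re (\<phi> x)"
      then have d: "\<bar>Re (cinner x w) - Re (\<phi> x)\<bar> > 0" by simp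
      have "((norm x)\<^sup>2 + 1) > 0" by (smt (verit) zero_le_power2)
      then have "\<bar>Re (cinner x w) - Re (\<phi> x)\<bar> * 2 \<le> (\<bar>Re (cinner x w) - Re (\<phi> x)\<bar> / ((norm x)\<^sup>2 + 1)) * (norm x)\<^sup>2"
        using d by (intro re x) auto
      also have "\<dots> \<le> \<bar>Re (cinner x w) - Re (\<phi> x)\<bar>"
        using \<open>(norm x)\<^sup>2 + 1 > 0\<close> by (simp add: field_simps)
      finally show False using d by simp
    qed
    have "Im (cinner v w) = Im (\<phi> v)"
      using re0[OF Vsc[OF v v, of "- \<i>"]] v unfolding scale[OF v] cinner_scaleC_left by simp
    with re0[OF v] show "\<phi> v = cinner v w" by (simp add: complex_eq_iff)
  qed
qed

lemma dense_cinner_eqI: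
  fixes V :: "'h::complex_hilbert_space set"
  assumes "closure V = UNIV" "\<And>u. u \<in> V \<Longrightarrow> cinner u y = cinner u z"
  shows "y = z"
proof (rule cinner_left_eqI)
  fix x
  have "x \<in> closure V" using assms(1) by simp
  then obtain u where u: "\<And>k. u k \<in> V" "u \<longlonglongrightarrow> x" unfolding closure_sequential by blast
  have "(\<lambda>k. cinner (u k) y) \<longlonglongrightarrow> cinner x y" "(\<lambda>k. cinner (u k) z) \<longlonglongrightarrow> cinner x z"
    by (intro cinner.tendsto u tendsto_const)+
  moreover have "cinner (u k) y = cinner (u k) z" for k using assms(2) u by blast
  ultimately show "cinner x y = cinner x z" using LIMSEQ_unique by simp
qed

section \<open>Adjoints of normal operators and uniform boundedness\<close>

text \<open>Normality is given only as an identity on \<open>W\<close>, the common domain of the two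
  products. On \<open>W\<close> it yields equal norms of \<open>T\<close> and its adjoint;
  \<open>W\<close> is large enough (a core) to carry this over to \<open>V\<close>. The third clause
  is the maximality of the adjoint and serves to prove membership in \<open>V\<close>.\<close>

theorem normal_operator_adjoint:
  fixes V :: "'h::complex_hilbert_space set"
  assumes "normal_operator V T"
  obtains T' where "\<And>u v. u \<in> V \<Longrightarrow> v \<in> V \<Longrightarrow> cinner (T u) v = cinner u (T' v)"
    "\<And>u v. u \<in> V \<Longrightarrow> v \<in> V \<Longrightarrow> cinner (T u) (T v) = cinner (T' u) (T' v)"
    "\<And>v w. (\<And>u. u \<in> V \<Longrightarrow> cinner (T u) v = cinner u w) \<Longrightarrow> v \<in> V \<and> T' v = w"
proof -
  have V: "complex_vector.subspace V" and dense: "closure V = UNIV"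
    and Tadd: "\<And>u v. u \<in> V \<Longrightarrow> v \<in> V \<Longrightarrow> T (u + v) = T u + T v"
    and Tsc: "\<And>c u. u \<in> V \<Longrightarrow> T (c *\<^sub>C u) = c *\<^sub>C T u"
    and closed: "closed {(u, T u) | u. u \<in> V}"
    using assms by (auto simp: normal_operator_def densely_defined_operator_def closed_operator_def)
  have V0: "0 \<in> V" and Vadd: "\<And>u v. u \<in> V \<Longrightarrow> v \<in> V \<Longrightarrow> u + v \<in> V" and Vsc: "\<And>u c. u \<in> V \<Longrightarrow> c *\<^sub>C u \<in> V"
    using V by (auto simp: complex_vector.subspace_def)
  have Vdiff: "u - v \<in> V" if "u \<in> V" "v \<in> V" for u v
    using that V by (rule complex_vector.subspace_diff[rotated])
  have Tdiff: "T (u - v) = T u - T v" if "u \<in> V" "v \<in> V" for u v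
    using Tadd[OF Vdiff[OF that] that(2)] by (simp add: algebra_simps)
  define Ds where "Ds = adjoint_domain V T"
  define T' where "T' = adjoint_op V T"
  have adjI: "v \<in> Ds \<and> T' v = w" if "\<And>u. u \<in> V \<Longrightarrow> cinner (T u) v = cinner u w" for v w
  proof
    show "v \<in> Ds" unfolding Ds_def adjoint_domain_def
      using that cauchy_schwarz[of _ w] by (auto intro!: exI[of _ "norm w"] simp: mult.commute)
    show "T' v = w" unfolding T'_def adjoint_op_def
    proof (rule the_equality)
      fix w' assume "\<forall>u\<in>V. cinner (T u) v = cinner u w'"
      then show "w' = w" using that by (intro dense_cinner_eqI[OF dense]) auto
    qed (use that in auto)
  qed
  have adj: "cinner (T u) v = cinner u (T' v)" if "u \<in> V" and v: "v \<in> Ds" for u v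
  proof -
    obtain C where C: "\<And>u. u \<in> V \<Longrightarrow> cmod (cinner (T u) v) \<le> C * norm u"
      using v by (auto simp: Ds_def adjoint_domain_def)
    obtain w where "\<And>u. u \<in> V \<Longrightarrow> cinner (T u) v = cinner u w"
      by (rule riesz_subspace[OF V, of "\<lambda>u. cinner (T u) v" C]) (auto simp: Tadd Tsc cinner_simps C)
    with adjI[OF this] that show ?thesis by auto
  qed
  have Ds_add: "u + v \<in> Ds \<and> T' (u + v) = T' u + T' v" if "u \<in> Ds" "v \<in> Ds" for u v
    using that by (intro adjI) (simp add: cinner_simps adj)
  have Ds_diff: "u - v \<in> Ds \<and> T' (u - v) = T' u - T' v" if "u \<in> Ds" "v \<in> Ds" for u v
    using that by (intro adjI) (simp add: cinner_simps adj)
  have Ds_sc: "c *\<^sub>C v \<in> Ds \<and> T' (c *\<^sub>C v) = c *\<^sub>C T' v" if "v \<in> Ds" for c v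
    using that by (intro adjI) (simp add: cinner_simps adj)
  define W where "W = {u \<in> V. T u \<in> Ds}"
  have W_alt: "W = {u \<in> Ds. T' u \<in> V}"
    using assms by (simp add: normal_operator_def W_def Ds_def T'_def)
  have W_comm: "T' (T u) = T (T' u)" if "u \<in> W" for u
    using assms that by (auto simp: normal_operator_def W_def Ds_def T'_def)
  have W: "u \<in> V" "T u \<in> Ds" "u \<in> Ds" "T' u \<in> V" if "u \<in> W" for u
    using that W_alt by (auto simp: W_def)
  define G where "G = {(u, T u) | u. u \<in> V}"
  have G: "complex_vector.subspace G" "closure G = G"
  proof -
    show "complex_vector.subspace G" unfolding complex_vector.subspace_def
      using V0 Vadd Vsc Tadd Tsc[OF V0, of 0]
      by (auto simp: G_def scaleC_prod_def Tsc zero_prod_def)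
    show "closure G = G" using closed by (simp add: G_def)
  qed
  have norm_fst: "norm (fst p) \<le> norm p" and norm_snd: "norm (snd p) \<le> norm p" for p :: "'h \<times> 'h"
    by (simp_all add: norm_prod_def)
  \<comment> \<open>Von Neumann's argument: the functional (u, T u) \<mapsto>
    \<open>cinner u x\<close> is represented on the graph by some (w, T w). This says that T w lies
    in the domain of the adjoint and that w + T' (T w) = x.\<close>
  have surj: "\<exists>w\<in>W. w + T' (T w) = x" for x
  proof -
    obtain p where p: "p \<in> closure G" "\<And>q. q \<in> G \<Longrightarrow> cinner (fst q) x = cinner q p"
    proof (rule riesz_subspace[OF G(1), of "\<lambda>q. cinner (fst q) x" "norm x"])
      fix q :: "'h \<times> 'h"
      have "cmod (cinner (fst q) x) \<le> norm (fst q) * norm x" by (rule cauchy_schwarz)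
      also have "\<dots> \<le> norm q * norm x" by (intro mult_right_mono norm_fst) auto
      finally show "cmod (cinner (fst q) x) \<le> norm x * norm q" by (simp add: mult.commute)
    qed (auto simp: cinner_simps scaleC_prod_def)
    then obtain w where w: "w \<in> V" "p = (w, T w)" using G(2) by (auto simp: G_def)
    have "cinner (T u) (T w) = cinner u (x - w)" if "u \<in> V" for u
      using p(2)[of "(u, T u)"] that w by (auto simp: G_def cinner_prod_def cinner_diff_right)
    from adjI[OF this] have "T w \<in> Ds" "T' (T w) = x - w" by auto
    with w show ?thesis by (intro bexI[of _ w]) (auto simp: W_def)
  qed
  have norm_W: "norm (T' w) = norm (T w)" if w: "w \<in> W" for w
  proof -
    have "cinner (T w) (T w) = cinner w (T (T' w))" using adj W[OF w] W_comm[OF w] by metis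
    also have "\<dots> = cnj (cinner (T (T' w)) w)" by (rule cinner_commute)
    also have "\<dots> = cnj (cinner (T' w) (T' w))" using adj W[OF w] by simp
    also have "\<dots> = cinner (T' w) (T' w)" by (rule cinner_commute[symmetric])
    finally have "(norm (T w))\<^sup>2 = (norm (T' w))\<^sup>2" by (simp flip: Re_cinner_self)
    then show ?thesis by (simp add: power2_eq_iff_nonneg)
  qed
  define GW where "GW = {(w, T w) | w. w \<in> W}"
  have Wsub: "complex_vector.subspace W"
    unfolding complex_vector.subspace_def
    using V0 Vadd Vsc Tadd Tsc Ds_add Ds_sc Tsc[OF V0, of 0] adjI[of 0 0]
    by (auto simp: W_def)
  have GW: "complex_vector.subspace GW" "GW \<subseteq> G"
  proof -
    show "complex_vector.subspace GW" unfolding complex_vector.subspace_def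
      using Wsub Tadd Tsc W(1) Tsc[OF V0, of 0]
      by (auto simp: complex_vector.subspace_def GW_def scaleC_prod_def zero_prod_def)
  qed (use W in \<open>auto simp: GW_def G_def\<close>)
  \<comment> \<open>The representer of (u, T u) on the closure of \<open>GW\<close> is some (y, T
    y). The difference u - y is graph-orthogonal to \<open>W\<close>, hence orthogonal to all w + T'
    (T w), which exhaust the space.\<close>
  have core: "(u, T u) \<in> closure GW" if u: "u \<in> V" for u
  proof -
    obtain p where p: "p \<in> closure GW" "\<And>q. q \<in> GW \<Longrightarrow> cinner q (u, T u) = cinner q p"
      by (rule riesz_subspace[OF GW(1), of "\<lambda>q. cinner q (u, T u)" "norm (u, T u)"])
        (auto simp: cinner_simps cauchy_schwarz mult.commute[of "norm (u, T u)"])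
    then have "p \<in> G" using closure_mono[OF GW(2)] G(2) by auto
    then obtain y where y: "y \<in> V" "p = (y, T y)" by (auto simp: G_def)
    define d where "d = u - y"
    have d: "d \<in> V" "T d = T u - T y" using u y Vdiff Tdiff by (auto simp: d_def)
    have "cinner (w + T' (T w)) d = 0" if w: "w \<in> W" for w
    proof -
      have "cinner w u + cinner (T w) (T u) = cinner w y + cinner (T w) (T y)"
        using p(2)[of "(w, T w)"] w y by (auto simp: GW_def cinner_prod_def)
      moreover have "cinner w d = cinner w u - cinner w y" by (simp add: d_def cinner_diff_right)
      ultimately have "cinner w d + cinner (T w) (T d) = 0"
        unfolding d(2) cinner_diff_right by algebra
      moreover have "cinner (T w) (T d) = cinner (T' (T w)) d"
        using adj[OF d(1) W(2)[OF w]] cinner_commute by metis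
      ultimately show ?thesis by (simp add: cinner_add_left)
    qed
    then have "cinner d d = 0" using surj[of d] by metis
    then have "u = y" by (simp add: d_def)
    then show ?thesis using p y by simp
  qed
  \<comment> \<open>Along a sequence in \<open>W\<close> converging in the graph norm, the adjoint
    values have the same mutual distances as the values of \<open>T\<close>, so they converge; the
    limit is the adjoint value at \<open>u\<close>.\<close>
  have VDs: "u \<in> Ds \<and> norm (T' u) = norm (T u)" if u: "u \<in> V" for u
  proof -
    obtain q where q: "\<And>k. q k \<in> GW" "q \<longlonglongrightarrow> (u, T u)"
      using core[OF u] unfolding closure_sequential by blast
    define w where "w k = fst (q k)" for k
    have w: "w k \<in> W" "q k = (w k, T (w k))" for k using q(1)[of k] by (auto simp: GW_def w_def)
    have wl: "w \<longlonglongrightarrow> u" "(\<lambda>k. T (w k)) \<longlonglongrightarrow> T u"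
      using tendsto_fst[OF q(2)] tendsto_snd[OF q(2)] by (simp_all add: w)
    have "Cauchy (\<lambda>k. T' (w k))"
    proof (rule metric_CauchyI)
      fix e :: real assume "e > 0"
      moreover have "Cauchy (\<lambda>k. T (w k))" using wl(2) by (rule LIMSEQ_imp_Cauchy)
      moreover have "dist (T' (w m)) (T' (w n)) = dist (T (w m)) (T (w n))" for m n
      proof -
        have "w m - w n \<in> W" using Wsub w(1) by (intro complex_vector.subspace_diff) auto
        from norm_W[OF this] show ?thesis
          using Tdiff[OF W(1)[OF w(1)] W(1)[OF w(1)]] Ds_diff[OF W(3)[OF w(1)] W(3)[OF w(1)]]
          by (simp add: dist_norm)
      qed
      ultimately show "\<exists>M. \<forall>m\<ge>M. \<forall>n\<ge>M. dist (T' (w m)) (T' (w n)) < e"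
        by (simp add: metric_CauchyD)
    qed
    then obtain y where y: "(\<lambda>k. T' (w k)) \<longlonglongrightarrow> y" using convergent_eq_Cauchy by blast
    have "cinner (T x) u = cinner x y" if x: "x \<in> V" for x
    proof -
      have "(\<lambda>k. cinner (T x) (w k)) \<longlonglongrightarrow> cinner (T x) u" "(\<lambda>k. cinner x (T' (w k))) \<longlonglongrightarrow> cinner x y"
        by (intro cinner.tendsto wl y tendsto_const)+
      moreover have "cinner (T x) (w k) = cinner x (T' (w k))" for k using adj x W(3) w(1) by blast
      ultimately show ?thesis using LIMSEQ_unique by simp
    qed
    from adjI[OF this] have "u \<in> Ds" "T' u = y" by auto
    moreover have "norm y = norm (T u)"
      using LIMSEQ_unique[OF tendsto_norm[OF y]] tendsto_norm[OF wl(2)] norm_W w(1) by simp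
    ultimately show ?thesis by simp
  qed
  have polar: "cinner (T u) (T v) = cinner (T' u) (T' v)" if uv: "u \<in> V" "v \<in> V" for u v
  proof -
    have re: "Re (cinner (T u) (T v)) = Re (cinner (T' u) (T' v))" if "u \<in> V" "v \<in> V" for u v
      using norm_add_square[of "T u" "T v"] norm_add_square[of "T' u" "T' v"] VDs[OF Vadd[OF that]]
        VDs[OF that(1)] VDs[OF that(2)] Tadd[OF that] Ds_add[of u v] by auto
    have "Im (cinner (T u) (T v)) = Im (cinner (T' u) (T' v))"
      using re[OF Vsc[OF uv(1), of "\<i>"] uv(2)] Ds_sc[of u "\<i>"] VDs[OF uv(1)] Tsc[OF uv(1), of "\<i>"]
      by (simp add: cinner_simps)
    with re[OF uv] show ?thesis by (simp add: complex_eq_iff)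
  qed
  \<comment> \<open>The functional \<phi> pairs with \<open>v\<close> in the graph norm of the
    adjoint, which on \<open>V\<close> is also that of \<open>T\<close>. Its representer v' lies in
    \<open>V\<close>, and v - v' is orthogonal to all w + T' (T w) because the two products agree on
    \<open>W\<close>.\<close>
  have DsV: "v \<in> V" if v: "v \<in> Ds" for v
  proof -
    define \<phi> where "\<phi> q = cinner (fst q) v + cinner (T' (fst q)) (T' v)" for q :: "'h \<times> 'h"
    obtain p where p: "p \<in> closure G" "\<And>q. q \<in> G \<Longrightarrow> \<phi> q = cinner q p"
    proof (rule riesz_subspace[OF G(1), of \<phi> "norm v + norm (T' v)"])
      fix q c assume q: "q \<in> G"
      then have q1: "fst q \<in> V" "fst q \<in> Ds" "norm (T' (fst q)) = norm (snd q)" using VDs by (auto simp: G_def)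
      show "\<phi> (c *\<^sub>C q) = c * \<phi> q"
        using Ds_sc[OF q1(2), of c] by (simp add: \<phi>_def scaleC_prod_def cinner_simps algebra_simps)
      have "cmod (\<phi> q) \<le> norm (fst q) * norm v + norm (T' (fst q)) * norm (T' v)"
        unfolding \<phi>_def by (intro order_trans[OF norm_triangle_ineq] add_mono cauchy_schwarz)
      also have "\<dots> \<le> norm q * norm v + norm q * norm (T' v)"
        unfolding q1 by (intro add_mono mult_right_mono norm_fst norm_snd) auto
      finally show "cmod (\<phi> q) \<le> (norm v + norm (T' v)) * norm q" by (simp add: algebra_simps)
    next
      fix q r assume "q \<in> G" "r \<in> G"
      then have "fst q \<in> Ds" "fst r \<in> Ds" using VDs by (auto simp: G_def)
      then show "\<phi> (q + r) = \<phi> q + \<phi> r"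
        using Ds_add[of "fst q" "fst r"] by (simp add: \<phi>_def cinner_simps algebra_simps)
    qed auto
    then obtain v' where v': "v' \<in> V" "p = (v', T v')" using G(2) by (auto simp: G_def)
    define d where "d = v - v'"
    have d: "d \<in> Ds" "T' d = T' v - T' v'" using Ds_diff v VDs[OF v'(1)] by (auto simp: d_def)
    have "cinner (w + T' (T w)) d = 0" if w: "w \<in> W" for w
    proof -
      have "cinner w v + cinner (T' w) (T' v) = cinner w v' + cinner (T' w) (T' v')"
        using p(2)[of "(w, T w)"] W(1)[OF w] v' polar[OF W(1)[OF w] v'(1)]
        by (auto simp: G_def cinner_prod_def \<phi>_def)
      moreover have "cinner w d = cinner w v - cinner w v'" by (simp add: d_def cinner_diff_right)
      ultimately have "cinner w d + cinner (T' w) (T' d) = 0"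
        unfolding d(2) cinner_diff_right by algebra
      moreover have "cinner (T' w) (T' d) = cinner (T' (T w)) d"
        using adj[OF W(4)[OF w] d(1)] W_comm[OF w] by simp
      ultimately show ?thesis by (simp add: cinner_add_left)
    qed
    then have "cinner d d = 0" using surj[of d] by metis
    then show "v \<in> V" using v' by (simp add: d_def)
  qed
  show ?thesis
    using that[of T'] adj VDs polar adjI DsV by blast
qed

text \<open>By Baire one of the closed sets \<open>S m\<close> contains a ball of radius
  \<open>r\<close>. A vector of norm \<open>r\<close> is the difference of two points of this ball,
  which costs 2 m / r.\<close>

theorem uniform_boundedness:
  fixes F :: "'i \<Rightarrow> 'a::banach \<Rightarrow>\<^sub>L 'b::real_normed_vector"
  assumes "\<And>x. \<exists>K. \<forall>i\<in>J. norm (F i x) \<le> K"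
  shows "\<exists>C. \<forall>i\<in>J. norm (F i) \<le> C"
proof -
  define S where "S m = {x. \<forall>i\<in>J. norm (F i x) \<le> real m}" for m :: nat
  have closed: "closed (S m)" for m
  proof -
    have "S m = (\<Inter>i\<in>J. {x. norm (F i x) \<le> real m})" by (auto simp: S_def)
    moreover have "closed {x. norm (F i x) \<le> real m}" for i
      by (intro closed_Collect_le continuous_intros)
    ultimately show ?thesis by auto
  qed
  have cover: "(\<Union>m. S m) = UNIV"
  proof -
    have "x \<in> (\<Union>m. S m)" for x
    proof -
      obtain K where "\<forall>i\<in>J. norm (F i x) \<le> K" using assms by blast
      moreover obtain m where "K \<le> real m" using real_arch_simple by blast
      ultimately have "x \<in> S m" by (auto simp: S_def intro: order_trans)
      then show ?thesis by blast
    qed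
    then show ?thesis by auto
  qed
  have "\<exists>m. interior (S m) \<noteq> {}"
  proof (rule ccontr)
    assume "\<not> ?thesis"
    then have "euclidean interior_of \<Union>(range S) = {}"
      using closed by (intro Baire_category_alt) (auto simp: completely_metrizable_space_euclidean)
    then show False using cover by simp
  qed
  then obtain m x0 where "x0 \<in> interior (S m)" by blast
  then obtain r where r: "r > 0" "cball x0 r \<subseteq> S m" by (meson mem_interior_cball)
  have "norm (F i) \<le> 2 * real m / r" if i: "i \<in> J" for i
  proof (rule norm_blinfun_bound)
    fix x :: 'a
    show "norm (F i x) \<le> 2 * real m / r * norm x"
    proof (cases "x = 0")
      case False
      define y where "y = (r / norm x) *\<^sub>R x"
      have "norm y = r" using False r by (simp add: y_def)
      then have "x0 + y \<in> S m" "x0 \<in> S m" using r by (auto simp: dist_norm subset_iff)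
      then have "norm (F i (x0 + y)) \<le> m" "norm (F i x0) \<le> m" using i by (auto simp: S_def)
      then have "norm (F i y) \<le> 2 * real m"
        using norm_triangle_ineq4[of "F i (x0 + y)" "F i x0"] by (simp add: blinfun.add_right)
      moreover have "norm (F i y) = (r / norm x) * norm (F i x)"
        using r by (simp add: y_def blinfun.scaleR_right)
      ultimately show ?thesis using False r by (simp add: field_simps)
    qed (simp add: blinfun.zero_right)
  qed (use r in auto)
  then show ?thesis by blast
qed

text \<open>Uniform boundedness is applied twice: for fixed \<open>x\<close> to the functionals
  \<open>\<lambda>v. cinner v (F i x)\<close>, and then to the operators themselves.\<close>

lemma weak_uniform_boundedness:
  fixes F :: "'i \<Rightarrow> 'a::banach \<Rightarrow>\<^sub>L 'h::complex_hilbert_space"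
  assumes "\<And>x v. \<exists>K. \<forall>i\<in>J. cmod (cinner (F i x) v) \<le> K"
  shows "\<exists>C. \<forall>i\<in>J. norm (F i) \<le> C"
proof (rule uniform_boundedness)
  fix x
  define \<phi> where "\<phi> i = Blinfun (\<lambda>v. cinner v (F i x))" for i
  have phi: "blinfun_apply (\<phi> i) v = cinner v (F i x)" for i v
    unfolding \<phi>_def by (subst bounded_linear_Blinfun_apply) (auto simp: cinner.bounded_linear_left)
  have "\<exists>C. \<forall>i\<in>J. norm (\<phi> i) \<le> C"
  proof (rule uniform_boundedness)
    fix v
    have "norm (\<phi> i v) = cmod (cinner (F i x) v)" for i
      unfolding phi by (subst cinner_commute) simp
    then show "\<exists>K. \<forall>i\<in>J. norm (\<phi> i v) \<le> K" using assms by simp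
  qed
  then obtain C where C: "\<And>i. i \<in> J \<Longrightarrow> norm (\<phi> i) \<le> C" by blast
  have "norm (F i x) \<le> C" if i: "i \<in> J" for i
  proof -
    have "(norm (F i x))\<^sup>2 = norm (\<phi> i (F i x))" by (simp add: phi cinner_self norm_power)
    also have "\<dots> \<le> C * norm (F i x)"
      using norm_blinfun[of "\<phi> i" "F i x"] mult_right_mono[OF C[OF i], of "norm (F i x)"] by simp
    finally have "(norm (F i x))\<^sup>2 \<le> C * norm (F i x)" .
    moreover have "0 \<le> C" using C[OF i] norm_ge_zero[of "\<phi> i"] by linarith
    ultimately show ?thesis by (cases "norm (F i x) = 0") (auto simp: power2_eq_square)
  qed
  then show "\<exists>K. \<forall>i\<in>J. norm (F i x) \<le> K" by blast
qed

section \<open>Weakly smooth operator functions\<close>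

text \<open>Uniform boundedness for germs: the level at which a weak bound sets in may depend on
  \<open>x\<close> and \<open>v\<close>, yet one level has a norm bound. Otherwise one could pick in
  each level an operator of norm above \<open>m\<close>; the resulting sequence is weakly bounded,
  because all but finitely many of its members lie in any given level.\<close>

lemma local_weak_boundedness:
  fixes F :: "'i \<Rightarrow> 'a::banach \<Rightarrow>\<^sub>L 'h::complex_hilbert_space"
  assumes dec: "\<And>m n. m \<le> n \<Longrightarrow> P n \<subseteq> P m"
    and bound: "\<And>x v. \<exists>K m. \<forall>i\<in>P m. cmod (cinner (F i x) v) \<le> K"
  shows "\<exists>C m. m > (0::nat) \<and> (\<forall>i\<in>P m. norm (F i) \<le> C)"
proof (rule ccontr)
  assume not: "\<not> ?thesis"
  have "\<exists>i. i \<in> P (Suc m) \<and> norm (F i) > real m" for m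
    using not by (meson not_le zero_less_Suc)
  then obtain i where i: "\<And>m. i m \<in> P (Suc m)" "\<And>m. norm (F (i m)) > real m" by metis
  have "\<exists>C. \<forall>m\<in>UNIV. norm (F (i m)) \<le> C"
  proof (rule weak_uniform_boundedness)
    fix x v
    obtain K m where K: "\<And>j. j \<in> P m \<Longrightarrow> cmod (cinner (F j x) v) \<le> K" using bound by blast
    let ?K = "\<bar>K\<bar> + (\<Sum>n<m. cmod (cinner (F (i n) x) v))"
    have "cmod (cinner (F (i n) x) v) \<le> ?K" for n
    proof (cases "n < m")
      case True
      then have "cmod (cinner (F (i n) x) v) \<le> (\<Sum>n<m. cmod (cinner (F (i n) x) v))"
        by (intro member_le_sum) auto
      then show ?thesis by linarith
    next
      case False
      then have "i n \<in> P m" using dec[of m "Suc n"] i(1)[of n] by auto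
      from K[OF this] have "cmod (cinner (F (i n) x) v) \<le> \<bar>K\<bar>" by linarith
      moreover have "0 \<le> (\<Sum>n<m. cmod (cinner (F (i n) x) v))" by (intro sum_nonneg) auto
      ultimately show ?thesis by linarith
    qed
    then show "\<exists>K. \<forall>m\<in>UNIV. cmod (cinner (F (i m) x) v) \<le> K" by blast
  qed
  then obtain C where C: "\<And>m. norm (F (i m)) \<le> C" by blast
  obtain m where "C \<le> real m" using real_arch_simple by blast
  with C[of m] i(2)[of m] show False by simp
qed

lemma interval_islimpt:
  fixes I :: "real set"
  assumes "is_interval I" "t \<in> I" "I \<noteq> {t}" "\<delta> > 0"
  shows "t islimpt (I \<inter> ball t \<delta>)"
proof -
  have "connected I" using assms(1) by (simp add: is_interval_connected)
  then have "t islimpt I" using assms(2,3) by (intro connected_imp_perfect) auto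
  show ?thesis unfolding islimpt_approachable
  proof (intro allI impI)
    fix e :: real assume "e > 0"
    then obtain x where "x \<in> I" "x \<noteq> t" "dist x t < min e \<delta>"
      using \<open>t islimpt I\<close> assms(4) unfolding islimpt_approachable by (meson min_less_iff_conj)
    then show "\<exists>x\<in>I \<inter> ball t \<delta>. x \<noteq> t \<and> dist x t < e" by (auto simp: dist_commute)
  qed
qed

lemma derivs_locally_bounded:
  fixes D :: "nat \<Rightarrow> real \<Rightarrow> 'b::real_normed_vector"
  assumes "derivs S D" "t \<in> S"
  obtains K \<eta> where "\<eta> > 0" "K > 0" "\<And>x. x \<in> S \<inter> ball t \<eta> \<Longrightarrow> norm (D k x) \<le> K"
proof -
  have "continuous (at t within S) (D k)"
    using derivs_continuous[OF assms(1)] assms(2) by (simp add: continuous_on_eq_continuous_within)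
  then obtain \<eta> where \<eta>: "\<eta> > 0" "\<And>x. x \<in> S \<Longrightarrow> dist x t < \<eta> \<Longrightarrow> dist (D k x) (D k t) < 1"
    unfolding continuous_within_eps_delta by (meson zero_less_one)
  show ?thesis
  proof (rule that[of \<eta> "norm (D k t) + 1"])
    show "norm (D k x) \<le> norm (D k t) + 1" if "x \<in> S \<inter> ball t \<eta>" for x
      using \<eta>(2)[of x] that norm_triangle_ineq2[of "D k x" "D k t"] by (auto simp: dist_norm abs_minus_commute)
  qed (use \<eta> in \<open>auto simp: add_nonneg_pos\<close>)
qed

text \<open>The linear rate, paid for with the second derivative, is what allows two difference
  quotients to be compared in \<open>weak_derivative\<close>.\<close>

lemma quotient_bound:
  fixes D :: "nat \<Rightarrow> real \<Rightarrow> 'b::banach"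
  assumes D: "derivs S D" and S: "convex S" and t: "t \<in> S"
    and K: "\<And>x. x \<in> S \<inter> ball t \<eta> \<Longrightarrow> norm (D 2 x) \<le> K"
    and h: "h \<in> S \<inter> ball t \<eta>" "h \<noteq> t"
  shows "norm ((D 0 h - D 0 t) /\<^sub>R (h - t) - D 1 t) \<le> K * \<bar>h - t\<bar>"
proof -
  have "t \<in> S \<inter> ball t \<eta>" using h t by (auto intro: le_less_trans[OF zero_le_dist])
  then have seg: "closed_segment t h \<subseteq> S \<inter> ball t \<eta>"
    using h S by (intro closed_segment_subset) (auto intro: convex_Int)
  have "norm (D 0 h - (\<Sum>k\<le>1. ((h - t) ^ k / fact k) *\<^sub>R D k t)) \<le> K * \<bar>h - t\<bar> ^ Suc 1 / fact 1"
  proof (rule taylor_bound[OF D])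
    show "norm (D (Suc 1) x) \<le> K" if "x \<in> closed_segment t h" for x
    proof -
      have "x \<in> S \<inter> ball t \<eta>" using seg that by blast
      from K[OF this] show ?thesis by (simp add: numeral_2_eq_2)
    qed
  qed (use seg in auto)
  then have 1: "norm (D 0 h - D 0 t - (h - t) *\<^sub>R D 1 t) \<le> K * \<bar>h - t\<bar> * \<bar>h - t\<bar>"
    by (simp add: algebra_simps)
  have "(D 0 h - D 0 t) /\<^sub>R (h - t) - D 1 t = (D 0 h - D 0 t - (h - t) *\<^sub>R D 1 t) /\<^sub>R (h - t)"
    using h by (simp add: scaleR_diff_right)
  then have "norm ((D 0 h - D 0 t) /\<^sub>R (h - t) - D 1 t) = norm (D 0 h - D 0 t - (h - t) *\<^sub>R D 1 t) / \<bar>h - t\<bar>"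
    by (simp add: divide_inverse mult.commute)
  also have "\<dots> \<le> K * \<bar>h - t\<bar>" using 1 h by (simp add: divide_le_eq)
  finally show ?thesis .
qed

lemma weak_derivative:
  fixes f :: "real \<Rightarrow> 'a::banach \<Rightarrow>\<^sub>L 'h::complex_hilbert_space"
  assumes I: "is_interval I" and t: "t \<in> I"
    and smooth: "\<And>x v. smooth_on I (\<lambda>t. cinner (f t x) v)"
  shows "\<exists>d. (f has_vector_derivative d) (at t within I)"
proof (cases "I = {t}")
  case True
  have "at t within {t} = bot" by (simp add: trivial_limit_within islimpt_finite)
  then show ?thesis unfolding has_vector_derivative_iff_quotient using True by simp
next
  case False
  have conv: "convex I" using I by (simp add: is_interval_convex)
  define \<Delta> where "\<Delta> h = (f h - f t) /\<^sub>R (h - t)" for h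
  define P where "P m = {(h, h'). h \<in> I \<inter> ball t (1 / real m) - {t} \<and> h' \<in> I \<inter> ball t (1 / real m) - {t}}" for m :: nat
  \<comment> \<open>A weak Lipschitz quotient: weakly, both difference quotients are within a
    multiple of their distance to \<open>t\<close> of the same derivative, so these operators are
    weakly bounded near \<open>t\<close>. The resulting norm bound makes the difference quotients
    Cauchy in operator norm.\<close>
  define F where "F = (\<lambda>(h, h'). (\<Delta> h - \<Delta> h') /\<^sub>R (\<bar>h - t\<bar> + \<bar>h' - t\<bar>))"
  have "\<exists>C m. m > (0::nat) \<and> (\<forall>i\<in>P (Suc m). norm (F i) \<le> C)"
  proof (rule local_weak_boundedness[where P = "\<lambda>m. P (Suc m)"])
    fix m n :: nat assume "m \<le> n"
    then have "1 / real (Suc n) \<le> 1 / real (Suc m)" by (simp add: frac_le)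
    then have "ball t (1 / real (Suc n)) \<subseteq> ball t (1 / real (Suc m))" by auto
    then show "P (Suc n) \<subseteq> P (Suc m)" unfolding P_def by blast
  next
    fix x v
    obtain D where D: "\<And>t. t \<in> I \<Longrightarrow> D 0 t = cinner (f t x) v" "derivs I D"
      using smooth[of x v] by (auto simp: smooth_on_def derivs_def)
    obtain K \<eta> where K: "\<eta> > 0" "K > 0" "\<And>x. x \<in> I \<inter> ball t \<eta> \<Longrightarrow> norm (D 2 x) \<le> K"
      using derivs_locally_bounded[OF D(2) t, of 2] by blast
    obtain m :: nat where m: "1 / \<eta> < real m" using reals_Archimedean2 by blast
    then have "1 / real (Suc m) \<le> \<eta>" using K by (simp add: field_simps)
    have q: "cmod (cinner (\<Delta> h x) v - D 1 t) \<le> K * \<bar>h - t\<bar>" if h: "h \<in> I \<inter> ball t (1 / real (Suc m)) - {t}" for h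
    proof -
      have "cinner (\<Delta> h x) v = (D 0 h - D 0 t) /\<^sub>R (h - t)"
        using h t D(1) by (simp add: \<Delta>_def blinfun.bilinear_simps cinner.scaleR_left cinner_diff_left)
      moreover have "h \<in> I \<inter> ball t \<eta>" using h \<open>1 / real (Suc m) \<le> \<eta>\<close> by auto
      ultimately show ?thesis using quotient_bound[where \<eta> = \<eta>, OF D(2) conv t K(3)] h by simp
    qed
    have "cmod (cinner (F i x) v) \<le> K" if i: "i \<in> P (Suc m)" for i
    proof -
      obtain h h' where h: "i = (h, h')" "h \<in> I \<inter> ball t (1 / real (Suc m)) - {t}" "h' \<in> I \<inter> ball t (1 / real (Suc m)) - {t}"
        using i by (auto simp: P_def)
      have pos: "\<bar>h - t\<bar> + \<bar>h' - t\<bar> > 0" using h by auto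
      have "cinner (F i x) v = (cinner (\<Delta> h x) v - cinner (\<Delta> h' x) v) /\<^sub>R (\<bar>h - t\<bar> + \<bar>h' - t\<bar>)"
        using h by (simp add: F_def blinfun.bilinear_simps cinner.scaleR_left cinner_diff_left)
      also have "cmod \<dots> = cmod ((cinner (\<Delta> h x) v - D 1 t) - (cinner (\<Delta> h' x) v - D 1 t)) / (\<bar>h - t\<bar> + \<bar>h' - t\<bar>)"
        using pos by (simp add: divide_inverse mult.commute)
      also have "\<dots> \<le> (K * \<bar>h - t\<bar> + K * \<bar>h' - t\<bar>) / (\<bar>h - t\<bar> + \<bar>h' - t\<bar>)"
        using pos order_trans[OF norm_triangle_ineq4 add_mono[OF q[OF h(2)] q[OF h(3)]]]
          by (intro divide_right_mono) auto
      also have "\<dots> = K" using pos by (simp add: field_simps)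
      finally show ?thesis .
    qed
    then show "\<exists>K m. \<forall>i\<in>P (Suc m). cmod (cinner (F i x) v) \<le> K" by blast
  qed
  then obtain C m where C: "\<And>i. i \<in> P (Suc m) \<Longrightarrow> norm (F i) \<le> C" by blast
  define \<rho> where "\<rho> = 1 / real (Suc m)"
  have \<rho>: "\<rho> > 0" by (simp add: \<rho>_def)
  have C2: "norm (\<Delta> h - \<Delta> h') \<le> C * (\<bar>h - t\<bar> + \<bar>h' - t\<bar>)"
    if "h \<in> I \<inter> ball t \<rho> - {t}" "h' \<in> I \<inter> ball t \<rho> - {t}" for h h'
  proof -
    have pos: "\<bar>h - t\<bar> + \<bar>h' - t\<bar> > 0" using that by auto
    have "norm (F (h, h')) \<le> C" using that by (intro C) (auto simp: P_def \<rho>_def)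
    moreover have "norm (F (h, h')) = norm (\<Delta> h - \<Delta> h') / (\<bar>h - t\<bar> + \<bar>h' - t\<bar>)"
      using pos by (simp add: F_def divide_inverse mult.commute)
    ultimately show ?thesis using pos by (simp add: divide_le_eq)
  qed
  obtain y where y: "y \<in> I \<inter> ball t \<rho> - {t}"
    using interval_islimpt[OF I t False \<rho>] unfolding islimpt_approachable by (metis DiffI singletonD zero_less_one)
  then have C0: "0 \<le> C" using order_trans[OF norm_ge_zero C2[OF y y]] by (auto simp: zero_le_mult_iff)
  obtain h where h: "\<And>n. h n \<in> I \<inter> ball t \<rho> - {t}" "h \<longlonglongrightarrow> t"
    using interval_islimpt[OF I t False \<rho>] unfolding islimpt_sequential by blast
  have h0: "(\<lambda>n. \<bar>h n - t\<bar>) \<longlonglongrightarrow> 0" using h(2) by (simp add: LIM_zero tendsto_rabs_zero)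
  have "Cauchy (\<lambda>n. \<Delta> (h n))"
  proof (rule metric_CauchyI)
    fix e :: real assume e: "e > 0"
    then have "e / (2 * (C + 1)) > 0" using C0 by simp
    then obtain N where N: "\<And>n. n \<ge> N \<Longrightarrow> \<bar>h n - t\<bar> < e / (2 * (C + 1))"
      using h0 unfolding LIMSEQ_iff by (metis abs_abs diff_zero real_norm_def)
    have "dist (\<Delta> (h i)) (\<Delta> (h j)) < e" if "i \<ge> N" "j \<ge> N" for i j
    proof -
      have "dist (\<Delta> (h i)) (\<Delta> (h j)) \<le> C * (\<bar>h i - t\<bar> + \<bar>h j - t\<bar>)"
        unfolding dist_norm by (rule C2[OF h(1) h(1)])
      also have "\<dots> \<le> (C + 1) * (\<bar>h i - t\<bar> + \<bar>h j - t\<bar>)" by (intro mult_right_mono) auto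
      also have "\<dots> < (C + 1) * (e / (2 * (C + 1)) + e / (2 * (C + 1)))"
        using N[OF that(1)] N[OF that(2)] C0 by (intro mult_strict_left_mono) auto
      also have "\<dots> = e"
      proof -
        have "c * (e / (2 * c) + e / (2 * c)) = e" if "c > 0" for c
          using that by (simp add: field_simps)
        from this[of "C + 1"] show ?thesis using C0 by simp
      qed
      finally show ?thesis .
    qed
    then show "\<exists>M. \<forall>i\<ge>M. \<forall>j\<ge>M. dist (\<Delta> (h i)) (\<Delta> (h j)) < e" by blast
  qed
  then obtain L where L: "(\<lambda>n. \<Delta> (h n)) \<longlonglongrightarrow> L" using convergent_eq_Cauchy by blast
  have bL: "norm (\<Delta> y - L) \<le> C * \<bar>y - t\<bar>" if y: "y \<in> I \<inter> ball t \<rho> - {t}" for y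
  proof (rule LIMSEQ_le)
    show "(\<lambda>n. norm (\<Delta> y - \<Delta> (h n))) \<longlonglongrightarrow> norm (\<Delta> y - L)" by (intro tendsto_intros L)
    have "(\<lambda>n. C * (\<bar>y - t\<bar> + \<bar>h n - t\<bar>)) \<longlonglongrightarrow> C * (\<bar>y - t\<bar> + 0)" by (intro tendsto_intros h0)
    then show "(\<lambda>n. C * (\<bar>y - t\<bar> + \<bar>h n - t\<bar>)) \<longlonglongrightarrow> C * \<bar>y - t\<bar>" by simp
  qed (use C2[OF y h(1)] in auto)
  have "((\<lambda>y. \<Delta> y - L) \<longlongrightarrow> 0) (at t within I)"
  proof (rule Lim_null_comparison)
    have "\<forall>\<^sub>F y in at t within I. y \<in> I \<inter> ball t \<rho> - {t}"
      unfolding eventually_at using \<rho> by (intro exI[of _ \<rho>]) (auto simp: dist_commute)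
    then show "\<forall>\<^sub>F y in at t within I. norm (\<Delta> y - L) \<le> C * \<bar>y - t\<bar>"
      by (rule eventually_mono) (rule bL)
    have "((\<lambda>y. C * \<bar>y - t\<bar>) \<longlongrightarrow> C * \<bar>t - t\<bar>) (at t within I)" by (intro tendsto_intros)
    then show "((\<lambda>y. C * \<bar>y - t\<bar>) \<longlongrightarrow> 0) (at t within I)" by simp
  qed
  from LIM_zero_cancel[OF this] show ?thesis
    unfolding has_vector_derivative_iff_quotient \<Delta>_def by blast
qed

lemma derivs_weak:
  assumes "(f has_vector_derivative d) (at t within I)"
  shows "((\<lambda>t. cinner (blinfun_apply (f t) x) (v::'h::complex_hilbert_space)) has_vector_derivative cinner (d x) v) (at t within I)"
  by (rule bounded_linear.has_vector_derivative[OF _ assms])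
    (intro bounded_linear_compose[OF cinner.bounded_linear_left blinfun.bounded_linear_left])

text \<open>On a nondegenerate interval derivatives are unique, so the scalar derivatives are those
  obtained from the norm derivative. Shifting their sequence by one shows that the norm derivative
  is weakly smooth again.\<close>

lemma weak_smooth_step:
  fixes f :: "real \<Rightarrow> 'a::banach \<Rightarrow>\<^sub>L 'h::complex_hilbert_space"
  assumes I: "is_interval I" "\<And>t. I \<noteq> {t}"
    and smooth: "\<And>x v. smooth_on I (\<lambda>t. cinner (f t x) v)"
  shows "\<exists>f' :: real \<Rightarrow> 'a \<Rightarrow>\<^sub>L 'h. (\<forall>x v. smooth_on I (\<lambda>t. cinner (blinfun_apply (f' t) x) v)) \<and> (\<forall>t\<in>I. (f has_vector_derivative f' t) (at t within I))"
proof -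
  obtain f' :: "real \<Rightarrow> 'a \<Rightarrow>\<^sub>L 'h" where f': "\<And>t. t \<in> I \<Longrightarrow> (f has_vector_derivative f' t) (at t within I)"
    using weak_derivative[OF I(1) _ smooth] by metis
  have "smooth_on I (\<lambda>t. cinner (blinfun_apply (f' t) x) v)" for x v
  proof -
    obtain D where D: "\<And>t. t \<in> I \<Longrightarrow> D 0 t = cinner (f t x) v" "derivs I D"
      using smooth[of x v] by (auto simp: smooth_on_def derivs_def)
    have "D 1 t = cinner (blinfun_apply (f' t) x) v" if t: "t \<in> I" for t
    proof (rule vector_derivative_unique_within)
      have "t islimpt (I \<inter> ball t 1)" by (rule interval_islimpt[OF I(1) t I(2)]) simp
      then have "t islimpt I" by (rule islimpt_subset) simp
      then show "at t within I \<noteq> bot" by (simp add: trivial_limit_within)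
      show "(D 0 has_vector_derivative D 1 t) (at t within I)" using D(2) t by (simp add: derivs_def)
      show "(D 0 has_vector_derivative cinner (blinfun_apply (f' t) x) v) (at t within I)"
        by (rule has_vector_derivative_transform[OF t _ derivs_weak[OF f'[OF t]]]) (use D(1) in auto)
    qed
    then show ?thesis using D(2) unfolding smooth_on_def derivs_def
      by (intro exI[of _ "\<lambda>k. D (Suc k)"]) auto
  qed
  then show ?thesis using f' by blast
qed

lemma weak_smooth_derivs:
  fixes f :: "real \<Rightarrow> 'a::banach \<Rightarrow>\<^sub>L 'h::complex_hilbert_space"
  assumes I: "is_interval I" "\<And>t. I \<noteq> {t}"
    and smooth: "\<And>x v. smooth_on I (\<lambda>t. cinner (f t x) v)"
  obtains D :: "nat \<Rightarrow> real \<Rightarrow> 'a \<Rightarrow>\<^sub>L 'h" where "D 0 = f" "derivs I D"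
proof -
  have "\<exists>D :: nat \<Rightarrow> real \<Rightarrow> 'a \<Rightarrow>\<^sub>L 'h. \<forall>n. ((\<forall>x v. smooth_on I (\<lambda>t. cinner (blinfun_apply (D n t) x) v)) \<and> (n = 0 \<longrightarrow> D n = f)) \<and>
     (\<forall>t\<in>I. (D n has_vector_derivative D (Suc n) t) (at t within I))"
  proof (rule dependent_nat_choice)
    show "\<exists>g :: real \<Rightarrow> 'a \<Rightarrow>\<^sub>L 'h. (\<forall>x v. smooth_on I (\<lambda>t. cinner (blinfun_apply (g t) x) v)) \<and> ((0::nat) = 0 \<longrightarrow> g = f)" using smooth by blast
    show "\<exists>g' :: real \<Rightarrow> 'a \<Rightarrow>\<^sub>L 'h. ((\<forall>x v. smooth_on I (\<lambda>t. cinner (blinfun_apply (g' t) x) v)) \<and> (Suc n = 0 \<longrightarrow> g' = f)) \<and>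
      (\<forall>t\<in>I. (g has_vector_derivative g' t) (at t within I))"
      if "(\<forall>x v. smooth_on I (\<lambda>t. cinner (blinfun_apply (g t) x) v)) \<and> (n = 0 \<longrightarrow> g = f)" for g :: "real \<Rightarrow> 'a \<Rightarrow>\<^sub>L 'h" and n :: nat
      using weak_smooth_step[OF I, of g] that by blast
  qed
  then obtain D :: "nat \<Rightarrow> real \<Rightarrow> 'a \<Rightarrow>\<^sub>L 'h" where
    D: "\<And>n. n = 0 \<longrightarrow> D n = f" "\<And>n. \<forall>t\<in>I. (D n has_vector_derivative D (Suc n) t) (at t within I)"
    by blast
  show ?thesis by (rule that[of D]) (use D in \<open>auto simp: derivs_def\<close>)
qed

text \<open>The power series at \<open>s\<close> is extended to a complex disc and differentiated
  termwise; uniqueness of derivatives identifies the results with the given \<open>E\<close>. This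
  yields bounds at all points near \<open>s\<close>, not only at \<open>s\<close>.\<close>

lemma analytic_derivative_bound:
  fixes g :: "real \<Rightarrow> complex"
  assumes I: "is_interval I" "I \<noteq> {s}" "s \<in> I" and an: "real_analytic_on I g"
    and E: "derivs I E" "\<And>t. t \<in> I \<Longrightarrow> E 0 t = g t"
  shows "\<exists>M r \<delta>. M > 0 \<and> r > 0 \<and> \<delta> > 0 \<and> (\<forall>t\<in>I \<inter> ball s \<delta>. \<forall>k. cmod (E k t) \<le> M * fact k * r ^ k)"
proof -
  obtain \<rho> c where \<rho>: "\<rho> > 0" "\<And>t. t \<in> I \<inter> ball s \<rho> \<Longrightarrow> (\<lambda>k. (t - s) ^ k *\<^sub>R c k) sums g t"
    using an I(3) unfolding real_analytic_on_def by blast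
  obtain t1 where t1: "t1 \<in> I \<inter> ball s \<rho>" "t1 \<noteq> s"
    using interval_islimpt[OF I(1,3,2) \<rho>(1)] unfolding islimpt_def by (metis UNIV_I open_UNIV)
  define a where "a = \<bar>t1 - s\<bar>"
  have a: "a > 0" using t1 by (simp add: a_def)
  have "summable (\<lambda>k. (t1 - s) ^ k *\<^sub>R c k)" using \<rho>(2)[OF t1(1)] sums_summable by blast
  then have "Bseq (\<lambda>k. (t1 - s) ^ k *\<^sub>R c k)"
    by (intro convergent_imp_Bseq convergentI[OF summable_LIMSEQ_zero])
  then obtain M0 where M0: "M0 > 0" "\<And>k. norm ((t1 - s) ^ k *\<^sub>R c k) \<le> M0" unfolding Bseq_def by blast
  have c: "cmod (c k) \<le> M0 * (1 / a) ^ k" for k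
    using M0(2)[of k] a by (simp add: a_def power_abs power_divide field_simps)
  \<comment> \<open>Coefficients of the k-th derived series. The factorial quotient is k! times a
    binomial coefficient, hence at most k! 2^(j + k), which turns the rate 1/a into 2/a.\<close>
  define b where "b k j = (fact (j + k) / fact j) *\<^sub>R c (j + k)" for k j :: nat
  have b_bound: "cmod (b k j) \<le> (M0 * fact k * (2 / a) ^ k) * (2 / a) ^ j" for k j
  proof -
    have "fact (j + k) / (fact j :: real) = fact k * real ((j + k) choose k)"
      by (simp add: binomial_fact field_simps)
    also have "\<dots> \<le> fact k * 2 ^ (j + k)"
    proof -
      have "(j + k) choose k \<le> 2 ^ (j + k)" by (rule binomial_le_pow2)
      then have "real ((j + k) choose k) \<le> 2 ^ (j + k)" by (metis of_nat_le_iff of_nat_numeral of_nat_power)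
      then show ?thesis by (intro mult_left_mono) auto
    qed
    finally have "fact (j + k) / fact j * cmod (c (j + k)) \<le> (fact k * 2 ^ (j + k)) * (M0 * (1 / a) ^ (j + k))"
      using c by (intro mult_mono) auto
    then show ?thesis by (simp add: b_def power_add power_divide mult_ac)
  qed
  have diffs_b: "diffs (b k) = b (Suc k)" for k
  proof
    fix n
    have "real (Suc n) * (fact (Suc n + k) / fact (Suc n)) = fact (n + Suc k) / fact n"
      unfolding times_divide_eq_right fact_Suc[of n] by (subst mult_divide_mult_cancel_left) simp_all
    then have "real (Suc n) *\<^sub>R b k (Suc n) = b (Suc k) n"
      unfolding b_def scaleR_scaleR by (simp only: add_Suc add_Suc_right)
    then show "diffs (b k) n = b (Suc k) n" by (simp add: diffs_def scaleR_conv_of_real)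
  qed
  define p where "p k z = (\<Sum>j. b k j * z ^ j)" for k and z :: complex
  have summ: "summable (\<lambda>j. b k j * z ^ j)" and pb: "cmod (\<Sum>j. b k j * z ^ j) \<le> (M0 * fact k * (2 / a) ^ k) * (1 / (1 - q))"
    if z: "cmod z * (2 / a) \<le> q" "q < 1" for k z q
  proof -
    have q: "0 \<le> q" using z a by (meson divide_nonneg_pos mult_nonneg_nonneg norm_ge_zero order_trans zero_le_numeral)
    have bd: "norm (b k j * z ^ j) \<le> (M0 * fact k * (2 / a) ^ k) * q ^ j" for j
    proof -
      have "norm (b k j * z ^ j) \<le> ((M0 * fact k * (2 / a) ^ k) * (2 / a) ^ j) * cmod z ^ j"
        unfolding norm_mult norm_power by (intro mult_right_mono b_bound) auto
      also have "\<dots> = (M0 * fact k * (2 / a) ^ k) * (cmod z * (2 / a)) ^ j" unfolding power_mult_distrib by (simp only: mult_ac)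
      also have "\<dots> \<le> (M0 * fact k * (2 / a) ^ k) * q ^ j"
        using z a M0 by (intro mult_left_mono power_mono) auto
      finally show ?thesis .
    qed
    have sq: "summable (\<lambda>j. (M0 * fact k * (2 / a) ^ k) * q ^ j)"
      using q z by (intro summable_mult summable_geometric) auto
    show "summable (\<lambda>j. b k j * z ^ j)" using summable_comparison_test'[OF sq bd] .
    have "norm (\<Sum>j. b k j * z ^ j) \<le> (\<Sum>j. (M0 * fact k * (2 / a) ^ k) * q ^ j)"
      by (rule norm_suminf_le[OF bd sq])
    also have "\<dots> = (M0 * fact k * (2 / a) ^ k) * (1 / (1 - q))"
      using q z by (subst suminf_mult) (auto simp: suminf_geometric summable_geometric)
    finally show "cmod (\<Sum>j. b k j * z ^ j) \<le> (M0 * fact k * (2 / a) ^ k) * (1 / (1 - q))" .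
  qed
  \<comment> \<open>For |t - s| < a/4 the ratio 2 |t - s| / a is at most 1/2, so the geometric
    series contributes a factor 2. Termwise differentiation uses the larger disc of radius a/3,
    where the ratio is at most 2/3.\<close>
  define \<delta> where "\<delta> = a / 4"
  have \<delta>: "\<delta> > 0" "\<delta> < \<rho>" using a t1 by (auto simp: \<delta>_def a_def dist_real_def)
  have dp: "(p k has_field_derivative p (Suc k) z) (at z)" if "cmod z < a / 3" for z k
    unfolding p_def diffs_b[symmetric]
  proof (rule termdiffs_strong)
    show "summable (\<lambda>j. b k j * of_real (a / 3) ^ j)" by (rule summ[of _ "2/3"]) (use a in auto)
    show "norm z < norm (complex_of_real (a / 3))" using that a by simp
  qed
  have Ep: "\<forall>t\<in>I \<inter> ball s \<delta>. E k t = p k (complex_of_real (t - s))" for k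
  proof (induction k)
    case 0
    show ?case
    proof
      fix t assume t: "t \<in> I \<inter> ball s \<delta>"
      then have "(\<lambda>k. (t - s) ^ k *\<^sub>R c k) sums g t" using \<delta> by (intro \<rho>) auto
      then have "(\<lambda>k. b 0 k * complex_of_real (t - s) ^ k) sums g t"
        by (simp add: b_def scaleR_conv_of_real mult.commute)
      then show "E 0 t = p 0 (complex_of_real (t - s))"
        using E(2) t by (simp add: p_def sums_iff)
    qed
  next
    case (Suc k)
    show ?case
    proof
      fix t assume t: "t \<in> I \<inter> ball s \<delta>"
      let ?J = "I \<inter> ball s \<delta>"
      show "E (Suc k) t = p (Suc k) (complex_of_real (t - s))"
      proof (rule vector_derivative_unique_within)
        have J: "is_interval ?J" using I(1) by (intro is_interval_Int is_interval_ball_real)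
        obtain y where y: "y \<in> ?J" "y \<noteq> s"
          using interval_islimpt[OF I(1,3,2) \<delta>(1)] unfolding islimpt_def by (metis UNIV_I open_UNIV)
        have "s \<in> ?J" using I \<delta> by auto
        then have "?J \<noteq> {t}" using y by (metis singletonD)
        then have "t islimpt (?J \<inter> ball t 1)" by (intro interval_islimpt[OF J t]) auto
        then have "t islimpt ?J" by (rule islimpt_subset) (rule Int_lower1)
        then show "at t within ?J \<noteq> bot" by (simp add: trivial_limit_within)
        show "(E k has_vector_derivative E (Suc k) t) (at t within ?J)"
          by (rule has_vector_derivative_within_subset[where S = I]) (use E(1) t in \<open>auto simp: derivs_def\<close>)
        have "cmod (complex_of_real (t - s)) < a / 3"
        proof -
          have "\<bar>t - s\<bar> < a / 4" using t by (simp add: \<delta>_def dist_real_def abs_minus_commute)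
          then show ?thesis using a unfolding norm_of_real by linarith
        qed
        then have "((\<lambda>z. p k (z - of_real s)) has_field_derivative p (Suc k) (complex_of_real t - of_real s) * 1) (at (of_real t))"
          by (intro DERIV_chain2[where f = "p k" and g = "\<lambda>z. z - of_real s"] dp) (auto intro!: derivative_eq_intros)
        then have "((\<lambda>t. p k (complex_of_real t - of_real s)) has_vector_derivative p (Suc k) (complex_of_real (t - s))) (at t within ?J)"
          using has_vector_derivative_real_field by fastforce
        then show "(E k has_vector_derivative p (Suc k) (complex_of_real (t - s))) (at t within ?J)"
          by (rule has_vector_derivative_transform[OF t, rotated]) (use Suc in auto)
      qed
    qed
  qed
  have "cmod (E k t) \<le> (2 * M0) * fact k * (2 / a) ^ k" if t: "t \<in> I \<inter> ball s \<delta>" for t k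
  proof -
    have "cmod (complex_of_real (t - s)) * (2 / a) \<le> 1 / 2"
    proof -
      have "\<bar>t - s\<bar> < a / 4" using t by (simp add: \<delta>_def dist_real_def abs_minus_commute)
      then show ?thesis using a unfolding norm_of_real by (simp add: field_simps)
    qed
    from pb[OF this, of k] show ?thesis using Ep t by (simp add: p_def mult_ac)
  qed
  then show ?thesis using M0 a \<delta> by (intro exI[of _ "2 * M0"] exI[of _ "2 / a"] exI[of _ \<delta>]) auto
qed

theorem weak_regular:
  fixes f :: "real \<Rightarrow> 'a::banach \<Rightarrow>\<^sub>L 'h::complex_hilbert_space"
  assumes I: "is_interval I" "t0 \<in> I"
    and smooth: "\<And>x v. smooth_on I (\<lambda>t. cinner (f t x) v)"
    and an: "\<And>x v. an \<Longrightarrow> real_analytic_on I (\<lambda>t. cinner (f t x) v)"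
  obtains \<delta> where "\<delta> > 0" "regular an (I \<inter> ball t0 \<delta>) f"
proof (cases "I = {t0}")
  case True
  have "regular an (I \<inter> ball t0 1) f"
    by (rule regular_cong[OF regular_const[where c = "f t0"]]) (use True in auto)
  then show ?thesis using that[of 1] by simp
next
  case False
  then have nd: "I \<noteq> {t}" for t using I(2) by blast
  obtain D :: "nat \<Rightarrow> real \<Rightarrow> 'a \<Rightarrow>\<^sub>L 'h" where D: "D 0 = f" "derivs I D" using weak_smooth_derivs[OF I(1) nd smooth] by blast
  have "\<exists>\<delta>>0. an \<longrightarrow> factorial_bound (I \<inter> ball t0 \<delta>) D"
  proof (cases an)
    case True
    \<comment> \<open>One index \<open>m\<close> controls both the radius 1/(m + 1) of the
      neighbourhood and the rate m + 1 in the normalisation by k! (m + 1)^k. The unknown radius and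
      rate of each scalar function are thus both reached by increasing \<open>m\<close>, as
      \<open>local_weak_boundedness\<close> requires.\<close>
    define P where "P m = {(m', t, k::nat). m \<le> m' \<and> t \<in> I \<inter> ball t0 (1 / real (Suc m))}" for m :: nat
    define F where "F = (\<lambda>(m, t, k). D k t /\<^sub>R (fact k * real (Suc m) ^ k))"
    have "\<exists>C m. m > (0::nat) \<and> (\<forall>i\<in>P m. norm (F i) \<le> C)"
    proof (rule local_weak_boundedness)
      fix m n :: nat assume "m \<le> n"
      moreover from this have "1 / real (Suc n) \<le> 1 / real (Suc m)" by (simp add: frac_le)
      ultimately show "P n \<subseteq> P m" by (auto simp: P_def)
    next
      fix x v
      have E: "derivs I (\<lambda>k t. cinner (blinfun_apply (D k t) x) v)"
        using D(2) unfolding derivs_def by (blast intro: derivs_weak)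
      obtain M r \<delta> where M: "M > 0" "r > 0" "\<delta> > 0"
        "\<And>t k. t \<in> I \<inter> ball t0 \<delta> \<Longrightarrow> cmod (cinner (blinfun_apply (D k t) x) v) \<le> M * fact k * r ^ k"
        using analytic_derivative_bound[OF I(1) False I(2) an[OF True] E] D(1) by blast
      obtain m :: nat where m: "max r (1 / \<delta>) < real m" using reals_Archimedean2 by blast
      have m1: "1 / real (Suc m) \<le> \<delta>" "r \<le> real (Suc m)" using m M by (auto simp: field_simps)
      have "cmod (cinner (F i x) v) \<le> M" if "i \<in> P m" for i
      proof -
        obtain m' t k where i: "i = (m', t, k)" "m \<le> m'" "t \<in> I \<inter> ball t0 (1 / real (Suc m))"
          using \<open>i \<in> P m\<close> by (auto simp: P_def)
        have pos: "fact k * real (Suc m') ^ k > (0::real)" by simp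
        have "cmod (cinner (F i x) v) = cmod (cinner (blinfun_apply (D k t) x) v) / (fact k * real (Suc m') ^ k)"
          using pos by (simp add: F_def i blinfun.bilinear_simps cinner.scaleR_left divide_inverse mult.commute norm_mult norm_power)
        also have "\<dots> \<le> (M * fact k * r ^ k) / (fact k * real (Suc m') ^ k)"
          using pos i m1 by (intro divide_right_mono M) auto
        also have "\<dots> \<le> M"
        proof -
          have "r ^ k \<le> real (Suc m') ^ k" using M m1 i by (intro power_mono) auto
          then have "M * fact k * r ^ k \<le> M * (fact k * real (Suc m') ^ k)"
            using M by (simp only: mult.assoc) (intro mult_left_mono, auto)
          then show ?thesis using pos by (simp only: divide_le_eq if_True)
        qed
        finally show ?thesis .
      qed
      then show "\<exists>K m. \<forall>i\<in>P m. cmod (cinner (F i x) v) \<le> K" by blast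
    qed
    then obtain C m where C: "\<And>i. i \<in> P m \<Longrightarrow> norm (F i) \<le> C" by blast
    have "norm (D k t) \<le> C * fact k * real (Suc m) ^ k" if t: "t \<in> I \<inter> ball t0 (1 / real (Suc m))" for t k
    proof -
      have pos: "fact k * real (Suc m) ^ k > (0::real)" by simp
      have "norm (F (m, t, k)) \<le> C" using t by (intro C) (auto simp: P_def)
      moreover have "norm (F (m, t, k)) = norm (D k t) / (fact k * real (Suc m) ^ k)"
        using pos by (simp add: F_def divide_inverse mult.commute)
      ultimately have "norm (D k t) \<le> C * (fact k * real (Suc m) ^ k)"
        using pos by (simp only: divide_le_eq if_True)
      then show ?thesis by (simp only: mult.assoc)
    qed
    then have "factorial_bound (I \<inter> ball t0 (1 / real (Suc m))) D"
      by (intro factorial_boundI[where r = "real (Suc m)"]) auto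
    then show ?thesis by (intro exI[of _ "1 / real (Suc m)"]) auto
  qed (auto intro: exI[of _ 1])
  then obtain \<delta> where "\<delta> > 0" "an \<longrightarrow> factorial_bound (I \<inter> ball t0 \<delta>) D" by blast
  moreover have "derivs (I \<inter> ball t0 \<delta>) D" using D(2) by (rule derivs_subset) auto
  ultimately have "regular_derivs an (I \<inter> ball t0 \<delta>) D" by (simp add: regular_derivs_def)
  then have "regular an (I \<inter> ball t0 \<delta>) f" by (rule regularI) (simp add: D(1))
  with \<open>\<delta> > 0\<close> show ?thesis by (rule that)
qed

section \<open>Inverses and spectral projections of smooth operator functions\<close>

lemma blinfun_inverse_of_bij:
  fixes L :: "'a::banach \<Rightarrow>\<^sub>L 'a"
  assumes surj: "\<And>y. \<exists>x. L x = y" and below: "\<And>x. norm x \<le> C * norm (L x)"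
  obtains M where "L o\<^sub>L M = id_blinfun" "M o\<^sub>L L = id_blinfun" "norm M \<le> \<bar>C\<bar>"
proof -
  obtain g where g: "\<And>y. L (g y) = y" using surj by metis
  have inj: "x = y" if "L x = L y" for x y
    using below[of "x - y"] that by (simp add: blinfun.diff_right)
  have bl: "bounded_linear g"
  proof (rule bounded_linear_intro[where K = C])
    show "g (x + y) = g x + g y" for x y by (rule inj) (simp add: g blinfun.add_right)
    show "g (r *\<^sub>R x) = r *\<^sub>R g x" for r x by (rule inj) (simp add: g blinfun.scaleR_right)
    show "norm (g x) \<le> norm x * C" for x using below[of "g x"] by (simp add: g mult.commute)
  qed
  have ap: "Blinfun g y = g y" for y by (simp add: bounded_linear_Blinfun_apply[OF bl])
  show ?thesis
  proof
    show "L o\<^sub>L Blinfun g = id_blinfun" by (rule blinfun_eqI) (simp add: ap g)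
    show "Blinfun g o\<^sub>L L = id_blinfun" by (rule blinfun_eqI) (simp add: ap, rule inj, simp add: g)
    show "norm (Blinfun g) \<le> \<bar>C\<bar>"
    proof (rule norm_blinfun_bound)
      fix x
      have "norm (g x) \<le> C * norm x" using below[of "g x"] by (simp add: g)
      also have "\<dots> \<le> \<bar>C\<bar> * norm x" by (intro mult_right_mono) auto
      finally show "norm (Blinfun g x) \<le> \<bar>C\<bar> * norm x" by (simp add: ap)
    qed simp
  qed
qed

text \<open>L x = y says that \<open>x\<close> is a fixed point of x \<mapsto> M0 (y - (L - L0) x),
  a contraction with constant 1/2.\<close>

lemma perturb_inverse:
  fixes L L0 :: "'a::banach \<Rightarrow>\<^sub>L 'a"
  assumes M0: "L0 o\<^sub>L M0 = id_blinfun" "M0 o\<^sub>L L0 = id_blinfun"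
    and small: "norm (L - L0) * norm M0 \<le> 1 / 2"
  obtains M where "L o\<^sub>L M = id_blinfun" "M o\<^sub>L L = id_blinfun" "norm M \<le> 2 * norm M0"
proof -
  have LM: "L0 (M0 y) = y" "M0 (L0 y) = y" for y
    using M0 by (metis blinfun_apply_blinfun_compose blinfun_apply_id_blinfun id_apply)+
  have half: "norm (M0 ((L - L0) x)) \<le> 1 / 2 * norm x" for x
  proof -
    have "norm (M0 ((L - L0) x)) \<le> norm M0 * (norm (L - L0) * norm x)"
      by (meson norm_blinfun mult_left_mono norm_ge_zero order_trans)
    also have "\<dots> = (norm (L - L0) * norm M0) * norm x" by simp
    also have "\<dots> \<le> 1 / 2 * norm x" by (rule mult_right_mono[OF small]) simp
    finally show ?thesis .
  qed
  have "\<exists>x. L x = y" for y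
  proof -
    have "\<exists>!x. M0 (y - (L - L0) x) = x"
    proof (rule banach_fix_type[where c = "1/2"])
      show "\<forall>x z. dist (M0 (y - (L - L0) x)) (M0 (y - (L - L0) z)) \<le> 1 / 2 * dist x z"
      proof (intro allI)
        fix x z
        have "M0 (y - (L - L0) x) - M0 (y - (L - L0) z) = M0 ((L - L0) (z - x))"
          by (simp add: blinfun.diff_right flip: blinfun.diff_right)
        then show "dist (M0 (y - (L - L0) x)) (M0 (y - (L - L0) z)) \<le> 1 / 2 * dist x z"
          using half[of "z - x"] by (simp add: dist_norm norm_minus_commute)
      qed
    qed auto
    then obtain x where "M0 (y - (L - L0) x) = x" by blast
    then have "L0 x = y - (L - L0) x" using LM by metis
    then have "L x = y" by (simp add: blinfun.diff_left)
    then show ?thesis by blast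
  qed
  moreover have "norm x \<le> (2 * norm M0) * norm (L x)" for x
  proof -
    have "x = M0 (L x) - M0 ((L - L0) x)"
      by (simp add: LM blinfun.diff_left flip: blinfun.diff_right)
    then have "norm x \<le> norm (M0 (L x)) + norm (M0 ((L - L0) x))" by (metis norm_triangle_ineq4)
    also have "\<dots> \<le> norm M0 * norm (L x) + 1 / 2 * norm x"
      by (intro add_mono norm_blinfun half)
    finally show ?thesis by simp
  qed
  ultimately show ?thesis
    using blinfun_inverse_of_bij[of L "2 * norm M0"] that by auto
qed

lemma blinfun_inverse_unique:
  fixes L :: "'a::real_normed_vector \<Rightarrow>\<^sub>L 'a"
  assumes "M o\<^sub>L L = id_blinfun" "L o\<^sub>L M' = id_blinfun"
  shows "M = M'"
proof -
  have "M = M o\<^sub>L (L o\<^sub>L M')" by (simp add: assms blinfun_product.right_unit)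
  also have "\<dots> = M'" unfolding blinfun_product.assoc[symmetric] assms(1) by (rule blinfun_product.left_unit)
  finally show ?thesis .
qed

lemma regular_inverse_near:
  fixes L :: "real \<Rightarrow> 'a::banach \<Rightarrow>\<^sub>L 'a"
  assumes reg: "regular an S L" and t0: "t0 \<in> S"
    and M0: "L t0 o\<^sub>L M0 = id_blinfun" "M0 o\<^sub>L L t0 = id_blinfun"
  obtains \<delta> M where "\<delta> > 0" "regular an (S \<inter> ball t0 \<delta>) M" "M t0 = M0"
    "\<And>t. t \<in> S \<inter> ball t0 \<delta> \<Longrightarrow> L t o\<^sub>L M t = id_blinfun \<and> M t o\<^sub>L L t = id_blinfun"
proof -
  \<comment> \<open>Makes the product of |L t - L t0| with |M0| at most 1/2; the added 1 keeps the
    quotient meaningful for M0 = 0.\<close>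
  define \<epsilon> where "\<epsilon> = 1 / (2 * (norm M0 + 1))"
  have e: "\<epsilon> > 0" by (simp add: \<epsilon>_def add_nonneg_pos)
  obtain \<delta> where \<delta>: "\<delta> > 0" "\<And>t. t \<in> S \<Longrightarrow> dist t t0 < \<delta> \<Longrightarrow> dist (L t) (L t0) < \<epsilon>"
    using regular_continuous[OF reg] t0 e unfolding continuous_on_iff by blast
  have "\<exists>M. L t o\<^sub>L M = id_blinfun \<and> M o\<^sub>L L t = id_blinfun \<and> norm M \<le> 2 * norm M0" if t: "t \<in> S \<inter> ball t0 \<delta>" for t
  proof -
    have "dist t t0 < \<delta>" "t \<in> S" using t by (simp_all add: dist_commute)
    then have "norm (L t - L t0) < \<epsilon>" using \<delta>(2)[of t] by (simp add: dist_norm)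
    then have "norm (L t - L t0) * norm M0 \<le> \<epsilon> * (norm M0 + 1)"
      using e by (intro mult_mono) auto
    also have "\<dots> = 1 / 2"
    proof -
      have "norm M0 + 1 \<noteq> 0" using norm_ge_zero[of M0] by linarith
      then show ?thesis by (simp add: \<epsilon>_def)
    qed
    finally show ?thesis using perturb_inverse[OF M0] by blast
  qed
  then obtain M where M: "\<And>t. t \<in> S \<inter> ball t0 \<delta> \<Longrightarrow> L t o\<^sub>L M t = id_blinfun \<and> M t o\<^sub>L L t = id_blinfun \<and> norm (M t) \<le> 2 * norm M0"
    by metis
  have "regular an (S \<inter> ball t0 \<delta>) M"
    by (rule blinfun_product.regular_inverse[OF regular_subset[OF reg]]) (use M in auto)
  moreover have "M t0 = M0"
    by (rule blinfun_inverse_unique[of _ "L t0"]) (use M[of t0] t0 \<delta> M0 in auto)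
  ultimately show ?thesis using that \<delta>(1) M by blast
qed

text \<open>The library has the completeness of \<open>int \<Rightarrow>\<^sub>C 'a\<close> only for metric index types.\<close>

instantiation int :: metric_space
begin

definition dist_int :: "int \<Rightarrow> int \<Rightarrow> real" where
  "dist_int x y = real_of_int \<bar>x - y\<bar>"

definition uniformity_int :: "(int \<times> int) filter" where
  "uniformity_int = (INF e\<in>{0<..}. principal {(x, y). dist x y < e})"

instance
proof
  show "open U \<longleftrightarrow> (\<forall>x\<in>U. \<forall>\<^sub>F (x', y) in uniformity. x' = x \<longrightarrow> y \<in> U)" for U :: "int set"
  proof -
    have "\<forall>\<^sub>F (x', y) in uniformity. x' = x \<longrightarrow> y \<in> U" if "x \<in> U" for x
      unfolding uniformity_int_def
      by (rule eventually_INF1[of 1]) (use that in \<open>auto simp: eventually_principal dist_int_def simp del: of_int_abs of_int_diff\<close>)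
    then show ?thesis by (simp add: open_discrete)
  qed
qed (auto simp: dist_int_def uniformity_int_def)

end

instance bcontfun :: (metric_space, banach) banach ..

section \<open>Riesz projections from bounded solutions of a difference equation\<close>

lemma apply_Bcontfun_int:
  fixes f :: "int \<Rightarrow> 'b::real_normed_vector"
  assumes "\<And>j. norm (f j) \<le> b"
  shows "apply_bcontfun (Bcontfun f) = f"
proof (rule Bcontfun_inverse, rule bcontfun_normI)
  show "continuous_on UNIV f"
    by (simp add: continuous_on_open_vimage open_discrete)
qed (rule assms)

definition pointwise :: "('a::banach \<Rightarrow>\<^sub>L 'a) \<Rightarrow> (int \<Rightarrow>\<^sub>C 'a) \<Rightarrow>\<^sub>L (int \<Rightarrow>\<^sub>C 'a)" where
  "pointwise X = Blinfun (\<lambda>u. Bcontfun (\<lambda>j. X (apply_bcontfun u j)))"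

definition shift :: "int \<Rightarrow> (int \<Rightarrow>\<^sub>C 'a::banach) \<Rightarrow>\<^sub>L (int \<Rightarrow>\<^sub>C 'a)" where
  "shift d = Blinfun (\<lambda>u. Bcontfun (\<lambda>j. apply_bcontfun u (j + d)))"

definition impulse :: "'a::banach \<Rightarrow>\<^sub>L (int \<Rightarrow>\<^sub>C 'a)" where
  "impulse = Blinfun (\<lambda>v. Bcontfun (\<lambda>j. if j = 0 then v else 0))"

definition value_one :: "(int \<Rightarrow>\<^sub>C 'a::banach) \<Rightarrow>\<^sub>L 'a" where
  "value_one = Blinfun (\<lambda>u. apply_bcontfun u 1)"

lemma apply_bcontfun_simps:
  "apply_bcontfun (u + v) j = apply_bcontfun u j + apply_bcontfun v j"
  "apply_bcontfun (u - v) j = apply_bcontfun u j - apply_bcontfun v j"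
  "apply_bcontfun (r *\<^sub>R u) j = r *\<^sub>R apply_bcontfun u j"
  for u v :: "int \<Rightarrow>\<^sub>C 'a::banach"
  by (simp_all add: plus_bcontfun.rep_eq minus_bcontfun.rep_eq scaleR_bcontfun.rep_eq)

lemma Blinfun_bcontfun:
  fixes F :: "'b::real_normed_vector \<Rightarrow> int \<Rightarrow> 'a::banach"
  assumes "\<And>u v j. F (u + v) j = F u j + F v j" "\<And>r u j. F (r *\<^sub>R u) j = r *\<^sub>R F u j"
    and b: "\<And>u j. norm (F u j) \<le> K * norm u" and K: "0 \<le> K"
  shows "apply_bcontfun (Blinfun (\<lambda>u. Bcontfun (F u)) u) j = F u j"
    "norm (Blinfun (\<lambda>u. Bcontfun (F u))) \<le> K"
proof -
  have ap: "apply_bcontfun (Bcontfun (F u)) j = F u j" for u j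
    by (subst apply_Bcontfun_int[OF b]) simp
  have nb: "norm (Bcontfun (F u)) \<le> K * norm u" for u
    by (rule norm_bound) (simp add: ap b)
  have bl: "bounded_linear (\<lambda>u. Bcontfun (F u))"
    by (rule bounded_linear_intro[where K = K])
      (auto intro!: bcontfun_eqI simp: ap apply_bcontfun_simps assms nb mult.commute[of _ K])
  show "apply_bcontfun (Blinfun (\<lambda>u. Bcontfun (F u)) u) j = F u j"
    by (simp add: bounded_linear_Blinfun_apply[OF bl] ap)
  show "norm (Blinfun (\<lambda>u. Bcontfun (F u))) \<le> K"
    by (rule norm_blinfun_bound[OF K]) (simp add: bounded_linear_Blinfun_apply[OF bl] nb)
qed

lemma pointwise: "apply_bcontfun (pointwise X u) j = X (apply_bcontfun u j)"
  and norm_pointwise: "norm (pointwise X) \<le> norm X"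
proof -
  have "norm (X (apply_bcontfun u j)) \<le> norm X * norm u" for u j
    by (meson norm_blinfun norm_bounded mult_left_mono norm_ge_zero order_trans)
  then show "apply_bcontfun (pointwise X u) j = X (apply_bcontfun u j)" "norm (pointwise X) \<le> norm X"
    unfolding pointwise_def
    by (subst Blinfun_bcontfun[where K = "norm X"], auto simp: apply_bcontfun_simps blinfun.bilinear_simps)
      (rule Blinfun_bcontfun(2), auto simp: apply_bcontfun_simps blinfun.bilinear_simps)
qed

lemma shift: "apply_bcontfun (shift d u) j = apply_bcontfun u (j + d)"
  and norm_shift: "norm (shift d) \<le> 1"
  unfolding shift_def
  by (subst Blinfun_bcontfun[where K = 1], auto simp: apply_bcontfun_simps norm_bounded)
    (rule Blinfun_bcontfun(2), auto simp: apply_bcontfun_simps norm_bounded)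

lemma impulse: "apply_bcontfun (impulse v) j = (if j = 0 then v else 0)"
  unfolding impulse_def
  by (subst Blinfun_bcontfun[where K = 1]) auto

lemma value_one: "value_one u = apply_bcontfun u 1"
proof -
  have "bounded_linear (\<lambda>u :: int \<Rightarrow>\<^sub>C 'a. apply_bcontfun u 1)"
    by (rule bounded_linear_intro[where K = 1]) (auto simp: apply_bcontfun_simps norm_bounded)
  then show ?thesis by (simp add: value_one_def bounded_linear_Blinfun_apply)
qed

lemma bounded_linear_pointwise: "bounded_linear (pointwise :: ('a::banach \<Rightarrow>\<^sub>L 'a) \<Rightarrow> _)"
  by (rule bounded_linear_intro[where K = 1])
    (auto intro!: blinfun_eqI bcontfun_eqI simp: pointwise apply_bcontfun_simps blinfun.bilinear_simps norm_pointwise)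

text \<open>The bounded two-sided sequences \<open>u\<close> with \<open>u (j + 1) - X (u j) = f j\<close> replace the contour
  integral of the resolvent of \<open>X\<close> over the unit circle: if for every bounded \<open>f\<close> there is exactly
  one such \<open>u\<close>, then the Riesz projection belonging to the open unit disc is \<open>v \<mapsto> u 1\<close> for the
  impulse \<open>f = v\<close> at \<open>0\<close>.\<close>

definition difference_op :: "('a::banach \<Rightarrow>\<^sub>L 'a) \<Rightarrow> (int \<Rightarrow>\<^sub>C 'a) \<Rightarrow>\<^sub>L (int \<Rightarrow>\<^sub>C 'a)" where
  "difference_op X = shift 1 - pointwise X"

definition impulse_response :: "((int \<Rightarrow>\<^sub>C 'a::banach) \<Rightarrow>\<^sub>L (int \<Rightarrow>\<^sub>C 'a)) \<Rightarrow> 'a \<Rightarrow>\<^sub>L 'a" where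
  "impulse_response M = value_one o\<^sub>L (M o\<^sub>L impulse)"

lemma difference_op: "apply_bcontfun (difference_op X u) j = apply_bcontfun u (j + 1) - X (apply_bcontfun u j)"
  by (simp add: difference_op_def blinfun.diff_left apply_bcontfun_simps shift pointwise)

lemma bounded_linear_impulse_response: "bounded_linear (impulse_response :: _ \<Rightarrow> 'a::banach \<Rightarrow>\<^sub>L 'a)"
  unfolding impulse_response_def[abs_def]
  by (intro bounded_linear_compose[OF blinfun_product.bounded_linear_right]
      bounded_linear_compose[OF bounded_bilinear.bounded_linear_right[OF bounded_bilinear_blinfun_compose]]
      bounded_bilinear.bounded_linear_left[OF bounded_bilinear_blinfun_compose])

text \<open>A discrete exponential dichotomy. The projection is a linear function of the inverse
  \<open>M\<close>, so regularity of inverses is all that its perturbation theory needs.\<close>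

locale inverted_difference_op =
  fixes X :: "'a::banach \<Rightarrow>\<^sub>L 'a" and M
  assumes right_inverse: "difference_op X o\<^sub>L M = id_blinfun"
    and left_inverse: "M o\<^sub>L difference_op X = id_blinfun"
begin

lemma response_eqI:
  fixes u :: "int \<Rightarrow> 'a"
  assumes "\<And>j. norm (u j) \<le> b" "\<And>j. u (j + 1) - X (u j) = (if j = 0 then v else 0)"
  shows "impulse_response M v = u 1"
proof -
  have u: "apply_bcontfun (Bcontfun u) = u" using assms(1) by (rule apply_Bcontfun_int)
  have "difference_op X (Bcontfun u) = impulse v"
    by (rule bcontfun_eqI) (simp add: difference_op impulse u assms(2))
  then have "M (impulse v) = Bcontfun u"
    using left_inverse by (metis blinfun_apply_blinfun_compose blinfun_apply_id_blinfun id_apply)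
  then show ?thesis by (simp add: impulse_response_def value_one u)
qed

lemma response_exists:
  "\<exists>u b. (\<forall>j. norm (u j) \<le> b) \<and> (\<forall>j. u (j + 1) - X (u j) = (if j = 0 then v else 0)) \<and>
    impulse_response M v = u (1::int)"
proof (intro exI conjI allI)
  let ?u = "apply_bcontfun (M (impulse v))"
  show "norm (?u j) \<le> norm (M (impulse v))" for j by (rule norm_bounded)
  have "difference_op X (M (impulse v)) = impulse v"
    using right_inverse by (metis blinfun_apply_blinfun_compose blinfun_apply_id_blinfun id_apply)
  then show "?u (j + 1) - X (?u j) = (if j = 0 then v else 0)" for j
    by (metis difference_op impulse)
qed (simp add: impulse_response_def value_one)

text \<open>Applying \<open>C\<close> to the bounded solution with impulse \<open>v\<close> gives a
  bounded solution with impulse C v, and bounded solutions are unique.\<close>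

lemma response_commute:
  assumes "C o\<^sub>L X = X o\<^sub>L C"
  shows "C o\<^sub>L impulse_response M = impulse_response M o\<^sub>L C"
proof (rule blinfun_eqI)
  fix v
  have CX: "C (X x) = X (C x)" for x using assms by (metis blinfun_apply_blinfun_compose)
  obtain u :: "int \<Rightarrow> 'a" and b where u: "\<And>j. norm (u j) \<le> b" "\<And>j. u (j + 1) - X (u j) = (if j = 0 then v else 0)"
    "impulse_response M v = u 1" using response_exists[of v] by blast
  have "impulse_response M (C v) = C (u 1)"
  proof (rule response_eqI[of "\<lambda>j. C (u j)"])
    show "norm (C (u j)) \<le> norm C * b" for j
      by (meson u(1) norm_blinfun mult_left_mono norm_ge_zero order_trans)
    show "C (u (j + 1)) - X (C (u j)) = (if j = 0 then C v else 0)" for j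
    proof -
      have "C (u (j + 1)) - X (C (u j)) = C (u (j + 1) - X (u j))" by (simp add: CX blinfun.diff_right)
      then show ?thesis by (simp add: u(2) blinfun.zero_right)
    qed
  qed
  then show "(C o\<^sub>L impulse_response M) v = (impulse_response M o\<^sub>L C) v" by (simp add: u(3))
qed

text \<open>A bounded forward orbit, preceded by zeros, is the bounded solution with impulse
  \<open>w 0\<close>. So every vector with a bounded forward orbit is fixed.\<close>

lemma response_forward:
  assumes "\<And>n::nat. w (Suc n) = X (w n)" "\<And>n. norm (w n) \<le> b"
  shows "impulse_response M (w 0) = w 0"
proof -
  define u where "u j = (if j \<ge> 1 then w (nat (j - 1)) else 0)" for j :: int
  have "impulse_response M (w 0) = u 1"
  proof (rule response_eqI)
    show "norm (u j) \<le> b" for j using assms(2) order_trans[OF norm_ge_zero assms(2)] by (simp add: u_def)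
    show "u (j + 1) - X (u j) = (if j = 0 then w 0 else 0)" for j
    proof (cases "j \<ge> 1")
      case True
      then have "nat j = Suc (nat (j - 1))" by simp
      then show ?thesis using True assms(1)[of "nat (j - 1)"] by (simp add: u_def)
    qed (auto simp: u_def blinfun.zero_right)
  qed
  then show ?thesis by (simp add: u_def)
qed

text \<open>A bounded backward orbit, negated and followed by zeros, is the bounded solution with
  impulse \<open>w 0\<close>; its value at 1 is 0.\<close>

lemma response_backward:
  assumes "\<And>n::nat. X (w (Suc n)) = w n" "\<And>n. norm (w n) \<le> b"
  shows "impulse_response M (w 0) = 0"
proof -
  define u where "u j = (if j \<ge> 1 then 0 else - w (nat (1 - j)))" for j :: int
  have "impulse_response M (w 0) = u 1"
  proof (rule response_eqI)
    show "norm (u j) \<le> b" for j using assms(2) order_trans[OF norm_ge_zero assms(2)] by (simp add: u_def)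
    show "u (j + 1) - X (u j) = (if j = 0 then w 0 else 0)" for j
    proof (cases "j \<ge> 1")
      case False
      then have "nat (1 - j) = Suc (nat (- j))" by simp
      then show ?thesis using False assms(1)[of "nat (- j)"] by (auto simp: u_def blinfun.minus_right)
    qed (auto simp: u_def blinfun.zero_right)
  qed
  then show ?thesis by (simp add: u_def)
qed

text \<open>After the impulse at 0 the solution obeys the homogeneous recursion, so u 1 starts a
  bounded forward orbit.\<close>

lemma response_idempotent: "impulse_response M (impulse_response M v) = impulse_response M v"
proof -
  obtain u :: "int \<Rightarrow> 'a" and b where u: "\<And>j. norm (u j) \<le> b" "\<And>j. u (j + 1) - X (u j) = (if j = 0 then v else 0)"
    "impulse_response M v = u 1" using response_exists[of v] by blast
  define w where "w n = u (int n + 1)" for n :: nat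
  have "impulse_response M (w 0) = w 0"
  proof (rule response_forward)
    show "w (Suc n) = X (w n)" for n
      using u(2)[of "int n + 1"] by (simp add: w_def add.commute)
    show "norm (w n) \<le> b" for n by (simp add: w_def u(1))
  qed
  then have "impulse_response M (u 1) = u 1" by (simp add: w_def)
  then show ?thesis by (simp add: u(3))
qed

end

text \<open>\<open>Z\<close> is the group inverse of \<open>Y\<close>: it inverts \<open>Y\<close>
  on the range and vanishes on the kernel, and x = (x - Y (Z x)) + Y (Z x) splits the space. After
  scaling by \<open>s\<close> the operator is 0 on the first part and expands by at least 2 on the
  second, so the projection keeps the first.\<close>

lemma difference_op_invertible:
  fixes Y Z :: "'a::banach \<Rightarrow>\<^sub>L 'a"
  assumes YZ: "\<And>x. Y (Z x) = Z (Y x)" and YZY: "\<And>x. Y (Z (Y x)) = Y x" and ZYZ: "\<And>x. Z (Y (Z x)) = Z x"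
    and s: "s > 0" "s \<ge> 2 * norm Z"
  obtains M where "inverted_difference_op (s *\<^sub>R Y) M" "impulse_response M = id_blinfun - (Y o\<^sub>L Z)"
proof -
  define Z' where "Z' = (1 / s) *\<^sub>R Z"
  define X where "X = s *\<^sub>R Y"
  define Pr where "Pr = id_blinfun - (Y o\<^sub>L Z)"
  have Pi: "Pr x = x - Y (Z x)" for x by (simp add: Pr_def blinfun.diff_left)
  have YZZ1: "Y (Z (Z x)) = Z x" for x using YZ[of "Z x"] ZYZ[of x] by simp
  have YYZ: "Y (Y (Z x)) = Y x" for x using YZ[of x] YZY[of x] by simp
  have XZ: "X (Z' x) = Y (Z x)" for x using s by (simp add: X_def Z'_def blinfun.scaleR_left blinfun.scaleR_right)
  have ZX: "Z' (X x) = Y (Z x)" for x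
    using s by (simp add: X_def Z'_def blinfun.scaleR_left blinfun.scaleR_right YZ)
  have YZZ: "Y (Z (Z' x)) = Z' x" for x by (simp add: Z'_def blinfun.scaleR_left blinfun.scaleR_right YZZ1)
  have XPi: "X (Pr x) = 0" for x by (simp add: X_def Pi blinfun.scaleR_left blinfun.diff_right YYZ)
  have XYZ: "X (Y (Z x)) = X x" for x by (simp add: X_def blinfun.scaleR_left YYZ)
  have PiX: "Pr (X x) = 0" for x by (simp add: X_def Pi blinfun.scaleR_left blinfun.scaleR_right YZY)
  have nZ': "norm Z' \<le> 1 / 2" using s by (simp add: Z'_def field_simps)
  have Zle: "norm (Z' x) \<le> 1 / 2 * norm x" for x
    using norm_blinfun[of Z' x] mult_right_mono[OF nZ', of "norm x"] by simp
  \<comment> \<open>On the expanding part the recursion is solved backwards, g j = Z' (f j) + Z' (g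
    (j + 1)); the operator to be inverted differs from the identity by norm at most 1/2.\<close>
  obtain N where N: "(id_blinfun - (pointwise Z' o\<^sub>L shift 1)) o\<^sub>L N = id_blinfun"
  proof (rule perturb_inverse[of id_blinfun id_blinfun "id_blinfun - (pointwise Z' o\<^sub>L shift 1)"])
    have "norm (pointwise Z' o\<^sub>L shift 1) \<le> norm Z' * 1"
      by (rule order_trans[OF norm_blinfun_compose mult_mono[OF norm_pointwise norm_shift]]) auto
    then have a: "norm (pointwise Z' o\<^sub>L shift 1) \<le> 1 / 2" using nZ' by simp
    have b: "norm (id_blinfun :: (int \<Rightarrow>\<^sub>C 'a) \<Rightarrow>\<^sub>L _) \<le> 1" by (rule norm_blinfun_id_le)
    have "norm (pointwise Z' o\<^sub>L shift 1) * norm (id_blinfun :: (int \<Rightarrow>\<^sub>C 'a) \<Rightarrow>\<^sub>L _) \<le> 1 / 2 * 1"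
      by (rule mult_mono[OF a b]) auto
    then show "norm (id_blinfun - (pointwise Z' o\<^sub>L shift 1) - id_blinfun) * norm (id_blinfun :: (int \<Rightarrow>\<^sub>C 'a) \<Rightarrow>\<^sub>L _) \<le> 1 / 2"
      by (simp add: norm_minus_commute)
  qed (auto intro: blinfun_product.left_unit)
  \<comment> \<open>On the kernel part the operator vanishes, so the solution is the right-hand side
    delayed by one; hence the shift by - 1. The expanding part contributes - g.\<close>
  define M where "M = (shift (- 1) o\<^sub>L pointwise Pr) - (N o\<^sub>L pointwise Z')"
  have right: "difference_op X o\<^sub>L M = id_blinfun"
  proof (rule blinfun_eqI, rule bcontfun_eqI)
    fix f and j :: int
    define g where "g = apply_bcontfun (N (pointwise Z' f))"
    have "(id_blinfun - (pointwise Z' o\<^sub>L shift 1)) (N (pointwise Z' f)) = pointwise Z' f"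
      using N by (metis blinfun_apply_blinfun_compose blinfun_apply_id_blinfun id_apply)
    then have N_eq: "N (pointwise Z' f) = pointwise Z' f + pointwise Z' (shift 1 (N (pointwise Z' f)))"
      by (simp add: blinfun.diff_left algebra_simps)
    have g: "g j = Z' (apply_bcontfun f j) + Z' (g (j + 1))" for j
      unfolding g_def by (subst N_eq) (simp add: pointwise shift apply_bcontfun_simps)
    have M: "apply_bcontfun (M f) j = Pr (apply_bcontfun f (j - 1)) - g j" for j
      by (simp add: M_def blinfun.diff_left apply_bcontfun_simps shift pointwise g_def)
    have Yg: "Y (Z (g j)) = g j" for j
      by (subst (1 2) g) (simp add: blinfun.add_right YZZ)
    have Xg: "X (g j) = Y (Z (apply_bcontfun f j)) + g (j + 1)"
      by (subst g) (simp add: blinfun.add_right XZ Yg)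
    show "apply_bcontfun ((difference_op X o\<^sub>L M) f) j = apply_bcontfun (id_blinfun f) j"
      by (simp add: difference_op M blinfun.diff_right XYZ Xg Pi)
  qed
  have inj: "u = 0" if u: "difference_op X u = 0" for u
  proof -
    have step: "apply_bcontfun u (j + 1) = X (apply_bcontfun u j)" for j
      using arg_cong[OF u, of "\<lambda>w. apply_bcontfun w j"] by (simp add: difference_op)
    have "Pr (apply_bcontfun u j) = 0" for j
      using step[of "j - 1"] PiX by simp
    then have "apply_bcontfun u j = Y (Z (apply_bcontfun u j))" for j by (simp add: Pi)
    then have "apply_bcontfun u j = Z' (apply_bcontfun u (j + 1))" for j by (metis step ZX)
    then have "norm (apply_bcontfun u j) \<le> 1 / 2 * norm (apply_bcontfun u (j + 1))" for j by (metis Zle)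
    moreover have "1 / 2 * norm (apply_bcontfun u (j + 1)) \<le> 1 / 2 * norm u" for j
      by (intro mult_left_mono norm_bounded) auto
    ultimately have "norm u \<le> 1 / 2 * norm u" by (intro norm_bound) (meson order_trans)
    then show ?thesis by simp
  qed
  have left: "M o\<^sub>L difference_op X = id_blinfun"
  proof (rule blinfun_eqI)
    fix u
    have "difference_op X (M f) = f" for f
      using right by (metis blinfun_apply_blinfun_compose blinfun_apply_id_blinfun id_apply)
    then have "difference_op X (M (difference_op X u) - u) = 0" by (simp add: blinfun.diff_right)
    from inj[OF this] show "(M o\<^sub>L difference_op X) u = id_blinfun u" by simp
  qed
  interpret inverted_difference_op X M by unfold_locales (fact right left)+
  have "impulse_response M = Pr"
  proof (rule blinfun_eqI)
    fix v
    have 1: "impulse_response M (Pr v) = Pr v"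
    proof -
      define w where "w n = (if n = 0 then Pr v else 0)" for n :: nat
      have "impulse_response M (w 0) = w 0"
        by (rule response_forward[of w "norm (Pr v)"]) (auto simp: w_def XPi blinfun.zero_right)
      then show ?thesis by (simp add: w_def)
    qed
    have 2: "impulse_response M (Y (Z v)) = 0"
    proof -
      define w where "w n = (blinfun_apply Z' ^^ n) (Y (Z v))" for n
      have "Y (Z (w n)) = w n" for n
        using YYZ ZYZ by (cases n) (auto simp: w_def YZZ)
      then have "X (w (Suc n)) = w n" for n by (simp add: w_def XZ)
      moreover have "norm (w n) \<le> norm (Y (Z v))" for n
      proof (induction n)
        case (Suc n)
        have "norm (w (Suc n)) \<le> 1 / 2 * norm (w n)" unfolding w_def using Zle by simp
        with Suc norm_ge_zero[of "w n"] show ?case by linarith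
      qed (simp add: w_def)
      ultimately have "impulse_response M (w 0) = 0" by (rule response_backward)
      then show ?thesis by (simp add: w_def)
    qed
    have "v = Pr v + Y (Z v)" by (simp add: Pi)
    then have "impulse_response M v = impulse_response M (Pr v) + impulse_response M (Y (Z v))"
      by (metis blinfun.add_right)
    then show "impulse_response M v = Pr v" using 1 2 by simp
  qed
  then show ?thesis
    using that[of M] inverted_difference_op_axioms by (simp add: X_def Pr_def)
qed

text \<open>The hypotheses say that \<open>Y\<close> maps its range bijectively onto itself with
  bounded inverse. \<open>Z x\<close> is the only \<open>z\<close> in the range with Y (Y z) = Y x;
  using \<open>below\<close> twice accounts for K^2 in its norm.\<close>

lemma group_inverse_exists:
  fixes Y :: "'a::banach \<Rightarrow>\<^sub>L 'a"
  assumes below: "\<And>x. norm (Y x) \<le> K * norm (Y (Y x))"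
    and range: "\<And>x. \<exists>y. Y x = Y (Y y)"
  obtains Z :: "'a \<Rightarrow>\<^sub>L 'a" where "\<And>x. Y (Z x) = Z (Y x)" "\<And>x. Y (Z (Y x)) = Y x" "\<And>x. Z (Y (Z x)) = Z x"
proof -
  have inj: "Y x = Y y" if "Y (Y x) = Y (Y y)" for x y
    using below[of "x - y"] that by (simp add: blinfun.diff_right)
  have "\<exists>z. z \<in> range Y \<and> Y (Y z) = Y x" for x
  proof -
    obtain y where "Y x = Y (Y y)" using range by blast
    moreover obtain y' where "Y y = Y (Y y')" using range by blast
    ultimately show ?thesis by (intro exI[of _ "Y y'"]) auto
  qed
  then obtain Z where Z: "\<And>x. Z x \<in> range Y" "\<And>x. Y (Y (Z x)) = Y x" by metis
  have eqI: "a = b" if ab: "a \<in> range Y" "b \<in> range Y" "Y (Y a) = Y (Y b)" for a b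
  proof -
    obtain a' b' where "a = Y a'" "b = Y b'" using ab by auto
    then show ?thesis using inj[of "Y a'" "Y b'"] inj[of a' b'] ab(3) by simp
  qed
  have rng_add: "a + b \<in> range Y" if "a \<in> range Y" "b \<in> range Y" for a b
    using that by (auto simp flip: blinfun.add_right)
  have rng_sc: "r *\<^sub>R a \<in> range Y" if "a \<in> range Y" for a r
    using that by (auto simp flip: blinfun.scaleR_right)
  have bl: "bounded_linear Z"
  proof (rule bounded_linear_intro[where K = "\<bar>K\<bar> * \<bar>K\<bar> * norm Y"])
    show "Z (x + y) = Z x + Z y" for x y
      by (rule eqI[OF Z(1) rng_add[OF Z(1) Z(1)]]) (simp add: Z(2) blinfun.add_right)
    show "Z (r *\<^sub>R x) = r *\<^sub>R Z x" for r x
      by (rule eqI[OF Z(1) rng_sc[OF Z(1)]]) (simp add: Z(2) blinfun.scaleR_right)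
    fix x
    have b: "norm (Y y) \<le> \<bar>K\<bar> * norm (Y (Y y))" for y
      using below[of y] by (meson abs_ge_self mult_right_mono norm_ge_zero order_trans)
    obtain z where "Z x = Y z" using Z(1) by blast
    then have "norm (Z x) \<le> \<bar>K\<bar> * norm (Y (Z x))" using b[of z] by simp
    also have "\<dots> \<le> \<bar>K\<bar> * (\<bar>K\<bar> * norm (Y (Y (Z x))))" by (intro mult_left_mono b) auto
    also have "\<dots> \<le> \<bar>K\<bar> * (\<bar>K\<bar> * (norm Y * norm x))"
      unfolding Z(2) by (intro mult_left_mono norm_blinfun) auto
    finally show "norm (Z x) \<le> norm x * (\<bar>K\<bar> * \<bar>K\<bar> * norm Y)" by (simp add: mult_ac)
  qed
  have ap: "Blinfun Z x = Z x" for x by (simp add: bounded_linear_Blinfun_apply[OF bl])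
  show ?thesis
  proof (rule that[of "Blinfun Z"])
    have c: "Y (Z x) = Z (Y x)" for x by (rule eqI[OF rangeI Z(1)]) (simp add: Z(2))
    show "Y (Blinfun Z x) = Blinfun Z (Y x)" for x by (simp add: ap c)
    show "Y (Blinfun Z (Y x)) = Y x" for x by (simp add: ap Z(2) flip: c)
    have "Z (Y (Z x)) = Z x" for x by (rule eqI[OF Z(1) Z(1)]) (simp add: Z(2))
    then show "Blinfun Z (Y (Blinfun Z x)) = Blinfun Z x" for x by (simp add: ap)
  qed
qed

text \<open>At \<open>t0\<close> the projection belongs to the eigenvalue 0. Since
  \<open>difference_op\<close> is linear in \<open>Y\<close>, inverting it preserves regularity. The
  last clause locates eigenvectors for t \<noteq> t0: if s Y(t) has the eigenvalue c on
  \<open>x\<close> with |c| \<le> 1, the orbit of \<open>x\<close> is bounded and \<open>x\<close>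
  lies in the range.\<close>

theorem regular_dichotomy:
  fixes Y :: "real \<Rightarrow> 'a::banach \<Rightarrow>\<^sub>L 'a" and Z :: "'a \<Rightarrow>\<^sub>L 'a"
  assumes reg: "regular an S Y" and t0: "t0 \<in> S"
    and YZ: "\<And>x. Y t0 (Z x) = Z (Y t0 x)" and YZY: "\<And>x. Y t0 (Z (Y t0 x)) = Y t0 x"
    and ZYZ: "\<And>x. Z (Y t0 (Z x)) = Z x"
  obtains s \<delta> :: real and Pr :: "real \<Rightarrow> 'a \<Rightarrow>\<^sub>L 'a" where "s > 0" "\<delta> > 0" "regular an (S \<inter> ball t0 \<delta>) Pr"
    "\<And>x. Pr t0 x = x - Y t0 (Z x)"
    "\<And>t x. t \<in> S \<inter> ball t0 \<delta> \<Longrightarrow> Pr t (Pr t x) = Pr t x"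
    "\<And>t C. t \<in> S \<inter> ball t0 \<delta> \<Longrightarrow> C o\<^sub>L Y t = Y t o\<^sub>L C \<Longrightarrow> C o\<^sub>L Pr t = Pr t o\<^sub>L C"
    "\<And>t w b. t \<in> S \<inter> ball t0 \<delta> \<Longrightarrow> (\<And>n::nat. w (Suc n) = s *\<^sub>R Y t (w n)) \<Longrightarrow> (\<And>n. norm (w n) \<le> b) \<Longrightarrow> Pr t (w 0) = w 0"
proof -
  \<comment> \<open>Any s \<ge> 2 |Z| makes the range expand by 2; the added 1 keeps
    \<open>s\<close> positive for Z = 0.\<close>
  define s where "s = 2 * norm Z + 1"
  have s: "s > 0" "s \<ge> 2 * norm Z" by (auto simp: s_def add_nonneg_pos)
  obtain M0 where M0: "inverted_difference_op (s *\<^sub>R Y t0) M0" "impulse_response M0 = id_blinfun - (Y t0 o\<^sub>L Z)"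
    by (rule difference_op_invertible[OF YZ YZY ZYZ s])
  have regL: "regular an S (\<lambda>t. difference_op (s *\<^sub>R Y t))"
    unfolding difference_op_def
    by (intro regular_diff regular_const regular_linear[OF bounded_linear_pointwise]
        regular_linear[OF bounded_linear_scaleR_right] reg)
  obtain \<delta> M where M: "\<delta> > 0" "regular an (S \<inter> ball t0 \<delta>) M" "M t0 = M0"
    "\<And>t. t \<in> S \<inter> ball t0 \<delta> \<Longrightarrow> difference_op (s *\<^sub>R Y t) o\<^sub>L M t = id_blinfun \<and> M t o\<^sub>L difference_op (s *\<^sub>R Y t) = id_blinfun"
    using regular_inverse_near[where L = "\<lambda>t. difference_op (s *\<^sub>R Y t)", OF regL t0] M0(1) unfolding inverted_difference_op_def by metis
  have loc: "inverted_difference_op (s *\<^sub>R Y t) (M t)" if "t \<in> S \<inter> ball t0 \<delta>" for t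
    using M(4)[OF that] by (simp add: inverted_difference_op_def)
  show ?thesis
  proof (rule that[of s \<delta> "\<lambda>t. impulse_response (M t)"])
    show "regular an (S \<inter> ball t0 \<delta>) (\<lambda>t. impulse_response (M t))"
      by (rule regular_linear[OF bounded_linear_impulse_response M(2)])
    show "impulse_response (M t0) x = x - Y t0 (Z x)" for x by (simp add: M(3) M0(2) blinfun.diff_left)
    show "impulse_response (M t) (impulse_response (M t) x) = impulse_response (M t) x" if "t \<in> S \<inter> ball t0 \<delta>" for t x
      by (rule inverted_difference_op.response_idempotent[OF loc[OF that]])
    show "C o\<^sub>L impulse_response (M t) = impulse_response (M t) o\<^sub>L C" if "t \<in> S \<inter> ball t0 \<delta>" "C o\<^sub>L Y t = Y t o\<^sub>L C" for t C
    proof (rule inverted_difference_op.response_commute[OF loc[OF that(1)]])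
      show "C o\<^sub>L (s *\<^sub>R Y t) = (s *\<^sub>R Y t) o\<^sub>L C"
        using that(2) by (simp add: blinfun_product.scaleR_left blinfun_product.scaleR_right)
    qed
    show "impulse_response (M t) (w 0) = w 0"
      if "t \<in> S \<inter> ball t0 \<delta>" "\<And>n::nat. w (Suc n) = s *\<^sub>R Y t (w n)" "\<And>n. norm (w n) \<le> b" for t w b
      by (rule inverted_difference_op.response_forward[OF loc[OF that(1)] _ that(3)])
        (simp add: that(2) blinfun.scaleR_left)
  qed (use s M in auto)
qed

section \<open>Finite-dimensional spectral theory\<close>

definition orthonormal :: "'h::complex_hilbert_space set \<Rightarrow> bool" where
  "orthonormal B \<longleftrightarrow> (\<forall>x\<in>B. \<forall>y\<in>B. cinner x y = (if x = y then 1 else 0))"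

definition orthonormal_basis :: "'h::complex_hilbert_space set \<Rightarrow> 'h set \<Rightarrow> bool" where
  "orthonormal_basis B W \<longleftrightarrow> finite B \<and> orthonormal B \<and> complex_vector.span B = W"

lemma orthonormal_norm: "orthonormal B \<Longrightarrow> e \<in> B \<Longrightarrow> norm e = 1"
proof -
  assume "orthonormal B" "e \<in> B"
  then have "cinner e e = 1" by (simp add: orthonormal_def)
  then have "(norm e)\<^sup>2 = 1" by (simp flip: Re_cinner_self)
  then show "norm e = 1" by (simp add: power2_eq_1_iff) (use norm_ge_zero[of e] in linarith)
qed

lemma orthonormal_coeff:
  assumes "finite B" "orthonormal B" "e \<in> B"
  shows "cinner (\<Sum>b\<in>B. u b *\<^sub>C b) e = u e"
proof -
  have "cinner (\<Sum>b\<in>B. u b *\<^sub>C b) e = (\<Sum>b\<in>B. u b * cinner b e)" by (simp add: cinner_simps)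
  also have "\<dots> = (\<Sum>b\<in>B. if b = e then u b else 0)"
    using assms by (intro sum.cong) (auto simp: orthonormal_def)
  finally show ?thesis using assms by simp
qed

lemma orthonormal_expand:
  assumes "finite B" "orthonormal B" "x \<in> complex_vector.span B"
  shows "x = (\<Sum>e\<in>B. cinner x e *\<^sub>C e)"
proof -
  obtain u where u: "x = (\<Sum>e\<in>B. u e *\<^sub>C e)"
    using assms(3) unfolding complex_vector.span_finite[OF assms(1)] by blast
  have "cinner x e = u e" if "e \<in> B" for e using orthonormal_coeff[OF assms(1,2) that] u by simp
  then show ?thesis using u by simp
qed

lemma orthonormal_independent:
  assumes "finite B" "orthonormal B"
  shows "complex_vector.independent B"
  unfolding complex_vector.dependent_finite[OF assms(1)]
proof
  assume "\<exists>u. (\<exists>v\<in>B. u v \<noteq> 0) \<and> (\<Sum>v\<in>B. u v *\<^sub>C v) = 0"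
  then obtain u v where "v \<in> B" "u v \<noteq> 0" "(\<Sum>v\<in>B. u v *\<^sub>C v) = 0" by blast
  with orthonormal_coeff[OF assms, of v u] show False by simp
qed

lemma orthonormal_extend:
  fixes W :: "'h::complex_hilbert_space set"
  assumes B: "finite B" "orthonormal B" "B \<subseteq> W" and W: "complex_vector.subspace W"
    and x: "x \<in> W" "x \<notin> complex_vector.span B"
  obtains e where "e \<in> W" "e \<notin> B" "orthonormal (insert e B)"
proof -
  define p where "p = (\<Sum>b\<in>B. cinner x b *\<^sub>C b)"
  define y where "y = x - p"
  have p: "p \<in> complex_vector.span B"
    unfolding p_def by (intro complex_vector.span_sum complex_vector.span_scale complex_vector.span_base)
  have "p \<in> W" using p complex_vector.span_minimal[OF B(3) W] by blast
  then have y: "y \<in> W" "y \<noteq> 0" using x p W by (auto simp: y_def intro: complex_vector.subspace_diff)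
  have orth: "cinner y b = 0" if "b \<in> B" for b
    using orthonormal_coeff[OF B(1,2) that, of "cinner x"] by (simp add: y_def p_def cinner_diff_left)
  define e where "e = complex_of_real (1 / norm y) *\<^sub>C y"
  have "norm e = 1" using y by (simp add: e_def norm_scaleC norm_divide)
  then have ee: "cinner e e = 1" by (simp add: cinner_self)
  have eb: "cinner e b = 0" if "b \<in> B" for b using orth[OF that] by (simp add: e_def cinner_simps)
  have be: "cinner b e = 0" if "b \<in> B" for b using eb[OF that] by (subst cinner_commute) simp
  show ?thesis
  proof
    show "e \<in> W" unfolding e_def using y W by (intro complex_vector.subspace_scale)
    show "e \<notin> B" using eb ee by force
    then show "orthonormal (insert e B)"
      using B(2) ee eb be by (auto simp: orthonormal_def)
  qed
qed

text \<open>An orthonormal subset of maximal size spans, since it could be extended otherwise. The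
  bound \<open>m\<close> is the point where finite dimension enters; for eigenspaces it comes from
  compactness.\<close>

lemma orthonormal_basis_exists:
  fixes W :: "'h::complex_hilbert_space set"
  assumes W: "complex_vector.subspace W"
    and bound: "\<And>B. finite B \<Longrightarrow> orthonormal B \<Longrightarrow> B \<subseteq> W \<Longrightarrow> card B \<le> m"
  obtains B where "orthonormal_basis B W"
proof -
  define S where "S = {B. finite B \<and> orthonormal B \<and> B \<subseteq> W}"
  have "{} \<in> S" by (simp add: S_def orthonormal_def)
  moreover have "\<forall>B. B \<in> S \<longrightarrow> card B < Suc m" using bound by (auto simp: S_def less_Suc_eq_le)
  ultimately obtain B where B: "B \<in> S" "\<And>C. C \<in> S \<Longrightarrow> card C \<le> card B"
    using ex_has_greatest_nat[of "\<lambda>B. B \<in> S" "{}" card "Suc m"] by blast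
  have fin: "finite B" "orthonormal B" "B \<subseteq> W" using B(1) by (auto simp: S_def)
  have "W \<subseteq> complex_vector.span B"
  proof
    fix x assume x: "x \<in> W"
    show "x \<in> complex_vector.span B"
    proof (rule ccontr)
      assume "x \<notin> complex_vector.span B"
      then obtain e where e: "e \<in> W" "e \<notin> B" "orthonormal (insert e B)"
        using orthonormal_extend[OF fin W x] by metis
      then have "insert e B \<in> S" using fin by (auto simp: S_def)
      from B(2)[OF this] show False using e fin by simp
    qed
  qed
  then have "complex_vector.span B = W"
    using complex_vector.span_minimal[OF fin(3) W] by blast
  then show ?thesis using that fin by (simp add: orthonormal_basis_def)
qed

lemma orthonormal_basis_subspace: "orthonormal_basis B W \<Longrightarrow> complex_vector.subspace W"
  unfolding orthonormal_basis_def using complex_vector.subspace_span by blast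

lemma orthonormal_basis_of_subspace:
  fixes W :: "'h::complex_hilbert_space set"
  assumes W: "complex_vector.subspace W" "W \<subseteq> complex_vector.span F" "finite F"
  obtains B where "orthonormal_basis B W" "card B \<le> card F"
proof -
  have bd: "card B \<le> card F" if "finite B" "orthonormal B" "B \<subseteq> W" for B
    using complex_vector.independent_span_bound[OF W(3) orthonormal_independent[OF that(1,2)]] that(3) W(2) by auto
  obtain B where B: "orthonormal_basis B W"
    using orthonormal_basis_exists[OF W(1) bd] by metis
  have "B \<subseteq> W" using B complex_vector.span_superset unfolding orthonormal_basis_def by blast
  then show ?thesis using that[OF B] bd B by (simp add: orthonormal_basis_def)
qed

lemma orthonormal_basis_in: "orthonormal_basis B W \<Longrightarrow> e \<in> B \<Longrightarrow> e \<in> W"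
  unfolding orthonormal_basis_def using complex_vector.span_base by blast

lemma orthonormal_basis_expand: "orthonormal_basis B W \<Longrightarrow> x \<in> W \<Longrightarrow> x = (\<Sum>e\<in>B. cinner x e *\<^sub>C e)"
  unfolding orthonormal_basis_def using orthonormal_expand by blast

text \<open>Formulated for indexed families, so that a repetition g i = g j counts as a
  dependence.\<close>

lemma dependent_family:
  fixes g :: "'i \<Rightarrow> 'h::complex_hilbert_space"
  assumes "finite A" "finite B" "card B < card A" "\<And>i. i \<in> A \<Longrightarrow> g i \<in> complex_vector.span B"
  obtains a where "\<exists>i\<in>A. a i \<noteq> 0" "(\<Sum>i\<in>A. a i *\<^sub>C g i) = 0"
proof (cases "inj_on g A")
  case True
  then have card: "card (g ` A) = card A" by (rule card_image)
  have "complex_vector.dependent (g ` A)"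
  proof (rule ccontr)
    assume "\<not> complex_vector.dependent (g ` A)"
    from complex_vector.independent_span_bound[OF assms(2) this] assms(3,4) card show False by auto
  qed
  then obtain u v where u: "v \<in> g ` A" "u v \<noteq> 0" "(\<Sum>v\<in>g ` A. u v *\<^sub>C v) = 0"
    using complex_vector.dependent_finite[of "g ` A"] assms(1) by auto
  show ?thesis
  proof (rule that[of "u \<circ> g"])
    show "\<exists>i\<in>A. (u \<circ> g) i \<noteq> 0" using u by auto
    show "(\<Sum>i\<in>A. (u \<circ> g) i *\<^sub>C g i) = 0" using u(3) by (simp add: sum.reindex[OF True])
  qed
next
  case False
  then obtain i j where ij: "i \<in> A" "j \<in> A" "g i = g j" "i \<noteq> j" by (auto simp: inj_on_def)
  define a where "a l = (if l = i then 1 else if l = j then - 1 else (0::complex))" for l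
  have "(\<Sum>l\<in>A. a l *\<^sub>C g l) = (\<Sum>l\<in>{i, j}. a l *\<^sub>C g l)"
    using ij assms(1) by (intro sum.mono_neutral_right) (auto simp: a_def)
  also have "\<dots> = 0" using ij by (simp add: a_def)
  finally have sum0: "(\<Sum>l\<in>A. a l *\<^sub>C g l) = 0" .
  have "\<exists>i\<in>A. a i \<noteq> 0" using ij by (intro bexI[of _ i]) (auto simp: a_def)
  then show ?thesis using sum0 by (rule that)
qed

definition complex_linear :: "('h::complex_hilbert_space \<Rightarrow>\<^sub>L 'h) \<Rightarrow> bool" where
  "complex_linear X \<longleftrightarrow> (\<forall>c x. X (c *\<^sub>C x) = c *\<^sub>C X x)"

definition scalar_op :: "complex \<Rightarrow> 'h::complex_hilbert_space \<Rightarrow>\<^sub>L 'h" where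
  "scalar_op c = Blinfun (scaleC c)"

lemma scalar_op [simp]: "scalar_op c x = c *\<^sub>C x"
  by (simp add: scalar_op_def bounded_linear_Blinfun_apply scaleC.bounded_linear_right)

lemma bounded_linear_scalar_op: "bounded_linear (scalar_op :: complex \<Rightarrow> 'h::complex_hilbert_space \<Rightarrow>\<^sub>L 'h)"
proof (rule bounded_linear_intro[where K = 1])
  show "scalar_op (c + d) = scalar_op c + scalar_op d" for c d :: complex
    by (rule blinfun_eqI) (simp add: blinfun.add_left scaleC_add_left)
  show "scalar_op (r *\<^sub>R c) = r *\<^sub>R scalar_op c" for r and c :: complex
    by (rule blinfun_eqI) (simp add: blinfun.scaleR_left scaleC.scaleR_left)
  show "norm (scalar_op c :: 'h \<Rightarrow>\<^sub>L 'h) \<le> norm c * 1" for c :: complex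
    by (rule norm_blinfun_bound) (auto simp: norm_scaleC)
qed

lemma complex_linear_simps:
  assumes "complex_linear X"
  shows "X (c *\<^sub>C x) = c *\<^sub>C X x" "X (sum f A) = (\<Sum>a\<in>A. X (f a))"
  using assms by (auto simp: complex_linear_def blinfun.sum_right)

lemma complex_linear_diff: "complex_linear X \<Longrightarrow> complex_linear Y \<Longrightarrow> complex_linear (X - Y)"
  by (simp add: complex_linear_def blinfun.diff_left scaleC.diff_right)

lemma complex_linear_scalar_op: "complex_linear (scalar_op c)"
  by (simp add: complex_linear_def scaleC_scaleC mult.commute)

lemma injective_imp_surjective_on:
  fixes Y :: "'h::complex_hilbert_space \<Rightarrow>\<^sub>L 'h"
  assumes B: "orthonormal_basis B W" and Y: "complex_linear Y" "\<And>x. x \<in> W \<Longrightarrow> Y x \<in> W"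
    and inj: "\<And>x. x \<in> W \<Longrightarrow> Y x = 0 \<Longrightarrow> x = 0" and w: "w \<in> W"
  shows "\<exists>x\<in>W. Y x = w"
proof -
  have fin: "finite B" and span: "complex_vector.span B = W" and orth: "orthonormal B"
    using B by (auto simp: orthonormal_basis_def)
  \<comment> \<open>The images of the basis together with \<open>w\<close>, indexed by
    \<open>None\<close>, are one vector more than the dimension. In a dependence among them the
    coefficient of \<open>w\<close> cannot vanish, because \<open>Y\<close> is injective.\<close>
  define g where "g i = (case i of None \<Rightarrow> w | Some b \<Rightarrow> Y b)" for i
  have "card (insert None (Some ` B)) = Suc (card B)"
    using fin by (subst card_insert_disjoint) (auto simp: card_image)
  then have card: "card B < card (insert None (Some ` B))" by simp
  have "g i \<in> complex_vector.span B" if "i \<in> insert None (Some ` B)" for i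
    using that w Y(2) orthonormal_basis_in[OF B] by (auto simp: g_def span)
  then obtain a where a: "\<exists>i\<in>insert None (Some ` B). a i \<noteq> 0" "(\<Sum>i\<in>insert None (Some ` B). a i *\<^sub>C g i) = 0"
    using dependent_family[OF _ fin card, of g] fin by blast
  define y where "y = (\<Sum>b\<in>B. a (Some b) *\<^sub>C b)"
  have y: "y \<in> W" unfolding y_def span[symmetric]
    by (intro complex_vector.span_sum complex_vector.span_scale complex_vector.span_base)
  have "(\<Sum>i\<in>insert None (Some ` B). a i *\<^sub>C g i) = a None *\<^sub>C w + (\<Sum>b\<in>B. a (Some b) *\<^sub>C Y b)"
    using fin by (subst sum.insert) (auto simp: g_def sum.reindex)
  also have "(\<Sum>b\<in>B. a (Some b) *\<^sub>C Y b) = Y y" by (simp add: y_def complex_linear_simps[OF Y(1)])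
  finally have eq: "a None *\<^sub>C w + Y y = 0" using a(2) by simp
  have "a None \<noteq> 0"
  proof
    assume 0: "a None = 0"
    then have "y = 0" using eq inj[OF y] by simp
    then have "a (Some b) = 0" if "b \<in> B" for b
      using orthonormal_coeff[OF fin orth that, of "\<lambda>b. a (Some b)"] by (simp add: y_def)
    then show False using a(1) 0 by auto
  qed
  have "Y ((- 1 / a None) *\<^sub>C y) = (- 1 / a None) *\<^sub>C Y y" by (rule complex_linear_simps(1)[OF Y(1)])
  also have "Y y = - (a None *\<^sub>C w)" using eq by (simp only: eq_neg_iff_add_eq_0 add.commute)
  also have "(- 1 / a None) *\<^sub>C - (a None *\<^sub>C w) = w"
    using \<open>a None \<noteq> 0\<close> by (simp add: scaleC.minus_right scaleC.minus_left scaleC_scaleC scaleC_one)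
  finally have "Y ((- 1 / a None) *\<^sub>C y) = w" .
  moreover have "(- 1 / a None) *\<^sub>C y \<in> W"
    by (rule complex_vector.subspace_scale[OF orthonormal_basis_subspace[OF B] y])
  ultimately show ?thesis by (rule bexI)
qed

lemma finite_dim_bounded:
  fixes f :: "'h::complex_hilbert_space \<Rightarrow> 'h"
  assumes B: "orthonormal_basis B W"
    and add: "\<And>x y. x \<in> W \<Longrightarrow> y \<in> W \<Longrightarrow> f (x + y) = f x + f y"
    and sc: "\<And>c x. x \<in> W \<Longrightarrow> f (c *\<^sub>C x) = c *\<^sub>C f x"
  shows "\<exists>K. \<forall>x\<in>W. norm (f x) \<le> K * norm x"
proof (intro exI ballI)
  fix x assume x: "x \<in> W"
  have fin: "finite B" and orth: "orthonormal B" using B by (auto simp: orthonormal_basis_def)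
  have W: "complex_vector.subspace W" by (rule orthonormal_basis_subspace[OF B])
  have f0: "f 0 = 0" using sc[of 0 0] complex_vector.subspace_0[OF W] by simp
  have fs: "f (\<Sum>e\<in>A. u e *\<^sub>C e) = (\<Sum>e\<in>A. u e *\<^sub>C f e)" if "finite A" "A \<subseteq> B" for A u
    using that
  proof (induction A rule: finite_induct)
    case (insert e A)
    have "u e *\<^sub>C e \<in> W" "(\<Sum>e\<in>A. u e *\<^sub>C e) \<in> W"
      using insert orthonormal_basis_in[OF B] W
      by (auto intro!: complex_vector.subspace_scale complex_vector.subspace_sum)
    then show ?case using insert orthonormal_basis_in[OF B] by (simp add: add sc)
  qed (simp add: f0)
  have "f x = (\<Sum>e\<in>B. cinner x e *\<^sub>C f e)"
    by (subst orthonormal_basis_expand[OF B x]) (simp add: fs[OF fin])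
  also have "norm \<dots> \<le> (\<Sum>e\<in>B. norm (f e) * norm x)"
  proof (intro order_trans[OF norm_sum] sum_mono)
    fix e assume "e \<in> B"
    then have "cmod (cinner x e) \<le> norm x" using cauchy_schwarz[of x e] orthonormal_norm[OF orth] by simp
    from mult_right_mono[OF this norm_ge_zero[of "f e"]]
    show "norm (cinner x e *\<^sub>C f e) \<le> norm (f e) * norm x" by (simp add: norm_scaleC mult.commute)
  qed
  finally show "norm (f x) \<le> (\<Sum>e\<in>B. norm (f e)) * norm x" by (simp add: sum_distrib_right)
qed

lemma finite_dim_bounded_below:
  fixes Y :: "'h::complex_hilbert_space \<Rightarrow>\<^sub>L 'h"
  assumes B: "orthonormal_basis B W" and Y: "complex_linear Y" "\<And>x. x \<in> W \<Longrightarrow> Y x \<in> W"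
    and inj: "\<And>x. x \<in> W \<Longrightarrow> Y x = 0 \<Longrightarrow> x = 0"
  shows "\<exists>K. \<forall>x\<in>W. norm x \<le> K * norm (Y x)"
proof -
  have W: "complex_vector.subspace W" by (rule orthonormal_basis_subspace[OF B])
  obtain g where g: "\<And>w. w \<in> W \<Longrightarrow> g w \<in> W" "\<And>w. w \<in> W \<Longrightarrow> Y (g w) = w"
    using injective_imp_surjective_on[OF B Y inj] by metis
  have eqI: "x = y" if "x \<in> W" "y \<in> W" "Y x = Y y" for x y
    using inj[of "x - y"] that complex_vector.subspace_diff[OF W] by (simp add: blinfun.diff_right)
  obtain K where K: "\<And>x. x \<in> W \<Longrightarrow> norm (g x) \<le> K * norm x"
    using finite_dim_bounded[OF B, of g]
  proof (rule exE)
    show "g (x + y) = g x + g y" if "x \<in> W" "y \<in> W" for x y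
      by (rule eqI) (use that W g in \<open>auto simp: blinfun.add_right complex_vector.subspace_add\<close>)
    show "g (c *\<^sub>C x) = c *\<^sub>C g x" if "x \<in> W" for c x
      by (rule eqI) (use that W g in \<open>auto simp: complex_linear_simps[OF Y(1)] complex_vector.subspace_scale\<close>)
  qed blast
  have "norm x \<le> K * norm (Y x)" if x: "x \<in> W" for x
  proof -
    have "g (Y x) = x" by (rule eqI) (use x Y g in auto)
    then show ?thesis using K[OF Y(2)[OF x]] by simp
  qed
  then show ?thesis by blast
qed

text \<open>The iterates of \<open>x\<close> are dependent, so some nonzero polynomial annihilates
  \<open>x\<close>. Splitting off a root \<open>z\<close>, either the quotient applied to
  \<open>x\<close> is an eigenvector for \<open>z\<close>, or the quotient annihilates
  \<open>x\<close> and has smaller degree.\<close>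

lemma eigenvector_exists:
  fixes X :: "'h::complex_hilbert_space \<Rightarrow>\<^sub>L 'h"
  assumes B: "orthonormal_basis B W" and X: "complex_linear X" "\<And>x. x \<in> W \<Longrightarrow> X x \<in> W"
    and x: "x \<in> W" "x \<noteq> 0"
  obtains c y where "y \<in> W" "y \<noteq> 0" "X y = c *\<^sub>C y"
proof -
  have fin: "finite B" and span: "complex_vector.span B = W" using B by (auto simp: orthonormal_basis_def)
  have W: "complex_vector.subspace W" by (rule orthonormal_basis_subspace[OF B])
  define N where "N = card B"
  define g where "g i = (blinfun_apply X ^^ i) x" for i
  have gW: "g i \<in> W" for i by (induction i) (use x X in \<open>auto simp: g_def\<close>)
  have Xg: "X (g i) = g (Suc i)" for i by (simp add: g_def)
  \<comment> \<open>p(X) x for polynomials of degree at most \<open>N\<close>; the fixed summation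
    range spares a dependence on the degree.\<close>
  define ev where "ev p = (\<Sum>i\<le>N. coeff p i *\<^sub>C g i)" for p
  obtain a where a: "\<exists>i\<in>{..N}. a i \<noteq> 0" "(\<Sum>i\<le>N. a i *\<^sub>C g i) = 0"
    using dependent_family[of "{..N}" B g] fin gW by (auto simp: N_def span)
  define p0 where "p0 = (\<Sum>i\<le>N. monom (a i) i)"
  have c0: "coeff p0 i = (if i \<le> N then a i else 0)" for i
    by (simp add: p0_def coeff_sum)
  have p0: "p0 \<noteq> 0" "degree p0 \<le> N" "ev p0 = 0"
  proof -
    show "p0 \<noteq> 0" using a(1) c0 by (metis atMost_iff coeff_0)
    show "degree p0 \<le> N" using c0 by (intro degree_le) auto
    show "ev p0 = 0" using a(2) by (simp add: ev_def c0)
  qed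
  have "\<exists>c y. y \<in> W \<and> y \<noteq> 0 \<and> X y = c *\<^sub>C y" if "p \<noteq> 0" "degree p \<le> N" "ev p = 0" for p
    using that
  proof (induction "degree p" arbitrary: p)
    case 0
    then have "coeff p 0 \<noteq> 0" by (metis leading_coeff_0_iff)
    moreover have "ev p = coeff p 0 *\<^sub>C g 0"
    proof -
      have "ev p = (\<Sum>i\<in>{0}. coeff p i *\<^sub>C g i)"
        unfolding ev_def using 0 by (intro sum.mono_neutral_right) (auto simp: coeff_eq_0)
      then show ?thesis by simp
    qed
    ultimately show ?case using 0 x by (simp add: g_def)
  next
    case (Suc d)
    have "\<not> constant (poly p)" using Suc.hyps(2) by (simp add: constant_degree)
    then obtain z where "poly p z = 0" using fundamental_theorem_of_algebra by blast
    then obtain q where q: "p = [:- z, 1:] * q" by (metis dvdE poly_eq_0_iff_dvd)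
    have q0: "q \<noteq> 0" using q Suc.prems by auto
    have dq: "degree p = Suc (degree q)" unfolding q using q0 degree_mult_eq[of "[:- z, 1:]" q] by (simp del: mult_pCons_left)
    have cp: "coeff p i = (if i = 0 then 0 else coeff q (i - 1)) - z * coeff q i" for i
      by (cases i) (simp_all add: q)
    obtain N' where N': "N = Suc N'" using dq Suc.prems(2) by (cases N) auto
    have "ev p = (\<Sum>i\<le>N. (if i = 0 then 0 else coeff q (i - 1)) *\<^sub>C g i) - (\<Sum>i\<le>N. (z * coeff q i) *\<^sub>C g i)"
      by (simp add: ev_def cp scaleC.diff_left sum_subtractf)
    also have "(\<Sum>i\<le>N. (z * coeff q i) *\<^sub>C g i) = z *\<^sub>C ev q"
      by (simp add: ev_def scaleC.sum_right scaleC_scaleC)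
    also have "(\<Sum>i\<le>N. (if i = 0 then 0 else coeff q (i - 1)) *\<^sub>C g i) = (\<Sum>i\<le>N'. coeff q i *\<^sub>C g (Suc i))"
      unfolding N' by (subst sum.atMost_Suc_shift) simp
    also have "\<dots> = X (\<Sum>i\<le>N'. coeff q i *\<^sub>C g i)" by (simp add: complex_linear_simps[OF X(1)] Xg)
    also have "(\<Sum>i\<le>N'. coeff q i *\<^sub>C g i) = ev q"
      using dq Suc.prems(2) by (simp add: ev_def N' coeff_eq_0)
    finally have eq: "X (ev q) = z *\<^sub>C ev q" using Suc.prems(3) by simp
    have "ev q \<in> W" unfolding ev_def
      using gW W by (auto intro!: complex_vector.subspace_sum complex_vector.subspace_scale)
    with eq show ?case
    proof (cases "ev q = 0")
      case True
      then show ?thesis using Suc.hyps(1)[of q] Suc.hyps(2) q0 dq Suc.prems(2) by simp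
    qed blast
  qed
  from this[OF p0] show ?thesis using that by blast
qed

text \<open>A consequence of normality that passes to limits and to invariant subspaces and needs no adjoint.\<close>

definition paranormal_on :: "'h::complex_hilbert_space set \<Rightarrow> ('h \<Rightarrow>\<^sub>L 'h) \<Rightarrow> bool" where
  "paranormal_on W X \<longleftrightarrow> (\<forall>c. \<forall>x\<in>W.
     (norm (X x - c *\<^sub>C x))\<^sup>2 \<le> norm (X (X x - c *\<^sub>C x) - c *\<^sub>C (X x - c *\<^sub>C x)) * norm x)"

text \<open>Paranormality bounds |Y w|^2 by |Y (Y w)| |w|, so \<open>Y\<close> is injective on its
  image of \<open>W\<close>. By finite dimension it is then also surjective there, which makes
  \<open>W\<close> the direct sum of the kernel and the image.\<close>

lemma eigenspace_splitting:
  fixes X :: "'h::complex_hilbert_space \<Rightarrow>\<^sub>L 'h" and c :: complex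
  assumes B: "orthonormal_basis B W" and X: "complex_linear X" "\<forall>x\<in>W. X x \<in> W"
    and pn: "paranormal_on W X"
  defines "Y \<equiv> X - scalar_op c"
  shows "complex_linear Y" "\<And>x. x \<in> W \<Longrightarrow> Y x \<in> W"
    "complex_vector.subspace (blinfun_apply Y ` W)"
    "\<And>x. x \<in> blinfun_apply Y ` W \<Longrightarrow> Y x = 0 \<Longrightarrow> x = 0"
    "\<And>w. w \<in> W \<Longrightarrow> \<exists>y\<in>blinfun_apply Y ` W. Y w = Y y"
proof -
  have W: "complex_vector.subspace W" by (rule orthonormal_basis_subspace[OF B])
  show lin: "complex_linear Y" unfolding Y_def by (intro complex_linear_diff X complex_linear_scalar_op)
  have Y: "Y x = X x - c *\<^sub>C x" for x by (simp add: Y_def blinfun.diff_left)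
  show YW: "Y x \<in> W" if "x \<in> W" for x
    unfolding Y using that X(2) W by (intro complex_vector.subspace_diff complex_vector.subspace_scale) auto
  let ?R = "blinfun_apply Y ` W"
  show R: "complex_vector.subspace ?R"
    unfolding complex_vector.subspace_def
  proof (intro conjI ballI allI)
    show "0 \<in> ?R" using complex_vector.subspace_0[OF W] by (auto intro: image_eqI[of _ _ 0] simp: blinfun.zero_right)
    show "x + y \<in> ?R" if "x \<in> ?R" "y \<in> ?R" for x y
      using that W by (auto simp: complex_vector.subspace_add simp flip: blinfun.add_right)
    show "a *\<^sub>C x \<in> ?R" if "x \<in> ?R" for a x
      using that W by (auto simp: complex_vector.subspace_scale simp flip: complex_linear_simps(1)[OF lin])
  qed
  show inj: "x = 0" if x: "x \<in> ?R" "Y x = 0" for x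
  proof -
    obtain w where w: "w \<in> W" "x = Y w" using x(1) by blast
    have "(norm (Y w))\<^sup>2 \<le> norm (Y (Y w)) * norm w"
      using pn w(1) unfolding paranormal_on_def Y by blast
    then show ?thesis using x(2) w(2) by simp
  qed
  have RW: "?R \<subseteq> W" using YW by blast
  then have "?R \<subseteq> complex_vector.span B" "finite B" using B by (auto simp: orthonormal_basis_def)
  then obtain B2 where B2: "orthonormal_basis B2 ?R"
    using orthonormal_basis_of_subspace[OF R] by metis
  show "\<exists>y\<in>?R. Y w = Y y" if w: "w \<in> W" for w
  proof -
    have "\<exists>y\<in>?R. Y y = Y w"
      by (rule injective_imp_surjective_on[OF B2 lin _ inj]) (use RW w in auto)
    then obtain y where "y \<in> ?R" "Y y = Y w" by (rule bexE)
    then show ?thesis by (intro bexI[of _ y]) simp_all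
  qed
qed

text \<open>Induction on the dimension: an orthonormal basis of one eigenspace is joined with an
  eigenbasis of the image of X - c. Orthogonality between eigenspaces is a hypothesis, as
  paranormality alone is only used for the splitting.\<close>

lemma orthonormal_eigenbasis:
  fixes X :: "'h::complex_hilbert_space \<Rightarrow>\<^sub>L 'h"
  assumes "orthonormal_basis B W" and X: "complex_linear X" and "\<And>x. x \<in> W \<Longrightarrow> X x \<in> W"
    and "paranormal_on W X"
    and orth: "\<And>x y \<mu> \<nu>. X x = \<mu> *\<^sub>C x \<Longrightarrow> X y = \<nu> *\<^sub>C y \<Longrightarrow> \<mu> \<noteq> \<nu> \<Longrightarrow> cinner x y = 0"
  shows "\<exists>E. orthonormal_basis E W \<and> (\<forall>e\<in>E. \<exists>\<mu>. X e = \<mu> *\<^sub>C e)"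
  using assms(1,3,4)
proof (induction "card B" arbitrary: B W rule: less_induct)
  case less
  have W: "complex_vector.subspace W" by (rule orthonormal_basis_subspace[OF less.prems(1)])
  have B: "finite B" "complex_vector.span B = W" using less.prems(1) by (auto simp: orthonormal_basis_def)
  show ?case
  proof (cases "W = {0}")
    case True
    then have "orthonormal_basis {} W" by (simp add: orthonormal_basis_def orthonormal_def)
    then show ?thesis by (intro exI[of _ "{}"]) auto
  next
    case False
    then obtain x where "x \<in> W" "x \<noteq> 0" using complex_vector.subspace_0[OF W] by blast
    then obtain c y where y: "y \<in> W" "y \<noteq> 0" "X y = c *\<^sub>C y"
      using eigenvector_exists[OF less.prems(1) X less.prems(2)] by metis
    define Y where "Y = X - scalar_op c"
    have XW: "\<forall>x\<in>W. X x \<in> W" using less.prems(2) by blast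
    note split = eigenspace_splitting[OF less.prems(1) X XW less.prems(3), where c = c, folded Y_def]
    let ?R = "blinfun_apply Y ` W"
    have Yx: "Y x = X x - c *\<^sub>C x" for x by (simp add: Y_def blinfun.diff_left)
    define K where "K = {x \<in> W. Y x = 0}"
    have K: "complex_vector.subspace K" unfolding K_def complex_vector.subspace_def
      using W by (auto simp: complex_vector.subspace_def blinfun.zero_right blinfun.add_right complex_linear_simps(1)[OF split(1)])
    have RW: "?R \<subseteq> W" using split(2) by blast
    have "K \<subseteq> complex_vector.span B" "?R \<subseteq> complex_vector.span B" using RW B(2) by (auto simp: K_def)
    then obtain B1 B2 where B1: "orthonormal_basis B1 K" and B2: "orthonormal_basis B2 ?R"
      using orthonormal_basis_of_subspace[OF K _ B(1)] orthonormal_basis_of_subspace[OF split(3) _ B(1)] by metis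
    have yR: "y \<notin> ?R" using split(4)[of y] y by (auto simp: Yx)
    have indep: "complex_vector.independent (insert y B2)"
      using orthonormal_independent[of B2] B2 yR by (auto simp: complex_vector.independent_insert orthonormal_basis_def)
    have "insert y B2 \<subseteq> complex_vector.span B"
      using y(1) B(2) RW orthonormal_basis_in[OF B2] by auto
    from complex_vector.independent_span_bound[OF B(1) indep this]
    have "card (insert y B2) \<le> card B" by simp
    moreover have "y \<notin> B2" using yR orthonormal_basis_in[OF B2] by blast
    ultimately have "card B2 < card B" using B2 by (simp add: orthonormal_basis_def)
    moreover have "X x \<in> ?R" if "x \<in> ?R" for x
    proof -
      have "X x = Y x + c *\<^sub>C x" by (simp add: Yx)
      then show ?thesis using that RW split(3) by (auto intro!: complex_vector.subspace_add complex_vector.subspace_scale)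
    qed
    moreover have "paranormal_on ?R X" using less.prems(3) RW unfolding paranormal_on_def by blast
    ultimately obtain E where E: "orthonormal_basis E ?R" "\<And>e. e \<in> E \<Longrightarrow> \<exists>\<mu>. X e = \<mu> *\<^sub>C e"
      using less.hyps[OF _ B2] by blast
    have eig1: "X e = c *\<^sub>C e" if "e \<in> B1" for e
      using orthonormal_basis_in[OF B1 that] by (simp add: K_def Yx)
    have cross: "cinner e f = 0" if e: "e \<in> B1" and f: "f \<in> E" for e f
    proof -
      obtain \<mu> where \<mu>: "X f = \<mu> *\<^sub>C f" using E(2)[OF f] by blast
      have "f \<noteq> 0" using E(1) f orthonormal_norm[of E f] by (auto simp: orthonormal_basis_def)
      have "\<mu> \<noteq> c"
      proof
        assume "\<mu> = c"
        then have "Y f = 0" using \<mu> by (simp add: Yx)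
        then show False using split(4) orthonormal_basis_in[OF E(1) f] \<open>f \<noteq> 0\<close> by blast
      qed
      then show ?thesis using orth[OF eig1[OF e] \<mu>] by auto
    qed
    have cross': "cinner f e = 0" if "e \<in> B1" "f \<in> E" for e f
      using cross[OF that] by (subst cinner_commute) simp
    have disj: "B1 \<inter> E = {}"
      using cross B1 orthonormal_norm[of B1] by (force simp: orthonormal_basis_def)
    have "orthonormal (B1 \<union> E)"
      using B1 E(1) cross cross' disj unfolding orthonormal_basis_def orthonormal_def
      by (auto split: if_splits)
    moreover have "complex_vector.span (B1 \<union> E) = W"
    proof
      show "complex_vector.span (B1 \<union> E) \<subseteq> W"
        using orthonormal_basis_in[OF B1] orthonormal_basis_in[OF E(1)] RW W
        by (intro complex_vector.span_minimal) (auto simp: K_def)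
      show "W \<subseteq> complex_vector.span (B1 \<union> E)"
      proof
        fix w assume w: "w \<in> W"
        obtain v where v: "v \<in> ?R" "Y w = Y v" using split(5)[OF w] by blast
        then have "w - v \<in> K" using w RW W by (auto simp: K_def blinfun.diff_right intro!: complex_vector.subspace_diff)
        then have "w - v \<in> complex_vector.span B1" "v \<in> complex_vector.span E"
          using v(1) B1 E(1) by (simp_all add: orthonormal_basis_def)
        then have "(w - v) + v \<in> complex_vector.span (B1 \<union> E)"
          using complex_vector.span_mono[of B1 "B1 \<union> E"] complex_vector.span_mono[of E "B1 \<union> E"]
          by (intro complex_vector.span_add) auto
        then show "w \<in> complex_vector.span (B1 \<union> E)" by simp
      qed
    qed
    ultimately have "orthonormal_basis (B1 \<union> E) W"
      using B1 E(1) by (auto simp: orthonormal_basis_def)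
    then show ?thesis using E(2) eig1 by (intro exI[of _ "B1 \<union> E"]) auto
  qed
qed

section \<open>Continuous eigenvalues\<close>

text \<open>Jump to the last point of the chain near the centre of its first point: this moves at
  most 2 \<epsilon>, one more step costs \<epsilon>, and the rest of the chain never meets this
  centre again. So each centre is charged 3 \<epsilon> once, whatever the length of the
  chain.\<close>

lemma chain_displacement:
  fixes x :: "nat \<Rightarrow> 'a::metric_space"
  assumes "finite C" "\<And>j. j \<le> m \<Longrightarrow> \<exists>c\<in>C. dist (x j) c < \<epsilon>" "\<And>j. j < m \<Longrightarrow> dist (x j) (x (Suc j)) < \<epsilon>" "\<epsilon> > 0"
  shows "dist (x 0) (x m) \<le> 3 * \<epsilon> * real (card C)"
  using assms
proof (induction "card C" arbitrary: C x m)
  case 0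
  then show ?case using "0.prems"(2)[of 0] by auto
next
  case (Suc n)
  obtain c where c: "c \<in> C" "dist (x 0) c < \<epsilon>" using Suc.prems(2)[of 0] by auto
  define J where "J = {j. j \<le> m \<and> dist (x j) c < \<epsilon>}"
  have J: "finite J" "0 \<in> J" using c by (auto simp: J_def)
  define q where "q = Max J"
  have "q \<in> J" unfolding q_def using J by (intro Max_in) auto
  then have q: "q \<le> m" "dist (x q) c < \<epsilon>" by (auto simp: J_def)
  have xq: "dist (x 0) (x q) \<le> 2 * \<epsilon>"
    using dist_triangle2[of "x 0" "x q" c] c q by simp
  have card: "real (card C) = real n + 1" using Suc.hyps(2) by simp
  show ?case
  proof (cases "q = m")
    case True
    have "2 * \<epsilon> \<le> 3 * \<epsilon> * real (card C)"
      unfolding card using Suc.prems(4) by (simp add: algebra_simps)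
    then show ?thesis using xq True by simp
  next
    case False
    then have qm: "q < m" using q by simp
    have far: "\<not> dist (x j) c < \<epsilon>" if "q < j" "j \<le> m" for j
    proof
      assume "dist (x j) c < \<epsilon>"
      then have "j \<in> J" using that by (simp add: J_def)
      from Max_ge[OF J(1) this] show False using that by (simp add: q_def)
    qed
    have "dist (x (Suc q + 0)) (x (Suc q + (m - Suc q))) \<le> 3 * \<epsilon> * real (card (C - {c}))"
    proof (rule Suc.hyps(1)[of "C - {c}" "m - Suc q" "\<lambda>j. x (Suc q + j)"])
      show "n = card (C - {c})" using Suc.hyps(2) c Suc.prems(1) by simp
      show "finite (C - {c})" using Suc.prems(1) by simp
      show "\<exists>d\<in>C - {c}. dist (x (Suc q + j)) d < \<epsilon>" if "j \<le> m - Suc q" for j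
      proof -
        have j: "Suc q + j \<le> m" "q < Suc q + j" using that qm by auto
        obtain d where "d \<in> C" "dist (x (Suc q + j)) d < \<epsilon>" using Suc.prems(2)[OF j(1)] by blast
        then show ?thesis using far[OF j(2,1)] by blast
      qed
      show "dist (x (Suc q + j)) (x (Suc q + Suc j)) < \<epsilon>" if "j < m - Suc q" for j
        using Suc.prems(3)[of "Suc q + j"] that by simp
    qed (rule Suc.prems(4))
    moreover have "card (C - {c}) = n" using Suc.hyps(2) c Suc.prems(1) by simp
    ultimately have "dist (x (Suc q)) (x m) \<le> 3 * \<epsilon> * real n" using qm by simp
    moreover have "dist (x 0) (x m) \<le> dist (x 0) (x q) + (dist (x q) (x (Suc q)) + dist (x (Suc q)) (x m))"
      using dist_triangle[of "x 0" "x m" "x q"] dist_triangle[of "x q" "x m" "x (Suc q)"] by linarith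
    ultimately show ?thesis
      unfolding card using xq Suc.prems(3)[OF qm] by (simp add: algebra_simps)
  qed
qed

text \<open>The bottleneck distance of two unordered k-tuples is below \<epsilon>.\<close>

definition matched :: "nat \<Rightarrow> real \<Rightarrow> (nat \<Rightarrow> complex) \<Rightarrow> (nat \<Rightarrow> complex) \<Rightarrow> bool" where
  "matched k \<epsilon> p q \<longleftrightarrow> (\<exists>\<pi>. \<pi> permutes {..<k} \<and> (\<forall>i<k. dist (p i) (q (\<pi> i)) < \<epsilon>))"

lemma matched_sym:
  assumes "matched k \<epsilon> p q"
  shows "matched k \<epsilon> q p"
proof -
  obtain \<pi> where \<pi>: "\<pi> permutes {..<k}" "\<And>i. i < k \<Longrightarrow> dist (p i) (q (\<pi> i)) < \<epsilon>"
    using assms unfolding matched_def by blast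
  have "dist (q i) (p (inv \<pi> i)) < \<epsilon>" if "i < k" for i
  proof -
    have "inv \<pi> i < k" using permutes_in_image[OF permutes_inv[OF \<pi>(1)], of i] that by simp
    from \<pi>(2)[OF this] show ?thesis by (simp add: permutes_inverses[OF \<pi>(1)] dist_commute)
  qed
  then show ?thesis using permutes_inv[OF \<pi>(1)] unfolding matched_def by blast
qed

lemma matched_trans:
  assumes "matched k \<epsilon> p q" "matched k \<delta> q r"
  shows "matched k (\<epsilon> + \<delta>) p r"
proof -
  obtain \<pi> where \<pi>: "\<pi> permutes {..<k}" "\<And>i. i < k \<Longrightarrow> dist (p i) (q (\<pi> i)) < \<epsilon>"
    using assms unfolding matched_def by blast
  obtain \<rho> where \<rho>: "\<rho> permutes {..<k}" "\<And>i. i < k \<Longrightarrow> dist (q i) (r (\<rho> i)) < \<delta>"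
    using assms unfolding matched_def by blast
  have "dist (p i) (r ((\<rho> \<circ> \<pi>) i)) < \<epsilon> + \<delta>" if i: "i < k" for i
  proof -
    have "\<pi> i < k" using permutes_in_image[OF \<pi>(1), of i] i by simp
    then show ?thesis using dist_triangle[of "p i" "r (\<rho> (\<pi> i))" "q (\<pi> i)"] \<pi>(2)[OF i] \<rho>(2)[of "\<pi> i"] by simp
  qed
  then show ?thesis using permutes_compose[OF \<pi>(1) \<rho>(1)] unfolding matched_def by blast
qed

lemma matched_uniform:
  fixes F :: "real \<Rightarrow> nat \<Rightarrow> complex"
  assumes cont: "\<And>s \<epsilon>. s \<in> {a..b} \<Longrightarrow> \<epsilon> > 0 \<Longrightarrow> \<exists>\<delta>>0. \<forall>t\<in>{a..b}. dist t s < \<delta> \<longrightarrow> matched k \<epsilon> (F s) (F t)"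
    and e: "\<epsilon> > 0"
  shows "\<exists>\<delta>>0. \<forall>s\<in>{a..b}. \<forall>t\<in>{a..b}. dist s t < \<delta> \<longrightarrow> matched k \<epsilon> (F s) (F t)"
proof -
  obtain d where d: "\<And>s. s \<in> {a..b} \<Longrightarrow> d s > 0"
    "\<And>s t. s \<in> {a..b} \<Longrightarrow> t \<in> {a..b} \<Longrightarrow> dist t s < d s \<Longrightarrow> matched k (\<epsilon> / 2) (F s) (F t)"
    using cont[of _ "\<epsilon> / 2"] e by (metis half_gt_zero)
  have cover: "{a..b} \<subseteq> \<Union> ((\<lambda>s. ball s (d s)) ` {a..b})" using d(1) by (auto intro!: bexI)
  have op: "open G" if "G \<in> (\<lambda>s. ball s (d s)) ` {a..b}" for G using that by auto
  from Heine_Borel_lemma[OF compact_Icc cover op] obtain \<delta> where \<delta>: "\<delta> > 0" "\<And>x. x \<in> {a..b} \<Longrightarrow> \<exists>G\<in>(\<lambda>s. ball s (d s)) ` {a..b}. ball x \<delta> \<subseteq> G"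
    by blast
  have "matched k \<epsilon> (F s) (F t)" if st: "s \<in> {a..b}" "t \<in> {a..b}" "dist s t < \<delta>" for s t
  proof -
    obtain r where r: "r \<in> {a..b}" "ball s \<delta> \<subseteq> ball r (d r)" using \<delta>(2)[OF st(1)] by auto
    have "s \<in> ball s \<delta>" "t \<in> ball s \<delta>" using st(3) \<delta>(1) by auto
    then have "s \<in> ball r (d r)" "t \<in> ball r (d r)" using subsetD[OF r(2)] by blast+
    then have "matched k (\<epsilon> / 2) (F r) (F s)" "matched k (\<epsilon> / 2) (F r) (F t)"
      using d(2)[OF r(1) st(1)] d(2)[OF r(1) st(2)] by (simp_all add: dist_commute)
    from matched_trans[OF matched_sym[OF this(1)] this(2)] show ?thesis by simp
  qed
  then show ?thesis using \<delta>(1) by blast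
qed

text \<open>Matchings are composed along a fine grid. Errors would add up with the number of grid
  points, but the values between \<open>s\<close> and \<open>t\<close> stay near the at most
  \<open>k\<close> points of \<open>F s\<close>, so \<open>chain_displacement\<close> bounds the
  drift. The modulus is therefore the same for all \<open>N\<close>; the constant is 3 k for the
  chain and 1 for each end.\<close>

lemma approximate_selection:
  fixes F :: "real \<Rightarrow> nat \<Rightarrow> complex" and \<delta> :: "nat \<Rightarrow> real"
  assumes ab: "a \<le> b" and \<delta>: "\<And>n. \<delta> n > 0"
    and unif: "\<And>n s t. s \<in> {a..b} \<Longrightarrow> t \<in> {a..b} \<Longrightarrow> dist s t < \<delta> n \<Longrightarrow> matched k (1 / real (Suc n)) (F s) (F t)"
  shows "\<exists>p. (\<forall>t. p t permutes {..<k}) \<and> (\<forall>n\<le>N. \<forall>s\<in>{a..b}. \<forall>t\<in>{a..b}. dist s t < \<delta> n \<longrightarrow>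
     (\<forall>i<k. dist (F s (p s i)) (F t (p t i)) \<le> (3 * real k + 2) * (1 / real (Suc n))))"
proof -
  define \<eta> where "\<eta> = Min (\<delta> ` {..N})"
  have \<eta>: "\<eta> > 0" "\<And>n. n \<le> N \<Longrightarrow> \<eta> \<le> \<delta> n" using \<delta> by (auto simp: \<eta>_def Min_gr_iff)
  \<comment> \<open>A mesh below every \<delta> n with n \<le> N: neighbouring grid points are
    matched at the finest level, and the grid points between \<open>s\<close> and \<open>t\<close>
    remain within \<delta> n of \<open>s\<close>.\<close>
  define h where "h = \<eta> / 2"
  have h: "h > 0" "h < \<eta>" using \<eta> by (auto simp: h_def)
  define g where "g j = a + real j * h" for j
  define ix where "ix t = nat \<lfloor>(t - a) / h\<rfloor>" for t
  have ix: "g (ix t) \<le> t" "t < g (ix t) + h" "g (ix t) \<in> {a..b}" if t: "t \<in> {a..b}" for t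
  proof -
    have "0 \<le> (t - a) / h" using t h by auto
    then have "real (ix t) = of_int \<lfloor>(t - a) / h\<rfloor>" by (simp add: ix_def)
    moreover have "of_int \<lfloor>(t - a) / h\<rfloor> \<le> (t - a) / h" "(t - a) / h < of_int \<lfloor>(t - a) / h\<rfloor> + 1" by linarith+
    ultimately have 1: "real (ix t) \<le> (t - a) / h" "(t - a) / h < real (ix t) + 1" by auto
    then have 2: "real (ix t) * h \<le> t - a" "t - a < (real (ix t) + 1) * h"
      using h by (simp_all only: pos_le_divide_eq pos_divide_less_eq)
    show "g (ix t) \<le> t" using 2(1) by (simp add: g_def)
    show "t < g (ix t) + h" using 2(2) by (simp add: g_def algebra_simps)
    show "g (ix t) \<in> {a..b}" using 2(1) t h by (simp add: g_def)
  qed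
  have ix_mono: "ix s \<le> ix t" if "s \<le> t" for s t
    unfolding ix_def using that h by (intro nat_mono floor_mono divide_right_mono) auto
  have gmono: "g i \<le> g j" if "i \<le> j" for i j using that h by (simp add: g_def)
  have near: "matched k (1 / real (Suc N)) (F s) (F t)" if "s \<in> {a..b}" "t \<in> {a..b}" "dist s t \<le> h" for s t
    using unif[OF that(1,2), of N] that(3) h \<eta>(2)[of N] by simp
  have "\<exists>\<pi>. \<forall>s t. \<pi> s t permutes {..<k} \<and> (s \<in> {a..b} \<longrightarrow> t \<in> {a..b} \<longrightarrow> dist s t \<le> h \<longrightarrow>
      (\<forall>i<k. dist (F s i) (F t (\<pi> s t i)) < 1 / real (Suc N)))"
  proof (intro choice allI)
    fix s t
    show "\<exists>\<pi>. \<pi> permutes {..<k} \<and> (s \<in> {a..b} \<longrightarrow> t \<in> {a..b} \<longrightarrow> dist s t \<le> h \<longrightarrow>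
      (\<forall>i<k. dist (F s i) (F t (\<pi> i)) < 1 / real (Suc N)))"
    proof (cases "s \<in> {a..b} \<and> t \<in> {a..b} \<and> dist s t \<le> h")
      case True
      then show ?thesis using near[of s t] unfolding matched_def by blast
    next
      case False
      then show ?thesis using permutes_id by (intro exI[of _ id]) blast
    qed
  qed
  then obtain \<pi> where \<pi>: "\<And>s t. \<pi> s t permutes {..<k}"
    "\<And>s t i. s \<in> {a..b} \<Longrightarrow> t \<in> {a..b} \<Longrightarrow> dist s t \<le> h \<Longrightarrow> i < k \<Longrightarrow> dist (F s i) (F t (\<pi> s t i)) < 1 / real (Suc N)"
    by blast
  define gp where "gp = rec_nat id (\<lambda>j p. \<pi> (g j) (g (Suc j)) \<circ> p)"
  have gp0: "gp 0 = id" and gpSuc: "gp (Suc j) = \<pi> (g j) (g (Suc j)) \<circ> gp j" for j by (simp_all add: gp_def)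
  have gp: "gp j permutes {..<k}" for j
  proof (induction j)
    case 0
    show ?case unfolding gp0 by (rule permutes_id)
  next
    case (Suc j)
    show ?case unfolding gpSuc by (rule permutes_compose[OF Suc \<pi>(1)])
  qed
  have gpS: "gp (Suc j) i = \<pi> (g j) (g (Suc j)) (gp j i)" for i j by (simp add: gpSuc)
  define p where "p t = \<pi> (g (ix t)) t \<circ> gp (ix t)" for t
  have pp: "p t permutes {..<k}" for t unfolding p_def by (intro permutes_compose gp \<pi>)
  have gpk: "gp j i < k" if "i < k" for i j using permutes_in_image[OF gp[of j], of i] that by simp
  have edge: "dist (F (g (ix t)) (gp (ix t) i)) (F t (p t i)) < 1 / real (Suc N)" if "t \<in> {a..b}" "i < k" for t i
    unfolding p_def o_def using ix[OF that(1)] that gpk by (intro \<pi>(2)) (auto simp: dist_real_def)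
  have main: "dist (F s (p s i)) (F t (p t i)) \<le> (3 * real k + 2) * (1 / real (Suc n))"
    if n: "n \<le> N" and st: "s \<in> {a..b}" "t \<in> {a..b}" "dist s t < \<delta> n" "s \<le> t" and i: "i < k" for n s t i
  proof -
    define \<epsilon> where "\<epsilon> = 1 / real (Suc n)"
    have e: "\<epsilon> > 0" "1 / real (Suc N) \<le> \<epsilon>" using n by (auto simp: \<epsilon>_def frac_le)
    define m where "m = ix t - ix s"
    have m: "ix s + m = ix t" using ix_mono[OF st(4)] by (simp add: m_def)
    define x where "x j = F (g (ix s + j)) (gp (ix s + j) i)" for j
    have gin: "g (ix s + j) \<in> {a..b}" "dist (g (ix s + j)) s < \<delta> n" if j: "j \<le> m" for j
    proof -
      have lo: "g (ix s) \<le> g (ix s + j)" and hi: "g (ix s + j) \<le> g (ix t)"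
        using gmono j m by auto
      show "g (ix s + j) \<in> {a..b}" using lo hi ix(3)[OF st(1)] ix(3)[OF st(2)] by auto
      have "g (ix s + j) \<le> t" "s - h < g (ix s + j)" using lo hi ix(1)[OF st(2)] ix(2)[OF st(1)] by linarith+
      then show "dist (g (ix s + j)) s < \<delta> n"
        using h \<eta>(2)[OF n] st(3,4) by (simp add: dist_real_def)
    qed
    have "dist (x 0) (x m) \<le> 3 * \<epsilon> * real (card (F s ` {..<k}))"
    proof (rule chain_displacement[OF _ _ _ e(1)])
      fix j assume j: "j \<le> m"
      have "matched k \<epsilon> (F (g (ix s + j))) (F s)"
        unfolding \<epsilon>_def by (rule unif[OF gin(1)[OF j] st(1) gin(2)[OF j]])
      then obtain \<sigma> where \<sigma>: "\<sigma> permutes {..<k}" "\<And>i. i < k \<Longrightarrow> dist (F (g (ix s + j)) i) (F s (\<sigma> i)) < \<epsilon>"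
        unfolding matched_def by blast
      have "\<sigma> (gp (ix s + j) i) < k" using permutes_in_image[OF \<sigma>(1)] gpk[OF i] by simp
      then show "\<exists>c\<in>F s ` {..<k}. dist (x j) c < \<epsilon>"
        using \<sigma>(2)[OF gpk[OF i]] by (intro bexI[of _ "F s (\<sigma> (gp (ix s + j) i))"]) (auto simp: x_def)
    next
      fix j assume j: "j < m"
      have "dist (g (ix s + j)) (g (ix s + Suc j)) \<le> h" using h by (simp add: g_def dist_real_def algebra_simps)
      from \<pi>(2)[OF gin(1) gin(1) this gpk[OF i, of "ix s + j"]] j
      have "dist (x j) (x (Suc j)) < 1 / real (Suc N)" by (simp add: x_def gpS)
      then show "dist (x j) (x (Suc j)) < \<epsilon>" using e(2) by (rule less_le_trans)
    qed simp
    also have "\<dots> \<le> 3 * \<epsilon> * real k"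
      using e card_image_le[of "{..<k}" "F s"] by (intro mult_left_mono) auto
    finally have 1: "dist (x 0) (x m) \<le> 3 * \<epsilon> * real k" .
    have 2: "dist (F s (p s i)) (x 0) \<le> \<epsilon>" using edge[OF st(1) i] e(2) by (simp add: x_def dist_commute)
    have 3: "dist (x m) (F t (p t i)) \<le> \<epsilon>" using edge[OF st(2) i] e(2) by (simp add: x_def m)
    have "dist (F s (p s i)) (F t (p t i)) \<le> dist (F s (p s i)) (x 0) + (dist (x 0) (x m) + dist (x m) (F t (p t i)))"
      using dist_triangle[of "F s (p s i)" "F t (p t i)" "x 0"] dist_triangle[of "x 0" "F t (p t i)" "x m"] by linarith
    then show ?thesis using 1 2 3 unfolding \<epsilon>_def[symmetric] by (simp add: algebra_simps)
  qed
  have "dist (F s (p s i)) (F t (p t i)) \<le> (3 * real k + 2) * (1 / real (Suc n))"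
    if "n \<le> N" "s \<in> {a..b}" "t \<in> {a..b}" "dist s t < \<delta> n" "i < k" for n s t i
  proof (cases "s \<le> t")
    case True
    then show ?thesis using main that by blast
  next
    case False
    then show ?thesis using main[of n t s i] that by (simp add: dist_commute)
  qed
  then show ?thesis using pp by blast
qed

text \<open>The selections for growing \<open>N\<close> are functions into the finite set of
  permutations, so they have a cluster point in the product topology. Each bound involves only two
  coordinates and holds for all large \<open>N\<close>; hence the cluster point inherits all of
  them.\<close>

theorem continuous_selection:
  fixes F :: "real \<Rightarrow> nat \<Rightarrow> complex"
  assumes ab: "a \<le> b"
    and cont: "\<And>s \<epsilon>. s \<in> {a..b} \<Longrightarrow> \<epsilon> > 0 \<Longrightarrow> \<exists>\<delta>>0. \<forall>t\<in>{a..b}. dist t s < \<delta> \<longrightarrow> matched k \<epsilon> (F s) (F t)"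
  obtains p where "\<And>t. p t permutes {..<k}" "\<And>i. i < k \<Longrightarrow> continuous_on {a..b} (\<lambda>t. F t (p t i))"
proof -
  have "\<exists>\<delta>. \<forall>n. \<delta> n > 0 \<and> (\<forall>s\<in>{a..b}. \<forall>t\<in>{a..b}. dist s t < \<delta> n \<longrightarrow> matched k (1 / real (Suc n)) (F s) (F t))"
  proof (intro choice allI)
    fix n
    have "1 / real (Suc n) > 0" by simp
    from matched_uniform[OF cont this]
    show "\<exists>\<delta>>0. \<forall>s\<in>{a..b}. \<forall>t\<in>{a..b}. dist s t < \<delta> \<longrightarrow> matched k (1 / real (Suc n)) (F s) (F t)" by simp
  qed
  then obtain \<delta> :: "nat \<Rightarrow> real" where \<delta>: "\<And>n. \<delta> n > 0"
    "\<And>n s t. s \<in> {a..b} \<Longrightarrow> t \<in> {a..b} \<Longrightarrow> dist s t < \<delta> n \<Longrightarrow> matched k (1 / real (Suc n)) (F s) (F t)" by blast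
  have "\<exists>q. \<forall>N. (\<forall>t. q N t permutes {..<k}) \<and> (\<forall>n\<le>N. \<forall>s\<in>{a..b}. \<forall>t\<in>{a..b}. dist s t < \<delta> n \<longrightarrow>
     (\<forall>i<k. dist (F s (q N s i)) (F t (q N t i)) \<le> (3 * real k + 2) * (1 / real (Suc n))))"
    by (intro choice allI) (rule approximate_selection[OF ab \<delta>])
  then obtain q where Q: "\<forall>N. (\<forall>t. q N t permutes {..<k}) \<and> (\<forall>n\<le>N. \<forall>s\<in>{a..b}. \<forall>t\<in>{a..b}. dist s t < \<delta> n \<longrightarrow>
     (\<forall>i<k. dist (F s (q N s i)) (F t (q N t i)) \<le> (3 * real k + 2) * (1 / real (Suc n))))"
    by (rule exE)
  have q1: "q N t permutes {..<k}" for N t using Q by (rule allE[of _ N]) (erule conjE, erule spec)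
  have q2: "dist (F s (q N s i)) (F t (q N t i)) \<le> (3 * real k + 2) * (1 / real (Suc n))"
    if "n \<le> N" "s \<in> {a..b}" "t \<in> {a..b}" "dist s t < \<delta> n" "i < k" for N n s t i
    using spec[OF Q, of N] that by simp
  define Perms where "Perms = {\<pi>. \<pi> permutes {..<k}}"
  define X where "X = product_topology (\<lambda>_::real. discrete_topology Perms) UNIV"
  have "finite Perms" unfolding Perms_def by (rule finite_permutations) simp
  then have comp: "compact_space X" unfolding X_def
    by (intro compact_space_product_topology[THEN iffD2] disjI2) (simp add: compact_space_discrete_topology)
  have qX: "q N \<in> topspace X" for N using q1 by (auto simp: X_def Perms_def)
  define C where "C N = X closure_of (q ` {N..})" for N
  have "(\<Inter>N. C N) \<noteq> {}"
  proof (rule compact_space_imp_nest[OF comp])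
    show "closedin X (C N)" for N by (simp add: C_def)
    show "C N \<noteq> {}" for N
    proof -
      have "q N \<in> C N" unfolding C_def
        by (rule subsetD[OF closure_of_subset]) (use qX in auto)
      then show ?thesis by blast
    qed
    show "decseq C" unfolding decseq_def C_def by (intro allI impI closure_of_mono image_mono) auto
  qed
  then obtain p where p: "\<And>N. p \<in> C N" by blast
  have pt: "p t permutes {..<k}" for t
  proof -
    have "p \<in> topspace X" using p[of 0] by (auto simp: C_def in_closure_of)
    then show ?thesis by (auto simp: X_def Perms_def)
  qed
  have approx: "\<exists>M\<ge>N. q M s = p s \<and> q M t = p t" for N s t
  proof -
    have op: "openin X {r \<in> topspace X. r u \<in> {p u}}" for u
      unfolding X_def
      by (rule openin_continuous_map_preimage[OF continuous_map_product_projection]) (use pt in \<open>auto simp: Perms_def\<close>)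
    define T where "T = {r \<in> topspace X. r s \<in> {p s}} \<inter> {r \<in> topspace X. r t \<in> {p t}}"
    have T: "openin X T" unfolding T_def by (intro openin_Int op)
    have pT: "p \<in> T" unfolding T_def using p[of 0] by (auto simp: C_def in_closure_of)
    have "\<exists>y. y \<in> q ` {N..} \<and> y \<in> T"
      using p[of N] T pT unfolding C_def in_closure_of by simp
    then obtain M where "M \<ge> N" "q M \<in> T" by auto
    then show ?thesis by (auto simp: T_def)
  qed
  have bound: "dist (F s (p s i)) (F t (p t i)) \<le> (3 * real k + 2) * (1 / real (Suc n))"
    if "s \<in> {a..b}" "t \<in> {a..b}" "dist s t < \<delta> n" "i < k" for s t i n
  proof -
    obtain M where "M \<ge> n" "q M s = p s" "q M t = p t" using approx by blast
    then show ?thesis using q2[of n M s t i] that by simp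
  qed
  have "continuous_on {a..b} (\<lambda>t. F t (p t i))" if i: "i < k" for i
    unfolding continuous_on_iff
  proof (intro ballI allI impI)
    fix s and e :: real assume s: "s \<in> {a..b}" and e: "e > 0"
    obtain n :: nat where n: "(3 * real k + 2) / e < real n" using reals_Archimedean2 by blast
    then have "3 * real k + 2 < e * real (Suc n)" using e by (simp add: divide_less_eq algebra_simps)
    then have "(3 * real k + 2) * (1 / real (Suc n)) < e" by (simp add: divide_less_eq)
    then have "dist (F t (p t i)) (F s (p s i)) < e" if "t \<in> {a..b}" "dist t s < \<delta> n" for t
      using bound[OF that(1) s that(2) i] by linarith
    then show "\<exists>d>0. \<forall>t\<in>{a..b}. dist t s < d \<longrightarrow> dist (F t (p t i)) (F s (p s i)) < e"
      using \<delta>(1) by blast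
  qed
  then show ?thesis using that pt by blast
qed

definition eigenframe :: "nat \<Rightarrow> (nat \<Rightarrow> 'h) \<Rightarrow> (nat \<Rightarrow> complex) \<Rightarrow> ('h \<Rightarrow>\<^sub>L 'h) \<Rightarrow> 'h::complex_hilbert_space set \<Rightarrow> bool" where
  "eigenframe k f l R W \<longleftrightarrow> (\<forall>i<k. \<forall>j<k. cinner (f i) (f j) = (if i = j then 1 else 0)) \<and>
     W = range (\<lambda>u. \<Sum>i<k. u i *\<^sub>C f i) \<and> (\<forall>i<k. R (f i) = l i *\<^sub>C f i)"

lemma frame_coeff:
  assumes "\<And>i j. i < k \<Longrightarrow> j < k \<Longrightarrow> cinner (f i) (f j) = (if i = j then 1 else 0)" "j < (k::nat)"
  shows "cinner (\<Sum>i<k. u i *\<^sub>C f i) (f j) = u j"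
proof -
  have "cinner (\<Sum>i<k. u i *\<^sub>C f i) (f j) = (\<Sum>i<k. if i = j then u i else 0)"
    unfolding cinner_simps using assms by (intro sum.cong) auto
  then show ?thesis using assms(2) by simp
qed

lemma frame_norm:
  assumes "\<And>i j. i < k \<Longrightarrow> j < k \<Longrightarrow> cinner (f i) (f j) = (if i = j then 1 else (0::complex))"
  shows "(norm (\<Sum>i<k. u i *\<^sub>C f i))\<^sup>2 = (\<Sum>i<(k::nat). (cmod (u i))\<^sup>2)"
proof -
  let ?x = "\<Sum>i<k. u i *\<^sub>C f i"
  have "cinner ?x ?x = (\<Sum>j<k. cnj (u j) * cinner ?x (f j))"
    by (simp only: cinner_sum_right cinner_scaleC_right)
  also have "\<dots> = (\<Sum>j<k. cnj (u j) * u j)" using frame_coeff[OF assms] by (intro sum.cong) auto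
  also have "\<dots> = (\<Sum>j<k. complex_of_real ((cmod (u j))\<^sup>2))"
    using complex_norm_square by (intro sum.cong) (simp_all add: mult.commute)
  also have "\<dots> = complex_of_real (\<Sum>j<k. (cmod (u j))\<^sup>2)" by simp
  finally show ?thesis by (metis cinner_self of_real_eq_iff)
qed

lemma separating_radius:
  fixes A :: "'a::metric_space set"
  assumes "finite A" "\<epsilon> > 0"
  obtains r where "r > 0" "r \<le> \<epsilon>" "\<And>c d. c \<in> A \<Longrightarrow> d \<in> A \<Longrightarrow> c \<noteq> d \<Longrightarrow> 2 * r \<le> dist c d"
proof -
  define D where "D = (\<lambda>(c, d). dist c d / 2) ` {(c, d). c \<in> A \<and> d \<in> A \<and> c \<noteq> d}"
  have "finite {(c, d). c \<in> A \<and> d \<in> A \<and> c \<noteq> d}"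
    by (rule finite_subset[of _ "A \<times> A"]) (use assms in auto)
  then have fin: "finite (insert \<epsilon> D)" by (simp add: D_def)
  show ?thesis
  proof (rule that[of "Min (insert \<epsilon> D)"])
    show "Min (insert \<epsilon> D) > 0" using fin assms(2) by (subst Min_gr_iff) (auto simp: D_def)
    show "Min (insert \<epsilon> D) \<le> \<epsilon>" using fin by (rule Min_le) simp
    fix c d assume "c \<in> A" "d \<in> A" "c \<noteq> d"
    then have "dist c d / 2 \<in> insert \<epsilon> D" unfolding D_def by (intro insertI2 image_eqI[of _ _ "(c, d)"]) auto
    from Min_le[OF fin this] show "2 * Min (insert \<epsilon> D) \<le> dist c d" by simp
  qed
qed

text \<open>The r-balls around the distinct values of \<open>p\<close> are disjoint. The counts give
  an injection within each ball, and together these form an injection of a finite index set into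
  itself.\<close>

lemma matched_of_counts:
  assumes r: "r > 0" "\<And>c d. c \<in> p ` {..<k} \<Longrightarrow> d \<in> p ` {..<k} \<Longrightarrow> c \<noteq> d \<Longrightarrow> 2 * r \<le> dist c d"
    and count: "\<And>c. c \<in> p ` {..<k} \<Longrightarrow> card {i. i < k \<and> p i = c} \<le> card {j. j < k \<and> dist c (q j) < r}"
  shows "matched k r p q"
proof -
  have "\<forall>c\<in>p ` {..<k}. \<exists>f. f ` {i. i < k \<and> p i = c} \<subseteq> {j. j < k \<and> dist c (q j) < r} \<and> inj_on f {i. i < k \<and> p i = c}"
    by (intro ballI card_le_inj count) auto
  from bchoice[OF this] obtain f where
    F: "\<forall>c\<in>p ` {..<k}. f c ` {i. i < k \<and> p i = c} \<subseteq> {j. j < k \<and> dist c (q j) < r} \<and> inj_on (f c) {i. i < k \<and> p i = c}"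
    by (rule exE)
  have f: "f c ` {i. i < k \<and> p i = c} \<subseteq> {j. j < k \<and> dist c (q j) < r}" "inj_on (f c) {i. i < k \<and> p i = c}"
    if "c \<in> p ` {..<k}" for c using bspec[OF F that] by (rule conjunct1, rule conjunct2)
  define \<pi> where "\<pi> i = (if i < k then f (p i) i else i)" for i
  have \<pi>: "\<pi> i < k \<and> dist (p i) (q (\<pi> i)) < r" if "i < k" for i
  proof -
    have "f (p i) i \<in> f (p i) ` {j. j < k \<and> p j = p i}" using that by (intro imageI) simp
    moreover have "p i \<in> p ` {..<k}" using that by simp
    ultimately have "f (p i) i \<in> {j. j < k \<and> dist (p i) (q j) < r}" using f(1) by blast
    then show ?thesis using that by (simp add: \<pi>_def)
  qed
  have inj: "inj_on \<pi> {..<k}"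
  proof (rule inj_onI)
    fix i j assume ij: "i \<in> {..<k}" "j \<in> {..<k}" "\<pi> i = \<pi> j"
    have "p i = p j"
    proof (rule ccontr)
      assume "p i \<noteq> p j"
      then have "2 * r \<le> dist (p i) (p j)" using ij by (intro r) auto
      moreover have "dist (p i) (p j) < r + r"
        using dist_triangle2[of "p i" "p j" "q (\<pi> i)"] \<pi>[of i] \<pi>[of j] ij by simp
      ultimately show False by simp
    qed
    moreover from this have "f (p i) i = f (p i) j" using ij by (simp add: \<pi>_def)
    ultimately show "i = j" using f(2)[of "p i"] ij unfolding inj_on_def by auto
  qed
  have "\<pi> ` {..<k} = {..<k}"
    by (rule endo_inj_surj[OF _ _ inj]) (use \<pi> in auto)
  then have "bij_betw \<pi> {..<k} {..<k}" using inj by (simp add: bij_betw_def)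
  then have "\<pi> permutes {..<k}" by (rule bij_imp_permutes) (simp add: \<pi>_def)
  then show ?thesis unfolding matched_def using \<pi> by blast
qed

text \<open>If too few eigenvalues at \<open>t\<close> lie near an eigenvalue \<open>c\<close> at
  \<open>s\<close>, then some eigenvector \<open>x\<close> for \<open>c\<close> has P t x orthogonal
  to all nearby eigenvectors. Then (R t - c) P t x has norm at least r |P t x|, whereas continuity
  makes it small.\<close>

lemma eigenvalues_matched:
  fixes R P :: "real \<Rightarrow> 'h::complex_hilbert_space \<Rightarrow>\<^sub>L 'h"
  assumes contR: "continuous_on S R" and contP: "continuous_on S P"
    and lin: "\<And>t. t \<in> S \<Longrightarrow> complex_linear (R t) \<and> complex_linear (P t)"
    and proj: "\<And>t x. t \<in> S \<Longrightarrow> P t (P t x) = P t x"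
    and frame: "\<And>t. t \<in> S \<Longrightarrow> eigenframe k (f t) (F t) (R t) (range (P t))"
    and s: "s \<in> S" and e: "\<epsilon> > 0"
  shows "\<exists>\<delta>>0. \<forall>t\<in>S. dist t s < \<delta> \<longrightarrow> matched k \<epsilon> (F s) (F t)"
proof -
  obtain r where r: "r > 0" "r \<le> \<epsilon>"
    "\<And>c d. c \<in> F s ` {..<k} \<Longrightarrow> d \<in> F s ` {..<k} \<Longrightarrow> c \<noteq> d \<Longrightarrow> 2 * r \<le> dist c d"
    using separating_radius[of "F s ` {..<k}" \<epsilon>] e by auto
  define Cm where "Cm = (\<Sum>i<k. cmod (F s i)) + 1"
  have Cm: "Cm > 0" "\<And>i. i < k \<Longrightarrow> cmod (F s i) \<le> Cm"
  proof -
    show "Cm > 0" by (simp add: Cm_def add_nonneg_pos sum_nonneg)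
    show "cmod (F s i) \<le> Cm" if "i < k" for i
      using member_le_sum[of i "{..<k}" "\<lambda>i. cmod (F s i)"] that by (simp add: Cm_def)
  qed
  \<comment> \<open>The bound 1/2 gives |P t x| \<ge> |x| / 2, and Cm \<eta> \<le> r/4 makes the
    change of c P at most r/4. With another r/4 for the change of R P, the total stays below the
    required r/2.\<close>
  define \<eta> where "\<eta> = min (1 / 2) (r / (4 * Cm))"
  have \<eta>: "\<eta> > 0" "\<eta> \<le> 1 / 2" "Cm * \<eta> \<le> r / 4"
  proof -
    show "\<eta> > 0" "\<eta> \<le> 1 / 2" using r Cm by (auto simp: \<eta>_def)
    have "Cm * \<eta> \<le> Cm * (r / (4 * Cm))" using Cm by (intro mult_left_mono) (auto simp: \<eta>_def)
    then show "Cm * \<eta> \<le> r / 4" using Cm by simp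
  qed
  have contRP: "continuous_on S (\<lambda>t. R t o\<^sub>L P t)"
    by (rule bounded_bilinear.continuous_on[OF bounded_bilinear_blinfun_compose contR contP])
  obtain d1 where d1: "d1 > 0" "\<And>t. t \<in> S \<Longrightarrow> dist t s < d1 \<Longrightarrow> dist (P t) (P s) < \<eta>"
    using contP s \<eta>(1) unfolding continuous_on_iff by blast
  have "r / 4 > 0" using r by simp
  then obtain d2 where d2: "d2 > 0" "\<And>t. t \<in> S \<Longrightarrow> dist t s < d2 \<Longrightarrow> dist (R t o\<^sub>L P t) (R s o\<^sub>L P s) < r / 4"
    using contRP s unfolding continuous_on_iff by blast
  have "matched k \<epsilon> (F s) (F t)" if t: "t \<in> S" "dist t s < min d1 d2" for t
  proof -
    have dP: "norm (P t - P s) < \<eta>" and dRP: "norm ((R t o\<^sub>L P t) - (R s o\<^sub>L P s)) < r / 4"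
      using d1(2)[OF t(1)] d2(2)[OF t(1)] t(2) by (simp_all add: dist_norm)
    have fs: "\<And>i j. i < k \<Longrightarrow> j < k \<Longrightarrow> cinner (f s i) (f s j) = (if i = j then 1 else 0)"
      "range (P s) = range (\<lambda>u. \<Sum>i<k. u i *\<^sub>C f s i)" "\<And>i. i < k \<Longrightarrow> R s (f s i) = F s i *\<^sub>C f s i"
      using frame[OF s] by (auto simp: eigenframe_def)
    have ft: "\<And>i j. i < k \<Longrightarrow> j < k \<Longrightarrow> cinner (f t i) (f t j) = (if i = j then 1 else 0)"
      "range (P t) = range (\<lambda>u. \<Sum>i<k. u i *\<^sub>C f t i)" "\<And>i. i < k \<Longrightarrow> R t (f t i) = F t i *\<^sub>C f t i"
      using frame[OF t(1)] by (auto simp: eigenframe_def)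
    have linR: "complex_linear (R t)" "complex_linear (R s)" and linP: "complex_linear (P t)"
      using lin t(1) s by auto
    have "card {i. i < k \<and> F s i = c} \<le> card {j. j < k \<and> dist c (F t j) < r}" if c: "c \<in> F s ` {..<k}" for c
    proof (rule ccontr)
      define D where "D = {i. i < k \<and> F s i = c}"
      define Nr where "Nr = {j. j < k \<and> dist c (F t j) < r}"
      assume "\<not> ?thesis"
      then have less: "card Nr < card D" by (simp add: D_def Nr_def)
      have fin: "finite D" "finite Nr" by (auto simp: D_def Nr_def)
      \<comment> \<open>Components of P t (f s i) along the eigenvectors with nearby eigenvalue.
        There are more vectors than dimensions, so a combination of them vanishes; its coefficients
        define \<open>x\<close>.\<close>
      define g where "g i = (\<Sum>j\<in>Nr. cinner (P t (f s i)) (f t j) *\<^sub>C f t j)" for i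
      have "card (f t ` Nr) < card D" using card_image_le[OF fin(2), of "f t"] less by linarith
      moreover have "g i \<in> complex_vector.span (f t ` Nr)" for i
        unfolding g_def by (intro complex_vector.span_sum complex_vector.span_scale complex_vector.span_base) auto
      ultimately obtain a where a: "\<exists>i\<in>D. a i \<noteq> 0" "(\<Sum>i\<in>D. a i *\<^sub>C g i) = 0"
        using dependent_family[of D "f t ` Nr" g] fin by blast
      define a' where "a' i = (if i \<in> D then a i else 0)" for i
      define x where "x = (\<Sum>i<k. a' i *\<^sub>C f s i)"
      have x_D: "x = (\<Sum>i\<in>D. a i *\<^sub>C f s i)"
      proof -
        have "(\<Sum>i\<in>D. a i *\<^sub>C f s i) = (\<Sum>i\<in>D. a' i *\<^sub>C f s i)" by (intro sum.cong) (auto simp: a'_def)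
        also have "\<dots> = x" unfolding x_def by (intro sum.mono_neutral_left) (auto simp: a'_def D_def)
        finally show ?thesis by simp
      qed
      have "x \<noteq> 0"
      proof
        assume x0: "x = 0"
        obtain i where i: "i \<in> D" "a i \<noteq> 0" using a(1) by blast
        then have ik: "i < k" by (simp add: D_def)
        have "a' i = 0" using frame_coeff[where u = a', OF fs(1) ik] x0 by (simp add: x_def)
        then show False using i by (simp add: a'_def)
      qed
      have "x \<in> range (P s)" unfolding fs(2) x_def by blast
      then have Psx: "P s x = x" using proj[OF s] by auto
      have Rsx: "R s x = c *\<^sub>C x"
        unfolding x_D complex_linear_simps(2)[OF linR(2)] scaleC.sum_right
        by (intro sum.cong) (auto simp: complex_linear_simps(1)[OF linR(2)] fs(3) D_def scaleC_scaleC mult.commute)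
      define u where "u j = cinner (P t x) (f t j)" for j
      have Ptx: "P t x = (\<Sum>j<k. u j *\<^sub>C f t j)"
      proof -
        have "P t x \<in> range (P t)" by blast
        then obtain v where v: "P t x = (\<Sum>j<k. v j *\<^sub>C f t j)" unfolding ft(2) by blast
        have "u j = v j" if "j < k" for j unfolding u_def v by (rule frame_coeff[OF ft(1) that])
        then show ?thesis unfolding v by (intro sum.cong) auto
      qed
      have u0: "u j = 0" if j: "j \<in> Nr" for j
      proof -
        have "(\<Sum>i\<in>D. a i *\<^sub>C g i) = (\<Sum>j\<in>Nr. \<Sum>i\<in>D. (a i * cinner (P t (f s i)) (f t j)) *\<^sub>C f t j)"
          unfolding g_def scaleC.sum_right scaleC_scaleC by (rule sum.swap)
        also have "\<dots> = (\<Sum>j\<in>Nr. u j *\<^sub>C f t j)"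
          by (intro sum.cong refl)
            (simp add: u_def x_D complex_linear_simps[OF linP] cinner_simps scaleC.sum_left)
        also have "\<dots> = (\<Sum>j<k. (if j \<in> Nr then u j else 0) *\<^sub>C f t j)"
          by (intro sum.mono_neutral_cong_left) (auto simp: Nr_def)
        finally have z: "(\<Sum>j<k. (if j \<in> Nr then u j else 0) *\<^sub>C f t j) = 0" using a(2) by simp
        have jk: "j < k" using j by (simp add: Nr_def)
        show ?thesis
          using frame_coeff[where u = "\<lambda>j. if j \<in> Nr then u j else 0", OF ft(1) jk] z j by simp
      qed
      have far: "(r * norm (P t x))\<^sup>2 \<le> (norm (R t (P t x) - c *\<^sub>C P t x))\<^sup>2"
      proof -
        have "R t (P t x) - c *\<^sub>C P t x = (\<Sum>j<k. (u j * (F t j - c)) *\<^sub>C f t j)"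
          unfolding Ptx complex_linear_simps(2)[OF linR(1)] scaleC.sum_right sum_subtractf[symmetric]
          by (intro sum.cong refl)
            (simp add: complex_linear_simps(1)[OF linR(1)] ft(3) scaleC_scaleC right_diff_distrib scaleC.diff_left mult.commute)
        then have "(norm (R t (P t x) - c *\<^sub>C P t x))\<^sup>2 = (\<Sum>j<k. (cmod (u j * (F t j - c)))\<^sup>2)"
          using frame_norm[OF ft(1)] by simp
        moreover have "(\<Sum>j<k. r\<^sup>2 * (cmod (u j))\<^sup>2) \<le> (\<Sum>j<k. (cmod (u j * (F t j - c)))\<^sup>2)"
        proof (intro sum_mono)
          fix j assume "j \<in> {..<k}"
          show "r\<^sup>2 * (cmod (u j))\<^sup>2 \<le> (cmod (u j * (F t j - c)))\<^sup>2"
          proof (cases "j \<in> Nr")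
            case False
            then have "r \<le> cmod (F t j - c)"
              using \<open>j \<in> {..<k}\<close> by (simp add: Nr_def dist_norm norm_minus_commute)
            then have "r\<^sup>2 \<le> (cmod (F t j - c))\<^sup>2" using r(1) by (intro power_mono) auto
            from mult_left_mono[OF this, of "(cmod (u j))\<^sup>2"]
            show ?thesis by (simp add: norm_mult power_mult_distrib mult.commute)
          qed (simp add: u0)
        qed
        moreover have "(r * norm (P t x))\<^sup>2 = (\<Sum>j<k. r\<^sup>2 * (cmod (u j))\<^sup>2)"
          using frame_norm[where u = u, OF ft(1)] unfolding Ptx by (simp add: power_mult_distrib sum_distrib_left)
        ultimately show ?thesis by simp
      qed
      have "norm (R t (P t x) - c *\<^sub>C P t x) < r / 2 * norm x"
      proof -
        have "R t (P t x) - c *\<^sub>C P t x = ((R t o\<^sub>L P t) - (R s o\<^sub>L P s)) x - c *\<^sub>C ((P t - P s) x)"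
          by (simp add: blinfun.diff_left Psx Rsx scaleC.diff_right)
        also have "norm \<dots> \<le> norm ((R t o\<^sub>L P t) - (R s o\<^sub>L P s)) * norm x + cmod c * (norm (P t - P s) * norm x)"
          by (intro order_trans[OF norm_triangle_ineq4] add_mono norm_blinfun)
            (simp add: norm_scaleC mult_left_mono norm_blinfun)
        also have "\<dots> < r / 4 * norm x + r / 4 * norm x"
        proof (intro add_less_le_mono)
          show "norm ((R t o\<^sub>L P t) - (R s o\<^sub>L P s)) * norm x < r / 4 * norm x"
            using dRP \<open>x \<noteq> 0\<close> by simp
          have "cmod c \<le> Cm" using c Cm(2) by auto
          then have "cmod c * norm (P t - P s) \<le> Cm * \<eta>" using dP Cm by (intro mult_mono) auto
          then have "cmod c * norm (P t - P s) \<le> r / 4" using \<eta>(3) by linarith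
          then show "cmod c * (norm (P t - P s) * norm x) \<le> r / 4 * norm x"
            unfolding mult.assoc[symmetric] by (intro mult_right_mono) auto
        qed
        finally show ?thesis by simp
      qed
      moreover have "r / 2 * norm x \<le> norm (R t (P t x) - c *\<^sub>C P t x)"
      proof -
        have "norm (P t x - x) \<le> 1 / 2 * norm x"
        proof -
          have "P t x - x = (P t - P s) x" by (simp add: blinfun.diff_left Psx)
          then have "norm (P t x - x) \<le> norm (P t - P s) * norm x" by (simp add: norm_blinfun)
          also have "\<dots> \<le> 1 / 2 * norm x" using dP \<eta>(2) by (intro mult_right_mono) auto
          finally show ?thesis .
        qed
        then have "1 / 2 * norm x \<le> norm (P t x)"
          using norm_triangle_ineq2[of x "x - P t x"] by (simp add: norm_minus_commute)
        then have "r * (1 / 2 * norm x) \<le> r * norm (P t x)" using r by (intro mult_left_mono) auto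
        moreover have "r * norm (P t x) \<le> norm (R t (P t x) - c *\<^sub>C P t x)"
          using far by (rule power2_le_imp_le) simp
        ultimately show ?thesis by simp
      qed
      ultimately show False by simp
    qed
    from matched_of_counts[OF r(1,3) this] have "matched k r (F s) (F t)" .
    then show ?thesis using r(2) unfolding matched_def by (meson less_le_trans)
  qed
  then show ?thesis using d1(1) d2(1) by (intro exI[of _ "min d1 d2"]) auto
qed

theorem continuous_eigenvalues:
  fixes R P :: "real \<Rightarrow> 'h::complex_hilbert_space \<Rightarrow>\<^sub>L 'h"
  assumes ab: "a \<le> b" and contR: "continuous_on {a..b} R" and contP: "continuous_on {a..b} P"
    and lin: "\<And>t. t \<in> {a..b} \<Longrightarrow> complex_linear (R t) \<and> complex_linear (P t)"
    and proj: "\<And>t x. t \<in> {a..b} \<Longrightarrow> P t (P t x) = P t x"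
    and frame: "\<And>t. t \<in> {a..b} \<Longrightarrow> \<exists>f F. eigenframe k f F (R t) (range (P t))"
  obtains l :: "nat \<Rightarrow> real \<Rightarrow> complex" and f :: "real \<Rightarrow> nat \<Rightarrow> 'h" where "\<And>i. i < k \<Longrightarrow> continuous_on {a..b} (l i)"
    "\<And>t. t \<in> {a..b} \<Longrightarrow> (\<forall>i<k. f t i \<noteq> 0 \<and> R t (f t i) = l i t *\<^sub>C f t i) \<and> range (P t) = range (\<lambda>u. \<Sum>i<k. u i *\<^sub>C f t i)"
proof -
  obtain f :: "real \<Rightarrow> nat \<Rightarrow> 'h" and F :: "real \<Rightarrow> nat \<Rightarrow> complex" where fF: "\<And>t. t \<in> {a..b} \<Longrightarrow> eigenframe k (f t) (F t) (R t) (range (P t))"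
    using frame by metis
  obtain p where p: "\<And>t. p t permutes {..<k}" "\<And>i. i < k \<Longrightarrow> continuous_on {a..b} (\<lambda>t. F t (p t i))"
    using continuous_selection[OF ab eigenvalues_matched[OF contR contP lin proj fF]] by metis
  show ?thesis
  proof (rule that[of "\<lambda>i t. F t (p t i)" "\<lambda>t i. f t (p t i)"])
    show "continuous_on {a..b} (\<lambda>t. F t (p t i))" if "i < k" for i by (rule p(2)[OF that])
    fix t assume t: "t \<in> {a..b}"
    have pk: "p t i < k" if "i < k" for i using permutes_in_image[OF p(1)[of t], of i] that by simp
    have "f t (p t i) \<noteq> 0 \<and> R t (f t (p t i)) = F t (p t i) *\<^sub>C f t (p t i)" if i: "i < k" for i
    proof
      have "cinner (f t (p t i)) (f t (p t i)) = 1" using fF[OF t] pk[OF i] by (simp add: eigenframe_def)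
      then show "f t (p t i) \<noteq> 0" by auto
      show "R t (f t (p t i)) = F t (p t i) *\<^sub>C f t (p t i)" using fF[OF t] pk[OF i] by (simp add: eigenframe_def)
    qed
    moreover have "range (\<lambda>u. \<Sum>i<k. u i *\<^sub>C f t i) = range (\<lambda>u. \<Sum>i<k. u i *\<^sub>C f t (p t i))"
    proof -
      have e1: "(\<Sum>i<k. u i *\<^sub>C f t i) = (\<Sum>i<k. u (p t i) *\<^sub>C f t (p t i))" for u
        by (rule sum.permute[OF p(1), of "\<lambda>i. u i *\<^sub>C f t i", unfolded o_def])
      have e2: "(\<Sum>i<k. u i *\<^sub>C f t (p t i)) = (\<Sum>i<k. u (inv (p t) i) *\<^sub>C f t i)" for u
        using sum.permute[OF p(1)[of t], of "\<lambda>i. u (inv (p t) i) *\<^sub>C f t i"]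
        by (simp add: o_def permutes_inverses[OF p(1)])
      show ?thesis
      proof (intro subset_antisym image_subsetI)
        show "(\<Sum>i<k. u i *\<^sub>C f t i) \<in> range (\<lambda>u. \<Sum>i<k. u i *\<^sub>C f t (p t i))" for u
          by (rule range_eqI[where x = "\<lambda>i. u (p t i)"]) (rule e1)
        show "(\<Sum>i<k. u i *\<^sub>C f t (p t i)) \<in> range (\<lambda>u. \<Sum>i<k. u i *\<^sub>C f t i)" for u
          by (rule range_eqI[where x = "\<lambda>i. u (inv (p t) i)"]) (rule e2)
      qed
    qed
    ultimately show "(\<forall>i<k. f t (p t i) \<noteq> 0 \<and> R t (f t (p t i)) = F t (p t i) *\<^sub>C f t (p t i)) \<and>
       range (P t) = range (\<lambda>u. \<Sum>i<k. u i *\<^sub>C f t (p t i))"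
      using fF[OF t] by (simp add: eigenframe_def)
  qed
qed

section \<open>Simultaneous splitting of smooth operator functions\<close>

definition indexed_basis :: "nat \<Rightarrow> (nat \<Rightarrow> 'h) \<Rightarrow> 'h::complex_hilbert_space set \<Rightarrow> bool" where
  "indexed_basis k f W \<longleftrightarrow> (\<forall>u. (\<Sum>i<k. u i *\<^sub>C f i) = 0 \<longrightarrow> (\<forall>i<k. u i = 0)) \<and>
     W = range (\<lambda>u. \<Sum>i<k. u i *\<^sub>C f i)"

lemma indexed_basis_inj:
  assumes "indexed_basis k f W"
  shows "inj_on f {..<k}"
proof (rule inj_onI)
  fix i j assume ij: "i \<in> {..<k}" "j \<in> {..<k}" "f i = f j"
  show "i = j"
  proof (rule ccontr)
    assume ne: "i \<noteq> j"
    define u where "u l = (if l = i then 1 else if l = j then - 1 else (0::complex))" for l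
    have "(\<Sum>l<k. u l *\<^sub>C f l) = (\<Sum>l\<in>{i, j}. u l *\<^sub>C f l)"
      using ij by (intro sum.mono_neutral_right) (auto simp: u_def)
    also have "\<dots> = 0" using ij ne by (simp add: u_def)
    finally have "u i = 0" using assms ij unfolding indexed_basis_def by blast
    then show False by (simp add: u_def)
  qed
qed

lemma indexed_basis_span:
  assumes "indexed_basis k f W"
  shows "complex_vector.independent (f ` {..<k})" "complex_vector.span (f ` {..<k}) = W"
    "complex_vector.dim W = k"
proof -
  have inj: "inj_on f {..<k}" by (rule indexed_basis_inj[OF assms])
  have conv: "(\<Sum>v\<in>f ` {..<k}. u v *\<^sub>C v) = (\<Sum>i<k. u (f i) *\<^sub>C f i)" for u
    by (simp add: sum.reindex[OF inj])
  show ind: "complex_vector.independent (f ` {..<k})"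
    unfolding complex_vector.dependent_finite[OF finite_imageI[OF finite_lessThan]] conv
  proof
    assume "\<exists>u. (\<exists>v\<in>f ` {..<k}. u v \<noteq> 0) \<and> (\<Sum>i<k. u (f i) *\<^sub>C f i) = 0"
    then obtain u i where u: "i < k" "u (f i) \<noteq> 0" "(\<Sum>i<k. u (f i) *\<^sub>C f i) = 0" by auto
    have "\<forall>i<k. u (f i) = 0"
      using assms u(3) unfolding indexed_basis_def by (elim conjE allE[of _ "\<lambda>i. u (f i)"] impE) auto
    then show False using u by simp
  qed
  show span: "complex_vector.span (f ` {..<k}) = W"
  proof
    show "complex_vector.span (f ` {..<k}) \<subseteq> W"
    proof
      fix x assume "x \<in> complex_vector.span (f ` {..<k})"
      then obtain u where "x = (\<Sum>v\<in>f ` {..<k}. u v *\<^sub>C v)"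
        unfolding complex_vector.span_finite[OF finite_imageI[OF finite_lessThan]] by blast
      then have "x = (\<Sum>i<k. u (f i) *\<^sub>C f i)" by (simp only: conv)
      then have "x \<in> range (\<lambda>u. \<Sum>i<k. u i *\<^sub>C f i)" by (rule range_eqI[where x = "\<lambda>i. u (f i)"])
      then show "x \<in> W" using assms unfolding indexed_basis_def by simp
    qed
    show "W \<subseteq> complex_vector.span (f ` {..<k})"
    proof
      fix x assume "x \<in> W"
      then obtain u where x: "x = (\<Sum>i<k. u i *\<^sub>C f i)" using assms unfolding indexed_basis_def by blast
      show "x \<in> complex_vector.span (f ` {..<k})"
        unfolding x by (intro complex_vector.span_sum complex_vector.span_scale complex_vector.span_base) simp
    qed
  qed
  show "complex_vector.dim W = k"
    using complex_vector.dim_span_eq_card_independent[OF ind] card_image[OF inj] span by simp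
qed

lemma sum_lessThan_add:
  fixes f :: "nat \<Rightarrow> 'a::comm_monoid_add"
  shows "(\<Sum>i<m + n. f i) = (\<Sum>i<m. f i) + (\<Sum>i<n. f (m + i))"
  by (induction n) (simp_all add: add.assoc)

lemma orthonormal_basis_index:
  assumes "orthonormal_basis B W"
  obtains f where "f ` {..<card B} = B" "\<And>i j. i < card B \<Longrightarrow> j < card B \<Longrightarrow> cinner (f i) (f j) = (if i = j then 1 else 0)"
    "W = range (\<lambda>u. \<Sum>i<card B. u i *\<^sub>C f i)"
proof -
  have fin: "finite B" and orth: "orthonormal B" and span: "complex_vector.span B = W"
    using assms by (auto simp: orthonormal_basis_def)
  obtain f where f: "bij_betw f {..<card B} B"
    using ex_bij_betw_nat_finite[OF fin] by (auto simp: lessThan_atLeast0)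
  have inj: "inj_on f {..<card B}" and img: "f ` {..<card B} = B" using f by (auto simp: bij_betw_def)
  show ?thesis
  proof (rule that[OF img])
    show "cinner (f i) (f j) = (if i = j then 1 else 0)" if "i < card B" "j < card B" for i j
    proof -
      have "f i \<in> B" "f j \<in> B" using img that by auto
      moreover have "f i = f j \<longleftrightarrow> i = j" using inj_on_eq_iff[OF inj] that by simp
      ultimately show ?thesis using orth by (simp add: orthonormal_def)
    qed
    have reindex: "(\<Sum>b\<in>B. u b *\<^sub>C b) = (\<Sum>i<card B. u (f i) *\<^sub>C f i)" for u
      using sum.reindex[OF inj, of "\<lambda>b. u b *\<^sub>C b"] img by (simp add: o_def)
    show "W = range (\<lambda>u. \<Sum>i<card B. u i *\<^sub>C f i)"
    proof
      show "W \<subseteq> range (\<lambda>u. \<Sum>i<card B. u i *\<^sub>C f i)"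
      proof
        fix x assume "x \<in> W"
        then obtain u where "x = (\<Sum>b\<in>B. u b *\<^sub>C b)"
          unfolding span[symmetric] complex_vector.span_finite[OF fin] by blast
        then show "x \<in> range (\<lambda>u. \<Sum>i<card B. u i *\<^sub>C f i)"
          unfolding reindex by (rule range_eqI[where x = "\<lambda>i. u (f i)"])
      qed
      show "range (\<lambda>u. \<Sum>i<card B. u i *\<^sub>C f i) \<subseteq> W"
        unfolding span[symmetric]
        by (intro image_subsetI complex_vector.span_sum complex_vector.span_scale complex_vector.span_base) (use img in auto)
    qed
  qed
qed

lemma orthonormal_index_basis:
  assumes "\<And>i j. i < k \<Longrightarrow> j < k \<Longrightarrow> cinner (f i) (f j) = (if i = j then 1 else 0)"
    "W = range (\<lambda>u. \<Sum>i<k. u i *\<^sub>C f i)"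
  shows "indexed_basis k f W"
  unfolding indexed_basis_def
proof (intro conjI allI impI)
  fix u i assume "(\<Sum>i<k. u i *\<^sub>C f i) = 0" "i < k"
  then show "u i = 0" using frame_coeff[where u = u, OF assms(1) \<open>i < k\<close>] by simp
qed (rule assms(2))

lemma closed_extension:
  fixes f :: "real \<Rightarrow> 'b::topological_space"
  assumes s: "s \<in> U" "s islimpt U" and f: "continuous_on U f" "closed C" "\<And>t. t \<in> U \<Longrightarrow> t \<noteq> s \<Longrightarrow> f t \<in> C"
    and t: "t \<in> U"
  shows "f t \<in> C"
proof -
  have "f s \<in> C"
  proof (rule Lim_in_closed_set[OF f(2)])
    show "\<forall>\<^sub>F t in at s within U. f t \<in> C" using f(3) by (simp add: eventually_at_filter)
    show "at s within U \<noteq> bot" using s(2) by (simp add: trivial_limit_within)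
    show "(f \<longlongrightarrow> f s) (at s within U)" using f(1) s(1) by (simp add: continuous_on_def)
  qed
  then show ?thesis using f(3)[OF t] by (cases "t = s") auto
qed

lemma finite_common_radius:
  assumes "\<And>i. i < (k::nat) \<Longrightarrow> \<exists>\<eta>>0. \<forall>t\<in>A \<inter> ball (t0::real) \<eta>. Q i t"
  shows "\<exists>\<eta>>0. \<forall>i<k. \<forall>t\<in>A \<inter> ball t0 \<eta>. Q i t"
  using assms
proof (induction k)
  case 0
  show ?case by (intro exI[of _ 1]) auto
next
  case (Suc k)
  have "\<And>i. i < k \<Longrightarrow> \<exists>\<eta>>0. \<forall>t\<in>A \<inter> ball t0 \<eta>. Q i t" using Suc.prems by simp
  from Suc.IH[OF this] obtain a where a: "a > 0" "\<forall>i<k. \<forall>t\<in>A \<inter> ball t0 a. Q i t" by blast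
  obtain b where b: "b > 0" "\<forall>t\<in>A \<inter> ball t0 b. Q k t" using Suc.prems[of k] by blast
  show ?case by (intro exI[of _ "min a b"]) (use a b in \<open>auto simp: less_Suc_eq\<close>)
qed

text \<open>Selections live on compact intervals. Since \<open>t0\<close> may be an endpoint of
  \<open>S\<close>, a = t0 or b = t0 has to be allowed.\<close>

lemma interval_neighbourhood:
  fixes S :: "real set"
  assumes S: "is_interval S" "t0 \<in> S" and d: "\<delta> > 0"
  obtains a b \<eta> where "a \<le> t0" "t0 \<le> b" "{a..b} \<subseteq> S \<inter> ball t0 \<delta>" "\<eta> > 0" "S \<inter> ball t0 \<eta> \<subseteq> {a..b}"
proof -
  have mem: "x \<in> S" if "u \<in> S" "v \<in> S" "u \<le> x" "x \<le> v" for u v x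
    using S(1) that unfolding is_interval_1 by blast
  have up: "\<exists>b \<eta>. t0 \<le> b \<and> b \<in> S \<and> b < t0 + \<delta> \<and> \<eta> > 0 \<and> (\<forall>t\<in>S. t < t0 + \<eta> \<longrightarrow> t \<le> b)"
  proof (cases "\<exists>s\<in>S. s > t0")
    case True
    then obtain s where s: "s \<in> S" "s > t0" by blast
    define b where "b = min s (t0 + \<delta> / 2)"
    have b: "t0 < b" "b \<le> s" "b < t0 + \<delta>" using s d by (auto simp: b_def)
    then have "b \<in> S" using mem[OF S(2) s(1)] by simp
    then show ?thesis using b by (intro exI[of _ b] exI[of _ "b - t0"]) auto
  next
    case False
    then show ?thesis using S d by (intro exI[of _ t0] exI[of _ 1]) (auto simp: not_less)
  qed
  have down: "\<exists>a \<eta>. a \<le> t0 \<and> a \<in> S \<and> t0 - \<delta> < a \<and> \<eta> > 0 \<and> (\<forall>t\<in>S. t0 - \<eta> < t \<longrightarrow> a \<le> t)"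
  proof (cases "\<exists>s\<in>S. s < t0")
    case True
    then obtain s where s: "s \<in> S" "s < t0" by blast
    define a where "a = max s (t0 - \<delta> / 2)"
    have a: "a < t0" "s \<le> a" "t0 - \<delta> < a" using s d by (auto simp: a_def)
    then have "a \<in> S" using mem[OF s(1) S(2)] by simp
    then show ?thesis using a by (intro exI[of _ a] exI[of _ "t0 - a"]) auto
  next
    case False
    then show ?thesis using S d by (intro exI[of _ t0] exI[of _ 1]) (auto simp: not_less)
  qed
  obtain b \<eta>1 where b: "t0 \<le> b" "b \<in> S" "b < t0 + \<delta>" "\<eta>1 > 0" "\<forall>t\<in>S. t < t0 + \<eta>1 \<longrightarrow> t \<le> b" using up by blast
  obtain a \<eta>2 where a: "a \<le> t0" "a \<in> S" "t0 - \<delta> < a" "\<eta>2 > 0" "\<forall>t\<in>S. t0 - \<eta>2 < t \<longrightarrow> a \<le> t" using down by blast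
  show ?thesis
  proof (rule that[of a b "min \<eta>1 \<eta>2"])
    show "{a..b} \<subseteq> S \<inter> ball t0 \<delta>"
      using mem[OF a(2) b(2)] a(3) b(3) by (auto simp: dist_real_def)
    show "S \<inter> ball t0 (min \<eta>1 \<eta>2) \<subseteq> {a..b}"
      using a(5) b(5) by (auto simp: dist_real_def)
  qed (use a b in auto)
qed

lemma subspace_range:
  assumes "complex_linear X"
  shows "complex_vector.subspace (range (blinfun_apply X))"
  unfolding complex_vector.subspace_def
proof (intro conjI ballI allI)
  show "0 \<in> range (blinfun_apply X)" by (rule range_eqI[where x = 0]) (simp add: blinfun.zero_right)
  show "x + y \<in> range (blinfun_apply X)" if xy: "x \<in> range (blinfun_apply X)" "y \<in> range (blinfun_apply X)" for x y
    using xy by (auto simp flip: blinfun.add_right)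
  show "c *\<^sub>C x \<in> range (blinfun_apply X)" if x: "x \<in> range (blinfun_apply X)" for c x
    using x by (auto simp flip: complex_linear_simps(1)[OF assms])
qed

section \<open>Splitting of families of commuting projections\<close>

text \<open>Collects what the splitting argument uses of the resolvents. Paranormality and
  orthogonality of eigenvectors stand in for normality, so that no adjoint of \<open>R t\<close>
  appears; genericity is phrased for the eigenvalues of \<open>R\<close>, at \<open>t0\<close> only,
  and by estimates.\<close>

locale normal_family =
  fixes an :: bool and S :: "real set" and t0 :: real and R :: "real \<Rightarrow> 'h::complex_hilbert_space \<Rightarrow>\<^sub>L 'h"
  assumes S: "is_interval S" "t0 \<in> S"
    and reg: "regular an S R"
    and lin: "\<And>t. t \<in> S \<Longrightarrow> complex_linear (R t)"
    and paranormal: "\<And>t. t \<in> S \<Longrightarrow> paranormal_on UNIV (R t)"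
    and orth: "\<And>t x y \<mu> \<nu>. t \<in> S \<Longrightarrow> R t x = \<mu> *\<^sub>C x \<Longrightarrow> R t y = \<nu> *\<^sub>C y \<Longrightarrow> \<mu> \<noteq> \<nu> \<Longrightarrow> cinner x y = 0"
    and generic: "\<And>\<delta> l m. \<delta> > 0 \<Longrightarrow> continuous_on (S \<inter> ball t0 \<delta>) l \<Longrightarrow> continuous_on (S \<inter> ball t0 \<delta>) m \<Longrightarrow>
      (\<And>t. t \<in> S \<inter> ball t0 \<delta> \<Longrightarrow> \<exists>x. x \<noteq> 0 \<and> R t x = l t *\<^sub>C x) \<Longrightarrow>
      (\<And>t. t \<in> S \<inter> ball t0 \<delta> \<Longrightarrow> \<exists>x. x \<noteq> 0 \<and> R t x = m t *\<^sub>C x) \<Longrightarrow>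
      (\<And>p. \<exists>C \<eta>. \<eta> > 0 \<and> (\<forall>t\<in>S \<inter> ball t0 \<eta>. cmod (l t - m t) \<le> C * \<bar>t - t0\<bar> ^ Suc p)) \<Longrightarrow>
      \<exists>\<eta>>0. \<forall>t\<in>S \<inter> ball t0 \<eta>. l t = m t"
begin

definition projections :: "real set \<Rightarrow> (real \<Rightarrow> 'h \<Rightarrow>\<^sub>L 'h) \<Rightarrow> bool" where
  "projections U P \<longleftrightarrow> regular an U P \<and> (\<forall>t\<in>U. complex_linear (P t) \<and> (\<forall>x. P t (P t x) = P t x) \<and> (\<forall>x. R t (P t x) = P t (R t x)))"

lemma projectionsD:
  assumes "projections U P"
  shows "regular an U P" "\<And>t. t \<in> U \<Longrightarrow> complex_linear (P t)" "\<And>t x. t \<in> U \<Longrightarrow> P t (P t x) = P t x"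
    "\<And>t x. t \<in> U \<Longrightarrow> R t (P t x) = P t (R t x)"
  using assms by (auto simp: projections_def)

lemma projections_subset: "projections U P \<Longrightarrow> U' \<subseteq> U \<Longrightarrow> projections U' P"
  unfolding projections_def using regular_subset by blast

lemma range_projection:
  assumes "projections U P" "t \<in> U"
  shows "x \<in> range (P t) \<longleftrightarrow> P t x = x"
proof
  assume "x \<in> range (P t)"
  then obtain y where "x = P t y" by blast
  then show "P t x = x" using projectionsD(3)[OF assms, of y] by simp
next
  assume "P t x = x"
  then show "x \<in> range (P t)" by (intro range_eqI[where x = x]) simp
qed

lemma projection_basis:
  fixes P :: "real \<Rightarrow> 'h \<Rightarrow>\<^sub>L 'h"
  assumes P: "projections (S \<inter> ball t0 \<delta>) P" and d: "\<delta> > 0" and v: "indexed_basis k v (range (P t0))"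
  shows "\<exists>\<eta>>0. \<eta> \<le> \<delta> \<and> (\<forall>t\<in>S \<inter> ball t0 \<eta>. indexed_basis k (\<lambda>i. P t (v i)) (range (P t)))"
proof -
  let ?S = "S \<inter> ball t0 \<delta>"
  have t0: "t0 \<in> ?S" using S d by simp
  \<comment> \<open>Kato's intertwiner: it maps the range of P(t0) into that of P(t), and likewise
    for the complements. It is the identity at \<open>t0\<close>, hence invertible nearby, which
    turns a basis of one range into a basis of the other.\<close>
  define U where "U t = (P t o\<^sub>L P t0) + ((id_blinfun - P t) o\<^sub>L (id_blinfun - P t0))" for t
  have U: "U t x = P t (P t0 x) + (x - P t0 x) - P t (x - P t0 x)" for t x
    by (simp add: U_def blinfun.add_left blinfun.diff_left)
  have regU: "regular an ?S U"
    unfolding U_def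
    by (intro regular_add blinfun_product.regular_bilinear regular_diff regular_const projectionsD(1)[OF P])
  have "U t0 x = x" for x unfolding U by (simp add: blinfun.diff_right projectionsD(3)[OF P t0])
  then have U0: "U t0 = id_blinfun" by (intro blinfun_eqI) simp
  have "U t0 o\<^sub>L id_blinfun = id_blinfun" "id_blinfun o\<^sub>L U t0 = id_blinfun"
    unfolding U0 by (rule blinfun_product.left_unit)+
  from regular_inverse_near[OF regU t0 this]
  obtain \<eta> M where \<eta>: "\<eta> > 0"
    and M: "\<And>t. t \<in> ?S \<inter> ball t0 \<eta> \<Longrightarrow> U t o\<^sub>L M t = id_blinfun \<and> M t o\<^sub>L U t = id_blinfun" by metis
  have "indexed_basis k (\<lambda>i. P t (v i)) (range (P t))" if t: "t \<in> S \<inter> ball t0 (min \<eta> \<delta>)" for t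
  proof -
    have tS: "t \<in> ?S" "t \<in> ?S \<inter> ball t0 \<eta>" using t by auto
    have UM: "U t (M t x) = x" and MU: "M t (U t x) = x" for x
      using M[OF tS(2)] by (metis blinfun_apply_blinfun_compose blinfun_apply_id_blinfun id_apply)+
    have lin: "complex_linear (P t)" by (rule projectionsD(2)[OF P tS(1)])
    show ?thesis unfolding indexed_basis_def
    proof (intro conjI allI impI)
      fix u i assume u: "(\<Sum>i<k. u i *\<^sub>C P t (v i)) = 0" and i: "i < k"
      define x where "x = (\<Sum>i<k. u i *\<^sub>C v i)"
      have "x \<in> range (P t0)" using v unfolding indexed_basis_def x_def by blast
      then have "P t0 x = x" using range_projection[OF P t0] by simp
      moreover have "P t x = 0" using u by (simp add: x_def complex_linear_simps[OF lin])
      ultimately have "U t x = 0" by (simp add: U blinfun.zero_right)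
      then have "x = 0" using MU[of x] by (simp add: blinfun.zero_right)
      then show "u i = 0" using v i unfolding indexed_basis_def x_def by blast
    next
      show "range (P t) = range (\<lambda>u. \<Sum>i<k. u i *\<^sub>C P t (v i))"
      proof
        show "range (P t) \<subseteq> range (\<lambda>u. \<Sum>i<k. u i *\<^sub>C P t (v i))"
        proof
          fix y assume "y \<in> range (P t)"
          then have y: "P t y = y" using range_projection[OF P tS(1)] by simp
          define x where "x = M t y"
          have "y = P t (U t x)" by (simp add: x_def UM y)
          also have "\<dots> = P t (P t0 x)"
            unfolding U by (simp add: blinfun.add_right blinfun.diff_right projectionsD(3)[OF P tS(1)])
          finally have yx: "y = P t (P t0 x)" .
          have "P t0 x \<in> range (P t0)" by blast
          then obtain u where "P t0 x = (\<Sum>i<k. u i *\<^sub>C v i)" using v unfolding indexed_basis_def by blast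
          then have "y = (\<Sum>i<k. u i *\<^sub>C P t (v i))" using yx by (simp add: complex_linear_simps[OF lin])
          then show "y \<in> range (\<lambda>u. \<Sum>i<k. u i *\<^sub>C P t (v i))" by (rule range_eqI[where x = u])
        qed
        show "range (\<lambda>u. \<Sum>i<k. u i *\<^sub>C P t (v i)) \<subseteq> range (P t)"
        proof (rule image_subsetI)
          fix u
          have "(\<Sum>i<k. u i *\<^sub>C P t (v i)) = P t (\<Sum>i<k. u i *\<^sub>C v i)"
            by (simp add: complex_linear_simps[OF lin])
          then show "(\<Sum>i<k. u i *\<^sub>C P t (v i)) \<in> range (P t)" by (rule range_eqI)
        qed
      qed
    qed
  qed
  then show ?thesis using \<eta> d by (intro exI[of _ "min \<eta> \<delta>"]) auto
qed

lemma eigenframe_exists: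
  assumes P: "projections U P" and t: "t \<in> U" "t \<in> S" and f: "indexed_basis k f (range (P t))"
  shows "\<exists>g l. eigenframe k g l (R t) (range (P t))"
proof -
  let ?W = "range (P t)"
  have W: "complex_vector.subspace ?W" by (rule subspace_range[OF projectionsD(2)[OF P t(1)]])
  have "?W \<subseteq> complex_vector.span (f ` {..<k})" using indexed_basis_span(2)[OF f] by simp
  then obtain B where B: "orthonormal_basis B ?W"
    using orthonormal_basis_of_subspace[OF W, of "f ` {..<k}"] by blast
  have inv: "R t x \<in> ?W" if "x \<in> ?W" for x
    using projectionsD(4)[OF P t(1), of x] that by (simp add: range_projection[OF P t(1)])
  have "paranormal_on ?W (R t)" using paranormal[OF t(2)] by (auto simp: paranormal_on_def)
  then have "\<exists>E. orthonormal_basis E ?W \<and> (\<forall>e\<in>E. \<exists>\<mu>. R t e = \<mu> *\<^sub>C e)"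
  proof (rule orthonormal_eigenbasis[OF B lin[OF t(2)], rotated])
    show "R t x \<in> ?W" if "x \<in> ?W" for x by (rule inv[OF that])
    show "cinner x y = 0" if "R t x = \<mu> *\<^sub>C x" "R t y = \<nu> *\<^sub>C y" "\<mu> \<noteq> \<nu>" for x y \<mu> \<nu>
      by (rule orth[OF t(2) that])
  qed
  then obtain E where E: "orthonormal_basis E ?W" "\<forall>e\<in>E. \<exists>\<mu>. R t e = \<mu> *\<^sub>C e" by blast
  obtain g where g: "g ` {..<card E} = E"
    "\<And>i j. i < card E \<Longrightarrow> j < card E \<Longrightarrow> cinner (g i) (g j) = (if i = j then 1 else 0)"
    "?W = range (\<lambda>u. \<Sum>i<card E. u i *\<^sub>C g i)"
    by (rule orthonormal_basis_index[OF E(1)]) blast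
  have "card E = k"
    using indexed_basis_span(3)[OF f] indexed_basis_span(3)[OF orthonormal_index_basis[OF g(2,3)]] by simp
  obtain \<mu> where \<mu>: "\<And>e. e \<in> E \<Longrightarrow> R t e = \<mu> e *\<^sub>C e" using E(2) by metis
  have "R t (g i) = \<mu> (g i) *\<^sub>C g i" if "i < card E" for i using \<mu> g(1) that by blast
  then have "eigenframe k g (\<lambda>i. \<mu> (g i)) (R t) ?W"
    unfolding eigenframe_def \<open>card E = k\<close>[symmetric] using g(2,3) by auto
  then show ?thesis by blast
qed

text \<open>The rank \<open>k\<close> is existentially quantified, so that families of unknown ranks
  can be added; in the end it is recovered from the dimension at \<open>t0\<close>.\<close>

definition parameterized :: "real \<Rightarrow> (real \<Rightarrow> 'h \<Rightarrow>\<^sub>L 'h) \<Rightarrow> bool" where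
  "parameterized \<delta> P \<longleftrightarrow> (\<exists>k l e. (\<forall>i<k. regular an (S \<inter> ball t0 \<delta>) (l i) \<and> regular an (S \<inter> ball t0 \<delta>) (e i)) \<and>
     (\<forall>t\<in>S \<inter> ball t0 \<delta>. indexed_basis k (\<lambda>i. e i t) (range (P t)) \<and> (\<forall>i<k. R t (e i t) = l i t *\<^sub>C e i t)))"

text \<open>Where \<open>R\<close> is scalar on the range every vector is an eigenvector, so any
  regular frame will do, in particular the projections of a fixed basis.\<close>

lemma parameterized_scalar:
  assumes P: "projections (S \<inter> ball t0 \<delta>) P" and d: "\<delta> > 0" and v: "indexed_basis k v (range (P t0))"
    and \<tau>: "regular an (S \<inter> ball t0 \<delta>) \<tau>"
    and scalar: "\<And>t x. t \<in> S \<inter> ball t0 \<delta> \<Longrightarrow> R t (P t x) = \<tau> t *\<^sub>C P t x"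
  shows "\<exists>\<eta>>0. \<eta> \<le> \<delta> \<and> parameterized \<eta> P"
proof -
  obtain \<eta> where \<eta>: "\<eta> > 0" "\<eta> \<le> \<delta>" "\<forall>t\<in>S \<inter> ball t0 \<eta>. indexed_basis k (\<lambda>i. P t (v i)) (range (P t))"
    using projection_basis[OF P d v] by blast
  have sub: "S \<inter> ball t0 \<eta> \<subseteq> S \<inter> ball t0 \<delta>" using \<eta>(2) by auto
  have "regular an (S \<inter> ball t0 \<eta>) (\<lambda>t. P t (v i))" for i
    by (rule regular_linear[OF blinfun.bounded_linear_left regular_subset[OF projectionsD(1)[OF P] sub]])
  moreover have "regular an (S \<inter> ball t0 \<eta>) \<tau>" by (rule regular_subset[OF \<tau> sub])
  moreover have "\<forall>t\<in>S \<inter> ball t0 \<eta>. \<forall>i<k. R t (P t (v i)) = \<tau> t *\<^sub>C P t (v i)" using scalar sub by blast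
  ultimately have "parameterized \<eta> P"
    unfolding parameterized_def using \<eta>(3)
    by (intro exI[of _ k] exI[of _ "\<lambda>_. \<tau>"] exI[of _ "\<lambda>i t. P t (v i)"]) blast
  then show ?thesis using \<eta> by blast
qed

lemma parameterized_sum:
  fixes P P1 P2 :: "real \<Rightarrow> 'h \<Rightarrow>\<^sub>L 'h"
  assumes P1: "projections (S \<inter> ball t0 \<delta>) P1" and P2: "projections (S \<inter> ball t0 \<delta>) P2"
    and sum: "\<And>t x. t \<in> S \<inter> ball t0 \<delta> \<Longrightarrow> P t x = P1 t x + P2 t x"
    and prod: "\<And>t x. t \<in> S \<inter> ball t0 \<delta> \<Longrightarrow> P1 t (P2 t x) = 0 \<and> P2 t (P1 t x) = 0"
    and p1: "parameterized \<eta>1 P1" and p2: "parameterized \<eta>2 P2" and le: "\<eta>1 \<le> \<delta>" "\<eta>2 \<le> \<delta>"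
  shows "parameterized (min \<eta>1 \<eta>2) P"
proof -
  let ?U = "S \<inter> ball t0 (min \<eta>1 \<eta>2)"
  obtain k1 l1 e1 where 1: "\<forall>i<k1. regular an (S \<inter> ball t0 \<eta>1) (l1 i) \<and> regular an (S \<inter> ball t0 \<eta>1) (e1 i)"
    "\<forall>t\<in>S \<inter> ball t0 \<eta>1. indexed_basis k1 (\<lambda>i. e1 i t) (range (P1 t)) \<and> (\<forall>i<k1. R t (e1 i t) = l1 i t *\<^sub>C e1 i t)"
    using p1 unfolding parameterized_def by blast
  obtain k2 l2 e2 where 2: "\<forall>i<k2. regular an (S \<inter> ball t0 \<eta>2) (l2 i) \<and> regular an (S \<inter> ball t0 \<eta>2) (e2 i)"
    "\<forall>t\<in>S \<inter> ball t0 \<eta>2. indexed_basis k2 (\<lambda>i. e2 i t) (range (P2 t)) \<and> (\<forall>i<k2. R t (e2 i t) = l2 i t *\<^sub>C e2 i t)"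
    using p2 unfolding parameterized_def by blast
  define l where "l i = (if i < k1 then l1 i else l2 (i - k1))" for i
  define e where "e i = (if i < k1 then e1 i else e2 (i - k1))" for i
  have sub: "?U \<subseteq> S \<inter> ball t0 \<eta>1" "?U \<subseteq> S \<inter> ball t0 \<eta>2" "?U \<subseteq> S \<inter> ball t0 \<delta>" using le by auto
  have "regular an ?U (l i) \<and> regular an ?U (e i)" if "i < k1 + k2" for i
  proof (cases "i < k1")
    case True
    then show ?thesis using 1(1) by (auto simp: l_def e_def intro: regular_subset[OF _ sub(1)])
  next
    case False
    then have "i - k1 < k2" using that by simp
    then show ?thesis using False 2(1) by (auto simp: l_def e_def intro: regular_subset[OF _ sub(2)])
  qed
  moreover have "indexed_basis (k1 + k2) (\<lambda>i. e i t) (range (P t)) \<and> (\<forall>i<k1 + k2. R t (e i t) = l i t *\<^sub>C e i t)"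
    if t: "t \<in> ?U" for t
  proof
    have td: "t \<in> S \<inter> ball t0 \<delta>" using t sub(3) by blast
    have b1: "indexed_basis k1 (\<lambda>i. e1 i t) (range (P1 t))" and v1: "\<forall>i<k1. R t (e1 i t) = l1 i t *\<^sub>C e1 i t"
      using 1(2) t sub(1) by blast+
    have b2: "indexed_basis k2 (\<lambda>i. e2 i t) (range (P2 t))" and v2: "\<forall>i<k2. R t (e2 i t) = l2 i t *\<^sub>C e2 i t"
      using 2(2) t sub(2) by blast+
    have split: "(\<Sum>i<k1 + k2. u i *\<^sub>C e i t) = (\<Sum>i<k1. u i *\<^sub>C e1 i t) + (\<Sum>i<k2. u (k1 + i) *\<^sub>C e2 i t)" for u
      unfolding sum_lessThan_add by (simp add: e_def)
    have m1: "(\<Sum>i<k1. u i *\<^sub>C e1 i t) \<in> range (P1 t)" and m2: "(\<Sum>i<k2. u i *\<^sub>C e2 i t) \<in> range (P2 t)" for u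
      using b1 b2 unfolding indexed_basis_def by blast+
    show "indexed_basis (k1 + k2) (\<lambda>i. e i t) (range (P t))"
      unfolding indexed_basis_def
    proof (intro conjI allI impI)
      fix u i assume u: "(\<Sum>i<k1 + k2. u i *\<^sub>C e i t) = 0" and i: "i < k1 + k2"
      define x where "x = (\<Sum>i<k1. u i *\<^sub>C e1 i t)"
      define y where "y = (\<Sum>i<k2. u (k1 + i) *\<^sub>C e2 i t)"
      have xy: "x + y = 0" using u unfolding split x_def y_def .
      have x: "P1 t x = x" using m1[of u] range_projection[OF P1 td] by (simp add: x_def)
      have y: "P2 t y = y" using m2[of "\<lambda>i. u (k1 + i)"] range_projection[OF P2 td] by (simp add: y_def)
      have "P1 t y = 0" using prod[OF td, of y] y by simp
      then have "P1 t (x + y) = x" by (simp add: blinfun.add_right x)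
      then have "x = 0" using xy by (simp add: blinfun.zero_right)
      then have "y = 0" using xy by simp
      have "\<forall>i<k1. u i = 0"
        using spec[OF conjunct1[OF b1[unfolded indexed_basis_def]], of u] \<open>x = 0\<close> by (simp add: x_def)
      moreover have z2: "\<forall>i<k2. u (k1 + i) = 0"
        using spec[OF conjunct1[OF b2[unfolded indexed_basis_def]], of "\<lambda>i. u (k1 + i)"] \<open>y = 0\<close> by (simp add: y_def)
      moreover have "u i = 0" if "\<not> i < k1"
      proof -
        have "k1 + (i - k1) = i" "i - k1 < k2" using that i by auto
        then show ?thesis using z2 by metis
      qed
      ultimately show "u i = 0" by blast
    next
      show "range (P t) = range (\<lambda>u. \<Sum>i<k1 + k2. u i *\<^sub>C e i t)"
      proof
        show "range (P t) \<subseteq> range (\<lambda>u. \<Sum>i<k1 + k2. u i *\<^sub>C e i t)"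
        proof (rule image_subsetI)
          fix x
          have "P1 t x \<in> range (P1 t)" "P2 t x \<in> range (P2 t)" by blast+
          then obtain u w where u: "P1 t x = (\<Sum>i<k1. u i *\<^sub>C e1 i t)" and w: "P2 t x = (\<Sum>i<k2. w i *\<^sub>C e2 i t)"
            using b1 b2 unfolding indexed_basis_def by blast
          define z where "z i = (if i < k1 then u i else w (i - k1))" for i
          have "P t x = (\<Sum>i<k1 + k2. z i *\<^sub>C e i t)"
            unfolding split sum[OF td] u w by (simp add: z_def)
          then show "P t x \<in> range (\<lambda>u. \<Sum>i<k1 + k2. u i *\<^sub>C e i t)" by (rule range_eqI[where x = z])
        qed
        show "range (\<lambda>u. \<Sum>i<k1 + k2. u i *\<^sub>C e i t) \<subseteq> range (P t)"
        proof (rule image_subsetI)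
          fix u
          obtain x y where xy: "(\<Sum>i<k1. u i *\<^sub>C e1 i t) = P1 t x" "(\<Sum>i<k2. u (k1 + i) *\<^sub>C e2 i t) = P2 t y"
            using m1[of u] m2[of "\<lambda>i. u (k1 + i)"] by auto
          have "P t (P1 t x + P2 t y) = P1 t x + P2 t y"
            using prod[OF td] projectionsD(3)[OF P1 td] projectionsD(3)[OF P2 td]
            by (simp add: sum[OF td] blinfun.add_right)
          then have "(\<Sum>i<k1 + k2. u i *\<^sub>C e i t) = P t (P1 t x + P2 t y)" unfolding split xy by simp
          then show "(\<Sum>i<k1 + k2. u i *\<^sub>C e i t) \<in> range (P t)" by (rule range_eqI)
        qed
      qed
    qed
    show "\<forall>i<k1 + k2. R t (e i t) = l i t *\<^sub>C e i t"
    proof (intro allI impI)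
      fix i assume "i < k1 + k2"
      then show "R t (e i t) = l i t *\<^sub>C e i t"
        using v1 v2 by (cases "i < k1") (auto simp: l_def e_def)
    qed
  qed
  ultimately show ?thesis unfolding parameterized_def
    by (intro exI[of _ "k1 + k2"] exI[of _ l] exI[of _ e]) blast
qed

text \<open>If \<open>R - \<tau>\<close> is flat at \<open>t0\<close> on the range of \<open>P\<close>, then all pairs of continuous
  eigenvalues meet of infinite order at \<open>t0\<close>, so they agree near \<open>t0\<close>.\<close>

lemma flat_imp_scalar:
  assumes P: "projections (S \<inter> ball t0 \<delta>) P" and d: "\<delta> > 0" and v: "indexed_basis k v (range (P t0))" and k: "k > 0"
    and flat: "\<And>p. \<exists>C \<eta>. \<eta> > 0 \<and> (\<forall>t\<in>S \<inter> ball t0 \<delta> \<inter> ball t0 \<eta>. \<forall>x. norm (R t (P t x) - \<tau> t *\<^sub>C P t x) \<le> C * \<bar>t - t0\<bar> ^ Suc p * norm x)"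
  shows "\<exists>\<eta>>0. \<eta> \<le> \<delta> \<and> (\<forall>t\<in>S \<inter> ball t0 \<eta>. \<exists>c. \<forall>x. R t (P t x) = c *\<^sub>C P t x)"
proof -
  obtain \<eta>0 where \<eta>0: "\<eta>0 > 0" "\<eta>0 \<le> \<delta>" "\<forall>t\<in>S \<inter> ball t0 \<eta>0. indexed_basis k (\<lambda>i. P t (v i)) (range (P t))"
    using projection_basis[OF P d v] by blast
  \<comment> \<open>Continuous eigenvalues are selected on the compact interval and restricted to
    the relative neighbourhood on which \<open>generic\<close> is applied.\<close>
  obtain a b \<eta>1 where ab: "a \<le> t0" "t0 \<le> b" "{a..b} \<subseteq> S \<inter> ball t0 \<eta>0" "\<eta>1 > 0" "S \<inter> ball t0 \<eta>1 \<subseteq> {a..b}"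
    by (rule interval_neighbourhood[OF S \<eta>0(1)])
  have sub: "{a..b} \<subseteq> S \<inter> ball t0 \<delta>" using ab(3) \<eta>0(2) by auto
  have abS: "t \<in> S" "t \<in> S \<inter> ball t0 \<delta>" "t \<in> S \<inter> ball t0 \<eta>0" if "t \<in> {a..b}" for t
    using subsetD[OF sub that] subsetD[OF ab(3) that] by auto
  have contR: "continuous_on {a..b} R"
    by (rule continuous_on_subset[OF regular_continuous[OF reg]]) (use abS in blast)
  have contP: "continuous_on {a..b} P"
    by (rule continuous_on_subset[OF regular_continuous[OF projectionsD(1)[OF P]] sub])
  have linRP: "complex_linear (R t) \<and> complex_linear (P t)" if "t \<in> {a..b}" for t
    using lin[OF abS(1)[OF that]] projectionsD(2)[OF P abS(2)[OF that]] by blast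
  have frames: "\<exists>g l. eigenframe k g l (R t) (range (P t))" if "t \<in> {a..b}" for t
    by (rule eigenframe_exists[OF P abS(2)[OF that] abS(1)[OF that]]) (use \<eta>0(3) abS(3)[OF that] in blast)
  have "a \<le> b" using ab by simp
  obtain l f where l: "\<And>i. i < k \<Longrightarrow> continuous_on {a..b} (l i)"
    and f: "\<And>t. t \<in> {a..b} \<Longrightarrow> (\<forall>i<k. f t i \<noteq> 0 \<and> R t (f t i) = l i t *\<^sub>C f t i) \<and> range (P t) = range (\<lambda>u. \<Sum>i<k. u i *\<^sub>C f t i)"
    by (rule continuous_eigenvalues[OF \<open>a \<le> b\<close> contR contP linRP projectionsD(3)[OF P abS(2)] frames]) blast+
  have fP: "P t (f t i) = f t i" if t: "t \<in> {a..b}" and i: "i < k" for t i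
  proof -
    have "f t i = (\<Sum>j<k. (if j = i then 1 else 0) *\<^sub>C f t j)"
      using i by (simp add: if_distrib[of "\<lambda>c. c *\<^sub>C _"] scaleC_one cong: if_cong)
    then have "f t i \<in> range (\<lambda>u. \<Sum>i<k. u i *\<^sub>C f t i)"
      by (rule range_eqI[where x = "\<lambda>j. if j = i then 1 else 0"])
    then have "f t i \<in> range (P t)" using f[OF t] by simp
    then show ?thesis using range_projection[OF P abS(2)[OF t]] by simp
  qed
  have eq0: "\<exists>\<eta>>0. \<forall>t\<in>S \<inter> ball t0 \<eta>. l i t = l 0 t" if i: "i < k" for i
  proof (rule generic[OF ab(4)])
    show "continuous_on (S \<inter> ball t0 \<eta>1) (l i)" by (rule continuous_on_subset[OF l[OF i] ab(5)])
    show "continuous_on (S \<inter> ball t0 \<eta>1) (l 0)" by (rule continuous_on_subset[OF l[OF k] ab(5)])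
    show "\<exists>x. x \<noteq> 0 \<and> R t x = l i t *\<^sub>C x" if "t \<in> S \<inter> ball t0 \<eta>1" for t
      using f[OF subsetD[OF ab(5) that]] i by blast
    show "\<exists>x. x \<noteq> 0 \<and> R t x = l 0 t *\<^sub>C x" if "t \<in> S \<inter> ball t0 \<eta>1" for t
      using f[OF subsetD[OF ab(5) that]] k by blast
    fix p
    obtain C \<eta> where C: "\<eta> > 0" "\<forall>t\<in>S \<inter> ball t0 \<delta> \<inter> ball t0 \<eta>. \<forall>x. norm (R t (P t x) - \<tau> t *\<^sub>C P t x) \<le> C * \<bar>t - t0\<bar> ^ Suc p * norm x"
      using flat[of p] by blast
    have "cmod (l i t - l 0 t) \<le> (2 * C) * \<bar>t - t0\<bar> ^ Suc p" if t: "t \<in> S \<inter> ball t0 (min \<eta>1 \<eta>)" for t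
    proof -
      have tab: "t \<in> {a..b}" using t by (intro subsetD[OF ab(5)]) auto
      have b: "cmod (l j t - \<tau> t) \<le> C * \<bar>t - t0\<bar> ^ Suc p" if j: "j < k" for j
      proof -
        have "norm (R t (P t (f t j)) - \<tau> t *\<^sub>C P t (f t j)) \<le> C * \<bar>t - t0\<bar> ^ Suc p * norm (f t j)"
          using C(2) abS(2)[OF tab] t by auto
        moreover have "R t (P t (f t j)) - \<tau> t *\<^sub>C P t (f t j) = (l j t - \<tau> t) *\<^sub>C f t j"
          using f[OF tab] j by (simp add: fP[OF tab j] scaleC.diff_left)
        ultimately have "cmod (l j t - \<tau> t) * norm (f t j) \<le> C * \<bar>t - t0\<bar> ^ Suc p * norm (f t j)"
          by (simp only: norm_scaleC)
        then show ?thesis using f[OF tab] j by simp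
      qed
      have "cmod (l i t - l 0 t) \<le> cmod (l i t - \<tau> t) + cmod (l 0 t - \<tau> t)"
        using norm_triangle_ineq4[of "l i t - \<tau> t" "l 0 t - \<tau> t"] by simp
      then show ?thesis using b[OF i] b[OF k] by linarith
    qed
    then show "\<exists>C \<eta>. \<eta> > 0 \<and> (\<forall>t\<in>S \<inter> ball t0 \<eta>. cmod (l i t - l 0 t) \<le> C * \<bar>t - t0\<bar> ^ Suc p)"
      using ab(4) C(1) by (intro exI[of _ "2 * C"] exI[of _ "min \<eta>1 \<eta>"]) auto
  qed
  obtain \<eta>2 where \<eta>2: "\<eta>2 > 0" "\<forall>i<k. \<forall>t\<in>S \<inter> ball t0 \<eta>2. l i t = l 0 t"
    using finite_common_radius[where Q = "\<lambda>i t. l i t = l 0 t", OF eq0] by blast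
  have "\<exists>c. \<forall>x. R t (P t x) = c *\<^sub>C P t x" if t: "t \<in> S \<inter> ball t0 (min \<delta> (min \<eta>1 \<eta>2))" for t
  proof (intro exI allI)
    fix x
    have tab: "t \<in> {a..b}" using t by (intro subsetD[OF ab(5)]) auto
    have "t \<in> S \<inter> ball t0 \<eta>2" using t by auto
    then have tl: "l i t = l 0 t" if "i < k" for i using \<eta>2(2) that by blast
    have "P t x \<in> range (P t)" by blast
    then obtain u where u: "P t x = (\<Sum>i<k. u i *\<^sub>C f t i)" using f[OF tab] by auto
    have "R t (P t x) = (\<Sum>i<k. u i *\<^sub>C R t (f t i))"
      unfolding u complex_linear_simps[OF conjunct1[OF linRP[OF tab]]] by (rule refl)
    also have "\<dots> = (\<Sum>i<k. l 0 t *\<^sub>C (u i *\<^sub>C f t i))"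
    proof (intro sum.cong refl)
      fix i assume "i \<in> {..<k}"
      then have i: "i < k" by simp
      have "R t (f t i) = l 0 t *\<^sub>C f t i" using f[OF tab] i unfolding tl[OF i, symmetric] by blast
      then show "u i *\<^sub>C R t (f t i) = l 0 t *\<^sub>C (u i *\<^sub>C f t i)" by (simp only: scaleC_scaleC mult.commute)
    qed
    also have "\<dots> = l 0 t *\<^sub>C P t x" unfolding u by (simp add: scaleC.sum_right)
    finally show "R t (P t x) = l 0 t *\<^sub>C P t x" .
  qed
  then show ?thesis using d ab(4) \<eta>2(1) by (intro exI[of _ "min \<delta> (min \<eta>1 \<eta>2)"]) auto
qed

lemma proper_subspace_basis:
  assumes B: "orthonormal_basis B W" and W1: "complex_vector.subspace W1" "W1 \<subseteq> W" and y: "y \<in> W" "y \<notin> W1"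
  obtains B1 where "orthonormal_basis B1 W1" "card B1 < card B"
proof -
  have fin: "finite B" and span: "complex_vector.span B = W" using B by (auto simp: orthonormal_basis_def)
  have "W1 \<subseteq> complex_vector.span B" using W1(2) span by simp
  then obtain B1 where B1: "orthonormal_basis B1 W1"
    using orthonormal_basis_of_subspace[OF W1(1) _ fin] by metis
  then have fin1: "finite B1" and ind: "complex_vector.independent B1" and span1: "complex_vector.span B1 = W1"
    using orthonormal_independent by (auto simp: orthonormal_basis_def)
  have sub: "B1 \<subseteq> W1" using orthonormal_basis_in[OF B1] by blast
  have "y \<notin> B1" using sub y(2) by blast
  moreover have "complex_vector.independent (insert y B1)"
    using ind y(2) span1 by (simp add: complex_vector.independent_insert)
  moreover have "insert y B1 \<subseteq> complex_vector.span B" using y(1) sub W1(2) span by auto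
  ultimately have "card B1 < card B"
    using complex_vector.independent_span_bound[OF fin, of "insert y B1"] fin1 by simp
  with B1 show ?thesis by (rule that)
qed

text \<open>The strong induction also generalises over the projections and the radius, because every
  splitting shrinks the neighbourhood.\<close>

theorem parameterized_exists:
  fixes P :: "real \<Rightarrow> 'h \<Rightarrow>\<^sub>L 'h" and \<mu>0 :: complex
  assumes "projections (S \<inter> ball t0 \<delta>) P" "\<delta> > 0" "orthonormal_basis B (range (P t0))"
    "\<forall>x\<in>range (P t0). R t0 x = \<mu>0 *\<^sub>C x"
  shows "\<exists>\<eta>>0. \<eta> \<le> \<delta> \<and> parameterized \<eta> P"
  using assms
proof (induction "card B" arbitrary: B P \<delta> rule: less_induct)
  case less
  note P = less.prems(1) and d = less.prems(2) and B = less.prems(3) and eig = less.prems(4)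
  let ?U = "S \<inter> ball t0 \<delta>" and ?W = "range (P t0)"
  define k where "k = card B"
  have t0U: "t0 \<in> ?U" using S d by simp
  obtain v where v: "v ` {..<k} = B" "\<And>i j. i < k \<Longrightarrow> j < k \<Longrightarrow> cinner (v i) (v j) = (if i = j then 1 else 0)"
    "?W = range (\<lambda>u. \<Sum>i<k. u i *\<^sub>C v i)"
    unfolding k_def by (rule orthonormal_basis_index[OF B]) blast
  have vb: "indexed_basis k v ?W" by (rule orthonormal_index_basis[OF v(2,3)])
  show ?case
  proof (cases "k = 0")
    case True
    obtain \<eta> where \<eta>: "\<eta> > 0" "\<eta> \<le> \<delta>" "\<forall>t\<in>S \<inter> ball t0 \<eta>. indexed_basis k (\<lambda>i. P t (v i)) (range (P t))"
      using projection_basis[OF P d vb] by blast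
    have "parameterized \<eta> P" unfolding parameterized_def
      by (intro exI[of _ k] exI[of _ "\<lambda>i t. 0"] exI[of _ "\<lambda>i t. P t (v i)"]) (use \<eta>(3) True in simp)
    then show ?thesis using \<eta> by blast
  next
    case False
    then have k: "k > 0" by simp
    define v0 where "v0 = v 0"
    have v0: "cinner v0 v0 = 1" "v0 \<in> ?W" "v0 \<noteq> 0"
    proof -
      show 1: "cinner v0 v0 = 1" using v(2)[OF k k] by (simp add: v0_def)
      have "v0 \<in> B" using v(1) k by (auto simp: v0_def)
      then show "v0 \<in> ?W" by (rule orthonormal_basis_in[OF B])
      show "v0 \<noteq> 0" using 1 by auto
    qed
    have Pv0: "P t0 v0 = v0" using v0(2) range_projection[OF P t0U] by simp
    have evl: "bounded_linear (\<lambda>X :: 'h \<Rightarrow>\<^sub>L 'h. cinner (X v0) v0)"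
      by (rule bounded_linear_compose[OF cinner.bounded_linear_left blinfun.bounded_linear_left])
    \<comment> \<open>Denominator of \<tau>. It is 1 at \<open>t0\<close> since \<open>v0\<close> is
      a unit vector of the range; the ball is shrunk until |\<phi>| \<ge> 1/2, which keeps the
      inverse regular.\<close>
    define \<phi> where "\<phi> t = cinner (P t v0) v0" for t
    have reg\<phi>: "regular an ?U \<phi>" unfolding \<phi>_def by (rule regular_linear[OF evl projectionsD(1)[OF P]])
    have \<phi>0: "\<phi> t0 = 1" by (simp add: \<phi>_def Pv0 v0(1))
    have "(1/2::real) > 0" by simp
    then obtain d1 where d1: "d1 > 0" "\<And>t. t \<in> ?U \<Longrightarrow> dist t t0 < d1 \<Longrightarrow> dist (\<phi> t) (\<phi> t0) < 1 / 2"
      using regular_continuous[OF reg\<phi>] t0U unfolding continuous_on_iff by blast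
    define \<delta>1 where "\<delta>1 = min \<delta> d1"
    let ?U1 = "S \<inter> ball t0 \<delta>1"
    have \<delta>1: "\<delta>1 > 0" "\<delta>1 \<le> \<delta>" "?U1 \<subseteq> ?U" using d d1(1) by (auto simp: \<delta>1_def)
    have t01: "t0 \<in> ?U1" using S \<delta>1 by simp
    have \<phi>ge: "1 / 2 \<le> cmod (\<phi> t)" if "t \<in> ?U1" for t
    proof -
      have "dist (\<phi> t) 1 < 1 / 2" using d1(2)[of t] that \<phi>0 by (auto simp: \<delta>1_def dist_commute)
      then show ?thesis using norm_triangle_ineq2[of 1 "\<phi> t"] by (simp add: dist_norm norm_minus_commute)
    qed
    have \<phi>ne: "\<phi> t \<noteq> 0" if "t \<in> ?U1" for t using \<phi>ge[OF that] by auto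
    have reg\<phi>': "regular an ?U1 (\<lambda>t. inverse (\<phi> t))"
    proof (rule mult_product.regular_inverse[OF regular_subset[OF reg\<phi> \<delta>1(3)]])
      show "norm (inverse (\<phi> t)) \<le> 2" if "t \<in> ?U1" for t
      proof -
        have "inverse (cmod (\<phi> t)) \<le> inverse (1 / 2)" by (rule le_imp_inverse_le[OF \<phi>ge[OF that]]) simp
        then show ?thesis by (simp add: norm_inverse)
      qed
    qed (use \<phi>ne in auto)
    have P1: "projections ?U1 P" by (rule projections_subset[OF P \<delta>1(3)])
    have SU1: "t \<in> S" if "t \<in> ?U1" for t using that by blast
    have reg1: "regular an ?U1 R" by (rule regular_subset[OF reg]) blast
    have regP: "regular an ?U1 P" by (rule projectionsD(1)[OF P1])
    have regRP: "regular an ?U1 (\<lambda>t. R t o\<^sub>L P t)" by (rule blinfun_product.regular_bilinear[OF reg1 regP])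
    \<comment> \<open>A quotient of compressions to \<open>v0\<close>: if R P = c P, then \<tau> =
      c. It also makes the entry of \<open>T\<close> at (v0, v0) vanish. The quotient
      \<open>Q\<close> inherits this, so Q(t0) cannot be a nonzero scalar on the range.\<close>
    define \<tau> where "\<tau> t = cinner (R t (P t v0)) v0 * inverse (\<phi> t)" for t
    have reg\<tau>: "regular an ?U1 \<tau>"
      unfolding \<tau>_def using regular_linear[OF evl regRP]
      by (intro mult_product.regular_bilinear reg\<phi>') simp
    define T where "T t = (R t o\<^sub>L P t) - (scalar_op (\<tau> t) o\<^sub>L P t)" for t
    have T: "T t x = R t (P t x) - \<tau> t *\<^sub>C P t x" for t x by (simp add: T_def blinfun.diff_left)
    have regT: "regular an ?U1 T"
      unfolding T_def
      by (intro regular_diff regRP blinfun_product.regular_bilinear regP regular_linear[OF bounded_linear_scalar_op reg\<tau>])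
    have \<tau>0: "\<tau> t0 = \<mu>0"
      using bspec[OF eig v0(2)] v0(1) by (simp only: \<tau>_def Pv0 \<phi>0 cinner_scaleC_left inverse_1 mult_1_right)
    have T0: "T t0 = 0"
      by (rule blinfun_eqI) (use eig in \<open>simp add: T \<tau>0\<close>)
    obtain D where D: "\<And>t. t \<in> ?U1 \<Longrightarrow> D 0 t = T t" "regular_derivs an ?U1 D"
      using regT unfolding regular_def by blast
    have conv1: "convex ?U1"
      by (intro convex_Int is_interval_convex[OF S(1)] convex_ball)
    have scalar_case: ?thesis if "\<eta> > 0" "\<eta> \<le> \<delta>1" and sc: "\<And>t x. t \<in> S \<inter> ball t0 \<eta> \<Longrightarrow> R t (P t x) = \<tau> t *\<^sub>C P t x" for \<eta>
    proof -
      have sub: "S \<inter> ball t0 \<eta> \<subseteq> ?U1" using that(2) by auto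
      have "\<exists>\<eta>'>0. \<eta>' \<le> \<eta> \<and> parameterized \<eta>' P"
        by (rule parameterized_scalar[OF projections_subset[OF P1 sub] that(1) vb regular_subset[OF reg\<tau> sub] sc])
      then show ?thesis using that(2) \<delta>1(2) by (meson order_trans)
    qed
    show ?thesis
    proof (cases "S = {t0}")
      case True
      show ?thesis
      proof (rule scalar_case[OF \<delta>1(1) order_refl])
        fix t x assume "t \<in> S \<inter> ball t0 \<delta>1"
        then have "t = t0" using True by blast
        then show "R t (P t x) = \<tau> t *\<^sub>C P t x" using T[of t0 x] T0 by simp
      qed
    next
      case nondeg: False
      show ?thesis
      proof (cases "\<forall>m. D m t0 = 0")
        case True
        have "\<exists>\<eta>>0. \<eta> \<le> \<delta>1 \<and> (\<forall>t\<in>S \<inter> ball t0 \<eta>. \<exists>c. \<forall>x. R t (P t x) = c *\<^sub>C P t x)"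
        proof (rule flat_imp_scalar[OF P1 \<delta>1(1) vb k])
          fix p
          have dD: "derivs ?U1 D" using D(2) by (simp add: regular_derivs_def)
          obtain K \<eta> where K: "\<eta> > 0" "K > 0" "\<And>x. x \<in> ?U1 \<inter> ball t0 \<eta> \<Longrightarrow> norm (D (Suc p) x) \<le> K"
            by (rule derivs_locally_bounded[OF dD t01, of "Suc p"]) blast
          have "norm (R t (P t x) - \<tau> t *\<^sub>C P t x) \<le> (K / fact p) * \<bar>t - t0\<bar> ^ Suc p * norm x"
            if t: "t \<in> ?U1 \<inter> ball t0 \<eta>" for t x
          proof -
            have seg: "closed_segment t0 t \<subseteq> ?U1 \<inter> ball t0 \<eta>"
            proof (rule closed_segment_subset[OF _ t convex_Int[OF conv1 convex_ball]])
              show "t0 \<in> ?U1 \<inter> ball t0 \<eta>" using t01 K(1) by simp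
            qed
            have "norm (D 0 t - (\<Sum>k\<le>p. ((t - t0) ^ k / fact k) *\<^sub>R D k t0)) \<le> K * \<bar>t - t0\<bar> ^ Suc p / fact p"
              by (rule taylor_bound[OF dD]) (use seg K(3) in blast)+
            then have "norm (T t) \<le> (K / fact p) * \<bar>t - t0\<bar> ^ Suc p" using True D(1)[of t] t by simp
            then have "norm (T t) * norm x \<le> (K / fact p) * \<bar>t - t0\<bar> ^ Suc p * norm x" by (rule mult_right_mono) simp
            then show ?thesis using norm_blinfun[of "T t" x] unfolding T by linarith
          qed
          then show "\<exists>C \<eta>. \<eta> > 0 \<and> (\<forall>t\<in>?U1 \<inter> ball t0 \<eta>. \<forall>x. norm (R t (P t x) - \<tau> t *\<^sub>C P t x) \<le> C * \<bar>t - t0\<bar> ^ Suc p * norm x)"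
            using K(1) by blast
        qed
        then obtain \<eta> where \<eta>: "\<eta> > 0" "\<eta> \<le> \<delta>1" "\<forall>t\<in>S \<inter> ball t0 \<eta>. \<exists>c. \<forall>x. R t (P t x) = c *\<^sub>C P t x" by blast
        show ?thesis
        proof (rule scalar_case[OF \<eta>(1,2)])
          fix t x assume t: "t \<in> S \<inter> ball t0 \<eta>"
          then obtain c where c: "\<And>x. R t (P t x) = c *\<^sub>C P t x" using \<eta>(3) by blast
          have "t \<in> ?U1" using t \<eta>(2) by auto
          then have "\<tau> t = c" using \<phi>ne[of t] unfolding \<tau>_def c by (simp add: cinner_scaleC_left \<phi>_def)
          then show "R t (P t x) = \<tau> t *\<^sub>C P t x" using c by simp
        qed
      next
        case False
        define m where "m = (LEAST m. D m t0 \<noteq> 0)"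
        have m: "D m t0 \<noteq> 0" "\<And>j. j < m \<Longrightarrow> D j t0 = 0"
          unfolding m_def using False by (metis (mono_tags, lifting) LeastI_ex) (metis (mono_tags, lifting) not_less_Least)
        obtain E where E: "regular_derivs an ?U1 E" "\<forall>t\<in>?U1. D 0 t = (t - t0) ^ m *\<^sub>R E 0 t" "E 0 t0 = 0 \<longleftrightarrow> D m t0 = 0"
          using regular_divide_power[OF D(2) conv1 t01 m(2)] by blast
        define Q where "Q = E 0"
        have Q0: "Q t0 \<noteq> 0" using E(3) m(1) by (simp add: Q_def)
        have regQ: "regular an ?U1 Q" by (rule regularI[OF E(1)]) (simp add: Q_def)
        have lim: "t0 islimpt ?U1" by (rule interval_islimpt[OF S nondeg \<delta>1(1)])
        note cont = regular_continuous[OF regQ] regular_continuous[OF regP] regular_continuous[OF reg1]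
        have Qt: "Q t x = (1 / (t - t0) ^ m) *\<^sub>R (R t (P t x) - \<tau> t *\<^sub>C P t x)" if "t \<in> ?U1" "t \<noteq> t0" for t x
        proof -
          have "T t = (t - t0) ^ m *\<^sub>R Q t" using E(2) D(1) that(1) by (simp add: Q_def)
          then have "Q t = (1 / (t - t0) ^ m) *\<^sub>R T t" using that(2) by simp
          then show ?thesis by (simp add: blinfun.scaleR_left T)
        qed
        note PD = projectionsD(2)[OF P1] projectionsD(3)[OF P1] projectionsD(4)[OF P1]
        have linear1: "P t (c *\<^sub>C x) = c *\<^sub>C P t x" "R t (c *\<^sub>C x) = c *\<^sub>C R t x" if "t \<in> ?U1" for t c x
          using complex_linear_simps(1)[OF PD(1)[OF that]] complex_linear_simps(1)[OF lin[OF SU1[OF that]]] by auto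
        note blcont = bounded_bilinear.continuous_on[OF bounded_bilinear_blinfun_apply]
        have linQ: "complex_linear (Q t)" if t: "t \<in> ?U1" for t
          unfolding complex_linear_def
        proof (intro allI)
          fix c x
          have "Q t (c *\<^sub>C x) - c *\<^sub>C Q t x \<in> {0}"
          proof (rule closed_extension[where f = "\<lambda>t. Q t (c *\<^sub>C x) - c *\<^sub>C Q t x", OF t01 lim _ _ _ t])
            show "continuous_on ?U1 (\<lambda>t. Q t (c *\<^sub>C x) - c *\<^sub>C Q t x)"
              by (intro continuous_on_diff blcont scaleC.continuous_on cont continuous_on_const)
            show "Q t (c *\<^sub>C x) - c *\<^sub>C Q t x \<in> {0}" if "t \<in> ?U1" "t \<noteq> t0" for t
              unfolding Qt[OF that]
              by (simp add: linear1[OF that(1)] scaleC_scaleC mult.commute scaleC.diff_right scaleC.scaleR_right)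
          qed simp
          then show "Q t (c *\<^sub>C x) = c *\<^sub>C Q t x" by simp
        qed
        have PQ: "P t (Q t x) = Q t x" and QP: "Q t (P t x) = Q t x" and RQ: "R t (Q t x) = Q t (R t x)"
          if t: "t \<in> ?U1" for t x
        proof -
          have "P t (Q t x) - Q t x \<in> {0}"
          proof (rule closed_extension[where f = "\<lambda>t. P t (Q t x) - Q t x", OF t01 lim _ _ _ t])
            show "continuous_on ?U1 (\<lambda>t. P t (Q t x) - Q t x)"
              by (intro continuous_on_diff blcont cont continuous_on_const)
            show "P t (Q t x) - Q t x \<in> {0}" if "t \<in> ?U1" "t \<noteq> t0" for t
              unfolding Qt[OF that]
              by (simp add: blinfun.scaleR_right blinfun.diff_right linear1[OF that(1)] PD(2)[OF that(1)] flip: PD(3)[OF that(1)])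
          qed simp
          then show "P t (Q t x) = Q t x" by simp
          have "Q t (P t x) - Q t x \<in> {0}"
          proof (rule closed_extension[where f = "\<lambda>t. Q t (P t x) - Q t x", OF t01 lim _ _ _ t])
            show "continuous_on ?U1 (\<lambda>t. Q t (P t x) - Q t x)"
              by (intro continuous_on_diff blcont cont continuous_on_const)
            show "Q t (P t x) - Q t x \<in> {0}" if "t \<in> ?U1" "t \<noteq> t0" for t
              unfolding Qt[OF that] by (simp add: PD(2)[OF that(1)])
          qed simp
          then show "Q t (P t x) = Q t x" by simp
          have "R t (Q t x) - Q t (R t x) \<in> {0}"
          proof (rule closed_extension[where f = "\<lambda>t. R t (Q t x) - Q t (R t x)", OF t01 lim _ _ _ t])
            show "continuous_on ?U1 (\<lambda>t. R t (Q t x) - Q t (R t x))"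
              by (intro continuous_on_diff blcont cont continuous_on_const)
            show "R t (Q t x) - Q t (R t x) \<in> {0}" if "t \<in> ?U1" "t \<noteq> t0" for t
              unfolding Qt[OF that]
              by (simp add: blinfun.scaleR_right blinfun.diff_right linear1[OF that(1)] flip: PD(3)[OF that(1)])
          qed simp
          then show "R t (Q t x) = Q t (R t x)" by simp
        qed
        have Qv0: "cinner (Q t0 v0) v0 = 0"
        proof -
          have "cinner (Q t0 v0) v0 \<in> {0}"
          proof (rule closed_extension[where f = "\<lambda>t. cinner (Q t v0) v0", OF t01 lim _ _ _ t01])
            show "continuous_on ?U1 (\<lambda>t. cinner (Q t v0) v0)"
              by (intro cinner.continuous_on blcont cont continuous_on_const)
            show "cinner (Q t v0) v0 \<in> {0}" if "t \<in> ?U1" "t \<noteq> t0" for t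
            proof -
              have "\<tau> t * \<phi> t = cinner (R t (P t v0)) v0" using \<phi>ne[OF that(1)] by (simp add: \<tau>_def)
              then show ?thesis
                unfolding Qt[OF that] by (simp add: cinner.scaleR_left cinner_diff_left cinner_scaleC_left \<phi>_def)
            qed
          qed simp
          then show ?thesis by simp
        qed
        have pnQ: "paranormal_on ?W (Q t0)"
          unfolding paranormal_on_def
        proof (intro allI ballI)
          fix c x assume "x \<in> ?W"
          then have Px: "P t0 x = x" using range_projection[OF P1 t01] by simp
          define a where "a t = Q t (P t x) - c *\<^sub>C P t x" for t
          define b where "b t = Q t (a t) - c *\<^sub>C a t" for t
          have ca: "continuous_on ?U1 a" unfolding a_def
            by (intro continuous_on_diff blcont scaleC.continuous_on cont continuous_on_const)
          have cb: "continuous_on ?U1 b" unfolding b_def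
            by (intro continuous_on_diff blcont scaleC.continuous_on cont continuous_on_const ca)
          have "norm (b t0) * norm (P t0 x) - (norm (a t0))\<^sup>2 \<in> {0..}"
          proof (rule closed_extension[where f = "\<lambda>t. norm (b t) * norm (P t x) - (norm (a t))\<^sup>2", OF t01 lim _ _ _ t01])
            show "continuous_on ?U1 (\<lambda>t. norm (b t) * norm (P t x) - (norm (a t))\<^sup>2)"
              by (intro continuous_on_diff continuous_on_mult continuous_on_norm continuous_on_power blcont ca cb cont continuous_on_const)
            show "norm (b t) * norm (P t x) - (norm (a t))\<^sup>2 \<in> {0..}" if t: "t \<in> ?U1" "t \<noteq> t0" for t
            proof -
              define q where "q = 1 / (t - t0) ^ m"
              have q: "q \<noteq> 0" using t by (simp add: q_def)
              \<comment> \<open>On the range of P(t) one has Q - c = q (R - c') with real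
                \<open>q\<close>, so both sides of the inequality for \<open>Q\<close> are q^2 times
                those for \<open>R\<close>.\<close>
              define c' where "c' = \<tau> t + c / complex_of_real q"
              have cq: "c *\<^sub>C z = q *\<^sub>R ((c / complex_of_real q) *\<^sub>C z)" for z :: 'h
                using q by (simp add: scaleR_scaleC scaleC_scaleC)
              have Qy: "Q t y - c *\<^sub>C y = q *\<^sub>R (R t y - c' *\<^sub>C y)" if "P t y = y" for y
                unfolding Qt[OF t] q_def[symmetric] that
                by (subst cq) (simp add: c'_def scaleC.add_left scaleR_diff_right scaleR_add_right)
              define y where "y = P t x"
              have y: "P t y = y" by (simp add: y_def PD(2)[OF t(1)])
              define w where "w = R t y - c' *\<^sub>C y"
              have a: "a t = q *\<^sub>R (R t y - c' *\<^sub>C y)" unfolding a_def y_def[symmetric] by (rule Qy[OF y])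
              have "P t (R t y - c' *\<^sub>C y) = R t y - c' *\<^sub>C y"
                using PD(3)[OF t(1), of y] by (simp add: blinfun.diff_right linear1[OF t(1)] y)
              then have "P t (a t) = a t" by (simp add: a blinfun.scaleR_right)
              then have "b t = q *\<^sub>R (R t (a t) - c' *\<^sub>C a t)" unfolding b_def by (rule Qy)
              also have "\<dots> = q *\<^sub>R q *\<^sub>R (R t w - c' *\<^sub>C w)"
                unfolding a w_def[symmetric] by (simp only: blinfun.scaleR_right scaleC.scaleR_right scaleR_diff_right)
              finally have "norm (b t) = q\<^sup>2 * norm (R t w - c' *\<^sub>C w)"
                by (simp only: norm_scaleR power2_eq_square mult.assoc[symmetric] abs_mult_self_eq)
              moreover have "(norm (a t))\<^sup>2 = q\<^sup>2 * (norm (R t y - c' *\<^sub>C y))\<^sup>2"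
                unfolding a norm_scaleR power_mult_distrib power2_abs by (rule refl)
              moreover have "(norm (R t y - c' *\<^sub>C y))\<^sup>2 \<le> norm (R t (R t y - c' *\<^sub>C y) - c' *\<^sub>C (R t y - c' *\<^sub>C y)) * norm y"
                using paranormal[OF SU1[OF t(1)]] unfolding paranormal_on_def by blast
              ultimately show ?thesis
                unfolding y_def[symmetric] w_def[symmetric] atLeast_iff diff_ge_0_iff_ge mult.assoc
                by (simp only: mult.assoc mult_left_mono zero_le_power2)
            qed
          qed simp
          then show "(norm (Q t0 x - c *\<^sub>C x))\<^sup>2 \<le> norm (Q t0 (Q t0 x - c *\<^sub>C x) - c *\<^sub>C (Q t0 x - c *\<^sub>C x)) * norm x"
            by (simp add: b_def a_def Px)
        qed
        have QW: "\<forall>x\<in>?W. Q t0 x \<in> ?W" using PQ[OF t01] range_projection[OF P1 t01] by blast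
        obtain c y where y: "y \<in> ?W" "y \<noteq> 0" "Q t0 y = c *\<^sub>C y"
          by (rule eigenvector_exists[OF B linQ[OF t01] _ v0(2,3)]) (use QW in blast)+
        define Y0 where "Y0 = Q t0 - scalar_op c"
        have Y0: "Y0 x = Q t0 x - c *\<^sub>C x" for x by (simp add: Y0_def blinfun.diff_left)
        note sp = eigenspace_splitting[OF B linQ[OF t01] QW pnQ, where c = c, folded Y0_def]
        have PW: "P t0 x = x" if "x \<in> ?W" for x using that range_projection[OF P1 t01] by simp
        have W: "complex_vector.subspace ?W" by (rule subspace_range[OF PD(1)[OF t01]])
        let ?R = "blinfun_apply Y0 ` ?W"
        have RW: "?R \<subseteq> ?W" using sp(2) by blast
        have PY0: "P t0 (Y0 x) = Y0 x" if "x \<in> ?W" for x by (rule PW[OF sp(2)[OF that]])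
        have finB: "finite B" "complex_vector.span B = ?W" using B by (auto simp: orthonormal_basis_def)
        obtain B' where B': "orthonormal_basis B' ?R"
          using orthonormal_basis_of_subspace[OF sp(3) _ finB(1)] RW finB(2) by metis
        have "\<exists>K. \<forall>x\<in>?R. norm x \<le> K * norm (Y0 x)"
          by (rule finite_dim_bounded_below[OF B' sp(1) _ sp(4)]) (use RW in blast)+
        then obtain K where K: "\<And>x. x \<in> ?R \<Longrightarrow> norm x \<le> K * norm (Y0 x)" by blast
        \<comment> \<open>Q - c on the range of \<open>P\<close>, continued by the identity on the
          complement. Without this continuation the operator for c = 0 would vanish on the
          complement too, since Q = Q P.\<close>
        define Y where "Y t = ((Q t - scalar_op c) o\<^sub>L P t) + (id_blinfun - P t)" for t
        have Y: "Y t x = Q t (P t x) - c *\<^sub>C P t x + (x - P t x)" for t x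
          by (simp add: Y_def blinfun.add_left blinfun.diff_left)
        have Yt0: "Y t0 x = Y0 (P t0 x) + (x - P t0 x)" for x by (simp add: Y Y0)
        have regY: "regular an ?U1 Y"
          unfolding Y_def
          by (intro regular_add regular_diff regular_const blinfun_product.regular_bilinear regQ regP)
        have PP: "P t0 (x - P t0 x) = 0" for x by (simp add: blinfun.diff_right PD(2)[OF t01])
        have YY: "Y t0 (Y t0 x) = Y0 (Y0 (P t0 x)) + (x - P t0 x)" and PYY: "P t0 (Y t0 (Y t0 x)) = Y0 (Y0 (P t0 x))" for x
        proof -
          have "P t0 (Y t0 x) = Y0 (P t0 x)" unfolding Yt0 by (simp add: blinfun.add_right PP PY0)
          then show 1: "Y t0 (Y t0 x) = Y0 (Y0 (P t0 x)) + (x - P t0 x)"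
            unfolding Yt0[of "Y t0 x"] by (simp add: Yt0[of x])
          show "P t0 (Y t0 (Y t0 x)) = Y0 (Y0 (P t0 x))"
            unfolding 1 using sp(2)[of "P t0 x"] by (simp add: blinfun.add_right PP PY0)
        qed
        \<comment> \<open>Both parts of Y(t0) x are recovered from Y(t0)^2 x: its projection is Y0
          of the first part, where \<open>Y0\<close> is bounded below on its image, and the second
          part is the remainder.\<close>
        have below: "norm (Y t0 x) \<le> (\<bar>K\<bar> * norm (P t0) + 1 + norm (P t0)) * norm (Y t0 (Y t0 x))" for x
        proof -
          let ?w = "Y0 (P t0 x)" and ?u = "Y t0 (Y t0 x)"
          have nP: "norm (Y0 ?w) \<le> norm (P t0) * norm ?u" using norm_blinfun[of "P t0" ?u] by (simp add: PYY)
          have "norm ?w \<le> K * norm (Y0 ?w)" by (rule K) blast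
          also have "\<dots> \<le> \<bar>K\<bar> * (norm (P t0) * norm ?u)" using nP by (intro mult_mono) auto
          finally have 1: "norm ?w \<le> \<bar>K\<bar> * (norm (P t0) * norm ?u)" .
          have "x - P t0 x = ?u - Y0 ?w" by (simp add: YY)
          then have 2: "norm (x - P t0 x) \<le> norm ?u + norm (P t0) * norm ?u"
            using norm_triangle_ineq4[of ?u "Y0 ?w"] nP by simp
          have "norm (Y t0 x) \<le> norm ?w + norm (x - P t0 x)" unfolding Yt0[of x] by (rule norm_triangle_ineq)
          then show ?thesis using 1 2 by (simp add: algebra_simps)
        qed
        have range: "\<exists>u. Y t0 x = Y t0 (Y t0 u)" for x
        proof -
          obtain w where w: "w \<in> ?R" "Y0 (P t0 x) = Y0 w" using sp(5)[of "P t0 x"] by blast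
          then obtain b where b: "b \<in> ?W" "w = Y0 b" by blast
          have "P t0 (b + (x - P t0 x)) = b" by (simp add: blinfun.add_right PP PW[OF b(1)])
          then have "Y t0 (Y t0 (b + (x - P t0 x))) = Y0 (Y0 b) + (x - P t0 x)" by (simp add: YY)
          then show ?thesis using w b by (intro exI[of _ "b + (x - P t0 x)"]) (simp add: Yt0)
        qed
        obtain Z :: "'h \<Rightarrow>\<^sub>L 'h" where Z: "\<And>x. Y t0 (Z x) = Z (Y t0 x)" "\<And>x. Y t0 (Z (Y t0 x)) = Y t0 x"
          "\<And>x. Z (Y t0 (Z x)) = Z x"
          by (rule group_inverse_exists[of "Y t0", OF below range]) blast
        obtain s \<delta>2 :: real and Pr :: "real \<Rightarrow> 'h \<Rightarrow>\<^sub>L 'h" where Pr: "\<delta>2 > 0" "regular an (?U1 \<inter> ball t0 \<delta>2) Pr"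
          "\<And>x. Pr t0 x = x - Y t0 (Z x)"
          "\<And>t x. t \<in> ?U1 \<inter> ball t0 \<delta>2 \<Longrightarrow> Pr t (Pr t x) = Pr t x"
          "\<And>t C. t \<in> ?U1 \<inter> ball t0 \<delta>2 \<Longrightarrow> C o\<^sub>L Y t = Y t o\<^sub>L C \<Longrightarrow> C o\<^sub>L Pr t = Pr t o\<^sub>L C"
          by (rule regular_dichotomy[OF regY t01 Z]) blast
        define \<delta>3 where "\<delta>3 = min \<delta>1 \<delta>2"
        let ?U3 = "S \<inter> ball t0 \<delta>3"
        have \<delta>3: "\<delta>3 > 0" "\<delta>3 \<le> \<delta>1" "?U3 \<subseteq> ?U1 \<inter> ball t0 \<delta>2" "?U3 \<subseteq> ?U1"
          using \<delta>1(1) Pr(1) by (auto simp: \<delta>3_def)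
        have comm: "C (Pr t x) = Pr t (C x)" if t: "t \<in> ?U3" and C: "\<And>x. C (Y t x) = Y t (C x)" for t x and C :: "'h \<Rightarrow>\<^sub>L 'h"
        proof -
          have "C o\<^sub>L Y t = Y t o\<^sub>L C" by (rule blinfun_eqI) (simp add: C)
          from Pr(5)[OF subsetD[OF \<delta>3(3) t] this]
          have "blinfun_apply (C o\<^sub>L Pr t) x = blinfun_apply (Pr t o\<^sub>L C) x" by simp
          then show ?thesis by simp
        qed
        have PrP: "P t (Pr t x) = Pr t (P t x)" and PrR: "R t (Pr t x) = Pr t (R t x)" and Prlin: "c *\<^sub>C Pr t x = Pr t (c *\<^sub>C x)"
          if t: "t \<in> ?U3" for t x c
        proof -
          have t1: "t \<in> ?U1" using t \<delta>3(4) by blast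
          show "P t (Pr t x) = Pr t (P t x)"
            by (rule comm[OF t]) (simp add: Y blinfun.add_right blinfun.diff_right PD(2)[OF t1] PQ[OF t1] linear1[OF t1])
          show "R t (Pr t x) = Pr t (R t x)"
            by (rule comm[OF t]) (simp add: Y blinfun.add_right blinfun.diff_right PD(3)[OF t1] RQ[OF t1] linear1[OF t1])
          have "scalar_op c (Pr t x) = Pr t (scalar_op c x)"
          proof (rule comm[OF t])
            show "scalar_op c (Y t x) = Y t (scalar_op c x)" for x
              using complex_linear_simps(1)[OF linQ[OF t1]]
              by (simp add: Y linear1[OF t1] scaleC_add_right scaleC.diff_right scaleC_scaleC mult.commute)
          qed
          then show "c *\<^sub>C Pr t x = Pr t (c *\<^sub>C x)" by simp
        qed
        note PrPr = Pr(4)[OF subsetD[OF \<delta>3(3)]]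
        note P3 = PD(2)[OF subsetD[OF \<delta>3(4)]] PD(3)[OF subsetD[OF \<delta>3(4)]] linear1[OF subsetD[OF \<delta>3(4)]]
        define P1' where "P1' t = Pr t o\<^sub>L P t" for t
        define P2' where "P2' t = P t - (Pr t o\<^sub>L P t)" for t
        have P1': "P1' t x = Pr t (P t x)" and P2': "P2' t x = P t x - Pr t (P t x)" for t x
          by (simp_all add: P1'_def P2'_def blinfun.diff_left)
        have regPr: "regular an ?U3 Pr" by (rule regular_subset[OF Pr(2) \<delta>3(3)])
        have regP3: "regular an ?U3 P" by (rule regular_subset[OF regP \<delta>3(4)])
        have proj1: "projections ?U3 P1'"
          unfolding projections_def complex_linear_def
        proof (intro conjI ballI allI)
          show "regular an ?U3 P1'" unfolding P1'_def
            by (intro blinfun_product.regular_bilinear regPr regP3)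
        qed (simp_all add: P1' P3 PrPr PrP PrR Prlin)
        have proj2: "projections ?U3 P2'"
          unfolding projections_def complex_linear_def
        proof (intro conjI ballI allI)
          show "regular an ?U3 P2'" unfolding P2'_def
            by (intro regular_diff blinfun_product.regular_bilinear regPr regP3)
        qed (simp_all add: P2' P3 PrPr PrP PrR Prlin blinfun.diff_right scaleC.diff_right)
        have sum: "P t x = P1' t x + P2' t x" for t x by (simp add: P1' P2')
        have prod: "P1' t (P2' t x) = 0 \<and> P2' t (P1' t x) = 0" if t: "t \<in> ?U3" for t x
          by (simp add: P1' P2' blinfun.diff_right P3[OF t] PrPr[OF t] PrP[OF t])
        have t03: "t0 \<in> ?U3" using S \<delta>3(1) by simp
        have range1: "range (P1' t0) \<subseteq> ?W" and range2: "range (P2' t0) \<subseteq> ?W"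
          using PrP[OF t03] P3(1)[OF t03] PrPr[OF t03]
          by (auto simp: range_projection[OF P1 t01] P1' P2' blinfun.diff_right)
        have lin1: "complex_vector.subspace (range (P1' t0))" and lin2: "complex_vector.subspace (range (P2' t0))"
          by (rule subspace_range[OF projectionsD(2)[OF proj1 t03]], rule subspace_range[OF projectionsD(2)[OF proj2 t03]])
        \<comment> \<open>The eigenvector \<open>y\<close> is killed by the second projection and Y0
          w, found below, by the first. Each is a nonzero vector of \<open>?W\<close> missing from
          one range, so both ranks drop.\<close>
        have "Y t0 y = 0" unfolding Yt0 PW[OF y(1)] Y0 y(3) by simp
        then have "Pr t0 y = y" by (simp add: Pr(3) Z(1) blinfun.zero_right)
        then have "P2' t0 y = 0" by (simp add: P2' PW[OF y(1)])
        then have y_not2: "y \<notin> range (P2' t0)" using range_projection[OF proj2 t03, of y] y(2) by simp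
        \<comment> \<open>Otherwise Q(t0) would be the scalar \<open>c\<close> on the range, c = 0
          by \<open>Qv0\<close>, and Q(t0) = 0 because Q = Q P.\<close>
        have "\<exists>w\<in>?W. Y0 w \<noteq> 0"
        proof (rule ccontr)
          assume "\<not> ?thesis"
          then have neg: "\<forall>w\<in>?W. Y0 w = 0" by blast
          have Qc: "Q t0 w = c *\<^sub>C w" if "w \<in> ?W" for w
          proof -
            have "Y0 w = 0" using bspec[OF neg that] .
            then show ?thesis by (simp add: Y0)
          qed
          have "c = 0" using Qc[OF v0(2)] Qv0 v0(1) by (simp add: cinner_scaleC_left)
          then have "Q t0 x = 0" for x using Qc[of "P t0 x"] QP[OF t01, of x] by simp
          then have "Q t0 = 0" by (intro blinfun_eqI) simp
          then show False using Q0 by simp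
        qed
        then obtain w where w: "w \<in> ?W" "Y0 w \<noteq> 0" by blast
        have Yw: "Y t0 w = Y0 w" by (simp add: Yt0 PW[OF w(1)])
        have "Pr t0 (Y0 w) = 0" unfolding Pr(3) Yw[symmetric] by (simp add: Z(2))
        then have "P1' t0 (Y0 w) = 0" by (simp add: P1' PY0[OF w(1)])
        then have w_not1: "Y0 w \<notin> range (P1' t0)" using range_projection[OF proj1 t03, of "Y0 w"] w(2) by simp
        obtain B1 where B1: "orthonormal_basis B1 (range (P1' t0))" "card B1 < card B"
          by (rule proper_subspace_basis[OF B lin1 range1 sp(2)[OF w(1)] w_not1])
        obtain B2 where B2: "orthonormal_basis B2 (range (P2' t0))" "card B2 < card B"
          by (rule proper_subspace_basis[OF B lin2 range2 y(1) y_not2])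
        obtain \<eta>1 where \<eta>1: "\<eta>1 > 0" "\<eta>1 \<le> \<delta>3" "parameterized \<eta>1 P1'"
          using less.hyps[OF B1(2) proj1 \<delta>3(1) B1(1)] eig range1 by blast
        obtain \<eta>2 where \<eta>2: "\<eta>2 > 0" "\<eta>2 \<le> \<delta>3" "parameterized \<eta>2 P2'"
          using less.hyps[OF B2(2) proj2 \<delta>3(1) B2(1)] eig range2 by blast
        have "parameterized (min \<eta>1 \<eta>2) P"
          by (rule parameterized_sum[OF proj1 proj2 sum prod \<eta>1(3) \<eta>2(3) \<eta>1(2) \<eta>2(2)])
        then show ?thesis using \<eta>1 \<eta>2 \<delta>3(2) \<delta>1(2) by (intro exI[of _ "min \<eta>1 \<eta>2"]) auto
      qed
    qed
  qed
qed

end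

section \<open>Resolvents of unbounded normal operators\<close>

lemma normal_operatorD:
  assumes "normal_operator V T"
  shows "complex_vector.subspace V" "closure V = UNIV" "\<And>u v. u \<in> V \<Longrightarrow> v \<in> V \<Longrightarrow> T (u + v) = T u + T v"
    "\<And>c u. u \<in> V \<Longrightarrow> T (c *\<^sub>C u) = c *\<^sub>C T u" "0 \<in> V" "\<And>u v. u \<in> V \<Longrightarrow> v \<in> V \<Longrightarrow> u + v \<in> V"
    "\<And>c u. u \<in> V \<Longrightarrow> c *\<^sub>C u \<in> V" "\<And>u v. u \<in> V \<Longrightarrow> v \<in> V \<Longrightarrow> u - v \<in> V"
    "\<And>u v. u \<in> V \<Longrightarrow> v \<in> V \<Longrightarrow> T (u - v) = T u - T v" "T 0 = 0"
proof -
  show V: "complex_vector.subspace V" and "closure V = UNIV"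
    using assms by (auto simp: normal_operator_def densely_defined_operator_def)
  show add: "T (u + v) = T u + T v" if "u \<in> V" "v \<in> V" for u v
    using assms that by (auto simp: normal_operator_def densely_defined_operator_def)
  show scale: "T (c *\<^sub>C u) = c *\<^sub>C T u" if "u \<in> V" for c u
    using assms that by (auto simp: normal_operator_def densely_defined_operator_def)
  show "0 \<in> V" using V by (auto simp: complex_vector.subspace_def)
  show "u + v \<in> V" if "u \<in> V" "v \<in> V" for u v using V that by (auto simp: complex_vector.subspace_def)
  show "c *\<^sub>C u \<in> V" if "u \<in> V" for c u using V that by (auto simp: complex_vector.subspace_def)
  show diff: "u - v \<in> V" if "u \<in> V" "v \<in> V" for u v using complex_vector.subspace_diff[OF V that] .
  show "T (u - v) = T u - T v" if "u \<in> V" "v \<in> V" for u v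
    using add[OF diff[OF that] that(2)] by simp
  show "T 0 = 0" using scale[OF \<open>0 \<in> V\<close>, of 0] by simp
qed

lemma norm_eq_of_cinner:
  fixes x y :: "'h::complex_hilbert_space"
  assumes "cinner x x = cinner y y"
  shows "norm x = norm y"
proof -
  have "(norm x)\<^sup>2 = (norm y)\<^sup>2" using assms unfolding cinner_self of_real_eq_iff .
  then show ?thesis by (simp add: power2_eq_iff_nonneg)
qed

lemma shifted_adjoint:
  fixes V :: "'h::complex_hilbert_space set"
  assumes adj: "\<And>u v. u \<in> V \<Longrightarrow> v \<in> V \<Longrightarrow> cinner (T u) v = cinner u (T' v)"
    "\<And>u v. u \<in> V \<Longrightarrow> v \<in> V \<Longrightarrow> cinner (T u) (T v) = cinner (T' u) (T' v)"
    and uv: "u \<in> V" "v \<in> V"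
  shows "cinner (T u - c *\<^sub>C u) v = cinner u (T' v - cnj c *\<^sub>C v)"
    "cinner (T u - c *\<^sub>C u) (T v - c *\<^sub>C v) = cinner (T' u - cnj c *\<^sub>C u) (T' v - cnj c *\<^sub>C v)"
proof -
  show "cinner (T u - c *\<^sub>C u) v = cinner u (T' v - cnj c *\<^sub>C v)"
    by (simp add: cinner_diff_left cinner_diff_right cinner_scaleC_left cinner_scaleC_right adj(1)[OF uv])
  have "cinner (T' u) v = cinner u (T v)"
    using adj(1)[OF uv(2,1)] cinner_commute[of "T' u" v] cinner_commute[of u "T v"] by simp
  then show "cinner (T u - c *\<^sub>C u) (T v - c *\<^sub>C v) = cinner (T' u - cnj c *\<^sub>C u) (T' v - cnj c *\<^sub>C v)"
    by (simp add: cinner_diff_left cinner_diff_right cinner_scaleC_left cinner_scaleC_right adj(1)[OF uv] adj(2)[OF uv] algebra_simps)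
qed

text \<open>For \<open>a = S p\<close> and \<open>b = S' p\<close> with \<open>S\<close> normal and
  \<open>S'\<close> its adjoint, this is the equality of norms for the normal operator 1 - c S and
  its adjoint.\<close>

lemma norm_diff_conjugate:
  fixes p a b :: "'h::complex_hilbert_space"
  assumes "cinner a p = cinner p b" "norm a = norm b"
  shows "norm (p - c *\<^sub>C a) = norm (p - cnj c *\<^sub>C b)"
proof (rule norm_eq_of_cinner)
  have 1: "cinner p a = cnj (cinner p b)" "cinner b p = cnj (cinner p b)"
    using assms(1) cinner_commute[of p a] cinner_commute[of b p] by simp_all
  have 2: "cinner a a = cinner b b" using assms(2) by (simp add: cinner_self)
  show "cinner (p - c *\<^sub>C a) (p - c *\<^sub>C a) = cinner (p - cnj c *\<^sub>C b) (p - cnj c *\<^sub>C b)"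
    by (simp add: cinner_diff_left cinner_diff_right cinner_scaleC_left cinner_scaleC_right assms(1) 1 2 algebra_simps)
qed

lemma subspace_eigenspace:
  assumes "complex_linear X"
  shows "complex_vector.subspace {x. X x = \<mu> *\<^sub>C x}"
  unfolding complex_vector.subspace_def
  by (simp add: blinfun.zero_right blinfun.add_right complex_linear_simps(1)[OF assms] scaleC_add_right scaleC_scaleC mult.commute)

lemma orthogonal_decomposition:
  assumes B: "orthonormal_basis B W"
  obtains v where "v \<in> W" "\<forall>y\<in>W. cinner (x - v) y = 0"
proof
  have fin: "finite B" and on: "orthonormal B" and span: "complex_vector.span B = W"
    using B by (auto simp: orthonormal_basis_def)
  let ?v = "\<Sum>b\<in>B. cinner x b *\<^sub>C b"
  show "?v \<in> W"
    unfolding span[symmetric] by (intro complex_vector.span_sum complex_vector.span_scale complex_vector.span_base)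
  have perp: "cinner (x - ?v) b = 0" if "b \<in> B" for b
  proof -
    have "cinner ?v b = (\<Sum>a\<in>B. if a = b then cinner x a else 0)"
      unfolding cinner_sum_left cinner_scaleC_left
      by (intro sum.cong refl) (use on that in \<open>auto simp: orthonormal_def\<close>)
    then show ?thesis using fin that by (simp add: cinner_diff_left)
  qed
  show "\<forall>y\<in>W. cinner (x - ?v) y = 0"
  proof
    fix y assume "y \<in> W"
    then have y: "y = (\<Sum>b\<in>B. cinner y b *\<^sub>C b)" by (rule orthonormal_basis_expand[OF B])
    have "cinner (x - ?v) (\<Sum>b\<in>B. cinner y b *\<^sub>C b) = 0"
      unfolding cinner_sum_right by (rule sum.neutral) (simp add: cinner_scaleC_right perp)
    then show "cinner (x - ?v) y = 0" by (simp only: y[symmetric])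
  qed
qed

text \<open>The resolvent is described by its algebraic properties, so that an operator found by
  perturbation can be recognised as a resolvent directly.\<close>

locale normal_resolvent =
  fixes V :: "'h::complex_hilbert_space set" and T :: "'h \<Rightarrow> 'h" and z :: complex and G :: "'h \<Rightarrow>\<^sub>L 'h"
  assumes normal: "normal_operator V T"
    and G: "\<And>x. G x \<in> V" "\<And>x. T (G x) - z *\<^sub>C G x = x"
    and left: "\<And>u. u \<in> V \<Longrightarrow> G (T u - z *\<^sub>C u) = u"
begin

lemmas V = normal_operatorD[OF normal]

lemma G_eqI: "u \<in> V \<Longrightarrow> T u - z *\<^sub>C u = x \<Longrightarrow> G x = u"
  using left by force

lemma G_linear: "complex_linear G"
  unfolding complex_linear_def
proof (intro allI)
  fix c x
  show "G (c *\<^sub>C x) = c *\<^sub>C G x"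
  proof (rule G_eqI)
    have "T (c *\<^sub>C G x) - z *\<^sub>C c *\<^sub>C G x = c *\<^sub>C (T (G x) - z *\<^sub>C G x)"
      by (simp only: V(4)[OF G(1)] scaleC.diff_right scaleC_scaleC mult.commute)
    then show "T (c *\<^sub>C G x) - z *\<^sub>C c *\<^sub>C G x = c *\<^sub>C x" by (simp only: G)
  qed (simp add: V G)
qed

lemma eigenvector_resolvent:
  assumes "u \<in> V" "u \<noteq> 0" "T u = \<kappa> *\<^sub>C u"
  shows "\<kappa> \<noteq> z" "G u = (1 / (\<kappa> - z)) *\<^sub>C u"
proof -
  have 1: "(\<kappa> - z) *\<^sub>C G u = u"
    using left[OF assms(1)] assms(3) complex_linear_simps(1)[OF G_linear] by (simp flip: scaleC.diff_left)
  show 2: "\<kappa> \<noteq> z" using 1 assms(2) by auto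
  show "G u = (1 / (\<kappa> - z)) *\<^sub>C u"
    by (subst 1[symmetric]) (use 2 in \<open>simp add: scaleC_scaleC scaleC_one\<close>)
qed

lemma resolvent_eigenvector:
  assumes "x \<noteq> 0" "G x = \<mu> *\<^sub>C x"
  shows "\<mu> \<noteq> 0" "x \<in> V" "T x = (z + 1 / \<mu>) *\<^sub>C x"
proof -
  show mu: "\<mu> \<noteq> 0" using assms G(2)[of x] V(10) by auto
  then have x: "x = (1 / \<mu>) *\<^sub>C G x" using assms(2) by (simp add: scaleC_scaleC scaleC_one)
  show "x \<in> V" by (subst x) (intro V G)
  have "T x = (1 / \<mu>) *\<^sub>C T (G x)" by (subst x) (simp add: V G)
  also have "T (G x) = x + z *\<^sub>C G x" using G(2)[of x] by (simp add: algebra_simps)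
  also have "(1 / \<mu>) *\<^sub>C (x + z *\<^sub>C G x) = (z + 1 / \<mu>) *\<^sub>C x"
    using mu by (simp add: assms(2) scaleC_add_right scaleC_scaleC scaleC_add_left)
  finally show "T x = (z + 1 / \<mu>) *\<^sub>C x" .
qed

lemma eigenspace_resolvent:
  assumes "\<kappa> \<noteq> z"
  shows "{u \<in> V. T u = \<kappa> *\<^sub>C u} = {x. G x = (1 / (\<kappa> - z)) *\<^sub>C x}"
proof (intro equalityI subsetI)
  fix u assume "u \<in> {u \<in> V. T u = \<kappa> *\<^sub>C u}"
  then show "u \<in> {x. G x = (1 / (\<kappa> - z)) *\<^sub>C x}"
    using eigenvector_resolvent(2)[of u \<kappa>] by (cases "u = 0") (auto simp: blinfun.zero_right)
next
  fix x assume x: "x \<in> {x. G x = (1 / (\<kappa> - z)) *\<^sub>C x}"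
  show "x \<in> {u \<in> V. T u = \<kappa> *\<^sub>C u}"
  proof (cases "x = 0")
    case True
    then show ?thesis using V by simp
  next
    case False
    then show ?thesis using resolvent_eigenvector[OF False, of "1 / (\<kappa> - z)"] x by simp
  qed
qed

text \<open>By normality T - c and its adjoint have equal norms at \<open>u\<close>, so they vanish
  together.\<close>

lemma eigenvector_adjoint:
  assumes adj: "\<And>u v. u \<in> V \<Longrightarrow> v \<in> V \<Longrightarrow> cinner (T u) v = cinner u (T' v)"
    "\<And>u v. u \<in> V \<Longrightarrow> v \<in> V \<Longrightarrow> cinner (T u) (T v) = cinner (T' u) (T' v)" and u: "u \<in> V"
  shows "T u = c *\<^sub>C u \<longleftrightarrow> T' u = cnj c *\<^sub>C u"
  using norm_eq_of_cinner[OF shifted_adjoint(2)[OF adj u u, of c]] by (metis norm_eq_zero right_minus_eq)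

lemma resolvent_orthogonal:
  assumes "G x = \<mu> *\<^sub>C x" "G y = \<nu> *\<^sub>C y" "\<mu> \<noteq> \<nu>"
  shows "cinner x y = 0"
proof (cases "x = 0 \<or> y = 0")
  case False
  then have xy: "\<mu> \<noteq> 0" "x \<in> V" "T x = (z + 1 / \<mu>) *\<^sub>C x" "\<nu> \<noteq> 0" "y \<in> V" "T y = (z + 1 / \<nu>) *\<^sub>C y"
    using resolvent_eigenvector assms by auto
  obtain T' where adj: "\<And>u v. u \<in> V \<Longrightarrow> v \<in> V \<Longrightarrow> cinner (T u) v = cinner u (T' v)"
    "\<And>u v. u \<in> V \<Longrightarrow> v \<in> V \<Longrightarrow> cinner (T u) (T v) = cinner (T' u) (T' v)"
    using normal_operator_adjoint[OF normal] by metis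
  have "T' y = cnj (z + 1 / \<nu>) *\<^sub>C y" using eigenvector_adjoint[OF adj xy(5)] xy(6) by blast
  then have "(z + 1 / \<mu>) * cinner x y = (z + 1 / \<nu>) * cinner x y"
    using adj(1)[OF xy(2,5)] xy(3) by (simp only: cinner_scaleC_left cinner_scaleC_right complex_cnj_cnj)
  then show ?thesis using xy(1,4) assms(3) by simp
qed auto

text \<open>With \<open>S = T - z\<close>, \<open>g = G x\<close>, \<open>p = G (G x - c x)\<close>, normality of \<open>S\<close> gives
  \<open>\<langle>S p, g - c S g\<rangle> = \<langle>(1 - c S)\<^sup>* p, S\<^sup>* g\<rangle>\<close> and turns the norms of the two factors into those of \<open>(1 - c S) p\<close>
  and \<open>S g = x\<close>.\<close>

lemma resolvent_paranormal: "paranormal_on UNIV G"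
  unfolding paranormal_on_def
proof (intro allI ballI)
  fix c x
  obtain T' where adj: "\<And>u v. u \<in> V \<Longrightarrow> v \<in> V \<Longrightarrow> cinner (T u) v = cinner u (T' v)"
    "\<And>u v. u \<in> V \<Longrightarrow> v \<in> V \<Longrightarrow> cinner (T u) (T v) = cinner (T' u) (T' v)"
    using normal_operator_adjoint[OF normal] by metis
  define S where "S u = T u - z *\<^sub>C u" for u
  define S' where "S' u = T' u - cnj z *\<^sub>C u" for u
  have S: "cinner (S u) v = cinner u (S' v)" "cinner (S u) (S v) = cinner (S' u) (S' v)" if "u \<in> V" "v \<in> V" for u v
    unfolding S_def S'_def using shifted_adjoint[OF adj that, of z] by blast+
  define a where "a = G x - c *\<^sub>C x"
  define p where "p = G a"
  define g where "g = G x"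
  have pV: "p \<in> V" and gV: "g \<in> V" using G by (auto simp: p_def g_def)
  have Sp: "S p = a" and Sg: "S g = x" using G by (auto simp: S_def p_def g_def)
  have "complex_of_real ((norm a)\<^sup>2) = cinner a a" by (rule cinner_self[symmetric])
  also have "\<dots> = cinner (S p) (g - c *\<^sub>C S g)" unfolding Sp Sg by (simp only: a_def g_def)
  also have "\<dots> = cinner (p - cnj c *\<^sub>C S' p) (S' g)"
    by (simp add: cinner_diff_left cinner_diff_right cinner_scaleC_left cinner_scaleC_right S[OF pV gV])
  finally have "cmod (complex_of_real ((norm a)\<^sup>2)) \<le> norm (p - cnj c *\<^sub>C S' p) * norm (S' g)"
    by (simp only: cauchy_schwarz)
  moreover have "norm (S' g) = norm x" using norm_eq_of_cinner[OF S(2)[OF gV gV]] Sg by simp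
  moreover have "norm (p - c *\<^sub>C S p) = norm (p - cnj c *\<^sub>C S' p)"
    by (rule norm_diff_conjugate[OF S(1)[OF pV pV] norm_eq_of_cinner[OF S(2)[OF pV pV]]])
  ultimately have "(norm a)\<^sup>2 \<le> norm (G a - c *\<^sub>C a) * norm x" by (simp add: p_def[symmetric] Sp norm_power)
  then show "(norm (G x - c *\<^sub>C x))\<^sup>2 \<le> norm (G (G x - c *\<^sub>C x) - c *\<^sub>C (G x - c *\<^sub>C x)) * norm x"
    by (simp only: a_def)
qed

text \<open>Eigenvectors of \<open>T\<close> are eigenvectors of its adjoint. In consequence the
  range of G - \<mu> is orthogonal to the eigenspace.\<close>

lemma resolvent_eigenvector_cinner:
  assumes "G y = \<mu> *\<^sub>C y" "\<mu> \<noteq> 0"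
  shows "cinner (G x) y = \<mu> * cinner x y"
proof (cases "y = 0")
  case False
  have y: "y \<in> V" "T y = (z + 1 / \<mu>) *\<^sub>C y" by (rule resolvent_eigenvector[OF False assms(1)])+
  obtain T' where adj: "\<And>u v. u \<in> V \<Longrightarrow> v \<in> V \<Longrightarrow> cinner (T u) v = cinner u (T' v)"
    "\<And>u v. u \<in> V \<Longrightarrow> v \<in> V \<Longrightarrow> cinner (T u) (T v) = cinner (T' u) (T' v)"
    using normal_operator_adjoint[OF normal] by metis
  have T': "T' y = cnj (z + 1 / \<mu>) *\<^sub>C y" using eigenvector_adjoint[OF adj y(1)] y(2) by blast
  have "cinner x y = cinner (T (G x) - z *\<^sub>C G x) y" by (simp only: G)
  also have "\<dots> = (z + 1 / \<mu>) * cinner (G x) y - z * cinner (G x) y"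
    by (simp only: cinner_diff_left cinner_scaleC_left adj(1)[OF G(1) y(1)] T' cinner_scaleC_right complex_cnj_cnj)
  finally show ?thesis using assms(2) by (simp add: field_simps)
qed simp

text \<open>The converse: orthogonality to the range of G - \<mu> says that the adjoint of
  \<open>T\<close> acts on \<open>d\<close> as a scalar. Maximality of the adjoint puts
  \<open>d\<close> into \<open>V\<close>, and normality returns to \<open>T\<close>.\<close>

lemma resolvent_eigenvectorI:
  assumes mu: "\<mu> \<noteq> 0" and d: "\<And>x. cinner (G x - \<mu> *\<^sub>C x) d = 0"
  shows "G d = \<mu> *\<^sub>C d"
proof (cases "d = 0")
  case False
  obtain T' where adj: "\<And>u v. u \<in> V \<Longrightarrow> v \<in> V \<Longrightarrow> cinner (T u) v = cinner u (T' v)"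
    "\<And>u v. u \<in> V \<Longrightarrow> v \<in> V \<Longrightarrow> cinner (T u) (T v) = cinner (T' u) (T' v)"
    "\<And>v w. (\<And>u. u \<in> V \<Longrightarrow> cinner (T u) v = cinner u w) \<Longrightarrow> v \<in> V \<and> T' v = w"
    by (rule normal_operator_adjoint[OF normal]) blast
  have "d \<in> V \<and> T' d = cnj (z + 1 / \<mu>) *\<^sub>C d"
  proof (rule adj(3))
    fix u assume u: "u \<in> V"
    have "cinner u d = \<mu> * (cinner (T u) d - z * cinner u d)"
      using d[of "T u - z *\<^sub>C u"] unfolding left[OF u] by (simp add: cinner_diff_left cinner_scaleC_left)
    then show "cinner (T u) d = cinner u (cnj (z + 1 / \<mu>) *\<^sub>C d)"
      using mu by (simp add: cinner_scaleC_right field_simps)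
  qed
  then have "d \<in> V" "T d = (z + 1 / \<mu>) *\<^sub>C d" using eigenvector_adjoint[OF adj(1,2)] by blast+
  then show ?thesis using eigenvector_resolvent(2)[OF _ False] mu by fastforce
qed (simp add: blinfun.zero_right)

text \<open>For distinct members a, b of an orthonormal set in the eigenspace the images \<mu> a,
  \<mu> b are at least |\<mu>| apart. A finite cover of the compact image by balls of radius
  |\<mu>|/2 thus bounds the size of the set.\<close>

lemma eigenspace_basis:
  assumes cpt: "compact (closure (G ` cball 0 1))" and mu: "\<mu> \<noteq> 0"
  obtains B where "orthonormal_basis B {x. G x = \<mu> *\<^sub>C x}"
proof -
  let ?E = "{x. G x = \<mu> *\<^sub>C x}" and ?K = "closure (G ` cball 0 1)"
  have sub: "complex_vector.subspace ?E" by (rule subspace_eigenspace[OF G_linear])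
  define r where "r = cmod \<mu> / 2"
  have r: "r > 0" using mu by (simp add: r_def)
  have "?K \<subseteq> (\<Union>x\<in>?K. ball x r)" using r by auto
  then obtain D where D: "D \<subseteq> ?K" "finite D" "?K \<subseteq> (\<Union>x\<in>D. ball x r)"
    by (rule compactE_image[OF cpt, rotated]) auto
  have card: "card B \<le> card D" if B: "finite B" "orthonormal B" "B \<subseteq> ?E" for B
  proof -
    have "\<exists>d\<in>D. dist d (\<mu> *\<^sub>C b) < r" if b: "b \<in> B" for b
    proof -
      have "b \<in> cball 0 1" using orthonormal_norm[OF B(2) b] by simp
      then have "G b \<in> ?K" by (intro subsetD[OF closure_subset] imageI)
      moreover have "G b = \<mu> *\<^sub>C b" using B(3) b by auto
      ultimately show ?thesis using subsetD[OF D(3)] by auto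
    qed
    then obtain h where h: "\<And>b. b \<in> B \<Longrightarrow> h b \<in> D \<and> dist (h b) (\<mu> *\<^sub>C b) < r" by metis
    have "inj_on h B"
    proof (rule inj_onI, rule ccontr)
      fix a b assume ab: "a \<in> B" "b \<in> B" "h a = h b" "a \<noteq> b"
      have "cinner (a - b) (a - b) = 2"
        using B(2) ab unfolding orthonormal_def by (simp add: cinner_diff_left cinner_diff_right)
      then have "(norm (a - b))\<^sup>2 = 2" using Re_cinner_self[of "a - b"] by simp
      then have "norm (a - b) \<ge> 1" using power_le_one[of "norm (a - b)" 2] by force
      then have "cmod \<mu> * 1 \<le> cmod \<mu> * norm (a - b)" by (intro mult_left_mono) auto
      also have "\<dots> = dist (\<mu> *\<^sub>C a) (\<mu> *\<^sub>C b)" by (simp add: dist_norm norm_scaleC flip: scaleC.diff_right)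
      also have "\<dots> \<le> dist (h a) (\<mu> *\<^sub>C a) + dist (h b) (\<mu> *\<^sub>C b)" using dist_triangle3 ab(3) by metis
      also have "\<dots> < r + r" using h[OF ab(1)] h[OF ab(2)] by (intro add_strict_mono) auto
      finally show False by (simp add: r_def)
    qed
    moreover have "h ` B \<subseteq> D" using h by blast
    ultimately show ?thesis using D(2) by (rule card_inj_on_le)
  qed
  show ?thesis by (rule orthonormal_basis_exists[OF sub card that])
qed

text \<open>Otherwise there are unit vectors orthogonal to the eigenspace that are approximate
  eigenvectors. By compactness they subconverge to a unit eigenvector, which is then orthogonal to
  itself.\<close>

lemma bounded_below_on_complement:
  assumes cpt: "compact (closure (G ` cball 0 1))" and mu: "\<mu> \<noteq> 0"
  shows "\<exists>e>0. \<forall>x. (\<forall>y. G y = \<mu> *\<^sub>C y \<longrightarrow> cinner x y = 0) \<longrightarrow> e * norm x \<le> norm (G x - \<mu> *\<^sub>C x)"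
proof (rule ccontr)
  let ?C = "\<lambda>x. \<forall>y. G y = \<mu> *\<^sub>C y \<longrightarrow> cinner x y = 0"
  assume neg: "\<not> ?thesis"
  have "\<exists>x. ?C x \<and> norm (G x - \<mu> *\<^sub>C x) < inverse (real (Suc n)) * norm x" for n
  proof -
    have "inverse (real (Suc n)) > 0" by simp
    then show ?thesis using neg by (meson not_le)
  qed
  then obtain x where x: "\<And>n. ?C (x n)" "\<And>n. norm (G (x n) - \<mu> *\<^sub>C x n) < inverse (real (Suc n)) * norm (x n)" by metis
  have xpos: "norm (x n) > 0" for n using order_le_less_trans[OF norm_ge_zero x(2)[of n]] by (simp add: zero_less_mult_iff)
  define y where "y n = (1 / norm (x n)) *\<^sub>R x n" for n
  have y1: "norm (y n) = 1" for n using xpos[of n] by (simp add: y_def)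
  have yC: "cinner (y n) v = 0" if "G v = \<mu> *\<^sub>C v" for n v
    using x(1)[of n] that by (simp add: y_def cinner.scaleR_left)
  have small: "norm (G (y n) - \<mu> *\<^sub>C y n) \<le> inverse (real (Suc n))" for n
  proof -
    have "G (y n) - \<mu> *\<^sub>C y n = (1 / norm (x n)) *\<^sub>R (G (x n) - \<mu> *\<^sub>C x n)"
      by (simp add: y_def blinfun.scaleR_right scaleC.scaleR_right scaleR_diff_right)
    then have "norm (G (y n) - \<mu> *\<^sub>C y n) = norm (G (x n) - \<mu> *\<^sub>C x n) / norm (x n)" by simp
    also have "\<dots> \<le> inverse (real (Suc n))" using x(2)[of n] xpos[of n] by (simp only: pos_divide_le_eq less_imp_le)
    finally show ?thesis .
  qed
  have "G (y n) \<in> closure (G ` cball 0 1)" for n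
    by (intro subsetD[OF closure_subset] imageI) (simp add: y1)
  then obtain l s where s: "strict_mono (s :: nat \<Rightarrow> nat)" "((\<lambda>n. G (y n)) \<circ> s) \<longlonglongrightarrow> l"
    using cpt[unfolded compact_def, rule_format, of "\<lambda>n. G (y n)"] by blast
  have "(\<lambda>n. G (y n) - \<mu> *\<^sub>C y n) \<longlonglongrightarrow> 0"
    by (rule Lim_null_comparison[OF _ LIMSEQ_inverse_real_of_nat]) (use small in simp)
  from tendsto_diff[OF s(2) LIMSEQ_subseq_LIMSEQ[OF this s(1)]]
  have "(\<lambda>n. \<mu> *\<^sub>C y (s n)) \<longlonglongrightarrow> l" by (simp add: o_def)
  from scaleC.tendsto[OF tendsto_const this, of "1 / \<mu>"]
  have ylim: "(\<lambda>n. y (s n)) \<longlonglongrightarrow> (1 / \<mu>) *\<^sub>C l" using mu by (simp add: scaleC_scaleC scaleC_one)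
  let ?w = "(1 / \<mu>) *\<^sub>C l"
  have "(\<lambda>n. G (y (s n))) \<longlonglongrightarrow> G ?w" by (intro blinfun.tendsto tendsto_const ylim)
  then have "G ?w = l" using LIMSEQ_unique s(2) by (auto simp: o_def)
  then have Gw: "G ?w = \<mu> *\<^sub>C ?w" using mu by (simp add: scaleC_scaleC scaleC_one)
  have "(\<lambda>n. cinner (y (s n)) ?w) \<longlonglongrightarrow> cinner ?w ?w" by (intro cinner.tendsto ylim tendsto_const)
  then have "cinner ?w ?w = 0" unfolding yC[OF Gw] by (simp add: LIMSEQ_const_iff)
  moreover have "(\<lambda>n. norm (y (s n))) \<longlonglongrightarrow> norm ?w" by (intro tendsto_norm ylim)
  then have "norm ?w = 1" unfolding y1 by (simp add: LIMSEQ_const_iff)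
  ultimately show False by (metis cinner_eq_zero_iff norm_zero zero_neq_one)
qed

text \<open>The range of G - \<mu> is already the image of the complement \<open>C\<close>, where
  the operator is bounded below, so it is closed. Its orthogonal complement is the eigenspace; the
  component of \<open>x\<close> orthogonal to the range is thus an eigenvector, and it is orthogonal
  to itself.\<close>

lemma complement_in_range:
  assumes cpt: "compact (closure (G ` cball 0 1))" and mu: "\<mu> \<noteq> 0"
    and x: "\<And>y. G y = \<mu> *\<^sub>C y \<Longrightarrow> cinner x y = 0"
  shows "\<exists>y. x = G y - \<mu> *\<^sub>C y"
proof -
  define Y where "Y = G - scalar_op \<mu>"
  have Y: "Y x = G x - \<mu> *\<^sub>C x" for x by (simp add: Y_def blinfun.diff_left)
  have linY: "complex_linear Y" unfolding Y_def by (intro complex_linear_diff G_linear complex_linear_scalar_op)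
  define C where "C = {x. \<forall>y. G y = \<mu> *\<^sub>C y \<longrightarrow> cinner x y = 0}"
  have subC: "subspace C" by (auto simp: subspace_def C_def cinner_add_left cinner.scaleR_left)
  have "C = (\<Inter>y\<in>{y. G y = \<mu> *\<^sub>C y}. {x. cinner x y = 0})" by (auto simp: C_def)
  moreover have "closed {x. cinner x y = 0}" for y :: 'h
    by (intro closed_Collect_eq cinner.continuous_on continuous_intros)
  ultimately have closedC: "closed C" by auto
  have YC: "Y x \<in> C" for x
    using resolvent_eigenvector_cinner[OF _ mu] by (auto simp: C_def Y cinner_diff_left cinner_scaleC_left)
  obtain B where B: "orthonormal_basis B {x. G x = \<mu> *\<^sub>C x}" by (rule eigenspace_basis[OF cpt mu])
  have range: "range Y = Y ` C"
  proof (intro equalityI subsetI)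
    fix w assume "w \<in> range Y"
    then obtain x where w: "w = Y x" by blast
    obtain v where v: "v \<in> {x. G x = \<mu> *\<^sub>C x}" "\<forall>y\<in>{x. G x = \<mu> *\<^sub>C x}. cinner (x - v) y = 0"
      using orthogonal_decomposition[OF B] by metis
    have "Y x = Y (x - v)" using v(1) by (simp add: blinfun.diff_right Y)
    then show "w \<in> Y ` C" using v(2) w by (auto simp: C_def)
  qed blast
  obtain e where e: "e > 0" "\<And>x. x \<in> C \<Longrightarrow> e * norm x \<le> norm (Y x)"
    using bounded_below_on_complement[OF cpt mu] unfolding C_def Y by blast
  have "complete (blinfun_apply Y ` C)"
    by (rule complete_isometric_image[OF e(1) subC blinfun.bounded_linear_right])
      (use e(2) closedC in \<open>auto simp: complete_eq_closed\<close>)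
  then have closed: "closed (range Y)" unfolding range by (rule complete_imp_closed)
  obtain w where w: "w \<in> closure (range Y)" "\<And>u. u \<in> range Y \<Longrightarrow> cinner u x = cinner u w"
    by (rule riesz_subspace[OF subspace_range[OF linY], of "\<lambda>u. cinner u x" "norm x"])
      (use cauchy_schwarz in \<open>auto simp: cinner_add_left cinner_scaleC_left mult.commute\<close>)
  have wR: "w \<in> range Y" using w(1) closed by simp
  have "G (x - w) = \<mu> *\<^sub>C (x - w)"
    by (rule resolvent_eigenvectorI[OF mu]) (use w(2) in \<open>auto simp: cinner_diff_right simp flip: Y\<close>)
  then have "cinner (x - w) (x - w) = 0"
    using x[of "x - w"] wR YC by (auto simp: C_def cinner_diff_left)
  then have "x = w" by simp
  then show ?thesis using wR by (auto simp: Y)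
qed

theorem eigenspace_group_inverse:
  assumes cpt: "compact (closure (G ` cball 0 1))" and mu: "\<mu> \<noteq> 0" and Y: "Y = G - scalar_op \<mu>"
  obtains Z :: "'h \<Rightarrow>\<^sub>L 'h" where "\<And>x. Y (Z x) = Z (Y x)" "\<And>x. Y (Z (Y x)) = Y x" "\<And>x. Z (Y (Z x)) = Z x"
proof -
  have Y: "Y x = G x - \<mu> *\<^sub>C x" for x by (simp add: Y blinfun.diff_left)
  obtain B where B: "orthonormal_basis B {x. G x = \<mu> *\<^sub>C x}" by (rule eigenspace_basis[OF cpt mu])
  have YC: "cinner (Y x) y = 0" if "G y = \<mu> *\<^sub>C y" for x y
    using resolvent_eigenvector_cinner[OF that mu] by (simp add: Y cinner_diff_left cinner_scaleC_left)
  obtain e where e: "e > 0" "\<And>x. (\<And>y. G y = \<mu> *\<^sub>C y \<Longrightarrow> cinner x y = 0) \<Longrightarrow> e * norm x \<le> norm (Y x)"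
    using bounded_below_on_complement[OF cpt mu] unfolding Y by blast
  have below: "norm (Y x) \<le> (1 / e) * norm (Y (Y x))" for x
    using e(2)[of "Y x", OF YC] e(1) by (simp add: field_simps)
  have range: "\<exists>y. Y x = Y (Y y)" for x
  proof -
    obtain v where v: "v \<in> {x. G x = \<mu> *\<^sub>C x}" "\<forall>y\<in>{x. G x = \<mu> *\<^sub>C x}. cinner (x - v) y = 0"
      using orthogonal_decomposition[OF B] by metis
    then obtain y where y: "x - v = Y y" using complement_in_range[OF cpt mu, of "x - v"] unfolding Y by blast
    have "Y x = Y (x - v)" using v(1) by (simp add: blinfun.diff_right Y)
    then show ?thesis using y by metis
  qed
  show ?thesis by (rule group_inverse_exists[of Y, OF below range]) (rule that)
qed

end

lemma resolvent_exists:
  assumes T: "normal_operator V T" and z: "z \<in> resolvent_set V T"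
  obtains G where "normal_resolvent V T z G" "blinfun_apply G = resolvent V T z"
proof -
  let ?S = "\<lambda>u. T u - z *\<^sub>C u"
  note V = normal_operatorD[OF T]
  obtain C where bij: "bij_betw ?S V UNIV" and C: "\<And>w. norm (resolvent V T z w) \<le> C * norm w"
    using z by (auto simp: resolvent_set_def)
  have R: "resolvent V T z x \<in> V" "?S (resolvent V T z x) = x" for x
    using bij inv_into_into[of x ?S V] f_inv_into_f[of x ?S V] by (auto simp: resolvent_def bij_betw_def)
  have left: "resolvent V T z (?S u) = u" if "u \<in> V" for u
    using bij inv_into_f_f[of ?S V u] that by (auto simp: resolvent_def bij_betw_def)
  have "bounded_linear (resolvent V T z)"
  proof (rule bounded_linear_intro)
    show "resolvent V T z (x + y) = resolvent V T z x + resolvent V T z y" for x y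
    proof -
      have "?S (resolvent V T z x + resolvent V T z y) = x + y"
        using R(2)[of x] R(2)[of y] by (simp add: V(3) R(1) scaleC_add_right algebra_simps)
      then show ?thesis using left[OF V(6)[OF R(1) R(1)], of x y] by simp
    qed
    show "resolvent V T z (r *\<^sub>R x) = r *\<^sub>R resolvent V T z x" for r x
    proof -
      have "?S (complex_of_real r *\<^sub>C resolvent V T z x) = complex_of_real r *\<^sub>C (?S (resolvent V T z x))"
        by (simp add: V(4) R(1) scaleC.diff_right scaleC_scaleC mult.commute)
      then show ?thesis using left[OF V(7)[OF R(1)[of x]], of "complex_of_real r"] R(2)[of x] by (simp add: scaleR_scaleC)
    qed
    show "norm (resolvent V T z x) \<le> norm x * C" for x using C[of x] by (simp add: mult.commute)
  qed
  then have app: "blinfun_apply (Blinfun (resolvent V T z)) = resolvent V T z" by (rule bounded_linear_Blinfun_apply)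
  show ?thesis
    by (rule that[of "Blinfun (resolvent V T z)"]) (unfold_locales, unfold app, fact T, fact R, fact R, fact left, rule refl)
qed

lemma dense_norm_bound:
  fixes V :: "'h::complex_hilbert_space set"
  assumes dense: "closure V = UNIV" and b: "\<And>v. v \<in> V \<Longrightarrow> cmod (cinner y v) \<le> C * norm v"
  shows "norm y \<le> \<bar>C\<bar>"
proof (cases "y = 0")
  case False
  have "y \<in> closure V" using dense by simp
  then obtain v where v: "\<And>k. v k \<in> V" "v \<longlonglongrightarrow> y" unfolding closure_sequential by blast
  have "(\<lambda>k. cmod (cinner y (v k))) \<longlonglongrightarrow> cmod (cinner y y)" "(\<lambda>k. C * norm (v k)) \<longlonglongrightarrow> C * norm y"
    by (intro tendsto_norm cinner.tendsto tendsto_mult v tendsto_const)+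
  then have "cmod (cinner y y) \<le> C * norm y" by (rule LIMSEQ_le) (use b v(1) in blast)
  then have "norm y * norm y \<le> C * norm y" by (simp add: cinner_self norm_mult power2_eq_square)
  then have "norm y \<le> C" using False by simp
  then show ?thesis by simp
qed simp

text \<open>For \<open>v\<close> in \<open>V\<close> the functional x \<mapsto>
  \<open>cinner (S (G x)) v\<close> is bounded, because normality puts \<open>v\<close> into the
  domain of the adjoint of \<open>S\<close>. Uniform boundedness over the unit ball of the dense set
  \<open>V\<close> bounds the operator.\<close>

lemma bounded_linear_compose_resolvent:
  assumes "normal_resolvent V T z G" and S: "normal_operator V S"
  shows "bounded_linear (\<lambda>x. S (G x))"
proof -
  interpret normal_resolvent V T z G by fact
  note VS = normal_operatorD[OF S]
  obtain S' where adj: "\<And>u v. u \<in> V \<Longrightarrow> v \<in> V \<Longrightarrow> cinner (S u) v = cinner u (S' v)"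
    using normal_operator_adjoint[OF S] by metis
  define F where "F v = Blinfun (\<lambda>x. cinner (G x) (S' v))" for v
  have F: "F v x = cinner (S (G x)) v" if "v \<in> V" for v x
    unfolding F_def adj[OF G(1) that]
    by (subst bounded_linear_Blinfun_apply)
      (auto intro: bounded_linear_compose[OF cinner.bounded_linear_left blinfun.bounded_linear_right])
  have "\<exists>C. \<forall>v\<in>{v \<in> V. norm v \<le> 1}. norm (F v) \<le> C"
  proof (rule uniform_boundedness)
    fix x
    show "\<exists>K. \<forall>v\<in>{v \<in> V. norm v \<le> 1}. norm (F v x) \<le> K"
    proof (intro exI ballI)
      fix v assume v: "v \<in> {v \<in> V. norm v \<le> 1}"
      then have "norm (F v x) \<le> norm (S (G x)) * norm v" by (simp add: F cauchy_schwarz)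
      also have "\<dots> \<le> norm (S (G x)) * 1" by (rule mult_left_mono) (use v in auto)
      finally show "norm (F v x) \<le> norm (S (G x))" by simp
    qed
  qed
  then obtain C where C: "\<And>v. v \<in> V \<Longrightarrow> norm v \<le> 1 \<Longrightarrow> norm (F v) \<le> C" by blast
  have bound: "norm (S (G x)) \<le> \<bar>C * norm x\<bar>" for x
  proof (rule dense_norm_bound[OF VS(2)])
    fix v assume v: "v \<in> V"
    show "cmod (cinner (S (G x)) v) \<le> C * norm x * norm v"
    proof (cases "v = 0")
      case False
      define w where "w = (1 / norm v) *\<^sub>R v"
      have w: "w \<in> V" "norm w \<le> 1" "v = norm v *\<^sub>R w" using False v VS(7) by (auto simp: w_def scaleR_scaleC norm_scaleC norm_divide scaleC_scaleC scaleC_one)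
      have "norm (F w x) \<le> C * norm x"
        using norm_blinfun[of "F w" x] C[OF w(1,2)] by (meson mult_right_mono norm_ge_zero order_trans)
      then have "norm v * norm (F w x) \<le> norm v * (C * norm x)" by (rule mult_left_mono) simp
      moreover have "cinner (S (G x)) v = norm v *\<^sub>R F w x"
        by (subst w(3)) (simp only: F[OF w(1)] cinner.scaleR_right)
      ultimately show ?thesis by (simp add: mult_ac)
    qed simp
  qed
  show ?thesis
  proof (rule bounded_linear_intro[where K = "\<bar>C\<bar>"])
    show "S (G (x + y)) = S (G x) + S (G y)" for x y by (simp add: blinfun.add_right VS(3) G(1))
    show "S (G (r *\<^sub>R x)) = r *\<^sub>R S (G x)" for r x by (simp only: blinfun.scaleR_right) (simp only: scaleR_scaleC VS(4)[OF G(1)])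
    show "norm (S (G x)) \<le> norm x * \<bar>C\<bar>" for x using bound[of x] by (simp add: abs_mult mult.commute)
  qed
qed

section \<open>Passage between the operators A(t) and their resolvents\<close>

text \<open>With \<open>G\<close> fixed, L(t) = (A(t) - z) G is bounded, weakly smooth as G maps
  into \<open>V\<close>, and the identity at \<open>t0\<close>. So G times the inverse of L(t) is
  the resolvent and is regular in norm.\<close>

theorem resolvent_family:
  fixes A :: "real \<Rightarrow> 'h::complex_hilbert_space \<Rightarrow> 'h"
  assumes I: "is_interval I" "t0 \<in> I" and normals: "\<And>t. t \<in> I \<Longrightarrow> normal_operator V (A t)"
    and smooth: "\<And>u v. u \<in> V \<Longrightarrow> smooth_on I (\<lambda>t. cinner (A t u) v)"
    and an: "\<And>u v. an \<Longrightarrow> u \<in> V \<Longrightarrow> real_analytic_on I (\<lambda>t. cinner (A t u) v)"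
    and G0: "normal_resolvent V (A t0) z G"
  obtains \<delta> R where "\<delta> > 0" "regular an (I \<inter> ball t0 \<delta>) R" "R t0 = G"
    "\<And>t. t \<in> I \<inter> ball t0 \<delta> \<Longrightarrow> normal_resolvent V (A t) z (R t)"
proof -
  interpret normal_resolvent V "A t0" z G by fact
  define f where "f t = Blinfun (\<lambda>x. A t (G x))" for t
  have f: "f t x = A t (G x)" if "t \<in> I" for t x
    unfolding f_def by (rule fun_cong[OF bounded_linear_Blinfun_apply[OF bounded_linear_compose_resolvent[OF G0 normals[OF that]]]])
  have sm: "smooth_on I (\<lambda>t. cinner (f t x) v)" for x v
    using smooth[OF G(1), of x v] by (simp add: smooth_on_def f)
  have ana: "real_analytic_on I (\<lambda>t. cinner (f t x) v)" if an for x v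
    using an[OF that G(1), of x v] by (simp add: real_analytic_on_def f)
  obtain \<delta>1 where \<delta>1: "\<delta>1 > 0" "regular an (I \<inter> ball t0 \<delta>1) f"
    by (rule weak_regular[OF I sm ana])
  define L where "L t = f t - (scalar_op z o\<^sub>L G)" for t
  have L: "L t x = A t (G x) - z *\<^sub>C G x" if "t \<in> I" for t x by (simp add: L_def blinfun.diff_left f[OF that])
  have regL: "regular an (I \<inter> ball t0 \<delta>1) L" unfolding L_def by (intro regular_diff regular_const \<delta>1)
  have L0: "L t0 = id_blinfun" by (rule blinfun_eqI) (simp add: L[OF I(2)] G(2))
  have t0: "t0 \<in> I \<inter> ball t0 \<delta>1" using I \<delta>1 by simp
  obtain \<delta>2 M where \<delta>2: "\<delta>2 > 0" and M: "regular an (I \<inter> ball t0 \<delta>1 \<inter> ball t0 \<delta>2) M" "M t0 = id_blinfun"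
    "\<And>t. t \<in> I \<inter> ball t0 \<delta>1 \<inter> ball t0 \<delta>2 \<Longrightarrow> L t o\<^sub>L M t = id_blinfun \<and> M t o\<^sub>L L t = id_blinfun"
    by (rule regular_inverse_near[OF regL t0, of id_blinfun])
      (simp_all add: L0 blinfun_product.left_unit)
  define \<delta> where "\<delta> = min \<delta>1 \<delta>2"
  have sub: "I \<inter> ball t0 \<delta> \<subseteq> I \<inter> ball t0 \<delta>1 \<inter> ball t0 \<delta>2" by (auto simp: \<delta>_def)
  define R where "R t = G o\<^sub>L M t" for t
  have R: "R t x = G (M t x)" for t x by (simp add: R_def)
  show ?thesis
  proof (rule that[of \<delta> R])
    show "\<delta> > 0" using \<delta>1 \<delta>2 by (simp add: \<delta>_def)
    show "regular an (I \<inter> ball t0 \<delta>) R" unfolding R_def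
      by (intro blinfun_product.regular_bilinear regular_const regular_subset[OF M(1) sub])
    show "R t0 = G" by (rule blinfun_eqI) (simp add: R M(2))
    fix t assume t: "t \<in> I \<inter> ball t0 \<delta>"
    have tI: "t \<in> I" using t by simp
    have LM: "L t (M t x) = x" and inv: "M t (L t x) = x" for x
      using M(3)[OF subsetD[OF sub t]] by (metis blinfun_apply_blinfun_compose blinfun_apply_id_blinfun id_apply)+
    show "normal_resolvent V (A t) z (R t)"
    proof
      show "normal_operator V (A t)" by (rule normals[OF tI])
      show "R t x \<in> V" for x by (simp add: R G(1))
      show "A t (R t x) - z *\<^sub>C R t x = x" for x using LM[of x] by (simp add: R L[OF tI])
      show "R t (A t u - z *\<^sub>C u) = u" if u: "u \<in> V" for u
        using inv[of "A t0 u - z *\<^sub>C u"] by (simp add: R L[OF tI] left[OF u])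
    qed
  qed
qed

lemma meeting_order_infinite:
  assumes s: "s \<in> I" and \<delta>: "\<delta> > 0" and cont: "continuous_on (I \<inter> ball s \<delta>) f"
    and flat: "\<And>p. \<exists>C \<eta>. \<eta> > 0 \<and> (\<forall>t\<in>I \<inter> ball s \<eta>. cmod (f t) \<le> C * \<bar>t - s\<bar> ^ Suc p)"
  shows "meeting_order I s f = \<infinity>"
proof -
  have "\<exists>\<delta>>0. \<exists>g. continuous_on (I \<inter> ball s \<delta>) g \<and> (\<forall>t\<in>I \<inter> ball s \<delta>. f t = of_real ((t - s) ^ p) * g t)" for p
  proof -
    obtain C \<eta> where C: "\<eta> > 0" "\<And>t. t \<in> I \<inter> ball s \<eta> \<Longrightarrow> cmod (f t) \<le> C * \<bar>t - s\<bar> ^ Suc p"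
      using flat[of p] by blast
    \<comment> \<open>The estimate with exponent p + 1 leaves a bound C |t - s| for the quotient, so
      the value 0 at \<open>s\<close> makes \<open>g\<close> continuous.\<close>
    define g where "g t = (if t = s then 0 else f t / of_real ((t - s) ^ p))" for t
    let ?U = "I \<inter> ball s (min \<delta> \<eta>)"
    have gb: "cmod (g t) \<le> C * \<bar>t - s\<bar>" if t: "t \<in> ?U" for t
    proof (cases "t = s")
      case False
      have "cmod (f t) \<le> C * \<bar>t - s\<bar> * \<bar>t - s\<bar> ^ p" using C(2)[of t] t by (simp add: mult_ac)
      then show ?thesis using False by (simp add: g_def norm_divide norm_power pos_divide_le_eq flip: of_real_diff)
    qed (simp add: g_def)
    have "continuous_on ?U g"
      unfolding continuous_on_eq_continuous_within
    proof
      fix t assume t: "t \<in> ?U"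
      show "continuous (at t within ?U) g"
      proof (cases "t = s")
        case True
        have "((\<lambda>t. C * \<bar>t - s\<bar>) \<longlongrightarrow> C * \<bar>s - s\<bar>) (at s within ?U)" by (intro tendsto_intros)
        then have lim: "((\<lambda>t. C * \<bar>t - s\<bar>) \<longlongrightarrow> 0) (at s within ?U)" by simp
        have "(g \<longlongrightarrow> 0) (at s within ?U)"
          by (rule Lim_null_comparison[OF _ lim]) (use gb in \<open>auto simp: eventually_at_filter\<close>)
        then show ?thesis by (simp add: continuous_within True g_def)
      next
        case False
        have "continuous_on (?U - {s}) (\<lambda>t. f t / of_real ((t - s) ^ p))"
          by (intro continuous_intros continuous_on_subset[OF cont]) auto
        then have "continuous_on (?U - {s}) g"
          by (rule continuous_on_eq) (simp add: g_def)
        then have "continuous (at t within ?U - {s}) g"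
          using t False by (simp add: continuous_on_eq_continuous_within)
        moreover have "at t within ?U - {s} = at t within ?U"
          by (rule at_within_nhd[where S = "- {s}"]) (use False in auto)
        ultimately show ?thesis by simp
      qed
    qed
    moreover have "f t = of_real ((t - s) ^ p) * g t" if t: "t \<in> ?U" for t
      using C(2)[of t] t by (cases "t = s") (simp_all add: g_def)
    moreover have "min \<delta> \<eta> > 0" using \<delta> C(1) by simp
    ultimately show ?thesis by blast
  qed
  then have "{enat p | p. \<exists>\<delta>>0. \<exists>g. continuous_on (I \<inter> ball s \<delta>) g \<and>
                        (\<forall>t \<in> I \<inter> ball s \<delta>. f t = of_real ((t - s) ^ p) * g t)} = range enat" by auto
  moreover have "infinite (range enat)" by (rule range_inj_infinite) (simp add: inj_on_def)
  ultimately show ?thesis by (simp add: meeting_order_def Sup_enat_def)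
qed

lemma indexed_basis_nonzero:
  assumes "indexed_basis k f W" "i < k"
  shows "f i \<noteq> 0"
  using indexed_basis_span(1)[OF assms(1)] assms(2) complex_vector.dependent_zero by (metis imageI lessThan_iff)

text \<open>\<open>X\<close> is diagonal in the basis, so in an eigenvector for \<mu> all
  coefficients with l i \<noteq> \<mu> vanish; \<open>sub\<close> guarantees that no eigenvector
  lies outside \<open>W\<close>.\<close>

lemma dim_eigenspace:
  assumes e: "indexed_basis k e W" and X: "complex_linear X" "\<And>i. i < k \<Longrightarrow> X (e i) = l i *\<^sub>C e i"
    and sub: "{x. X x = \<mu> *\<^sub>C x} \<subseteq> W"
  shows "complex_vector.dim {x. X x = \<mu> *\<^sub>C x} = card {i. i < k \<and> l i = \<mu>}"
proof -
  let ?J = "{i. i < k \<and> l i = \<mu>}" and ?E = "{x. X x = \<mu> *\<^sub>C x}"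
  note sp = indexed_basis_span[OF e] and inj = indexed_basis_inj[OF e]
  have E: "complex_vector.subspace ?E" by (rule subspace_eigenspace[OF X(1)])
  have ind: "complex_vector.independent (e ` ?J)" by (rule complex_vector.independent_mono[OF sp(1)]) auto
  have "complex_vector.span (e ` ?J) = ?E"
  proof
    show "complex_vector.span (e ` ?J) \<subseteq> ?E"
      by (rule complex_vector.span_minimal[OF _ E]) (use X(2) in auto)
    show "?E \<subseteq> complex_vector.span (e ` ?J)"
    proof
      fix x assume x: "x \<in> ?E"
      then have "x \<in> range (\<lambda>u. \<Sum>i<k. u i *\<^sub>C e i)" using sub e unfolding indexed_basis_def by blast
      then obtain u where u: "x = (\<Sum>i<k. u i *\<^sub>C e i)" by blast
      have "(\<Sum>i<k. (u i * (l i - \<mu>)) *\<^sub>C e i) = (\<Sum>i<k. u i *\<^sub>C X (e i)) - (\<Sum>i<k. \<mu> *\<^sub>C u i *\<^sub>C e i)"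
        unfolding sum_subtractf[symmetric]
        by (intro sum.cong refl) (simp add: X(2) scaleC_scaleC right_diff_distrib scaleC.diff_left mult.commute)
      also have "\<dots> = X x - \<mu> *\<^sub>C x" unfolding u complex_linear_simps[OF X(1)] scaleC.sum_right by (rule refl)
      also have "\<dots> = 0" using x by simp
      finally have "\<forall>i<k. u i * (l i - \<mu>) = 0"
        using spec[OF conjunct1[OF e[unfolded indexed_basis_def]], of "\<lambda>i. u i * (l i - \<mu>)"] by blast
      then have "u i *\<^sub>C e i \<in> complex_vector.span (e ` ?J)" if "i \<in> {..<k}" for i
      proof (cases "u i = 0")
        case False
        then have "i \<in> ?J" using \<open>\<forall>i<k. u i * (l i - \<mu>) = 0\<close> that by auto
        then show ?thesis by (intro complex_vector.span_scale complex_vector.span_base imageI)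
      qed (simp add: complex_vector.span_zero)
      then show "x \<in> complex_vector.span (e ` ?J)" unfolding u by (rule complex_vector.span_sum)
    qed
  qed
  then have "complex_vector.span (e ` ?J) = complex_vector.span ?E" using E by (simp only: complex_vector.span_eq_iff[THEN iffD2])
  then have "complex_vector.dim ?E = card (e ` ?J)" using ind by (rule complex_vector.dim_eq_card)
  also have "\<dots> = card ?J" by (intro card_image inj_on_subset[OF inj]) auto
  finally show ?thesis .
qed

text \<open>Suppose eigenvalues in \<open>K\<close> occur at parameters tending to
  \<open>t0\<close>. Unit eigenvectors satisfy x = (\<kappa> - z) R(t) x; compactness of
  \<open>K\<close> and of R(t0) makes them subconverge to an eigenvector of A(t0) with eigenvalue in
  \<open>K\<close>.\<close>

lemma eigenvalue_free_near:
  fixes R :: "real \<Rightarrow> 'h::complex_hilbert_space \<Rightarrow>\<^sub>L 'h"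
  assumes t0: "t0 \<in> S" and cont: "continuous_on S R" and res: "\<And>t. t \<in> S \<Longrightarrow> normal_resolvent V (A t) z (R t)"
    and cpt: "compact (closure (R t0 ` cball 0 1))"
    and K: "compact K" "\<And>\<kappa>. \<kappa> \<in> K \<Longrightarrow> \<not> eigenvalue V (A t0) \<kappa>"
  shows "\<exists>\<delta>>0. \<forall>t\<in>S \<inter> ball t0 \<delta>. \<forall>\<kappa>\<in>K. \<not> eigenvalue V (A t) \<kappa>"
proof (rule ccontr)
  assume neg: "\<not> ?thesis"
  have "\<exists>t \<kappa> x. t \<in> S \<and> dist t t0 < inverse (real (Suc n)) \<and> \<kappa> \<in> K \<and> norm x = 1 \<and> x = (\<kappa> - z) *\<^sub>C R t x" for n
  proof -
    have "inverse (real (Suc n)) > 0" by simp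
    then obtain t \<kappa> where t: "t \<in> S \<inter> ball t0 (inverse (real (Suc n)))" and \<kappa>: "\<kappa> \<in> K" "eigenvalue V (A t) \<kappa>"
      using neg by blast
    then obtain u where u: "u \<in> V" "u \<noteq> 0" "A t u = \<kappa> *\<^sub>C u" unfolding eigenvalue_def by blast
    have tS: "t \<in> S" using t by simp
    have Ru: "(\<kappa> - z) *\<^sub>C R t u = u"
      using normal_resolvent.eigenvector_resolvent[OF res[OF tS] u] by (simp add: scaleC_scaleC scaleC_one)
    have "(\<kappa> - z) *\<^sub>C R t ((1 / norm u) *\<^sub>R u) = (1 / norm u) *\<^sub>R ((\<kappa> - z) *\<^sub>C R t u)"
      by (simp only: blinfun.scaleR_right scaleC.scaleR_right)
    then have "(1 / norm u) *\<^sub>R u = (\<kappa> - z) *\<^sub>C R t ((1 / norm u) *\<^sub>R u)" unfolding Ru by simp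
    then show ?thesis using t tS \<kappa>(1) u(2)
      by (intro exI[of _ t] exI[of _ \<kappa>] exI[of _ "(1 / norm u) *\<^sub>R u"]) (auto simp: dist_commute)
  qed
  then obtain t \<kappa> x where seq: "\<And>n. t n \<in> S" "\<And>n. dist (t n) t0 < inverse (real (Suc n))" "\<And>n. \<kappa> n \<in> K"
    "\<And>n. norm (x n) = 1" "\<And>n. x n = (\<kappa> n - z) *\<^sub>C R (t n) (x n)" by metis
  have "(\<lambda>n. dist (t n) t0) \<longlonglongrightarrow> 0"
    by (rule Lim_null_comparison[OF _ LIMSEQ_inverse_real_of_nat]) (simp add: less_imp_le[OF seq(2)] del: of_nat_Suc)
  then have tlim: "t \<longlonglongrightarrow> t0" by (rule tendsto_dist_iff[THEN iffD2])
  have Rlim: "(\<lambda>n. R (t n)) \<longlonglongrightarrow> R t0"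
    by (rule continuous_on_tendsto_compose[OF cont tlim t0]) (simp add: seq(1))
  obtain \<kappa>' s1 where s1: "\<kappa>' \<in> K" "strict_mono (s1 :: nat \<Rightarrow> nat)" "(\<kappa> \<circ> s1) \<longlonglongrightarrow> \<kappa>'"
    using K(1)[unfolded compact_def, rule_format, of \<kappa>] seq(3) by blast
  have "R t0 (x (s1 n)) \<in> closure (R t0 ` cball 0 1)" for n
    by (intro subsetD[OF closure_subset] imageI) (simp add: seq(4))
  then obtain y s2 where s2: "strict_mono (s2 :: nat \<Rightarrow> nat)" "((\<lambda>n. R t0 (x (s1 n))) \<circ> s2) \<longlonglongrightarrow> y"
    using cpt[unfolded compact_def, rule_format, of "\<lambda>n. R t0 (x (s1 n))"] by blast
  define r where "r = s1 \<circ> s2"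
  have r: "strict_mono r" unfolding r_def by (rule strict_mono_o[OF s1(2) s2(1)])
  have klim: "(\<lambda>n. \<kappa> (r n)) \<longlonglongrightarrow> \<kappa>'" using LIMSEQ_subseq_LIMSEQ[OF s1(3) s2(1)] by (simp add: r_def o_def)
  have ylim: "(\<lambda>n. R t0 (x (r n))) \<longlonglongrightarrow> y" using s2(2) by (simp add: r_def o_def)
  have "(\<lambda>n. R (t n) - R t0) \<longlonglongrightarrow> R t0 - R t0" by (intro tendsto_diff Rlim tendsto_const)
  then have "(\<lambda>n. norm (R (t n) - R t0)) \<longlonglongrightarrow> 0" by (intro tendsto_norm_zero) simp
  then have nlim: "(\<lambda>n. norm (R (t (r n)) - R t0)) \<longlonglongrightarrow> 0" using LIMSEQ_subseq_LIMSEQ[OF _ r] by (simp add: o_def)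
  have "(\<lambda>n. R (t (r n)) (x (r n)) - R t0 (x (r n))) \<longlonglongrightarrow> 0"
  proof (rule Lim_null_comparison[OF _ nlim])
    have "norm (R (t (r n)) (x (r n)) - R t0 (x (r n))) \<le> norm (R (t (r n)) - R t0)" for n
      using norm_blinfun[of "R (t (r n)) - R t0" "x (r n)"] by (simp add: blinfun.diff_left seq(4))
    then show "\<forall>\<^sub>F n in sequentially. norm (R (t (r n)) (x (r n)) - R t0 (x (r n))) \<le> norm (R (t (r n)) - R t0)" by simp
  qed
  from tendsto_add[OF this ylim] have Ry: "(\<lambda>n. R (t (r n)) (x (r n))) \<longlonglongrightarrow> y" by simp
  define w where "w = (\<kappa>' - z) *\<^sub>C y"
  have "(\<lambda>n. (\<kappa> (r n) - z) *\<^sub>C R (t (r n)) (x (r n))) \<longlonglongrightarrow> w"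
    unfolding w_def by (intro scaleC.tendsto tendsto_diff klim tendsto_const Ry)
  then have xlim: "(\<lambda>n. x (r n)) \<longlonglongrightarrow> w" by (simp only: seq(5)[symmetric])
  have "(\<lambda>n. norm (x (r n))) \<longlonglongrightarrow> norm w" by (intro tendsto_norm xlim)
  then have "norm w = 1" unfolding seq(4) by (simp add: LIMSEQ_const_iff)
  then have w0: "w \<noteq> 0" by auto
  have "(\<lambda>n. R t0 (x (r n))) \<longlonglongrightarrow> R t0 w" by (intro blinfun.tendsto tendsto_const xlim)
  then have Rw: "R t0 w = y" using LIMSEQ_unique ylim by blast
  have ne: "\<kappa>' - z \<noteq> 0" using w0 by (auto simp: w_def)
  have "R t0 w = (1 / (\<kappa>' - z)) *\<^sub>C w" using ne by (simp only: Rw) (simp add: w_def scaleC_scaleC scaleC_one)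
  from normal_resolvent.resolvent_eigenvector[OF res[OF t0] w0 this]
  have "eigenvalue V (A t0) \<kappa>'" using w0 ne by (auto simp: eigenvalue_def)
  then show False using K(2)[OF s1(1)] by blast
qed

lemma resolvent_set_not_eigenvalue:
  assumes T: "normal_operator V T" and \<kappa>: "\<kappa> \<in> resolvent_set V T"
  shows "\<not> eigenvalue V T \<kappa>"
proof
  note V = normal_operatorD[OF T]
  assume "eigenvalue V T \<kappa>"
  then obtain u where u: "u \<in> V" "u \<noteq> 0" "T u = \<kappa> *\<^sub>C u" unfolding eigenvalue_def by blast
  have "inj_on (\<lambda>u. T u - \<kappa> *\<^sub>C u) V" using \<kappa> by (auto simp: resolvent_set_def bij_betw_def)
  then have "u = 0" by (rule inj_onD) (use u V(5,10) in auto)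
  then show False using u by simp
qed

lemma multiplicity_of_not_eigenvalue:
  fixes V :: "'h::complex_hilbert_space set"
  assumes T: "normal_operator V T" and \<kappa>: "\<not> eigenvalue V T \<kappa>"
  shows "multiplicity_of V T \<kappa> = 0"
proof -
  have "{u \<in> V. T u = \<kappa> *\<^sub>C u} = {0}"
    using \<kappa> normal_operatorD(5,10)[OF T] by (auto simp: eigenvalue_def)
  moreover have "complex_vector.dim {0 :: 'h} = card ({} :: 'h set)"
    by (rule complex_vector.dim_eq_card) (auto simp: complex_vector.span_zero complex_vector.independent_empty)
  ultimately show ?thesis by (simp add: multiplicity_of_def)
qed

text \<open>Genericity concerns A(t). The map l \<mapsto> z + 1/l carries eigenvalues of the
  resolvent, which never vanish, to eigenvalues of A(t) and preserves contact of infinite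
  order.\<close>

lemma resolvent_normal_family:
  fixes A :: "real \<Rightarrow> 'h::complex_hilbert_space \<Rightarrow> 'h"
  assumes I: "is_interval I" "t0 \<in> I" and generic: "generic_curve I V A"
    and \<delta>: "\<delta> > 0" and regR: "regular an (I \<inter> ball t0 \<delta>) R"
    and res: "\<And>t. t \<in> I \<inter> ball t0 \<delta> \<Longrightarrow> normal_resolvent V (A t) z (R t)"
  shows "normal_family an (I \<inter> ball t0 \<delta>) t0 R"
proof
  let ?S = "I \<inter> ball t0 \<delta>"
  show "is_interval ?S" using I(1) by (intro is_interval_Int is_interval_ball_real)
  show t0S: "t0 \<in> ?S" using I(2) \<delta> by simp
  show "regular an ?S R" by (rule regR)
  show "complex_linear (R t)" if "t \<in> ?S" for t by (rule normal_resolvent.G_linear[OF res[OF that]])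
  show "paranormal_on UNIV (R t)" if "t \<in> ?S" for t by (rule normal_resolvent.resolvent_paranormal[OF res[OF that]])
  show "cinner x y = 0" if "t \<in> ?S" "R t x = \<mu> *\<^sub>C x" "R t y = \<nu> *\<^sub>C y" "\<mu> \<noteq> \<nu>" for t x y \<mu> \<nu>
    by (rule normal_resolvent.resolvent_orthogonal[OF res[OF that(1)] that(2-4)])
  fix d :: real and l m :: "real \<Rightarrow> complex"
  assume d: "d > 0" and cont: "continuous_on (?S \<inter> ball t0 d) l" "continuous_on (?S \<inter> ball t0 d) m"
    and evl: "\<And>t. t \<in> ?S \<inter> ball t0 d \<Longrightarrow> \<exists>x. x \<noteq> 0 \<and> R t x = l t *\<^sub>C x"
    and evm: "\<And>t. t \<in> ?S \<inter> ball t0 d \<Longrightarrow> \<exists>x. x \<noteq> 0 \<and> R t x = m t *\<^sub>C x"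
    and flat: "\<And>p. \<exists>C \<eta>. \<eta> > 0 \<and> (\<forall>t\<in>?S \<inter> ball t0 \<eta>. cmod (l t - m t) \<le> C * \<bar>t - t0\<bar> ^ Suc p)"
  define \<delta>' where "\<delta>' = min \<delta> d"
  have \<delta>': "\<delta>' > 0" using d \<delta> by (simp add: \<delta>'_def)
  let ?U = "I \<inter> ball t0 \<delta>'"
  have U: "?U = ?S \<inter> ball t0 d" by (auto simp: \<delta>'_def)
  have ev: "k t \<noteq> 0 \<and> eigenvalue V (A t) (z + 1 / k t)"
    if k: "\<exists>x. x \<noteq> 0 \<and> R t x = k t *\<^sub>C x" and t: "t \<in> ?S" for k :: "real \<Rightarrow> complex" and t
  proof -
    obtain x where x: "x \<noteq> 0" "R t x = k t *\<^sub>C x" using k by blast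
    show ?thesis using normal_resolvent.resolvent_eigenvector[OF res[OF t] x] x(1) by (auto simp: eigenvalue_def)
  qed
  have lne: "l t \<noteq> 0" "eigenvalue V (A t) (z + 1 / l t)" and mne: "m t \<noteq> 0" "eigenvalue V (A t) (z + 1 / m t)"
    if "t \<in> ?U" for t
    using ev[of t l] ev[of t m] evl[of t] evm[of t] that unfolding U by blast+
  have cl: "continuous_on ?U (\<lambda>t. z + 1 / l t)" and cm: "continuous_on ?U (\<lambda>t. z + 1 / m t)"
    using cont lne(1) mne(1) unfolding U by (auto intro!: continuous_intros)
  have "meeting_order I t0 (\<lambda>t. (z + 1 / l t) - (z + 1 / m t)) = \<infinity>"
  proof (rule meeting_order_infinite[OF I(2) \<delta>' continuous_on_diff[OF cl cm]])
    fix p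
    obtain C \<eta> where C: "\<eta> > 0" "\<And>t. t \<in> ?S \<inter> ball t0 \<eta> \<Longrightarrow> cmod (l t - m t) \<le> C * \<bar>t - t0\<bar> ^ Suc p"
      using flat[of p] by blast
    \<comment> \<open>The difference of the images under l \<mapsto> z + 1/l is - h times the
      difference of \<open>l\<close> and \<open>m\<close>, and \<open>h\<close> is bounded near
      \<open>t0\<close> by continuity.\<close>
    define h where "h t = 1 / (l t * m t)" for t
    have "continuous_on ?U h" unfolding h_def
      using cont lne(1) mne(1) unfolding U by (auto intro!: continuous_intros)
    moreover have "t0 \<in> ?U" using I(2) \<delta>' by simp
    moreover have "(1::real) > 0" by simp
    ultimately obtain e where e: "e > 0" "\<And>t. t \<in> ?U \<Longrightarrow> dist t t0 < e \<Longrightarrow> dist (h t) (h t0) < 1"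
      unfolding continuous_on_iff by blast
    define c where "c = cmod (h t0) + 1"
    have hc: "cmod (h t) \<le> c" if "t \<in> ?U" "dist t t0 < e" for t
      using e(2)[OF that] norm_triangle_ineq2[of "h t" "h t0"] by (simp add: c_def dist_norm)
    let ?\<eta> = "min \<eta> (min \<delta>' e)"
    have "cmod ((z + 1 / l t) - (z + 1 / m t)) \<le> (c * C) * \<bar>t - t0\<bar> ^ Suc p" if t: "t \<in> I \<inter> ball t0 ?\<eta>" for t
    proof -
      have tU: "t \<in> ?U" and te: "dist t t0 < e" and tS: "t \<in> ?S \<inter> ball t0 \<eta>"
        using t by (auto simp: \<delta>'_def dist_commute)
      have "(z + 1 / l t) - (z + 1 / m t) = - (h t * (l t - m t))"
        using lne(1)[OF tU] mne(1)[OF tU] by (simp add: h_def field_simps)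
      then have "cmod ((z + 1 / l t) - (z + 1 / m t)) = cmod (h t) * cmod (l t - m t)" by (simp only: norm_minus_cancel norm_mult)
      also have "\<dots> \<le> c * (C * \<bar>t - t0\<bar> ^ Suc p)" by (rule mult_mono[OF hc[OF tU te] C(2)[OF tS]]) (auto simp: c_def add_nonneg_nonneg)
      finally show ?thesis by (simp only: mult.assoc)
    qed
    moreover have "?\<eta> > 0" using C(1) \<delta>' e(1) by simp
    ultimately show "\<exists>C \<eta>. \<eta> > 0 \<and> (\<forall>t\<in>I \<inter> ball t0 \<eta>. cmod ((z + 1 / l t) - (z + 1 / m t)) \<le> C * \<bar>t - t0\<bar> ^ Suc p)"
      by blast
  qed
  moreover have "continuous_eigenvalue_on ?U V A (\<lambda>t. z + 1 / l t)" "continuous_eigenvalue_on ?U V A (\<lambda>t. z + 1 / m t)"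
    unfolding continuous_eigenvalue_on_def using cl cm lne(2) mne(2) by blast+
  ultimately obtain \<eta> where \<eta>: "\<eta> > 0" "\<forall>t\<in>?U \<inter> ball t0 \<eta>. z + 1 / l t = z + 1 / m t"
    using generic I(2) \<delta>' unfolding generic_curve_def by blast
  have "l t = m t" if t: "t \<in> ?S \<inter> ball t0 (min \<delta>' \<eta>)" for t
  proof -
    have tU: "t \<in> ?U" "t \<in> ball t0 \<eta>" using t by auto
    then have "z + 1 / l t = z + 1 / m t" using \<eta>(2) by blast
    then show ?thesis using lne(1)[OF tU(1)] mne(1)[OF tU(1)] by (simp add: field_simps)
  qed
  then show "\<exists>\<eta>>0. \<forall>t\<in>?S \<inter> ball t0 \<eta>. l t = m t" using \<eta>(1) \<delta>' by (intro exI[of _ "min \<delta>' \<eta>"]) auto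
qed

text \<open>For \<open>t\<close> near \<open>t0\<close> the eigenvalues inside the curve are close
  to \<open>z0\<close>, so their eigenvectors lie in the range of P(t) by \<open>near\<close>, where
  the basis \<open>e\<close> counts them.\<close>

lemma eigenvalues_through_exists:
  fixes A :: "real \<Rightarrow> 'h::complex_hilbert_space \<Rightarrow> 'h" and R :: "real \<Rightarrow> 'h \<Rightarrow>\<^sub>L 'h"
  assumes t0: "t0 \<in> W" and W: "W \<subseteq> S" and cont: "continuous_on S R"
    and res: "\<And>t. t \<in> S \<Longrightarrow> normal_resolvent V (A t) z (R t)"
    and cpt: "compact (closure (R t0 ` cball 0 1))" and z0: "z0 \<noteq> z"
    and l: "\<And>i. i < n \<Longrightarrow> continuous_on W (l i)" "\<And>i t. i < n \<Longrightarrow> t \<in> W \<Longrightarrow> l i t \<noteq> 0" "\<And>i. i < n \<Longrightarrow> l i t0 = 1 / (z0 - z)"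
    and e: "\<And>t i. t \<in> W \<Longrightarrow> i < n \<Longrightarrow> R t (e i t) = l i t *\<^sub>C e i t"
    and basis: "\<And>t. t \<in> W \<Longrightarrow> indexed_basis n (\<lambda>i. e i t) (range (P t))"
    and near: "\<And>t x \<mu>. t \<in> W \<Longrightarrow> R t x = \<mu> *\<^sub>C x \<Longrightarrow> s * cmod (\<mu> - 1 / (z0 - z)) \<le> 1 \<Longrightarrow> x \<in> range (P t)"
  shows "eigenvalues_through V A W t0 z0 n (\<lambda>i t. z + inverse (l i t))"
  unfolding eigenvalues_through_def
proof (intro allI impI)
  fix \<gamma> assume iso: "isolating_curve V (A t0) z0 \<gamma>"
  let ?\<Gamma> = "path_image \<gamma>" and ?O = "inside (path_image \<gamma>)"
  have cpt\<Gamma>: "compact ?\<Gamma>" and iso': "?\<Gamma> \<subseteq> resolvent_set V (A t0)" "{z. eigenvalue V (A t0) z} \<inter> ?O = {z0}"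
    using iso by (auto simp: isolating_curve_def compact_simple_path_image)
  have openO: "open ?O" by (rule open_inside[OF compact_imp_closed[OF cpt\<Gamma>]])
  have z0O: "z0 \<in> ?O" using iso'(2) by blast
  have t0S: "t0 \<in> S" using t0 W by blast
  obtain \<epsilon>1 where \<epsilon>1: "\<epsilon>1 > 0" "ball z0 \<epsilon>1 \<subseteq> ?O" using openO z0O openE by blast
  have "isCont (\<lambda>\<kappa>. s * cmod (1 / (\<kappa> - z) - 1 / (z0 - z))) z0" using z0 by (auto intro!: continuous_intros)
  moreover have "(1::real) > 0" by simp
  ultimately obtain \<epsilon>2 where \<epsilon>2: "\<epsilon>2 > 0"
    "\<And>\<kappa>. dist \<kappa> z0 < \<epsilon>2 \<Longrightarrow> dist (s * cmod (1 / (\<kappa> - z) - 1 / (z0 - z))) (s * cmod (1 / (z0 - z) - 1 / (z0 - z))) < 1"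
    unfolding continuous_at_eps_delta by (metis dist_commute)
  \<comment> \<open>Within this radius \<kappa> lies inside the curve, differs from
    \<open>z\<close>, and 1/(\<kappa> - z) satisfies the smallness condition in
    \<open>near\<close>.\<close>
  define \<epsilon> where "\<epsilon> = min \<epsilon>1 (min \<epsilon>2 (dist z0 z))"
  have \<epsilon>: "\<epsilon> > 0" using \<epsilon>1(1) \<epsilon>2(1) z0 by (simp add: \<epsilon>_def)
  have \<epsilon>b: "\<kappa> \<in> ?O" "\<kappa> \<noteq> z" "s * cmod (1 / (\<kappa> - z) - 1 / (z0 - z)) \<le> 1" if "\<kappa> \<in> ball z0 \<epsilon>" for \<kappa>
  proof -
    show "\<kappa> \<in> ?O" using that \<epsilon>1(2) by (auto simp: \<epsilon>_def)
    show "\<kappa> \<noteq> z" using that by (auto simp: \<epsilon>_def)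
    have "dist \<kappa> z0 < \<epsilon>2" using that by (auto simp: \<epsilon>_def dist_commute)
    from \<epsilon>2(2)[OF this] show "s * cmod (1 / (\<kappa> - z) - 1 / (z0 - z)) \<le> 1" by (simp add: dist_real_def)
  qed
  \<comment> \<open>Compact and free of eigenvalues of A(t0): on the curve there are only resolvent
    points, and inside it \<open>z0\<close> is the only eigenvalue.\<close>
  define K where "K = closure ?O - ball z0 \<epsilon>"
  have "compact (closure ?O)" using bounded_inside[OF compact_imp_bounded[OF cpt\<Gamma>]] by simp
  then have cptK: "compact K" unfolding K_def by (rule compact_diff) simp
  have "\<exists>\<delta>>0. \<forall>t\<in>S \<inter> ball t0 \<delta>. \<forall>\<kappa>\<in>K. \<not> eigenvalue V (A t) \<kappa>"
  proof (rule eigenvalue_free_near[OF t0S cont res cpt cptK])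
    fix \<kappa> assume k: "\<kappa> \<in> K"
    have "\<kappa> \<in> ?\<Gamma> \<union> ?O" using k closure_inside_subset[OF compact_imp_closed[OF cpt\<Gamma>]] by (auto simp: K_def)
    then show "\<not> eigenvalue V (A t0) \<kappa>"
    proof
      assume "\<kappa> \<in> ?\<Gamma>"
      then show ?thesis
        using resolvent_set_not_eigenvalue[OF normal_resolvent.normal[OF res[OF t0S]]] iso'(1) by blast
    next
      assume "\<kappa> \<in> ?O"
      then have "eigenvalue V (A t0) \<kappa> \<Longrightarrow> \<kappa> = z0" using iso'(2) by blast
      then show ?thesis using k \<epsilon> by (auto simp: K_def)
    qed
  qed
  then obtain \<delta>1 where \<delta>1: "\<delta>1 > 0" "\<And>t \<kappa>. t \<in> S \<inter> ball t0 \<delta>1 \<Longrightarrow> \<kappa> \<in> K \<Longrightarrow> \<not> eigenvalue V (A t) \<kappa>" by blast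
  have "\<exists>\<eta>>0. \<forall>t\<in>W \<inter> ball t0 \<eta>. z + inverse (l i t) \<in> ?O" if i: "i < n" for i
  proof -
    have "continuous_on W (\<lambda>t. z + inverse (l i t))" using l(1,2)[OF i] by (intro continuous_intros) auto
    then obtain \<eta> where \<eta>: "\<eta> > 0" "\<And>t. t \<in> W \<Longrightarrow> dist t t0 < \<eta> \<Longrightarrow> dist (z + inverse (l i t)) (z + inverse (l i t0)) < \<epsilon>"
      using t0 \<epsilon> unfolding continuous_on_iff by blast
    have "z + inverse (l i t0) = z0" by (simp add: l(3)[OF i])
    then have "z + inverse (l i t) \<in> ?O" if "t \<in> W \<inter> ball t0 \<eta>" for t
      using \<eta>(2)[of t] that by (intro \<epsilon>b(1)) (auto simp: dist_commute)
    then show ?thesis using \<eta>(1) by blast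
  qed
  from finite_common_radius[where Q = "\<lambda>i t. z + inverse (l i t) \<in> ?O", OF this]
  obtain \<delta>2 where \<delta>2: "\<delta>2 > 0" "\<And>i t. i < n \<Longrightarrow> t \<in> W \<inter> ball t0 \<delta>2 \<Longrightarrow> z + inverse (l i t) \<in> ?O" by blast
  have "card {i. i < n \<and> z + inverse (l i t) = \<kappa>} = multiplicity_of V (A t) \<kappa>"
    if t: "t \<in> W \<inter> ball t0 (min \<delta>1 \<delta>2)" and k: "\<kappa> \<in> ?O" for t \<kappa>
  proof -
    have tW: "t \<in> W" and tS: "t \<in> S" "t \<in> S \<inter> ball t0 \<delta>1" using t W by auto
    interpret N: normal_resolvent V "A t" z "R t" by (rule res[OF tS(1)])
    have linv: "z + inverse (l i t) = \<kappa> \<longleftrightarrow> l i t = 1 / (\<kappa> - z)" if "i < n" for i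
    proof -
      have "z + inverse (l i t) = \<kappa> \<longleftrightarrow> inverse (l i t) = \<kappa> - z" by (auto simp: algebra_simps)
      also have "\<dots> \<longleftrightarrow> l i t = inverse (\<kappa> - z)" by (metis inverse_inverse_eq)
      finally show ?thesis by (simp only: inverse_eq_divide)
    qed
    show ?thesis
    proof (cases "eigenvalue V (A t) \<kappa>")
      case False
      have "z + inverse (l i t) \<noteq> \<kappa>" if i: "i < n" for i
      proof
        assume eq: "z + inverse (l i t) = \<kappa>"
        have "e i t \<noteq> 0" by (rule indexed_basis_nonzero[OF basis[OF tW] i])
        from N.resolvent_eigenvector[OF this e[OF tW i]] have "eigenvalue V (A t) \<kappa>"
          using \<open>e i t \<noteq> 0\<close> unfolding eigenvalue_def eq[symmetric] by (auto simp: inverse_eq_divide)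
        then show False using False by blast
      qed
      then have "{i. i < n \<and> z + inverse (l i t) = \<kappa>} = {}" by blast
      then show ?thesis using multiplicity_of_not_eigenvalue[OF N.normal False] by simp
    next
      case True
      have "\<kappa> \<in> ball z0 \<epsilon>"
      proof (rule ccontr)
        assume "\<kappa> \<notin> ball z0 \<epsilon>"
        then have "\<kappa> \<in> K" using subsetD[OF closure_subset k] by (simp add: K_def)
        then show False using \<delta>1(2)[OF tS(2)] True by blast
      qed
      note kb = \<epsilon>b(2,3)[OF this]
      have "{x. R t x = (1 / (\<kappa> - z)) *\<^sub>C x} \<subseteq> range (P t)" using near[OF tW _ kb(2)] by blast
      from dim_eigenspace[OF basis[OF tW] N.G_linear e[OF tW] this]
      have "multiplicity_of V (A t) \<kappa> = card {i. i < n \<and> l i t = 1 / (\<kappa> - z)}"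
        unfolding multiplicity_of_def N.eigenspace_resolvent[OF kb(1)] by blast
      moreover have "{i. i < n \<and> z + inverse (l i t) = \<kappa>} = {i. i < n \<and> l i t = 1 / (\<kappa> - z)}" using linv by blast
      ultimately show ?thesis by simp
    qed
  qed
  then show "\<exists>\<delta>>0. \<forall>t \<in> W \<inter> ball t0 \<delta>. (\<forall>i<n. z + inverse (l i t) \<in> ?O) \<and>
      (\<forall>\<kappa>\<in>?O. card {i. i < n \<and> z + inverse (l i t) = \<kappa>} = multiplicity_of V (A t) \<kappa>)"
    using \<delta>1(1) \<delta>2 by (intro exI[of _ "min \<delta>1 \<delta>2"]) auto
qed

text \<open>The splitting is applied to the family of projections that starts with the eigenspace of
  \<open>z0\<close>; the number of eigenvectors is \<open>n\<close> because it can be read off at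
  \<open>t0\<close>.\<close>

theorem regular_parameterization:
  fixes A :: "real \<Rightarrow> 'h::complex_hilbert_space \<Rightarrow> 'h"
  assumes I: "is_interval I" "t0 \<in> I" and normals: "\<And>t. t \<in> I \<Longrightarrow> normal_operator V (A t)"
    and smooth: "\<And>u v. u \<in> V \<Longrightarrow> smooth_on I (\<lambda>t. cinner (A t u) v)"
    and an: "\<And>u v. an \<Longrightarrow> u \<in> V \<Longrightarrow> real_analytic_on I (\<lambda>t. cinner (A t u) v)"
    and compact: "compact_resolvent V (A t0)" and generic: "generic_curve I V A"
    and z0: "eigenvalue V (A t0) z0" and n: "n = multiplicity_of V (A t0) z0"
  obtains \<delta> l e where "\<delta> > 0" "\<And>i. i < n \<Longrightarrow> regular an (I \<inter> ball t0 \<delta>) (l i)"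
    "\<And>i. i < n \<Longrightarrow> regular an (I \<inter> ball t0 \<delta>) (e i)"
    "eigenvalues_through V A (I \<inter> ball t0 \<delta>) t0 z0 n l" "eigenvector_frame V A (I \<inter> ball t0 \<delta>) n l e"
proof -
  obtain z where z: "z \<in> resolvent_set V (A t0)" "compact_operator (resolvent V (A t0) z)"
    using compact by (auto simp: compact_resolvent_def)
  obtain G where G: "normal_resolvent V (A t0) z G" "blinfun_apply G = resolvent V (A t0) z"
    by (rule resolvent_exists[OF normals[OF I(2)] z(1)])
  have cpt: "compact (closure (G ` cball 0 1))"
    using z(2) bounded_cball unfolding compact_operator_def G(2) by blast
  have "\<exists>\<delta> R. \<delta> > 0 \<and> regular an (I \<inter> ball t0 \<delta>) R \<and> R t0 = G \<and> (\<forall>t\<in>I \<inter> ball t0 \<delta>. normal_resolvent V (A t) z (R t))"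
  proof (rule resolvent_family[OF I normals smooth an G(1)])
    fix \<delta> and R :: "real \<Rightarrow> 'h \<Rightarrow>\<^sub>L 'h"
    assume "\<delta> > 0" "regular an (I \<inter> ball t0 \<delta>) R" "R t0 = G" "\<And>t. t \<in> I \<inter> ball t0 \<delta> \<Longrightarrow> normal_resolvent V (A t) z (R t)"
    then show ?thesis by (intro exI[of _ \<delta>] exI[of _ R]) blast
  qed
  then obtain \<delta> R where \<delta>: "\<delta> > 0" and regR: "regular an (I \<inter> ball t0 \<delta>) R" and R0: "R t0 = G"
    and res: "\<And>t. t \<in> I \<inter> ball t0 \<delta> \<Longrightarrow> normal_resolvent V (A t) z (R t)"
    by blast
  define S where "S = I \<inter> ball t0 \<delta>"
  note regR = regR[folded S_def] and res = res[folded S_def]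
  interpret normal_family an S t0 R
    unfolding S_def by (rule resolvent_normal_family[OF I generic \<delta>]) (use regR res in \<open>auto simp: S_def\<close>)
  interpret G: normal_resolvent V "A t0" z G by (rule G(1))
  have t0S: "t0 \<in> S" using I(2) \<delta> by (simp add: S_def)
  obtain u where u: "u \<in> V" "u \<noteq> 0" "A t0 u = z0 *\<^sub>C u" using z0 by (auto simp: eigenvalue_def)
  have zz: "z0 \<noteq> z" by (rule G.eigenvector_resolvent(1)[OF u])
  define \<mu> where "\<mu> = 1 / (z0 - z)"
  have mu: "\<mu> \<noteq> 0" using zz by (simp add: \<mu>_def)
  have E0: "{u \<in> V. A t0 u = z0 *\<^sub>C u} = {x. G x = \<mu> *\<^sub>C x}" unfolding \<mu>_def by (rule G.eigenspace_resolvent[OF zz])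
  define Y where "Y t = R t - scalar_op \<mu>" for t
  have Y: "Y t x = R t x - \<mu> *\<^sub>C x" for t x by (simp add: Y_def blinfun.diff_left)
  have Y0: "Y t0 = G - scalar_op \<mu>" by (simp only: Y_def R0)
  have regY: "regular an S Y" unfolding Y_def by (intro regular_diff regR regular_const)
  obtain Z :: "'h \<Rightarrow>\<^sub>L 'h" where Z: "\<And>x. Y t0 (Z x) = Z (Y t0 x)" "\<And>x. Y t0 (Z (Y t0 x)) = Y t0 x" "\<And>x. Z (Y t0 (Z x)) = Z x"
    by (rule G.eigenspace_group_inverse[OF cpt mu Y0]) blast
  obtain s \<delta>1 :: real and Pr :: "real \<Rightarrow> 'h \<Rightarrow>\<^sub>L 'h" where s: "s > 0" and \<delta>1: "\<delta>1 > 0"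
    and Pr: "regular an (S \<inter> ball t0 \<delta>1) Pr" "\<And>x. Pr t0 x = x - Y t0 (Z x)"
    "\<And>t x. t \<in> S \<inter> ball t0 \<delta>1 \<Longrightarrow> Pr t (Pr t x) = Pr t x"
    "\<And>t C. t \<in> S \<inter> ball t0 \<delta>1 \<Longrightarrow> C o\<^sub>L Y t = Y t o\<^sub>L C \<Longrightarrow> C o\<^sub>L Pr t = Pr t o\<^sub>L C"
    "\<And>t w b. t \<in> S \<inter> ball t0 \<delta>1 \<Longrightarrow> (\<And>n::nat. w (Suc n) = s *\<^sub>R Y t (w n)) \<Longrightarrow> (\<And>n. norm (w n) \<le> b) \<Longrightarrow> Pr t (w 0) = w 0"
    by (rule regular_dichotomy[OF regY t0S Z]) blast
  let ?U = "S \<inter> ball t0 \<delta>1"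
  have linR: "R t (c *\<^sub>C x) = c *\<^sub>C R t x" if "t \<in> S" for t c x by (rule complex_linear_simps(1)[OF lin[OF that]])
  have comm: "C (Pr t x) = Pr t (C x)" if t: "t \<in> ?U" and C: "\<And>x. C (Y t x) = Y t (C x)" for t x and C :: "'h \<Rightarrow>\<^sub>L 'h"
  proof -
    have "C o\<^sub>L Y t = Y t o\<^sub>L C" by (rule blinfun_eqI) (simp add: C)
    from Pr(4)[OF t this] have "blinfun_apply (C o\<^sub>L Pr t) x = blinfun_apply (Pr t o\<^sub>L C) x" by simp
    then show ?thesis by simp
  qed
  have proj: "projections ?U Pr"
    unfolding projections_def complex_linear_def
  proof (intro conjI ballI allI Pr(1) Pr(3))
    fix t c x assume t: "t \<in> ?U"
    then have tS: "t \<in> S" by simp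
    have "scalar_op c (Pr t x) = Pr t (scalar_op c x)"
      by (rule comm[OF t]) (simp add: Y linR[OF tS] scaleC.diff_right scaleC_scaleC mult.commute)
    then show "Pr t (c *\<^sub>C x) = c *\<^sub>C Pr t x" by simp
  next
    fix t x assume t: "t \<in> ?U"
    then have tS: "t \<in> S" by simp
    show "R t (Pr t x) = Pr t (R t x)"
      by (rule comm[OF t]) (simp add: Y linR[OF tS] blinfun.diff_right)
  qed
  have range0: "range (Pr t0) = {x. G x = \<mu> *\<^sub>C x}"
  proof (intro equalityI subsetI)
    fix x assume "x \<in> range (Pr t0)"
    then obtain y where x: "x = Pr t0 y" by blast
    have "Y t0 x = 0" unfolding x Pr(2) blinfun.diff_right Z(1)[of y] Z(2) by simp
    then show "x \<in> {x. G x = \<mu> *\<^sub>C x}" by (simp add: Y R0)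
  next
    fix x assume "x \<in> {x. G x = \<mu> *\<^sub>C x}"
    then have "Y t0 x = 0" by (simp add: Y R0)
    then have "Pr t0 x = x" unfolding Pr(2) Z(1) by (simp add: blinfun.zero_right)
    then show "x \<in> range (Pr t0)" by (intro range_eqI[where x = x]) simp
  qed
  obtain B where B: "orthonormal_basis B (range (Pr t0))"
    unfolding range0 by (rule G.eigenspace_basis[OF cpt mu])
  have "\<forall>x\<in>range (Pr t0). R t0 x = \<mu> *\<^sub>C x" unfolding range0 R0 by blast
  from parameterized_exists[OF proj \<delta>1 B this]
  obtain \<eta> where \<eta>: "\<eta> > 0" "\<eta> \<le> \<delta>1" "parameterized \<eta> Pr" by blast
  then obtain k l e where le: "\<And>i. i < k \<Longrightarrow> regular an (S \<inter> ball t0 \<eta>) (l i)" "\<And>i. i < k \<Longrightarrow> regular an (S \<inter> ball t0 \<eta>) (e i)"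
    and basis: "\<And>t. t \<in> S \<inter> ball t0 \<eta> \<Longrightarrow> indexed_basis k (\<lambda>i. e i t) (range (Pr t))"
    and eig: "\<And>t i. t \<in> S \<inter> ball t0 \<eta> \<Longrightarrow> i < k \<Longrightarrow> R t (e i t) = l i t *\<^sub>C e i t"
    unfolding parameterized_def by blast
  have t0\<eta>: "t0 \<in> S \<inter> ball t0 \<eta>" using t0S \<eta>(1) by simp
  have kn: "k = n"
    using indexed_basis_span(3)[OF basis[OF t0\<eta>]] unfolding range0 n multiplicity_of_def E0 by simp
  have ne: "e i t \<noteq> 0" if i: "i < n" and t: "t \<in> S \<inter> ball t0 \<eta>" for i t
    by (rule indexed_basis_nonzero[OF basis[OF t]]) (simp only: kn i)
  have l0: "l i t0 = \<mu>" if i: "i < n" for i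
  proof -
    have "indexed_basis n (\<lambda>i. e i t0) (range (Pr t0))" using basis[OF t0\<eta>] by (simp only: kn)
    then have "e i t0 \<in> range (Pr t0)"
      using indexed_basis_span(2)[of n "\<lambda>i. e i t0"] complex_vector.span_base[of "e i t0" "(\<lambda>i. e i t0) ` {..<n}"] i by blast
    then have "R t0 (e i t0) = \<mu> *\<^sub>C e i t0" unfolding range0 R0 by simp
    then have "(l i t0 - \<mu>) *\<^sub>C e i t0 = 0" using eig[OF t0\<eta>] i kn by (simp add: scaleC.diff_left)
    then show ?thesis using ne[OF i t0\<eta>] by (simp add: complex_vector.scale_eq_0_iff)
  qed
  \<comment> \<open>A lower bound |\<mu>|/2 for the eigenvalues of the resolvent bounds their
    reciprocals, as \<open>regular_inverse\<close> demands.\<close>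
  have "\<exists>\<eta>'>0. \<forall>t\<in>(S \<inter> ball t0 \<eta>) \<inter> ball t0 \<eta>'. cmod \<mu> / 2 \<le> cmod (l i t)" if i: "i < n" for i
  proof -
    have "continuous_on (S \<inter> ball t0 \<eta>) (l i)" using regular_continuous le(1) i kn by blast
    moreover have "cmod \<mu> / 2 > 0" using mu by simp
    ultimately obtain \<eta>' where \<eta>': "\<eta>' > 0" "\<And>t. t \<in> S \<inter> ball t0 \<eta> \<Longrightarrow> dist t t0 < \<eta>' \<Longrightarrow> dist (l i t) (l i t0) < cmod \<mu> / 2"
      using t0\<eta> unfolding continuous_on_iff by blast
    have "cmod \<mu> / 2 \<le> cmod (l i t)" if "t \<in> (S \<inter> ball t0 \<eta>) \<inter> ball t0 \<eta>'" for t
    proof -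
      have "cmod (l i t - \<mu>) < cmod \<mu> / 2" using \<eta>'(2)[of t] that l0[OF i] by (auto simp: dist_norm norm_minus_commute)
      then show ?thesis using norm_triangle_ineq2[of \<mu> "l i t"] by (simp add: norm_minus_commute)
    qed
    then show ?thesis using \<eta>'(1) by blast
  qed
  from finite_common_radius[where Q = "\<lambda>i t. cmod \<mu> / 2 \<le> cmod (l i t)", OF this]
  obtain \<eta>' where \<eta>': "\<eta>' > 0" "\<And>i t. i < n \<Longrightarrow> t \<in> (S \<inter> ball t0 \<eta>) \<inter> ball t0 \<eta>' \<Longrightarrow> cmod \<mu> / 2 \<le> cmod (l i t)" by blast
  define \<delta>' where "\<delta>' = min \<delta> (min \<eta> \<eta>')"
  let ?W = "I \<inter> ball t0 \<delta>'"
  have W: "?W \<subseteq> S \<inter> ball t0 \<eta>" "?W \<subseteq> S" "?W \<subseteq> (S \<inter> ball t0 \<eta>) \<inter> ball t0 \<eta>'" by (auto simp: \<delta>'_def S_def)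
  have \<delta>': "\<delta>' > 0" using \<delta> \<eta> \<eta>' by (simp add: \<delta>'_def)
  have t0W: "t0 \<in> ?W" using I(2) \<delta>' by simp
  have lb: "cmod \<mu> / 2 \<le> cmod (l i t)" if "i < n" "t \<in> ?W" for i t using \<eta>'(2)[OF that(1) subsetD[OF W(3) that(2)]] .
  have lne: "l i t \<noteq> 0" if "i < n" "t \<in> ?W" for i t using lb[OF that] mu by auto
  have basisW: "indexed_basis n (\<lambda>i. e i t) (range (Pr t))" if "t \<in> ?W" for t
    using basis[OF subsetD[OF W(1) that]] by (simp only: kn)
  have eigW: "R t (e i t) = l i t *\<^sub>C e i t" if "t \<in> ?W" "i < n" for t i
    using eig[OF subsetD[OF W(1) that(1)]] that(2) by (simp only: kn)
  have regl: "regular an ?W (l i)" and rege: "regular an ?W (e i)" if "i < n" for i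
    using le that regular_subset[OF _ W(1)] unfolding kn by blast+
  show ?thesis
  proof (rule that[of \<delta>' "\<lambda>i t. z + inverse (l i t)" e])
    show "\<delta>' > 0" by (rule \<delta>')
    show "regular an ?W (e i)" if "i < n" for i by (rule rege[OF that])
    show "regular an ?W (\<lambda>t. z + inverse (l i t))" if i: "i < n" for i
    proof (intro regular_add regular_const mult_product.regular_inverse[OF regl[OF i]])
      show "norm (inverse (l i t)) \<le> inverse (cmod \<mu> / 2)" if "t \<in> ?W" for t
        unfolding norm_inverse by (rule le_imp_inverse_le[OF lb[OF i that]]) (use mu in simp)
    qed (use lne[OF i] in auto)
    show "eigenvector_frame V A ?W n (\<lambda>i t. z + inverse (l i t)) e"
      unfolding eigenvector_frame_def
    proof (intro ballI conjI allI impI)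
      fix t assume t: "t \<in> ?W"
      show "inj_on (\<lambda>i. e i t) {..<n}" by (rule indexed_basis_inj[OF basisW[OF t]])
      show "complex_vector.independent ((\<lambda>i. e i t) ` {..<n})" by (rule indexed_basis_span(1)[OF basisW[OF t]])
      fix i assume i: "i < n"
      note ev = normal_resolvent.resolvent_eigenvector[OF res[OF subsetD[OF W(2) t]] ne[OF i subsetD[OF W(1) t]] eigW[OF t i]]
      show "e i t \<in> V" by (rule ev(2))
      show "A t (e i t) = (z + inverse (l i t)) *\<^sub>C e i t" unfolding inverse_eq_divide by (rule ev(3))
    qed
    show "eigenvalues_through V A ?W t0 z0 n (\<lambda>i t. z + inverse (l i t))"
    proof (rule eigenvalues_through_exists[where R = R and S = S and P = Pr and e = e and s = s, OF t0W W(2) regular_continuous[OF regR] res _ zz])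
      show "compact (closure (R t0 ` cball 0 1))" unfolding R0 by (rule cpt)
      show "continuous_on ?W (l i)" if "i < n" for i by (rule regular_continuous[OF regl[OF that]])
      show "l i t \<noteq> 0" if "i < n" "t \<in> ?W" for i t by (rule lne[OF that])
      show "l i t0 = 1 / (z0 - z)" if "i < n" for i using l0[OF that] by (simp only: \<mu>_def)
      show "R t (e i t) = l i t *\<^sub>C e i t" if "t \<in> ?W" "i < n" for t i by (rule eigW[OF that])
      show "indexed_basis n (\<lambda>i. e i t) (range (Pr t))" if "t \<in> ?W" for t by (rule basisW[OF that])
      fix t x \<nu> assume t: "t \<in> ?W" and x: "R t x = \<nu> *\<^sub>C x" and small: "s * cmod (\<nu> - 1 / (z0 - z)) \<le> 1"
      have tU: "t \<in> ?U" and tS: "t \<in> S" using subsetD[OF W(1) t] \<eta>(2) by auto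
      \<comment> \<open>An eigenvector of R(t) for \<nu> is one of s Y(t) for \<open>c\<close>. As
        |c| \<le> 1, the orbit c^j x is bounded, so \<open>x\<close> is fixed by the
        projection.\<close>
      define c where "c = complex_of_real s * (\<nu> - \<mu>)"
      have c: "cmod c \<le> 1" using small s by (simp add: c_def \<mu>_def norm_mult)
      define w where "w j = c ^ j *\<^sub>C x" for j
      have "Pr t (w 0) = w 0"
      proof (rule Pr(5)[OF tU])
        have "Y t x = (\<nu> - \<mu>) *\<^sub>C x" by (simp add: Y x scaleC.diff_left)
        moreover have "Y t (a *\<^sub>C x) = a *\<^sub>C Y t x" for a
          by (simp add: Y linR[OF tS] scaleC.diff_right scaleC_scaleC mult.commute)
        ultimately show "w (Suc j) = s *\<^sub>R Y t (w j)" for j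
          by (simp add: w_def c_def scaleR_scaleC scaleC_scaleC mult_ac)
        show "norm (w j) \<le> norm x" for j
        proof -
          have "cmod c ^ j \<le> 1" using c by (simp add: power_le_one)
          then have "cmod c ^ j * norm x \<le> 1 * norm x" by (rule mult_right_mono) simp
          then show ?thesis by (simp add: w_def norm_scaleC norm_power)
        qed
      qed
      then show "x \<in> range (Pr t)" by (intro range_eqI[where x = x]) (simp add: w_def scaleC_one)
    qed
  qed
qed

section \<open>Reflection at t0 and conclusion\<close>

text \<open>The substitution is an isometry fixing \<open>t0\<close>, so every ball around
  \<open>t0\<close> in the definitions is preserved. The parameters \<open>reg\<close> and
  \<open>regH\<close> let one argument serve smooth, analytic and absolutely continuous
  curves.\<close>

lemma parameterizable_near_reflect:
  fixes A :: "real \<Rightarrow> 'h::complex_hilbert_space \<Rightarrow> 'h"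
  assumes \<sigma>: "\<sigma> = 1 \<or> \<sigma> = (-1::real)" and \<delta>: "\<delta> > 0"
    and l: "\<And>i. i < n \<Longrightarrow> regular an (I \<inter> ball t0 \<delta>) (l i)" and e: "\<And>i. i < n \<Longrightarrow> regular an (I \<inter> ball t0 \<delta>) (e i)"
    and through: "eigenvalues_through V A (I \<inter> ball t0 \<delta>) t0 z0 n l" and frame: "eigenvector_frame V A (I \<inter> ball t0 \<delta>) n l e"
  defines "J \<equiv> {t. t0 + \<sigma> * (t - t0) \<in> I}"
  assumes reg: "\<And>f. regular an (J \<inter> ball t0 \<delta>) f \<Longrightarrow> reg (J \<inter> ball t0 \<delta>) f"
    and regH: "\<And>f. regular an (J \<inter> ball t0 \<delta>) f \<Longrightarrow> regH (J \<inter> ball t0 \<delta>) f"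
  shows "parameterizable_near reg regH V (\<lambda>t. A (t0 + \<sigma> * (t - t0))) J t0 z0 n"
proof -
  let ?r = "\<lambda>t. t0 + \<sigma> * (t - t0)"
  have ball: "?r t \<in> ball t0 d \<longleftrightarrow> t \<in> ball t0 d" for t d
    using \<sigma> by (auto simp: dist_real_def)
  have J: "{t. ?r t \<in> I \<inter> ball t0 \<delta>} = J \<inter> ball t0 \<delta>" using ball by (auto simp: J_def)
  show ?thesis
    unfolding parameterizable_near_def
  proof (intro exI conjI allI impI)
    show "\<delta> > 0" by (rule \<delta>)
    show "reg (J \<inter> ball t0 \<delta>) (\<lambda>t. l i (?r t))" if "i < n" for i
      using regular_reflect[OF l[OF that] \<sigma>, of t0] unfolding J by (rule reg)
    show "regH (J \<inter> ball t0 \<delta>) (\<lambda>t. e i (?r t))" if "i < n" for i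
      using regular_reflect[OF e[OF that] \<sigma>, of t0] unfolding J by (rule regH)
    show "eigenvector_frame V (\<lambda>t. A (?r t)) (J \<inter> ball t0 \<delta>) n (\<lambda>i t. l i (?r t)) (\<lambda>i t. e i (?r t))"
      using frame unfolding eigenvector_frame_def J[symmetric] by blast
    show "eigenvalues_through V (\<lambda>t. A (?r t)) (J \<inter> ball t0 \<delta>) t0 z0 n (\<lambda>i t. l i (?r t))"
      unfolding eigenvalues_through_def J[symmetric]
    proof (intro allI impI)
      fix \<gamma> assume "isolating_curve V (A (?r t0)) z0 \<gamma>"
      then have "isolating_curve V (A t0) z0 \<gamma>" by simp
      from through[unfolded eigenvalues_through_def, rule_format, OF this]
      obtain d where d: "d > 0" "\<And>t. t \<in> I \<inter> ball t0 \<delta> \<inter> ball t0 d \<Longrightarrow> (\<forall>i<n. l i t \<in> inside (path_image \<gamma>)) \<and>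
           (\<forall>z \<in> inside (path_image \<gamma>). card {i. i < n \<and> l i t = z} = multiplicity_of V (A t) z)" by blast
      show "\<exists>d>0. \<forall>t \<in> {t. ?r t \<in> I \<inter> ball t0 \<delta>} \<inter> ball t0 d. (\<forall>i<n. l i (?r t) \<in> inside (path_image \<gamma>)) \<and>
           (\<forall>z \<in> inside (path_image \<gamma>). card {i. i < n \<and> l i (?r t) = z} = multiplicity_of V (A (?r t)) z)"
      proof (intro exI[of _ d] conjI[OF d(1)] ballI)
        fix t assume t: "t \<in> {t. ?r t \<in> I \<inter> ball t0 \<delta>} \<inter> ball t0 d"
        then have "?r t \<in> I \<inter> ball t0 \<delta> \<inter> ball t0 d" using ball[of t d] by blast
        from d(2)[OF this] show "(\<forall>i<n. l i (?r t) \<in> inside (path_image \<gamma>)) \<and>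
           (\<forall>z \<in> inside (path_image \<gamma>). card {i. i < n \<and> l i (?r t) = z} = multiplicity_of V (A (?r t)) z)" .
      qed
    qed
  qed
qed

lemma convex_reflect:
  assumes "is_interval I" "\<sigma> = 1 \<or> \<sigma> = (-1::real)"
  shows "convex ({t. t0 + \<sigma> * (t - t0) \<in> I} \<inter> ball t0 \<delta>)"
proof (rule convex_Int[OF _ convex_ball])
  have "is_interval {t. t0 + \<sigma> * (t - t0) \<in> I}"
    unfolding is_interval_1
  proof (intro ballI allI impI)
    fix a b x assume ab: "a \<in> {t. t0 + \<sigma> * (t - t0) \<in> I}" "b \<in> {t. t0 + \<sigma> * (t - t0) \<in> I}" and x: "a \<le> x \<and> x \<le> b"
    let ?r = "\<lambda>t. t0 + \<sigma> * (t - t0)"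
    have "(?r a \<le> ?r x \<and> ?r x \<le> ?r b) \<or> (?r b \<le> ?r x \<and> ?r x \<le> ?r a)" using assms(2) x by auto
    moreover have "?r a \<in> I" "?r b \<in> I" using ab by auto
    ultimately have "?r x \<in> I" using assms(1) unfolding is_interval_1 by blast
    then show "x \<in> {t. t0 + \<sigma> * (t - t0) \<in> I}" by simp
  qed
  then show "convex {t. t0 + \<sigma> * (t - t0) \<in> I}" by (rule is_interval_convex)
qed

theorem theorem7p1:
  fixes I :: "real set"
    and V :: "'h::complex_hilbert_space set"
    and A :: "real \<Rightarrow> 'h \<Rightarrow> 'h"
    and t0 :: real and z0 :: complex and n :: nat
  assumes "is_interval I"
    and normal: "\<And>t. t \<in> I \<Longrightarrow> normal_operator V (A t)"
    and smooth: "\<And>u v. u \<in> V \<Longrightarrow> smooth_on I (\<lambda>t. cinner (A t u) v)"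
    and compact: "\<And>t. t \<in> I \<Longrightarrow> compact_resolvent V (A t)"
    and generic: "generic_curve I V A"
    and "t0 \<in> I"
    and "eigenvalue V (A t0) z0"
    and "n = multiplicity_of V (A t0) z0"
  shows "(\<exists>N::nat. N > 0 \<and>
            (\<forall>\<sigma> \<in> {1, -1 :: real}.
               parameterizable_near smooth_on smooth_on
                 V (\<lambda>t. A (t0 + \<sigma> * (t - t0) ^ N)) {t. t0 + \<sigma> * (t - t0) ^ N \<in> I} t0 z0 n \<and>
               ((\<forall>u\<in>V. \<forall>v. real_analytic_on I (\<lambda>t. cinner (A t u) v)) \<longrightarrow>
                parameterizable_near real_analytic_on real_analytic_on
                 V (\<lambda>t. A (t0 + \<sigma> * (t - t0) ^ N)) {t. t0 + \<sigma> * (t - t0) ^ N \<in> I} t0 z0 n)))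
       \<and> parameterizable_near locally_abs_continuous_on locally_abs_continuous_on
            V A I t0 z0 n"
proof -
  have par: thesis
    if an: "\<And>u v. an \<Longrightarrow> u \<in> V \<Longrightarrow> real_analytic_on I (\<lambda>t. cinner (A t u) v)"
    and result: "\<And>\<delta> l e. \<delta> > 0 \<Longrightarrow> (\<And>i. i < n \<Longrightarrow> regular an (I \<inter> ball t0 \<delta>) (l i)) \<Longrightarrow>
      (\<And>i. i < n \<Longrightarrow> regular an (I \<inter> ball t0 \<delta>) (e i)) \<Longrightarrow>
      eigenvalues_through V A (I \<inter> ball t0 \<delta>) t0 z0 n l \<Longrightarrow> eigenvector_frame V A (I \<inter> ball t0 \<delta>) n l e \<Longrightarrow> thesis"
    for an and thesis
    by (rule regular_parameterization[OF assms(1,6) normal smooth an compact[OF assms(6)] generic assms(7,8) result])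
  have smooth_case: "parameterizable_near smooth_on smooth_on V (\<lambda>t. A (t0 + \<sigma> * (t - t0))) {t. t0 + \<sigma> * (t - t0) \<in> I} t0 z0 n"
    if \<sigma>: "\<sigma> = 1 \<or> \<sigma> = -1" for \<sigma> :: real
  proof (rule par[of False])
    fix \<delta> l e assume le: "\<delta> > 0" "\<And>i. i < n \<Longrightarrow> regular False (I \<inter> ball t0 \<delta>) (l i)" "\<And>i. i < n \<Longrightarrow> regular False (I \<inter> ball t0 \<delta>) (e i)"
      "eigenvalues_through V A (I \<inter> ball t0 \<delta>) t0 z0 n l" "eigenvector_frame V A (I \<inter> ball t0 \<delta>) n l e"
    show "parameterizable_near smooth_on smooth_on V (\<lambda>t. A (t0 + \<sigma> * (t - t0))) {t. t0 + \<sigma> * (t - t0) \<in> I} t0 z0 n"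
      by (rule parameterizable_near_reflect[OF \<sigma> le]) (assumption | erule regular_imp_smooth)+
  qed simp
  have analytic_case: "parameterizable_near real_analytic_on real_analytic_on V (\<lambda>t. A (t0 + \<sigma> * (t - t0))) {t. t0 + \<sigma> * (t - t0) \<in> I} t0 z0 n"
    if \<sigma>: "\<sigma> = 1 \<or> \<sigma> = -1" and an: "\<forall>u\<in>V. \<forall>v. real_analytic_on I (\<lambda>t. cinner (A t u) v)" for \<sigma> :: real
  proof (rule par[of True])
    show "real_analytic_on I (\<lambda>t. cinner (A t u) v)" if "u \<in> V" for u v using an that by blast
    fix \<delta> l e assume le: "\<delta> > 0" "\<And>i. i < n \<Longrightarrow> regular True (I \<inter> ball t0 \<delta>) (l i)" "\<And>i. i < n \<Longrightarrow> regular True (I \<inter> ball t0 \<delta>) (e i)"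
      "eigenvalues_through V A (I \<inter> ball t0 \<delta>) t0 z0 n l" "eigenvector_frame V A (I \<inter> ball t0 \<delta>) n l e"
    show "parameterizable_near real_analytic_on real_analytic_on V (\<lambda>t. A (t0 + \<sigma> * (t - t0))) {t. t0 + \<sigma> * (t - t0) \<in> I} t0 z0 n"
      by (rule parameterizable_near_reflect[OF \<sigma> le])
        (assumption | erule regular_imp_analytic[OF _ convex_reflect[OF assms(1) \<sigma>]])+
  qed
  have ac_case: "parameterizable_near locally_abs_continuous_on locally_abs_continuous_on V A I t0 z0 n"
  proof (rule par[of False])
    fix \<delta> l e assume le: "\<delta> > 0" "\<And>i. i < n \<Longrightarrow> regular False (I \<inter> ball t0 \<delta>) (l i)" "\<And>i. i < n \<Longrightarrow> regular False (I \<inter> ball t0 \<delta>) (e i)"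
      "eigenvalues_through V A (I \<inter> ball t0 \<delta>) t0 z0 n l" "eigenvector_frame V A (I \<inter> ball t0 \<delta>) n l e"
    have "parameterizable_near locally_abs_continuous_on locally_abs_continuous_on V (\<lambda>t. A (t0 + 1 * (t - t0))) {t. t0 + 1 * (t - t0) \<in> I} t0 z0 n"
      by (rule parameterizable_near_reflect[OF disjI1[OF refl] le]) (assumption | erule regular_imp_locally_abs_continuous)+
    then show "parameterizable_near locally_abs_continuous_on locally_abs_continuous_on V A I t0 z0 n" by simp
  qed simp
  show ?thesis
  proof (intro conjI ac_case exI[of _ 1] ballI impI)
    fix \<sigma> :: real assume "\<sigma> \<in> {1, -1}"
    then have \<sigma>: "\<sigma> = 1 \<or> \<sigma> = -1" by simp
    show "parameterizable_near smooth_on smooth_on V (\<lambda>t. A (t0 + \<sigma> * (t - t0) ^ 1)) {t. t0 + \<sigma> * (t - t0) ^ 1 \<in> I} t0 z0 n"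
      unfolding power_one_right by (rule smooth_case[OF \<sigma>])
    assume an: "\<forall>u\<in>V. \<forall>v. real_analytic_on I (\<lambda>t. cinner (A t u) v)"
    show "parameterizable_near real_analytic_on real_analytic_on V (\<lambda>t. A (t0 + \<sigma> * (t - t0) ^ 1)) {t. t0 + \<sigma> * (t - t0) ^ 1 \<in> I} t0 z0 n"
      unfolding power_one_right by (rule analytic_case[OF \<sigma> an])
  qed simp
qed

end
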